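(* (i) Let $\Lambda\subset\mathbb R^n$ be a selfdual lattice with $\sigma(\Lambda)=n-8$ and of minimum $2$. Then every nonempty shell of $\Lambda$ and every nonempty shell of $\mathrm{Sh}(\Lambda)$ is a spherical $3$-design. (ii) The shells $(2D_8)^+_m$ with $m=4^a$, $a\ge1$, are spherical $3\tfrac12$-designs. (iii) The shells $(4A_5)^+_m$ and $(5D_4)^+_m$ with $m=4^a$, $a\ge1$, and the shells $(2D_8)^+_m$ with $m=2a+1$, $a\ge1$, are spherical $5$-designs. (iv) Every nonempty shell of the shorter Leech lattice and of its shadow is a spherical $7$-design.
   Context: A selfdual lattice is an integral lattice equal to its dual; it is even if all norms $\langle x,x\rangle$ are even. Shadow: $\mathrm{Sh}(\Lambda)=\Lambda$ if even; otherwise $\mathrm{Sh}(\Lambda)=\Lambda_0^\sharp\setminus\Lambda$ where $\Lambda_0$ is the sublattice of vectors of even norm. $\sigma(\Lambda)=4\min\{\langle x,x\rangle:x\in\mathrm{Sh}(\Lambda)\}$. Shell $A_m=\{x\in A:\langle x,x\rangle=m\}$. For a norm-2 root system $R$, $R^+$ denotes the (unique up to isometry, in ranks $\le23$) selfdual lattice of minimum at least $2$ whose set of norm-2 vectors is $R$; here $(2D_8)^+$ (rank 16), $(4A_5)^+$ and $(5D_4)^+$ (rank 20) are such lattices, with $kR$ the orthogonal union of $k$ copies of the standard root system $R$. The shorter Leech lattice is the (unique) selfdual lattice of rank $23$ with minimum $3$. Designs (antipodal sets $X$): $(C_{2j})$ means $\sum_{x\in X}P(x)=0$ for all homogeneous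 harmonic $P$ of degree $2j$; $t$-design iff $(C_{2j})$ for $2\le 2j\le t$; $3\tfrac12$-design iff $(C_2)$ and $(C_6)$ hold. *)

theory Defs
  imports "HOL-Analysis.Analysis"
begin

definition is_lattice :: "(real^'n) set \<Rightarrow> bool" where
  "is_lattice L \<longleftrightarrow> (\<exists>b::'n \<Rightarrow> real^'n. inj b \<and> independent (range b) \<and>
      L = range (\<lambda>c::'n \<Rightarrow> int. \<Sum>i\<in>UNIV. of_int (c i) *\<^sub>R b i))"

definition dual_lattice :: "(real^'n) set \<Rightarrow> (real^'n) set" where
  "dual_lattice L = {y. \<forall>x\<in>L. x \<bullet> y \<in> \<int>}"

definition selfdual :: "(real^'n) set \<Rightarrow> bool" where
  "selfdual L \<longleftrightarrow> is_lattice L \<and> dual_lattice L = L"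

definition even_vec :: "real^'n \<Rightarrow> bool" where
  "even_vec x \<longleftrightarrow> (\<exists>k::int. x \<bullet> x = 2 * of_int k)"

definition even_lattice :: "(real^'n) set \<Rightarrow> bool" where
  "even_lattice L \<longleftrightarrow> (\<forall>x\<in>L. even_vec x)"

definition even_sublattice :: "(real^'n) set \<Rightarrow> (real^'n) set" where
  "even_sublattice L = {x\<in>L. even_vec x}"

definition shadow :: "(real^'n) set \<Rightarrow> (real^'n) set" where
  "shadow L = (if even_lattice L then L else dual_lattice (even_sublattice L) - L)"

definition sigma_inv :: "(real^'n) set \<Rightarrow> real" where
  "sigma_inv L = 4 * Inf ((\<lambda>x. x \<bullet> x) ` shadow L)"

definition lattice_min :: "(real^'n) set \<Rightarrow> real" where
  "lattice_min L = Inf ((\<lambda>x. x \<bullet> x) ` (L - {0}))"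

definition shell :: "(real^'n) set \<Rightarrow> real \<Rightarrow> (real^'n) set" where
  "shell A m = {x\<in>A. x \<bullet> x = m}"

definition monomials_deg :: "nat \<Rightarrow> ('n::finite \<Rightarrow> nat) set" where
  "monomials_deg d = {\<alpha>. (\<Sum>i\<in>UNIV. \<alpha> i) = d}"

definition hpoly :: "nat \<Rightarrow> (('n::finite \<Rightarrow> nat) \<Rightarrow> real) \<Rightarrow> real^'n \<Rightarrow> real" where
  "hpoly d c x = (\<Sum>\<alpha>\<in>monomials_deg d. c \<alpha> * (\<Prod>i\<in>UNIV. (x $ i) ^ (\<alpha> i)))"

text \<open>Harmonic: the Laplacian (written out on coefficients) vanishes.\<close>
definition harmonic :: "nat \<Rightarrow> (('n::finite \<Rightarrow> nat) \<Rightarrow> real) \<Rightarrow> bool" where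
  "harmonic d c \<longleftrightarrow> (2 \<le> d \<longrightarrow> (\<forall>\<beta>\<in>(monomials_deg (d - 2) :: ('n \<Rightarrow> nat) set).
      (\<Sum>i\<in>UNIV. real ((\<beta> i + 2) * (\<beta> i + 1)) * c (\<beta>(i := \<beta> i + 2))) = 0))"

definition cond_C :: "nat \<Rightarrow> (real^'n) set \<Rightarrow> bool" where
  "cond_C d X \<longleftrightarrow> (\<forall>c. harmonic d c \<longrightarrow> (\<Sum>x\<in>X. hpoly d c x) = 0)"

definition antipodal :: "(real^'n) set \<Rightarrow> bool" where
  "antipodal X \<longleftrightarrow> (\<forall>x\<in>X. - x \<in> X)"

definition design :: "(real^'n) set \<Rightarrow> nat \<Rightarrow> bool" where
  "design X t \<longleftrightarrow> finite X \<and> antipodal X \<and> (\<forall>j. 2 \<le> 2*j \<and> 2*j \<le> t \<longrightarrow> cond_C (2*j) X)"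

definition design_3half :: "(real^'n) set \<Rightarrow> bool" where
  "design_3half X \<longleftrightarrow> finite X \<and> antipodal X \<and> cond_C 2 X \<and> cond_C 6 X"

definition ip_int :: "nat \<Rightarrow> (nat \<Rightarrow> int) \<Rightarrow> (nat \<Rightarrow> int) \<Rightarrow> int" where
  "ip_int N u v = (\<Sum>l<N. u l * v l)"

text \<open>k orthogonal copies of D_m in Z^(k m): vectors \<pm>e_i \<pm>e_j, i \<noteq> j in the same block.\<close>
definition kD :: "nat \<Rightarrow> nat \<Rightarrow> (nat \<Rightarrow> int) set" where
  "kD k m = {v. \<exists>i j s t. i < k*m \<and> j < k*m \<and> i \<noteq> j \<and> i div m = j div m \<and>
      s \<in> {1, -1} \<and> t \<in> {1, -1} \<and>
      v = (\<lambda>l. if l = i then s else if l = j then t else 0)}"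

text \<open>k orthogonal copies of A_m in Z^(k (m+1)): vectors e_i - e_j, i \<noteq> j in the same block.\<close>
definition kA :: "nat \<Rightarrow> nat \<Rightarrow> (nat \<Rightarrow> int) set" where
  "kA k m = {v. \<exists>i j. i < k*(m+1) \<and> j < k*(m+1) \<and> i \<noteq> j \<and> i div (m+1) = j div (m+1) \<and>
      v = (\<lambda>l. if l = i then 1 else if l = j then -1 else 0)}"

definition roots_are :: "(real^'n) set \<Rightarrow> nat \<Rightarrow> (nat \<Rightarrow> int) set \<Rightarrow> bool" where
  "roots_are L N R \<longleftrightarrow> (\<exists>f. bij_betw f R (shell L 2) \<and>
      (\<forall>u\<in>R. \<forall>v\<in>R. f u \<bullet> f v = of_int (ip_int N u v)))"

text \<open>L is (isometric to) R^+: selfdual, of the given rank, minimum at least 2, norm-2 vectors R.\<close>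
definition plus_lattice :: "(real^'n) set \<Rightarrow> nat \<Rightarrow> nat \<Rightarrow> (nat \<Rightarrow> int) set \<Rightarrow> bool" where
  "plus_lattice L r N R \<longleftrightarrow> CARD('n) = r \<and> selfdual L \<and>
     (\<forall>x\<in>L. x \<noteq> 0 \<longrightarrow> 2 \<le> x \<bullet> x) \<and> roots_are L N R"

end

theory Submission
  imports Defs "HOL-Complex_Analysis.Complex_Analysis" "HOL-Probability.Probability"
begin

text \<open>
  For a selfdual lattice \<open>L\<close> of rank \<open>n\<close> and a harmonic polynomial \<open>P\<close> of degree \<open>d\<close>, Poisson
  summation turns the theta series of \<open>(L, P)\<close> into a modular form of weight \<open>n/2 + d\<close> for the group
  generated by \<open>z \<mapsto> -1/z\<close> and \<open>z \<mapsto> z + 2\<close>, whose expansion at the cusp 1 is the theta series of the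
  shadow. Since \<open>theta3\<close> and \<open>Delta8 = theta2\<^sup>4 theta4\<^sup>4 / 16\<close> have no zeros in the upper half plane, a
  form of weight \<open>K/2\<close> that vanishes to order \<open>j\<close> at infinity and to order \<open>s\<close> at the cusp 1 with
  \<open>K < 8 j + 4 s\<close> can be divided by a product of their powers, and the maximum principle forces it to be
  zero. Applied to \<open>P = 1\<close>, the number of vectors of norm 2 determines the theta series and bounds the
  norms in the shadow; in degree 2 the criterion kills the theta series; in degrees 4 and 6 it leaves
  only a multiple of \<open>theta3\<^sup>n\<^sup>-\<^sup>8 Delta8\<^sup>2\<close>, respectively of its product with \<open>Phi = theta4\<^sup>4 - theta2\<^sup>4\<close>.
  For \<open>n = 16\<close> the former is an even function of the nome. For \<open>m = 4\<^sup>a\<close> the coefficients of the relevant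
  forms vanish because their even parts agree with that of one form \<open>f\<close>, whose coefficients satisfy
  \<open>f(4 m) = 4096 f(m)\<close> and \<open>f(1) = 0\<close>.
\<close>

section \<open>Poisson summation on the integers\<close>

text \<open>All thresholds come from one count. In degree d the form has \<open>K\<close> = n + 2d,
  and \<open>sigma_inv L\<close> = n - 8 gives order s = (n - 8)/4 at the cusp 1, so the criterion
  reads 2d < 8j - 8. Minimum 2 gives j = 2, which suffices for d = 2. Subtracting a multiple of a
  model form that starts with q^2 gives j = 3, enough for d = 4 and d = 6; the multiplier is the sum
  of P over the roots. For P = 1 nothing is known about the shadow in advance, so s = 0, j = 3 and
  the criterion is n < 24. The comparison form theta3^n - 2n theta3^(n-8) Delta8 has no q-term and
  q^2-coefficient 2n(23 - n), which is 224, 120 and 0 in ranks 16, 20 and 23, the numbers of roots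
  of the lattices in question; at the cusp 1 it is divisible by theta2^(n-8), whence the shadow
  bound. Poisson summation in rank n is built by adding basis vectors one at a time, so that only
  the one-dimensional formula is analysis; harmonic weights enter afterwards, by comparing
  coefficients in a translation parameter. Weights may be half-integral: powers of
  \<open>csqrt (- \<i> * z)\<close> take the place of a multiplier system.\<close>

definition unit_lborel :: "real measure" where
  "unit_lborel = restrict_space lborel {0..<1}"

lemma finite_measure_unit_interval: "finite_measure unit_lborel"
  by (rule finite_measureI) (simp add: unit_lborel_def emeasure_restrict_space space_restrict_space)

lemma space_unit_interval [simp]: "space unit_lborel = {0..<1}"
  by (simp add: unit_lborel_def space_restrict_space)

lemma borel_measurable_unit_interval:
  "f \<in> borel_measurable borel \<Longrightarrow> f \<in> borel_measurable unit_lborel"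
  unfolding unit_lborel_def by (intro measurable_restrict_space1) simp

lemma borel_measurable_cnj' [measurable]:
  assumes "f \<in> borel_measurable M"
  shows "(\<lambda>x. cnj (f x)) \<in> borel_measurable M"
  using measurable_compose[OF assms borel_measurable_continuous_onI[of cnj]]
  by (simp add: continuous_on_cnj)

lemma integrable_unit_interval:
  fixes f :: "real \<Rightarrow> complex"
  assumes "f \<in> borel_measurable borel" "\<And>x. 0 \<le> x \<Longrightarrow> x < 1 \<Longrightarrow> cmod (f x) \<le> C"
  shows "integrable unit_lborel f"
  using assms by (intro finite_measure.integrable_const_bound[OF finite_measure_unit_interval, where B = C])
    (auto intro!: AE_I2 borel_measurable_unit_interval)

lemma integral_unit_interval:
  fixes f :: "real \<Rightarrow> complex"
  shows "(\<integral>x. f x \<partial>unit_lborel) = (\<integral>x. indicator {0..<1} x *\<^sub>R f x \<partial>lborel)"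
  unfolding unit_lborel_def by (subst integral_restrict_space) auto

lemma measure_unit_interval: "measure unit_lborel {0..<1} = 1"
  by (simp add: unit_lborel_def measure_restrict_space)

definition efun :: "int \<Rightarrow> real \<Rightarrow> complex" where
  "efun k x = cis (2 * pi * of_int k * x)"

lemma efun_measurable [measurable]: "efun k \<in> borel_measurable borel"
  unfolding efun_def by (intro borel_measurable_continuous_onI continuous_intros)

lemma norm_efun [simp]: "cmod (efun k x) = 1"
  by (simp add: efun_def)

lemma efun_0 [simp]: "efun 0 x = 1"
  by (simp add: efun_def)

lemma efun_add: "efun (j + k) x = efun j x * efun k x"
  by (simp add: efun_def cis_mult algebra_simps)

lemma cnj_efun: "cnj (efun k x) = efun (- k) x"
  by (simp add: efun_def cis_cnj)

lemma efun_of_int [simp]: "efun k (of_int j) = 1"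
proof -
  have "efun k (of_int j) = cis (2 * pi * of_int (k * j))" by (simp add: efun_def mult.assoc)
  also have "\<dots> = 1" by (rule cis_multiple_2pi) auto
  finally show ?thesis .
qed

lemma efun_shift: "efun k (x + of_int j) = efun k x"
proof -
  have "efun k (x + of_int j) = efun k x * efun k (of_int j)"
    by (simp add: efun_def cis_mult algebra_simps)
  then show ?thesis by simp
qed

lemma integral_efun: "(\<integral>x. efun k x \<partial>unit_lborel) = (if k = 0 then 1 else 0)"
proof (cases "k = 0")
  case True
  then show ?thesis by (simp add: measure_unit_interval)
next
  case False
  let ?c = "2 * pi * of_int k :: real"
  have c: "?c \<noteq> 0" using False by simp
  have "(\<integral>x. efun k x \<partial>unit_lborel) = (\<integral>x. indicator {0..1} x *\<^sub>R efun k x \<partial>lborel)"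
    unfolding integral_unit_interval
    by (rule integral_cong_AE)
      (use AE_lborel_singleton[of "1::real"] in \<open>auto elim!: eventually_mono split: split_indicator\<close>)
  also have "\<dots> = cis (?c * 1) / (\<i> * ?c) - cis (?c * 0) / (\<i> * ?c)"
  proof (rule integral_FTC_Icc)
    fix x :: real
    have "((\<lambda>x. cis (?c * x) / (\<i> * ?c)) has_vector_derivative (?c *\<^sub>R (\<i> * cis (?c * x))) / (\<i> * ?c)) (at x within {0..1})"
      by (auto intro!: derivative_eq_intros simp: has_vector_derivative_def fun_eq_iff algebra_simps scaleR_conv_of_real)
    then show "((\<lambda>x. cis (?c * x) / (\<i> * ?c)) has_vector_derivative efun k x) (at x within {0..1})"
      using c by (simp add: efun_def scaleR_conv_of_real field_simps)
  qed (auto simp: efun_def intro!: continuous_intros)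
  also have "\<dots> = 0" using efun_of_int[of k 1] by (simp add: efun_def)
  finally show ?thesis using False by simp
qed

definition fourier_coeff :: "(real \<Rightarrow> complex) \<Rightarrow> int \<Rightarrow> complex" where
  "fourier_coeff f k = (\<integral>x. f x * efun (- k) x \<partial>unit_lborel)"

text \<open>With \<open>S\<close> the Fourier sum over \<open>K\<close>, the integral of |g - S|^2
  is nonnegative. All three integrals involving \<open>S\<close> equal \<open>T\<close>, the sum of
  the squared coefficients, so the expansion leaves the integral of |g|^2 minus
  \<open>T\<close>.\<close>

lemma bessel_inequality:
  fixes g :: "real \<Rightarrow> complex"
  assumes g [measurable]: "g \<in> borel_measurable borel"
    and bound: "\<And>x. 0 \<le> x \<Longrightarrow> x < 1 \<Longrightarrow> cmod (g x) \<le> C" and K: "finite K"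
  shows "(\<Sum>k\<in>K. (cmod (fourier_coeff g k))\<^sup>2) \<le> C\<^sup>2"
proof -
  have C: "C \<ge> 0" using bound[of 0] norm_ge_zero[of "g 0"] by linarith
  define S where "S x = (\<Sum>k\<in>K. fourier_coeff g k * efun k x)" for x
  define T where "T = (\<Sum>k\<in>K. fourier_coeff g k * cnj (fourier_coeff g k))"
  have [measurable]: "S \<in> borel_measurable borel" unfolding S_def by (intro borel_measurable_sum borel_measurable_times) simp_all
  have Sb: "cmod (S x) \<le> (\<Sum>k\<in>K. cmod (fourier_coeff g k))" for x
    unfolding S_def by (rule order_trans[OF norm_sum]) (simp add: norm_mult)
  let ?B = "\<Sum>k\<in>K. cmod (fourier_coeff g k)"
  have B: "?B \<ge> 0" by (simp add: sum_nonneg)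
  have [simp]: "integrable unit_lborel (\<lambda>x. g x * cnj (g x))"
    by (rule integrable_unit_interval[where C = "C * C"]) (use bound C in \<open>auto simp: norm_mult intro!: mult_mono\<close>)
  have [simp]: "integrable unit_lborel (\<lambda>x. g x * cnj (S x))"
    by (rule integrable_unit_interval[where C = "C * ?B"]) (use bound C Sb in \<open>auto simp: norm_mult intro!: mult_mono\<close>)
  have [simp]: "integrable unit_lborel (\<lambda>x. S x * cnj (g x))"
    by (rule integrable_unit_interval[where C = "?B * C"]) (use bound C Sb B in \<open>auto simp: norm_mult intro!: mult_mono\<close>)
  have [simp]: "integrable unit_lborel (\<lambda>x. S x * cnj (S x))"
    by (rule integrable_unit_interval[where C = "?B * ?B"]) (use Sb B in \<open>auto simp: norm_mult intro!: mult_mono\<close>)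
  have ge: "integrable unit_lborel (\<lambda>x. g x * efun k x)" for k
    by (rule integrable_unit_interval[where C = C]) (use bound in \<open>auto simp: norm_mult\<close>)
  have ee: "integrable unit_lborel (efun k)" for k
    by (rule integrable_unit_interval[where C = 1]) auto
  have gS: "(\<integral>x. g x * cnj (S x) \<partial>unit_lborel) = T"
  proof -
    have "(\<integral>x. g x * cnj (S x) \<partial>unit_lborel) = (\<integral>x. (\<Sum>k\<in>K. cnj (fourier_coeff g k) * (g x * efun (- k) x)) \<partial>unit_lborel)"
      by (simp add: S_def cnj_efun sum_distrib_left algebra_simps)
    also have "\<dots> = (\<Sum>k\<in>K. cnj (fourier_coeff g k) * (\<integral>x. g x * efun (- k) x \<partial>unit_lborel))"
      using ge by (subst Bochner_Integration.integral_sum) auto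
    finally show ?thesis by (simp add: T_def fourier_coeff_def mult.commute)
  qed
  have Sg: "(\<integral>x. S x * cnj (g x) \<partial>unit_lborel) = T"
  proof -
    have "(\<integral>x. S x * cnj (g x) \<partial>unit_lborel) = (\<integral>x. cnj (g x * cnj (S x)) \<partial>unit_lborel)" by (simp add: mult.commute)
    also have "\<dots> = cnj T" using Bochner_Integration.integral_cnj[of unit_lborel "\<lambda>x. g x * cnj (S x)"] gS by simp
    also have "cnj T = T" by (simp add: T_def mult.commute)
    finally show ?thesis .
  qed
  have SS: "(\<integral>x. S x * cnj (S x) \<partial>unit_lborel) = T"
  proof -
    have "(\<integral>x. S x * cnj (S x) \<partial>unit_lborel) =
      (\<integral>x. (\<Sum>k\<in>K. \<Sum>l\<in>K. fourier_coeff g k * cnj (fourier_coeff g l) * efun (k - l) x) \<partial>unit_lborel)"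
      unfolding S_def cnj_sum sum_product
      using efun_add[of _ "- _"] by (simp add: cnj_efun mult_ac)
    also have "\<dots> = (\<Sum>k\<in>K. \<Sum>l\<in>K. fourier_coeff g k * cnj (fourier_coeff g l) * (if k - l = 0 then 1 else 0))"
      using ee by (simp add: Bochner_Integration.integral_sum integral_efun)
    also have "\<dots> = T" unfolding T_def using K by (simp add: if_distrib sum.delta cong: if_cong)
    finally show ?thesis .
  qed
  have "(\<integral>x. (g x - S x) * cnj (g x - S x) \<partial>unit_lborel) = (\<integral>x. g x * cnj (g x) \<partial>unit_lborel) - T"
  proof -
    have "(\<integral>x. (g x - S x) * cnj (g x - S x) \<partial>unit_lborel) =
      (\<integral>x. g x * cnj (g x) - g x * cnj (S x) - S x * cnj (g x) + S x * cnj (S x) \<partial>unit_lborel)"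
      by (simp add: algebra_simps)
    also have "\<dots> = (\<integral>x. g x * cnj (g x) \<partial>unit_lborel) - T - T + T" by (simp add: gS Sg SS)
    finally show ?thesis by simp
  qed
  moreover have "(\<integral>x. (g x - S x) * cnj (g x - S x) \<partial>unit_lborel) = of_real (\<integral>x. (cmod (g x - S x))\<^sup>2 \<partial>unit_lborel)"
    by (subst integral_complex_of_real[symmetric]) (simp only: complex_norm_square)
  moreover have "(\<integral>x. g x * cnj (g x) \<partial>unit_lborel) = of_real (\<integral>x. (cmod (g x))\<^sup>2 \<partial>unit_lborel)"
    by (subst integral_complex_of_real[symmetric]) (simp only: complex_norm_square)
  moreover have "T = of_real (\<Sum>k\<in>K. (cmod (fourier_coeff g k))\<^sup>2)"
    unfolding T_def of_real_sum by (simp only: complex_norm_square)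
  ultimately have "complex_of_real (\<integral>x. (cmod (g x - S x))\<^sup>2 \<partial>unit_lborel) =
      of_real ((\<integral>x. (cmod (g x))\<^sup>2 \<partial>unit_lborel) - (\<Sum>k\<in>K. (cmod (fourier_coeff g k))\<^sup>2))" by simp
  then have "(\<integral>x. (cmod (g x - S x))\<^sup>2 \<partial>unit_lborel) =
      (\<integral>x. (cmod (g x))\<^sup>2 \<partial>unit_lborel) - (\<Sum>k\<in>K. (cmod (fourier_coeff g k))\<^sup>2)"
    using of_real_eq_iff by blast
  moreover have "(\<integral>x. (cmod (g x - S x))\<^sup>2 \<partial>unit_lborel) \<ge> 0" by simp
  moreover have "(\<integral>x. (cmod (g x))\<^sup>2 \<partial>unit_lborel) \<le> (\<integral>x. C\<^sup>2 \<partial>unit_lborel)"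
  proof (rule integral_mono)
    show "integrable unit_lborel (\<lambda>x. (cmod (g x))\<^sup>2)"
      by (rule finite_measure.integrable_const_bound[OF finite_measure_unit_interval, where B = "C\<^sup>2"])
        (use bound in \<open>auto intro!: AE_I2 power_mono borel_measurable_unit_interval\<close>)
    show "integrable unit_lborel (\<lambda>x. C\<^sup>2)"
      using finite_measure_unit_interval by (simp add: finite_measure.integrable_const)
  qed (use bound in \<open>auto intro!: power_mono\<close>)
  ultimately show ?thesis by (simp add: measure_unit_interval)
qed

text \<open>The Riemann-Lebesgue lemma: by Bessel the squared coefficients have bounded partial
  sums. An injective index sequence covers both k = N and k = -N.\<close>

lemma fourier_coeff_tendsto_0:
  fixes g :: "real \<Rightarrow> complex" and r :: "nat \<Rightarrow> int"
  assumes "g \<in> borel_measurable borel" "\<And>x. 0 \<le> x \<Longrightarrow> x < 1 \<Longrightarrow> cmod (g x) \<le> C" and r: "inj r"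
  shows "(\<lambda>n. fourier_coeff g (r n)) \<longlonglongrightarrow> 0"
proof -
  have "summable (\<lambda>n. (cmod (fourier_coeff g (r n)))\<^sup>2)"
  proof (rule bounded_imp_summable[where B = "C\<^sup>2"])
    fix n
    have "(\<Sum>k\<le>n. (cmod (fourier_coeff g (r k)))\<^sup>2) = (\<Sum>k\<in>r ` {..n}. (cmod (fourier_coeff g k))\<^sup>2)"
      using r by (subst sum.reindex) (auto intro: inj_on_subset)
    also have "\<dots> \<le> C\<^sup>2" using assms by (intro bessel_inequality) auto
    finally show "(\<Sum>k\<le>n. (cmod (fourier_coeff g (r k)))\<^sup>2) \<le> C\<^sup>2" .
  qed simp
  from summable_LIMSEQ_zero[OF this] have "(\<lambda>n. sqrt ((cmod (fourier_coeff g (r n)))\<^sup>2)) \<longlonglongrightarrow> sqrt 0"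
    by (intro tendsto_intros)
  then show ?thesis by (simp add: tendsto_norm_zero_iff)
qed

text \<open>The chord has length 2 |sin (pi x)|. For 0 <= y <= 2 the cubic Taylor bound gives sin y
  >= y - y^3/6 >= y/3, and y = pi x lies in that range and is at least 3x. This bounds the
  denominator of Chernoff's quotient from below.\<close>

lemma cmod_efun_1_minus_1_ge:
  assumes "0 \<le> x" "x \<le> 1/2"
  shows "cmod (efun 1 x - 1) \<ge> 2 * x"
proof -
  have "(cmod (efun 1 x - 1))\<^sup>2 = (2 * sin (pi * x))\<^sup>2"
  proof -
    have "(cmod (efun 1 x - 1))\<^sup>2 = (cos (2 * (pi * x)) - 1)\<^sup>2 + (sin (2 * (pi * x)))\<^sup>2"
      by (simp add: cmod_power2 efun_def mult.assoc)
    also have "\<dots> = (2 * sin (pi * x))\<^sup>2"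
      unfolding cos_double_sin sin_double
      using sin_cos_squared_add[of "pi * x"] by algebra
    finally show ?thesis .
  qed
  then have eq: "cmod (efun 1 x - 1) = 2 * \<bar>sin (pi * x)\<bar>"
    using power2_eq_iff_nonneg[of "cmod (efun 1 x - 1)" "2 * \<bar>sin (pi * x)\<bar>"] by (simp add: power_mult_distrib)
  let ?y = "pi * x"
  have y: "0 \<le> ?y" "?y \<le> 2"
    using assms pi_less_4 mult_mono[of pi 4 x "1/2"] by auto
  have "\<bar>sin ?y - ?y\<bar> \<le> \<bar>?y\<bar> ^ 3 / 6"
    using Maclaurin_sin_bound[of ?y 3]
    by (simp add: sin_coeff_def eval_nat_numeral fact_numeral field_simps lessThan_Suc)
  moreover have "\<bar>?y\<bar> ^ 3 \<le> 4 * ?y"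
  proof -
    have "\<bar>?y\<bar> ^ 3 = ?y\<^sup>2 * ?y" using y by (simp add: power3_eq_cube power2_eq_square)
    also have "\<dots> \<le> 2\<^sup>2 * ?y" using y by (intro mult_right_mono power_mono) auto
    finally show ?thesis by simp
  qed
  ultimately have "sin ?y \<ge> ?y / 3" by linarith
  moreover have "?y \<ge> 3 * x" using pi_gt3 assms by (intro mult_right_mono) auto
  ultimately show ?thesis using eq by linarith
qed

text \<open>Chernoff's telescoping argument: dividing \<open>h - h 0\<close> by \<open>e\<^sup>2\<^sup>\<pi>\<^sup>i\<^sup>x - 1\<close> writes the Fourier
  coefficients of \<open>h\<close> as consecutive differences of those of a bounded function.\<close>

lemma fourier_sum_at_0:
  fixes h :: "real \<Rightarrow> complex"
  assumes h [measurable]: "h \<in> borel_measurable borel"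
    and bound: "\<And>x. 0 \<le> x \<Longrightarrow> x < 1 \<Longrightarrow> cmod (h x) \<le> C"
    and l: "\<And>x. 0 \<le> x \<Longrightarrow> x < 1 \<Longrightarrow> cmod (h x - h 0) \<le> M * x"
    and r: "\<And>x. 0 \<le> x \<Longrightarrow> x < 1 \<Longrightarrow> cmod (h x - h 0) \<le> M * (1 - x)"
  shows "(\<lambda>N. \<Sum>k\<in>{- int N<..int N}. fourier_coeff h k) \<longlonglongrightarrow> h 0"
proof -
  define g where "g x = (h x - h 0) / (efun 1 x - 1)" for x
  have [measurable]: "g \<in> borel_measurable borel" unfolding g_def by measurable
  have M: "M \<ge> 0" using order_trans[OF norm_ge_zero l[of "1/2"]] by simp
  have gb: "cmod (g x) \<le> M / 2" if x: "0 \<le> x" "x < 1" for x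
  proof (cases "x \<le> 1/2")
    case True
    show ?thesis
    proof (cases "x = 0")
      case False
      then have "cmod (g x) \<le> (M * x) / (2 * x)"
        unfolding g_def norm_divide using l[OF x] cmod_efun_1_minus_1_ge[OF x(1) True] x M
        by (intro frac_le) auto
      then show ?thesis using False by simp
    qed (simp add: g_def M)
  next
    case False
    have "cmod (efun 1 x - 1) = cmod (cnj (efun 1 x - 1))" by (simp only: complex_mod_cnj)
    also have "cnj (efun 1 x - 1) = efun 1 (1 - x) - 1"
      using efun_shift[of 1 "- x" 1] by (simp add: cnj_efun) (simp add: efun_def)
    finally have "cmod (efun 1 x - 1) \<ge> 2 * (1 - x)"
      using cmod_efun_1_minus_1_ge[of "1 - x"] False x by simp
    then have "cmod (g x) \<le> (M * (1 - x)) / (2 * (1 - x))"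
      unfolding g_def norm_divide using r[OF x] x M by (intro frac_le) auto
    also have "\<dots> = M / 2" using x by (simp add: divide_eq_eq)
    finally show ?thesis .
  qed
  have ig: "integrable unit_lborel (\<lambda>x. g x * efun k x)" for k
    by (rule integrable_unit_interval[where C = "M / 2"]) (use gb in \<open>auto simp: norm_mult\<close>)
  have ih: "integrable unit_lborel (\<lambda>x. h x * efun k x)" for k
    by (rule integrable_unit_interval[where C = C]) (use bound in \<open>auto simp: norm_mult\<close>)
  have ie: "integrable unit_lborel (efun k)" for k
    by (rule integrable_unit_interval[where C = 1]) auto
  \<comment> \<open>Integrate \<open>g x * (efun 1 x - 1) = h x - h 0\<close> against a character:
    multiplication by \<open>efun 1\<close> shifts the coefficient index by one.\<close>
  have diff: "fourier_coeff h k = (if k = 0 then h 0 else 0) + (fourier_coeff g (k - 1) - fourier_coeff g k)" for k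
  proof -
    have ne: "efun 1 x - 1 \<noteq> 0" if "0 < x" "x < 1" for x
    proof
      assume "efun 1 x - 1 = 0"
      then have "cos (2 * pi * x) = 1" "sin (2*pi*x) = 0" by (auto simp: efun_def complex_eq_iff)
      then obtain j :: int where "2 * pi * x = of_int j * 2 * pi"
        using cos_one_2pi_int[of "2*pi*x"] by auto
      then have "x = of_int j" by simp
      with that show False by simp
    qed
    have "fourier_coeff g (k - 1) - fourier_coeff g k = (\<integral>x. g x * efun (1 - k) x - g x * efun (- k) x \<partial>unit_lborel)"
      unfolding fourier_coeff_def using ig by simp
    also have "\<dots> = (\<integral>x. h x * efun (- k) x - h 0 * efun (- k) x \<partial>unit_lborel)"
    proof (rule Bochner_Integration.integral_cong[OF refl])
      fix x assume "x \<in> space unit_lborel"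
      then have x: "0 \<le> x" "x < 1" by auto
      have "g x * (efun 1 x - 1) = h x - h 0"
        using ne[of x] x by (cases "x = 0") (auto simp: g_def)
      then have "(g x * (efun 1 x - 1)) * efun (- k) x = (h x - h 0) * efun (- k) x" by simp
      then show "g x * efun (1 - k) x - g x * efun (- k) x = h x * efun (- k) x - h 0 * efun (- k) x"
        using efun_add[of 1 "- k" x] by (simp add: algebra_simps)
    qed
    also have "\<dots> = fourier_coeff h k - h 0 * (if k = 0 then 1 else 0)"
      using ih ie by (simp add: fourier_coeff_def integral_efun)
    finally show ?thesis by simp
  qed
  \<comment> \<open>The range is open on the left so that exactly the two coefficients at -N and at
    N survive; both tend to 0.\<close>
  have tele: "(\<Sum>k\<in>{- int N<..int N}. fourier_coeff g (k - 1) - fourier_coeff g k) =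
      fourier_coeff g (- int N) - fourier_coeff g (int N)" for N
  proof (induction N)
    case (Suc N)
    have "{- int (Suc N)<..int (Suc N)} = insert (- int N) (insert (int N + 1) {- int N<..int N})"
      by auto
    then show ?case using Suc
      by (simp add: algebra_simps) (rule arg_cong[where f = "fourier_coeff g"], simp)
  qed simp
  have "(\<lambda>N. fourier_coeff g (- int N) - fourier_coeff g (int N)) \<longlonglongrightarrow> 0 - 0"
    using gb by (intro tendsto_diff fourier_coeff_tendsto_0[where C = "M / 2"]) (auto simp: inj_def)
  then have "(\<lambda>N. h 0 + (\<Sum>k\<in>{- int N<..int N}. fourier_coeff g (k - 1) - fourier_coeff g k)) \<longlonglongrightarrow> h 0 + (0 - 0)"
    unfolding tele by (rule tendsto_add[OF tendsto_const])
  \<comment> \<open>For N = 0 the range is empty and misses k = 0, so the identity holds only from N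
    = 1 on.\<close>
  moreover have "eventually (\<lambda>N. h 0 + (\<Sum>k\<in>{- int N<..int N}. fourier_coeff g (k - 1) - fourier_coeff g k) =
     (\<Sum>k\<in>{- int N<..int N}. fourier_coeff h k)) sequentially"
    using eventually_gt_at_top[of 0]
  proof eventually_elim
    case (elim N)
    have "(\<Sum>k\<in>{- int N<..int N}. fourier_coeff h k) = (\<Sum>k\<in>{- int N<..int N}. if k = 0 then h 0 else 0) +
       (\<Sum>k\<in>{- int N<..int N}. fourier_coeff g (k - 1) - fourier_coeff g k)"
      by (subst diff) (simp only: sum.distrib)
    also have "(\<Sum>k\<in>{- int N<..int N}. if k = 0 then h 0 else 0) = h 0" using elim by (simp add: sum.delta)
    finally show ?case by simp
  qed
  ultimately show ?thesis by (simp add: filterlim_cong)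
qed

section \<open>Gaussian sums and Fourier transforms of Gaussians\<close>

lemma has_sum_diff:
  fixes f g :: "'a \<Rightarrow> 'b::real_normed_vector"
  assumes "(f has_sum a) A" "(g has_sum b) A"
  shows "((\<lambda>x. f x - g x) has_sum (a - b)) A"
  using has_sum_add[OF assms(1), of "\<lambda>x. - g x" "- b"] assms(2) by (simp add: has_sum_uminus)

lemma summable_gauss_int:
  assumes "(c::real) > 0"
  shows "(\<lambda>k::int. exp (- c * (of_int k)\<^sup>2)) summable_on UNIV"
proof -
  have nat: "(\<lambda>n::nat. exp (- c * (of_nat n)\<^sup>2)) summable_on UNIV"
  proof (rule summable_on_comparison_test)
    have "summable (\<lambda>n. exp (- c) ^ n)" using assms by (intro summable_geometric) simp
    then show "(\<lambda>n. exp (- c) ^ n) summable_on (UNIV::nat set)"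
      by (intro summable_nonneg_imp_summable_on) auto
    show "exp (- c * (of_nat n)\<^sup>2) \<le> exp (- c) ^ n" for n :: nat
    proof -
      have "real n \<le> (real n)\<^sup>2" by (metis of_nat_le_iff of_nat_power power2_nat_le_imp_le order_refl le_square power2_eq_square)
      then show ?thesis using assms by (simp flip: exp_of_nat_mult)
    qed
  qed auto
  have "(\<lambda>k::int. exp (- c * (of_int k)\<^sup>2)) summable_on range int"
    using nat by (subst summable_on_reindex) (auto simp: o_def)
  moreover have "(\<lambda>k::int. exp (- c * (of_int k)\<^sup>2)) summable_on range (\<lambda>n. - int n)"
    using nat by (subst summable_on_reindex) (auto simp: o_def inj_def)
  ultimately have "(\<lambda>k::int. exp (- c * (of_int k)\<^sup>2)) summable_on (range int \<union> range (\<lambda>n. - int n))"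
    by (rule summable_on_union)
  also have "range int \<union> range (\<lambda>n. - int n) = UNIV"
  proof -
    have "k \<in> range int \<union> range (\<lambda>n. - int n)" for k :: int
      by (cases k rule: int_cases2) auto
    then show ?thesis by auto
  qed
  finally show ?thesis .
qed

text \<open>Twice the difference of the sides is (k + 2s)^2. The bound trades a bounded shift of a
  Gaussian for half the exponent and a constant factor; the majorants in
  \<open>poisson_gauss_int\<close> rest on it.\<close>

lemma square_shift_ge: "((k::real) + s)\<^sup>2 \<ge> k\<^sup>2 / 2 - s\<^sup>2"
proof -
  have "0 \<le> (k + 2 * s)\<^sup>2" by simp
  then show ?thesis by (simp add: power2_eq_square algebra_simps)
qed

lemma summable_gauss_shift:
  assumes "(c::real) > 0"
  shows "(\<lambda>k::int. exp (- c * (of_int k + s)\<^sup>2)) summable_on UNIV"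
proof (rule summable_on_comparison_test)
  show "(\<lambda>k::int. exp (c * s\<^sup>2) * exp (- (c/2) * (of_int k)\<^sup>2)) summable_on UNIV"
    using assms by (intro summable_on_cmult_right summable_gauss_int) auto
  show "exp (- c * (of_int k + s)\<^sup>2) \<le> exp (c * s\<^sup>2) * exp (- (c/2) * (of_int k)\<^sup>2)" for k :: int
  proof -
    have "c * ((of_int k)\<^sup>2 / 2 - s\<^sup>2) \<le> c * (of_int k + s)\<^sup>2"
      using assms square_shift_ge by (intro mult_left_mono) auto
    then show ?thesis by (simp add: algebra_simps flip: exp_add)
  qed
qed auto

lemma has_sum_int_imp_tendsto:
  assumes "(f has_sum S) (UNIV :: int set)"
  shows "(\<lambda>N. \<Sum>k\<in>{- int N<..int N}. f k) \<longlonglongrightarrow> S"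
proof -
  have "filterlim (\<lambda>N. {- int N<..int N}) (finite_subsets_at_top UNIV) sequentially"
    unfolding filterlim_finite_subsets_at_top
  proof (intro allI impI)
    fix X :: "int set" assume "finite X \<and> X \<subseteq> UNIV"
    then have X: "finite X" by simp
    obtain B where B: "\<And>x. x \<in> X \<Longrightarrow> \<bar>x\<bar> \<le> B"
      using finite_imageI[OF X, of abs] by (metis Max_ge imageI)
    show "\<forall>\<^sub>F N in sequentially. finite {- int N<..int N} \<and> X \<subseteq> {- int N<..int N} \<and> {- int N<..int N} \<subseteq> UNIV"
      using eventually_gt_at_top[of "nat B"] by eventually_elim (use B in fastforce)
  qed
  with assms show ?thesis unfolding has_sum_def by (rule filterlim_compose)
qed

text \<open>Scaling by \<open>s\<close> turns the integrand into the standard normal density times a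
  character, and the value is the characteristic function exp(-t^2/2) at the rescaled frequency
  \<open>t\<close>.\<close>

lemma fourier_gauss:
  assumes a: "a > 0"
  shows "integrable lborel (\<lambda>x. of_real (exp (- pi * a * x\<^sup>2)) * cis (2 * pi * b * x))"
    and "(\<integral>x. of_real (exp (- pi * a * x\<^sup>2)) * cis (2 * pi * b * x) \<partial>lborel) =
      complex_of_real (exp (- pi * b\<^sup>2 / a) / sqrt a)"
proof -
  define s where "s = sqrt (2 * pi * a)"
  have s: "s > 0" "s\<^sup>2 = 2 * pi * a" using a by (auto simp: s_def)
  define t where "t = 2 * pi * b / s"
  have F: "of_real (exp (- pi * a * x\<^sup>2)) * cis (2 * pi * b * x) =
     of_real (sqrt (2 * pi)) * (of_real (std_normal_density (0 + s * x)) * cis (t * (0 + s * x)))" for x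
  proof -
    have "(s * x)\<^sup>2 / 2 = pi * a * x\<^sup>2" by (simp add: power_mult_distrib s)
    moreover have "t * (s * x) = 2 * pi * b * x" using s(1) by (simp add: t_def)
    ultimately show ?thesis unfolding std_normal_density_def add_0 by (simp only:) simp
  qed
  have int: "integrable lborel (\<lambda>x. of_real (std_normal_density x) * cis (t * x))"
  proof (rule Bochner_Integration.integrable_bound)
    show "integrable lborel std_normal_density" by simp
    have "(\<lambda>x. cis (t * x)) \<in> borel_measurable borel"
      by (intro borel_measurable_continuous_onI continuous_intros)
    then show "(\<lambda>x. of_real (std_normal_density x) * cis (t * x)) \<in> borel_measurable lborel"
      by simp
  qed (auto simp: norm_mult)
  have "integrable lborel (\<lambda>x. of_real (sqrt (2 * pi)) * (of_real (std_normal_density (0 + s * x)) * cis (t * (0 + s * x))))"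
    using lborel_integrable_real_affine[OF int, of s 0] s by simp
  then show "integrable lborel (\<lambda>x. of_real (exp (- pi * a * x\<^sup>2)) * cis (2 * pi * b * x))"
    unfolding F .
  have "complex_of_real (exp (- t\<^sup>2 / 2)) = char std_normal_distribution t"
    by (simp add: char_std_normal_distribution)
  also have "\<dots> = (\<integral>x. of_real (std_normal_density x) * cis (t * x) \<partial>lborel)"
  proof -
    have "(\<lambda>x. cis (t * x)) \<in> borel_measurable borel"
      by (intro borel_measurable_continuous_onI continuous_intros)
    then have [measurable]: "(\<lambda>x. iexp (t * x)) \<in> borel_measurable borel"
      by (simp add: cis_conv_exp)
    show ?thesis
      unfolding char_def
      by (subst integral_density) (auto simp: cis_conv_exp scaleR_conv_of_real)
  qed
  also have "\<dots> = s *\<^sub>R (\<integral>x. of_real (std_normal_density (0 + s * x)) * cis (t * (0 + s * x)) \<partial>lborel)"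
    using s by (subst lborel_integral_real_affine[where c = s and t = 0]) auto
  finally have "(\<integral>x. of_real (sqrt (2 * pi)) * (of_real (std_normal_density (0 + s * x)) * cis (t * (0 + s * x))) \<partial>lborel)
     = of_real (sqrt (2 * pi)) * (complex_of_real (exp (- t\<^sup>2 / 2)) / of_real s)"
    using s by (subst Bochner_Integration.integral_mult_right_zero) (simp add: scaleR_conv_of_real)
  also have "\<dots> = of_real (exp (- t\<^sup>2 / 2) / sqrt a)"
    using a by (simp add: s_def real_sqrt_mult)
  also have "- t\<^sup>2 / 2 = - pi * b\<^sup>2 / a"
    unfolding t_def power_divide s(2) using a by (simp add: power2_eq_square field_simps)
  finally show "(\<integral>x. of_real (exp (- pi * a * x\<^sup>2)) * cis (2 * pi * b * x) \<partial>lborel) =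
      complex_of_real (exp (- pi * b\<^sup>2 / a) / sqrt a)"
    unfolding F .
qed

text \<open>Translating the variable by \<open>v\<close> turns the character into the phase exp(2 pi
  i k v), and the modulation by \<open>b\<close> moves the dual frequency from k to k - b.\<close>

lemma fourier_gauss_shift:
  fixes a b v :: real
  assumes a: "a > 0"
  defines "f \<equiv> \<lambda>x. of_real (exp (- pi * a * (x + v)\<^sup>2)) * cis (2 * pi * b * (x + v))"
  shows "integrable lborel (\<lambda>x. f x * efun (- k) x)"
    and "(\<integral>x. f x * efun (- k) x \<partial>lborel) =
      of_real (exp (- pi * (of_int k - b)\<^sup>2 / a) / sqrt a) * cis (2 * pi * of_int k * v)"
proof -
  let ?g = "\<lambda>x. of_real (exp (- pi * a * x\<^sup>2)) * cis (2 * pi * (b - of_int k) * x)"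
  have F: "f x * efun (- k) x = cis (2 * pi * of_int k * v) * ?g (v + 1 * x)" for x
  proof -
    have "cis (2 * pi * b * (x + v)) * efun (- k) x = cis (2 * pi * of_int k * v) * cis (2 * pi * (b - of_int k) * (v + x))"
      by (simp add: efun_def cis_mult algebra_simps)
    then show ?thesis by (simp add: f_def add.commute mult_ac)
  qed
  note g = fourier_gauss[OF a, of "b - of_int k"]
  show "integrable lborel (\<lambda>x. f x * efun (- k) x)"
    unfolding F using lborel_integrable_real_affine[OF g(1), of 1 v] by (intro integrable_mult_right) simp
  have "(\<integral>x. f x * efun (- k) x \<partial>lborel) = cis (2 * pi * of_int k * v) * (\<integral>x. ?g (v + 1 * x) \<partial>lborel)"
    unfolding F by (rule Bochner_Integration.integral_mult_right_zero)
  also have "(\<integral>x. ?g (v + 1 * x) \<partial>lborel) = (\<integral>x. ?g x \<partial>lborel)"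
    by (subst (2) lborel_integral_real_affine[where c = 1 and t = v]) auto
  also have "\<dots> = complex_of_real (exp (- pi * (b - of_int k)\<^sup>2 / a) / sqrt a)" by (rule g(2))
  finally show "(\<integral>x. f x * efun (- k) x \<partial>lborel) =
      of_real (exp (- pi * (of_int k - b)\<^sup>2 / a) / sqrt a) * cis (2 * pi * of_int k * v)"
    by (simp add: power2_commute mult.commute)
qed

text \<open>The half-open unit intervals tile the line. The integers are enumerated by
  \<open>int_decode\<close> because countable additivity is phrased for sequences of sets.\<close>

lemma integral_lborel_eq_sum_unit_intervals:
  fixes F :: "real \<Rightarrow> complex"
  assumes F: "integrable lborel F"
  shows "(\<integral>x. F x \<partial>lborel) = (\<Sum>i. \<integral>x. F (x + of_int (int_decode i)) \<partial>unit_lborel)"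
proof -
  let ?c = "\<lambda>i. real_of_int (int_decode i)"
  let ?A = "\<lambda>i. {?c i..<?c i + 1}"
  have meas: "F \<in> borel_measurable borel" using F by auto
  have U: "(\<Union>i. ?A i) = UNIV"
  proof -
    have "x \<in> (\<Union>i. ?A i)" for x :: real
    proof
      show "x \<in> ?A (int_encode \<lfloor>x\<rfloor>)" by (simp; linarith)
    qed simp
    then show ?thesis by auto
  qed
  have "(\<integral>x. F x \<partial>lborel) = (LINT x:(\<Union>i. ?A i)|lborel. F x)"
    unfolding U by (simp add: set_lebesgue_integral_def)
  also have "\<dots> = (\<Sum>i. (LINT x:(?A i)|lborel. F x))"
  proof (rule lebesgue_integral_countable_add)
    fix i j :: nat assume "i \<noteq> j"
    then have "int_decode i \<noteq> int_decode j" by (simp add: inj_eq inj_int_decode)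
    then have "?c i + 1 \<le> ?c j \<or> ?c j + 1 \<le> ?c i" by linarith
    then show "?A i \<inter> ?A j = {}" by auto
  qed (use F in \<open>simp_all add: U set_integrable_def\<close>)
  also have "\<dots> = (\<Sum>i. \<integral>x. F (x + ?c i) \<partial>unit_lborel)"
  proof (rule suminf_cong)
    fix i
    have "(LINT x:(?A i)|lborel. F x) = (\<integral>x. indicator (?A i) (?c i + 1 * x) *\<^sub>R F (?c i + 1 * x) \<partial>lborel)"
      unfolding set_lebesgue_integral_def
      by (subst lborel_integral_real_affine[where c = 1 and t = "?c i"]) auto
    also have "\<dots> = (\<integral>x. indicator {0..<1} x *\<^sub>R F (x + ?c i) \<partial>lborel)"
      by (intro Bochner_Integration.integral_cong) (auto simp: add.commute split: split_indicator)
    finally show "(LINT x:(?A i)|lborel. F x) = (\<integral>x. F (x + ?c i) \<partial>unit_lborel)" by (simp add: integral_unit_interval)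
  qed
  finally show ?thesis .
qed

text \<open>The periodisation \<open>h\<close> of the Gaussian is Lipschitz, so its Fourier series
  converges at 0, and its coefficients are Gaussian integrals over the whole line. Both the shift
  \<open>v\<close> and the frequency \<open>b\<close> are kept, since the lattice induction meets
  one-dimensional sums that carry a shift and a phase at once.\<close>

theorem poisson_gauss_int:
  fixes a b v :: real
  assumes a: "a > 0"
  shows "(\<Sum>\<^sub>\<infinity>c\<in>(UNIV::int set). of_real (exp (- pi * a * (of_int c + v)\<^sup>2)) * cis (2 * pi * b * (of_int c + v))) =
    (\<Sum>\<^sub>\<infinity>k\<in>(UNIV::int set). of_real (exp (- pi * (of_int k - b)\<^sup>2 / a) / sqrt a) * cis (2 * pi * of_int k * v))"
proof -
  define f where "f x = complex_of_real (exp (- pi * a * (x + v)\<^sup>2)) * cis (2 * pi * b * (x + v))" for x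
  have nf: "cmod (f x) = exp (- pi * a * (x + v)\<^sup>2)" for x
    by (simp add: f_def norm_mult)
  have fc: "continuous_on UNIV f" unfolding f_def by (intro continuous_intros)
  have [measurable]: "f \<in> borel_measurable borel" by (rule borel_measurable_continuous_onI[OF fc])
  let ?c = "\<lambda>i. real_of_int (int_decode i)"
  define h where "h x = (\<Sum>\<^sub>\<infinity>c\<in>(UNIV::int set). f (x + of_int c))" for x
  have abs_sum: "(\<lambda>c::int. norm (f (x + of_int c))) summable_on UNIV" for x
    using summable_gauss_shift[of "pi * a" "x + v"] a by (simp add: nf add_ac)
  have sum: "(\<lambda>c::int. f (x + of_int c)) summable_on UNIV" for x
    using abs_sum by (rule abs_summable_summable)
  have nat_sums: "(\<lambda>i. f (x + ?c i)) sums h x" for x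
  proof -
    have "((\<lambda>c::int. f (x + of_int c)) has_sum h x) UNIV" unfolding h_def using sum by simp
    then have "((\<lambda>i. f (x + ?c i)) has_sum h x) UNIV"
      using has_sum_reindex_bij_betw[OF bij_int_decode, of "\<lambda>c. f (x + of_int c)"] by simp
    then show ?thesis by (rule has_sum_imp_sums)
  qed
  have [measurable]: "h \<in> borel_measurable borel"
  proof (rule borel_measurable_LIMSEQ_metric)
    show "(\<lambda>x. \<Sum>i<n. f (x + ?c i)) \<in> borel_measurable borel" for n by measurable
    show "(\<lambda>n. \<Sum>i<n. f (x + ?c i)) \<longlonglongrightarrow> h x" for x using nat_sums[of x] by (simp add: sums_def)
  qed
  define V where "V = (1 + \<bar>v\<bar>)\<^sup>2"
  have V: "(x + v)\<^sup>2 \<le> V" if "0 \<le> x" "x \<le> 1" for x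
    unfolding V_def using that by (intro power2_le_iff_abs_le[THEN iffD2]) auto
  have sq: "(x + of_int c + v)\<^sup>2 \<ge> (of_int c)\<^sup>2 / 2 - V" if "0 \<le> x" "x \<le> 1" for x and c :: int
    using square_shift_ge[of "of_int c" "x + v"] V[OF that] by (simp add: add_ac)
  \<comment> \<open>Majorant of the translate by c, uniform for x in [0, 1]; \<open>V\<close> bounds
    the square of the combined shift x + v.\<close>
  define B where "B c = exp (pi * a * V) * exp (- (pi * a / 2) * (of_int c)\<^sup>2)" for c :: int
  have fB: "cmod (f (x + of_int c)) \<le> B c" if "0 \<le> x" "x \<le> 1" for x c
  proof -
    have "pi * a * ((of_int c)\<^sup>2 / 2 - V) \<le> pi * a * (x + of_int c + v)\<^sup>2"
      using a sq[OF that] by (intro mult_left_mono) auto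
    then show ?thesis by (simp add: nf B_def algebra_simps flip: exp_add)
  qed
  have Bs: "B summable_on UNIV" unfolding B_def
    using a by (intro summable_on_cmult_right summable_gauss_int) auto
  \<comment> \<open>\<open>K\<close> absorbs the linear factor of the derivative: that factor is at
    most \<open>K * exp (pi * a / 2 * s\<^sup>2)\<close>, which costs half of the Gaussian exponent;
    the shift estimate halves the rest, hence \<open>pi * a / 4\<close> in \<open>D\<close>.\<close>
  define K where "K = (2 * pi * a + 2 * pi * \<bar>b\<bar>) * (1 + 2 / (pi * a))"
  define D where "D c = K * exp (pi * a / 2 * V) * exp (- (pi * a / 4) * (of_int c)\<^sup>2)" for c :: int
  have K: "K \<ge> 0" using a by (simp add: K_def)
  have Ds: "D summable_on UNIV" unfolding D_def
    using a by (intro summable_on_cmult_right summable_gauss_int) auto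
  have D0: "D c \<ge> 0" for c using K by (simp add: D_def)
  have f': "(f has_vector_derivative (of_real (- 2 * pi * a * (x + v)) + \<i> * of_real (2 * pi * b)) * f x) (at x within S)" for x S
  proof -
    have "((\<lambda>w. exp (- of_real (pi * a) * (w + of_real v)\<^sup>2 + \<i> * of_real (2 * pi * b) * (w + of_real v))) has_field_derivative
        (of_real (- 2 * pi * a * (x + v)) + \<i> * of_real (2 * pi * b)) * exp (- of_real (pi * a) * (of_real x + of_real v)\<^sup>2 + \<i> * of_real (2 * pi * b) * (of_real x + of_real v))) (at (of_real x))"
      by (rule derivative_eq_intros refl | simp add: algebra_simps)+
    from has_vector_derivative_real_field[OF this, of S]
    have "((\<lambda>x. exp (- of_real (pi * a) * (of_real x + of_real v)\<^sup>2 + \<i> * of_real (2 * pi * b) * (of_real x + of_real v))) has_vector_derivative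
        (of_real (- 2 * pi * a * (x + v)) + \<i> * of_real (2 * pi * b)) * exp (- of_real (pi * a) * (of_real x + of_real v)\<^sup>2 + \<i> * of_real (2 * pi * b) * (of_real x + of_real v))) (at x within S)" .
    moreover have fx: "f x = exp (- of_real (pi * a) * (of_real x + of_real v)\<^sup>2 + \<i> * of_real (2 * pi * b) * (of_real x + of_real v))" for x
      unfolding f_def cis_conv_exp of_real_exp exp_add[symmetric] by (simp add: algebra_simps)
    moreover have "f = (\<lambda>x. exp (- of_real (pi * a) * (of_real x + of_real v)\<^sup>2 + \<i> * of_real (2 * pi * b) * (of_real x + of_real v)))"
      using fx by blast
    ultimately show ?thesis by metis
  qed
  have f'D: "cmod ((of_real (- 2 * pi * a * (y + v)) + \<i> * of_real (2 * pi * b)) * f y) \<le> D c"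
    if y: "of_int c \<le> y" "y \<le> of_int c + 1" for y c
  proof -
    define s where "s = y + v"
    have "cmod (of_real (- 2 * pi * a * s) + \<i> * of_real (2 * pi * b)) \<le> 2 * pi * a * \<bar>s\<bar> + 2 * pi * \<bar>b\<bar>"
      by (rule order_trans[OF norm_triangle_ineq]) (use a in \<open>simp add: norm_mult abs_mult\<close>)
    also have "\<dots> \<le> (2 * pi * a + 2 * pi * \<bar>b\<bar>) * (1 + s\<^sup>2)"
    proof -
      have "\<bar>s\<bar> \<le> 1 + s\<^sup>2" using zero_le_power2[of "\<bar>s\<bar> - 1"]
        by (simp add: power2_eq_square algebra_simps)
      then have "2 * pi * a * \<bar>s\<bar> \<le> 2 * pi * a * (1 + s\<^sup>2)" using a by (intro mult_left_mono) auto
      moreover have "2 * pi * \<bar>b\<bar> * 1 \<le> 2 * pi * \<bar>b\<bar> * (1 + s\<^sup>2)" by (intro mult_left_mono) auto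
      ultimately have "2 * pi * a * \<bar>s\<bar> + 2 * pi * \<bar>b\<bar> * 1 \<le> 2 * pi * a * (1 + s\<^sup>2) + 2 * pi * \<bar>b\<bar> * (1 + s\<^sup>2)"
        by (rule add_mono)
      then show ?thesis by (simp only: distrib_right mult_1_right)
    qed
    also have "\<dots> \<le> (2 * pi * a + 2 * pi * \<bar>b\<bar>) * ((1 + 2 / (pi * a)) * exp (pi * a / 2 * s\<^sup>2))"
    proof (rule mult_left_mono)
      have "(1 + 2 / (pi * a)) * (1 + pi * a / 2 * s\<^sup>2) = 1 + s\<^sup>2 + (2 / (pi * a) + pi * a / 2 * s\<^sup>2)"
        using a by (simp add: field_simps)
      moreover have "0 \<le> 2 / (pi * a) + pi * a / 2 * s\<^sup>2" using a by simp
      ultimately have "1 + s\<^sup>2 \<le> (1 + 2 / (pi * a)) * (1 + pi * a / 2 * s\<^sup>2)"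
        by linarith
      also have "\<dots> \<le> (1 + 2 / (pi * a)) * exp (pi * a / 2 * s\<^sup>2)"
        using a exp_ge_add_one_self[of "pi * a / 2 * s\<^sup>2"] by (intro mult_left_mono) auto
      finally show "1 + s\<^sup>2 \<le> (1 + 2 / (pi * a)) * exp (pi * a / 2 * s\<^sup>2)" .
    qed (use a in auto)
    finally have "cmod (of_real (- 2 * pi * a * s) + \<i> * of_real (2 * pi * b)) \<le> K * exp (pi * a / 2 * s\<^sup>2)"
      by (simp add: K_def mult.assoc)
    then have "cmod (of_real (- 2 * pi * a * s) + \<i> * of_real (2 * pi * b)) * exp (- pi * a * s\<^sup>2) \<le>
       K * exp (pi * a / 2 * s\<^sup>2) * exp (- pi * a * s\<^sup>2)" by (intro mult_right_mono) auto
    also have "\<dots> = K * exp (- (pi * a / 2) * s\<^sup>2)" by (simp add: mult.assoc flip: exp_add)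
    also have "\<dots> \<le> K * (exp (pi * a / 2 * V) * exp (- (pi * a / 4) * (of_int c)\<^sup>2))"
    proof (rule mult_left_mono[OF _ K])
      have "pi * a / 2 * ((of_int c)\<^sup>2 / 2 - V) \<le> pi * a / 2 * s\<^sup>2"
        using a sq[of "y - of_int c" c] y by (intro mult_left_mono) (auto simp: s_def)
      then show "exp (- (pi * a / 2) * s\<^sup>2) \<le> exp (pi * a / 2 * V) * exp (- (pi * a / 4) * (of_int c)\<^sup>2)"
        by (simp add: algebra_simps flip: exp_add)
    qed
    finally show ?thesis by (simp add: norm_mult nf s_def D_def mult.assoc)
  qed
  have lip: "cmod (f x - f y) \<le> D c * \<bar>x - y\<bar>"
    if "x \<in> {of_int c..of_int c + 1}" "y \<in> {of_int c..of_int c + 1}" for x y c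
  proof -
    have "norm (f x - f y) \<le> D c * norm (x - y)"
    proof (rule differentiable_bound[of "{of_int c..of_int c + 1}"])
      fix z assume z: "z \<in> {real_of_int c..of_int c + 1}"
      show "(f has_derivative (\<lambda>t. t *\<^sub>R ((of_real (- 2 * pi * a * (z + v)) + \<i> * of_real (2 * pi * b)) * f z))) (at z within {of_int c..of_int c + 1})"
        using f' by (simp add: has_vector_derivative_def)
      show "onorm (\<lambda>t. t *\<^sub>R ((of_real (- 2 * pi * a * (z + v)) + \<i> * of_real (2 * pi * b)) * f z)) \<le> D c"
        using f'D[of c z] z D0[of c] by (intro onorm_bound) (auto simp: mult.commute[of "D c"] intro!: mult_left_mono)
    qed (use that in auto)
    then show ?thesis by simp
  qed
  have h_diff: "cmod (h x - h y) \<le> infsum D UNIV * \<bar>x - y\<bar>" if "x \<in> {0..1}" "y \<in> {0..1}" for x y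
  proof -
    have hs: "((\<lambda>c::int. f (x + of_int c)) has_sum h x) UNIV" for x
      unfolding h_def using sum by simp
    have "cmod (h x - h y) \<le> (\<Sum>\<^sub>\<infinity>c\<in>(UNIV::int set). D c * \<bar>x - y\<bar>)"
    proof (rule norm_infsum_le)
      show "((\<lambda>c::int. f (x + of_int c) - f (y + of_int c)) has_sum (h x - h y)) UNIV"
        by (intro has_sum_diff hs)
      show "((\<lambda>c. D c * \<bar>x - y\<bar>) has_sum (\<Sum>\<^sub>\<infinity>c\<in>(UNIV::int set). D c * \<bar>x - y\<bar>)) UNIV"
        using Ds by (intro has_sum_infsum summable_on_cmult_left) auto
      show "norm (f (x + of_int c) - f (y + of_int c)) \<le> D c * \<bar>x - y\<bar>" for c :: int
        using lip[of "x + of_int c" c "y + of_int c"] that by auto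
    qed
    also have "\<dots> = infsum D UNIV * \<bar>x - y\<bar>" using Ds by (intro infsum_cmult_left) auto
    finally show ?thesis .
  qed
  \<comment> \<open>Periodicity turns the Lipschitz estimate at the right end of the interval into
    one against \<open>h 0\<close>, so that 0 is approached from both sides.\<close>
  have h1: "h 1 = h 0"
  proof -
    have "h 1 = (\<Sum>\<^sub>\<infinity>c\<in>(UNIV::int set). f (0 + of_int (c + 1)))" by (simp add: h_def add_ac)
    also have "\<dots> = h 0" unfolding h_def
      by (rule infsum_reindex_bij_witness[of UNIV "\<lambda>c. c - 1" "\<lambda>c. c + 1"]) auto
    finally show ?thesis .
  qed
  have hb: "cmod (h x) \<le> infsum B UNIV" if "0 \<le> x" "x < 1" for x
    unfolding h_def
  proof (rule norm_infsum_le)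
    show "((\<lambda>c::int. f (x + of_int c)) has_sum (\<Sum>\<^sub>\<infinity>c. f (x + of_int c))) UNIV"
      using sum by simp
    show "(B has_sum infsum B UNIV) UNIV" using Bs by simp
    show "norm (f (x + of_int c)) \<le> B c" for c using fB that by simp
  qed
  have "(\<lambda>N. \<Sum>k\<in>{- int N<..int N}. fourier_coeff h k) \<longlonglongrightarrow> h 0"
  proof (rule fourier_sum_at_0)
    show "cmod (h x - h 0) \<le> infsum D UNIV * x" if "0 \<le> x" "x < 1" for x
      using h_diff[of x 0] that by simp
    show "cmod (h x - h 0) \<le> infsum D UNIV * (1 - x)" if "0 \<le> x" "x < 1" for x
      using h_diff[of x 1] that h1 by simp
  qed (use hb in auto)
  moreover have coeff: "fourier_coeff h k =
      of_real (exp (- pi * (of_int k - b)\<^sup>2 / a) / sqrt a) * cis (2 * pi * of_int k * v)" (is "_ = ?R k") for k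
  proof -
    have "fourier_coeff h k = (\<integral>x. (\<Sum>i. f (x + ?c i) * efun (- k) (x + ?c i)) \<partial>unit_lborel)"
    proof -
      have "(\<Sum>i. f (x + ?c i) * efun (- k) (x + ?c i)) = h x * efun (- k) x" for x
        unfolding efun_shift using sums_mult2[OF nat_sums[of x], of "efun (- k) x"] by (simp add: sums_iff)
      then show ?thesis by (simp add: fourier_coeff_def)
    qed
    \<comment> \<open>The majorant \<open>B\<close> does not depend on x and is summable, so series
      and integral may be exchanged; the pieces then reassemble into one integral over the
      line.\<close>
    also have "\<dots> = (\<Sum>i. \<integral>x. f (x + ?c i) * efun (- k) (x + ?c i) \<partial>unit_lborel)"
    proof (rule integral_suminf)
      have Bd: "cmod (f (x + ?c i) * efun (- k) (x + ?c i)) \<le> B (int_decode i)" if "0 \<le> x" "x < 1" for x i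
        using fB[of x "int_decode i"] that by (simp add: norm_mult)
      show int: "integrable unit_lborel (\<lambda>x. f (x + ?c i) * efun (- k) (x + ?c i))" for i
        by (rule integrable_unit_interval[where C = "B (int_decode i)"]) (use Bd in auto)
      have sB: "summable (\<lambda>i. B (int_decode i))"
        using Bs summable_on_reindex_bij_betw[OF bij_int_decode, of B]
        by (intro summable_on_imp_summable) (simp add: o_def)
      show "AE x in unit_lborel. summable (\<lambda>i. norm (f (x + ?c i) * efun (- k) (x + ?c i)))"
        by (rule AE_I2) (use Bd in \<open>auto intro!: summable_comparison_test[OF _ sB]\<close>)
      show "summable (\<lambda>i. \<integral>x. norm (f (x + ?c i) * efun (- k) (x + ?c i)) \<partial>unit_lborel)"
      proof (rule summable_comparison_test[OF _ sB], intro exI allI impI)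
        fix i
        have "(\<integral>x. norm (f (x + ?c i) * efun (- k) (x + ?c i)) \<partial>unit_lborel) \<le> (\<integral>x. B (int_decode i) \<partial>unit_lborel)"
          using int[of i] Bd finite_measure_unit_interval
          by (intro integral_mono) (auto simp: finite_measure.integrable_const)
        then show "norm (\<integral>x. norm (f (x + ?c i) * efun (- k) (x + ?c i)) \<partial>unit_lborel) \<le> B (int_decode i)"
          by (simp add: measure_unit_interval)
      qed
    qed
    also have "\<dots> = (\<integral>x. f x * efun (- k) x \<partial>lborel)"
      using integral_lborel_eq_sum_unit_intervals[OF fourier_gauss_shift(1)[OF a, of v b k]]
      by (simp add: f_def)
    also have "\<dots> = ?R k"
      using fourier_gauss_shift(2)[OF a, of v b k] by (simp add: f_def)
    finally show ?thesis .
  qed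
  moreover have "(\<lambda>N. \<Sum>k\<in>{- int N<..int N}. ?R k) \<longlonglongrightarrow> infsum ?R UNIV"
  proof (intro has_sum_int_imp_tendsto has_sum_infsum, rule abs_summable_summable)
    have "(\<lambda>k::int. exp (- (pi / a) * (of_int k + (- b))\<^sup>2) * (1 / sqrt a)) summable_on UNIV"
      using a by (intro summable_on_cmult_left summable_gauss_shift) auto
    then show "(\<lambda>k. norm (?R k)) summable_on UNIV"
      using a by (simp add: norm_mult norm_divide)
  qed
  ultimately have "h 0 = infsum ?R UNIV" by (simp add: LIMSEQ_unique)
  then show ?thesis by (simp add: h_def f_def)
qed

section \<open>Poisson summation on lattices\<close>

no_notation Infinite_Set_Sum.abs_summable_on (infix \<open>abs'_summable'_on\<close> 50)

definition zspan :: "'a::real_vector set \<Rightarrow> 'a set" where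
  "zspan B = range (\<lambda>c::'a \<Rightarrow> int. \<Sum>b\<in>B. of_int (c b) *\<^sub>R b)"

text \<open>Taken inside the span of \<open>B\<close>, so that it is again a lattice of the same
  rank for the partial bases met in the induction.\<close>

definition dual_in_span :: "'a::euclidean_space set \<Rightarrow> 'a set" where
  "dual_in_span B = {y \<in> span B. \<forall>b\<in>B. b \<bullet> y \<in> \<int>}"

lemma zspan_subset_span: "zspan B \<subseteq> span B"
  unfolding zspan_def by (auto intro: span_sum span_scale span_base)

lemma bij_betw_zspan_insert:
  assumes B: "finite B" "b \<notin> B" "independent (insert b B)"
  shows "bij_betw (\<lambda>(k::int, x). x + of_int k *\<^sub>R b) (UNIV \<times> zspan B) (zspan (insert b B))"
proof (rule bij_betw_imageI)
  have bs: "b \<notin> span B" using B by (simp add: independent_insert)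
  show "inj_on (\<lambda>(k::int, x). x + of_int k *\<^sub>R b) (UNIV \<times> zspan B)"
  proof (rule inj_onI, clarify)
    fix k k' :: int and x x' assume x: "x \<in> zspan B" "x' \<in> zspan B"
      and eq: "x + of_int k *\<^sub>R b = x' + of_int k' *\<^sub>R b"
    then have "(of_int k - of_int k' :: real) *\<^sub>R b = x' - x" by (simp add: algebra_simps)
    also have "\<dots> \<in> span B" using x zspan_subset_span by (intro span_diff) auto
    finally have sp: "(of_int k - of_int k' :: real) *\<^sub>R b \<in> span B" .
    have "k = k'"
    proof (rule ccontr)
      assume "k \<noteq> k'"
      then have "b = (1 / (of_int k - of_int k' :: real)) *\<^sub>R ((of_int k - of_int k' :: real) *\<^sub>R b)" by simp
      with sp bs show False by (metis span_scale)
    qed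
    with eq show "k = k' \<and> x = x'" by simp
  qed
  show "(\<lambda>(k::int, x). x + of_int k *\<^sub>R b) ` (UNIV \<times> zspan B) = zspan (insert b B)" (is "?L = ?R")
  proof
    show "?L \<subseteq> ?R"
    proof clarify
      fix k :: int and x assume "x \<in> zspan B"
      then obtain c :: "'a \<Rightarrow> int" where c: "x = (\<Sum>b\<in>B. of_int (c b) *\<^sub>R b)" by (auto simp: zspan_def)
      have "x + of_int k *\<^sub>R b = (\<Sum>a\<in>insert b B. of_int ((c(b := k)) a) *\<^sub>R a)"
        using B by (simp add: c) (auto intro!: sum.cong)
      then show "x + of_int k *\<^sub>R b \<in> zspan (insert b B)" unfolding zspan_def by (intro image_eqI[where x = "c(b := k)"]) auto
    qed
    show "?R \<subseteq> ?L"
    proof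
      fix x assume "x \<in> ?R"
      then obtain c :: "'a \<Rightarrow> int" where c: "x = (\<Sum>b\<in>insert b B. of_int (c b) *\<^sub>R b)" by (auto simp: zspan_def)
      then have "x = (\<lambda>(k::int, x). x + of_int k *\<^sub>R b) (c b, \<Sum>b\<in>B. of_int (c b) *\<^sub>R b)"
        using B by (simp add: add.commute)
      then show "x \<in> ?L" by (rule image_eqI) (auto simp: zspan_def)
    qed
  qed
qed

lemma abs_summable_on_times:
  fixes f :: "'a \<Rightarrow> real" and g :: "'b \<Rightarrow> real"
  assumes "f summable_on A" "g summable_on B" "\<And>x. f x \<ge> 0" "\<And>y. g y \<ge> 0"
  shows "(\<lambda>(x, y). f x * g y) abs_summable_on A \<times> B"
proof (subst Infinite_Sum.abs_summable_on_Sigma_iff, intro conjI ballI)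
  show "(\<lambda>y. case (x, y) of (x, y) \<Rightarrow> f x * g y) abs_summable_on B" for x
    using assms by (auto intro!: summable_on_cmult_right simp: abs_mult)
  have "(\<lambda>x. f x * infsum g B) summable_on A" using assms by (intro summable_on_cmult_left)
  moreover have "(\<Sum>\<^sub>\<infinity>y\<in>B. norm (f x * g y)) = f x * infsum g B" for x
    using assms by (simp add: infsum_cmult_right abs_mult)
  ultimately show "(\<lambda>x. \<Sum>\<^sub>\<infinity>y\<in>B. norm (case (x, y) of (x, y) \<Rightarrow> f x * g y)) abs_summable_on A"
    using assms by (simp add: infsum_nonneg abs_mult)
qed

text \<open>One-dimensional Poisson summation rewrites the left side with phases depending on
  \<open>s\<close>; dropping them gives a bound independent of \<open>s\<close>. This uniformity
  makes the double sum over the enlarged dual lattice converge absolutely.\<close>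

lemma infsum_gauss_dual_le:
  fixes a s :: real
  assumes a: "a > 0"
  shows "(\<Sum>\<^sub>\<infinity>k\<in>(UNIV::int set). exp (- pi * (of_int k - s)\<^sup>2 / a)) \<le> sqrt a * (\<Sum>\<^sub>\<infinity>k\<in>(UNIV::int set). exp (- pi * a * (of_int k)\<^sup>2))"
proof -
  let ?f = "\<lambda>k::int. exp (- pi * (of_int k - s)\<^sup>2 / a)"
  have fs: "?f summable_on UNIV"
    using summable_gauss_shift[of "pi / a" "- s"] a by simp
  have gs: "(\<lambda>k::int. exp (- pi * a * (of_int k)\<^sup>2)) summable_on UNIV"
    using summable_gauss_shift[of "pi * a" 0] a by simp
  have "complex_of_real (infsum ?f UNIV / sqrt a) =
     (\<Sum>\<^sub>\<infinity>k\<in>(UNIV::int set). of_real (?f k / sqrt a) * cis (2 * pi * of_int k * 0))"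
  proof -
    have "((\<lambda>k. complex_of_real (?f k * (1 / sqrt a))) has_sum of_real (infsum ?f UNIV * (1 / sqrt a))) UNIV"
      using fs by (intro has_sum_of_real has_sum_cmult_left) auto
    then show ?thesis by (simp add: infsumI)
  qed
  also have "\<dots> = (\<Sum>\<^sub>\<infinity>c\<in>(UNIV::int set). of_real (exp (- pi * a * (of_int c + 0)\<^sup>2)) * cis (2 * pi * s * (of_int c + 0)))"
    by (rule poisson_gauss_int[OF a, symmetric])
  finally have "cmod (complex_of_real (infsum ?f UNIV / sqrt a)) \<le> (\<Sum>\<^sub>\<infinity>k\<in>(UNIV::int set). exp (- pi * a * (of_int k)\<^sup>2))"
    using norm_infsum_bound[of "\<lambda>c::int. of_real (exp (- pi * a * (of_int c + 0)\<^sup>2)) * cis (2 * pi * s * (of_int c + 0))" UNIV] gs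
    by (simp add: norm_mult)
  moreover have "infsum ?f UNIV \<ge> 0" by (intro infsum_nonneg) auto
  ultimately show ?thesis using a by (simp add: norm_divide field_simps)
qed

text \<open>\<open>V\<close> stands for the inverse covolume of \<open>zspan B\<close> in its span.
  The translation is split into \<open>p\<close> in the span and \<open>r\<close> orthogonal to it,
  because a further basis vector contributes multiples of its orthogonal component: the formula for
  translations inside the span alone would not carry the induction.\<close>

definition gauss_poisson :: "'a::euclidean_space set \<Rightarrow> real \<Rightarrow> real \<Rightarrow> bool" where
  "gauss_poisson B V t \<longleftrightarrow>
     (\<forall>u. (\<lambda>x. exp (- pi * t * (norm (x + u))\<^sup>2)) summable_on zspan B) \<and>
     (\<lambda>y. exp (- pi * (norm y)\<^sup>2 / t)) summable_on dual_in_span B \<and>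
     (\<forall>p r. p \<in> span B \<longrightarrow> (\<forall>x\<in>span B. x \<bullet> r = 0) \<longrightarrow>
       complex_of_real (\<Sum>\<^sub>\<infinity>x\<in>zspan B. exp (- pi * t * (norm (x + (p + r)))\<^sup>2)) =
       of_real (V * (1 / sqrt t) ^ card B * exp (- pi * t * (norm r)\<^sup>2)) *
       (\<Sum>\<^sub>\<infinity>y\<in>dual_in_span B. of_real (exp (- pi * (norm y)\<^sup>2 / t)) * cis (2 * pi * (y \<bullet> p))))"

text \<open>For each multiple k b of the new vector the hypothesis handles the sum over
  \<open>zspan B\<close>, translated by k b0 inside the span and by k \<beta> across it; the
  remaining sum over k is a one-dimensional Gaussian sum. The factor 1/|\<beta>| is the change of
  the inverse covolume in a Gram-Schmidt step.\<close>

lemma gauss_poisson_insert: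
  fixes B :: "'a::euclidean_space set"
  assumes fin: "finite B" and bB: "b \<notin> B" and ind: "independent (insert b B)" and t: "t > 0" and V: "V > 0"
    and GP: "gauss_poisson B V t"
    and b0: "b0 \<in> span B" and orth: "\<And>x. x \<in> span B \<Longrightarrow> x \<bullet> \<beta> = 0" and b: "b = b0 + \<beta>"
  shows "gauss_poisson (insert b B) (V / norm \<beta>) t"
proof -
  define m where "m = card B"
  \<comment> \<open>The multiples of \<beta> contribute exp(-pi A (k + v)^2), so \<open>A\<close> is
    the parameter of the one-dimensional formula.\<close>
  define A where "A = t * (norm \<beta>)\<^sup>2"
  have bs: "b \<notin> span B" using bB ind by (simp add: independent_insert)
  have "\<beta> \<noteq> 0" using bs b b0 by auto
  then have A: "A > 0" and n\<beta>: "norm \<beta> > 0" using t by (auto simp: A_def)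
  have sA: "sqrt A = sqrt t * norm \<beta>" by (simp add: A_def real_sqrt_mult)
  note GPD = GP[unfolded gauss_poisson_def]
  define C0 where "C0 = V * (1 / sqrt t) ^ m"
  have C0: "C0 > 0" using V t by (simp add: C0_def)
  have summ: "(\<lambda>x. exp (- pi * t * (norm (x + u))\<^sup>2)) summable_on zspan B" for u using GPD by blast
  have dsumm: "(\<lambda>y. exp (- pi * (norm y)\<^sup>2 / t)) summable_on dual_in_span B" using GPD by blast
  have inner: "complex_of_real (\<Sum>\<^sub>\<infinity>x\<in>zspan B. exp (- pi * t * (norm (x + (p + r)))\<^sup>2)) =
       of_real (C0 * exp (- pi * t * (norm r)\<^sup>2)) *
       (\<Sum>\<^sub>\<infinity>y\<in>dual_in_span B. of_real (exp (- pi * (norm y)\<^sup>2 / t)) * cis (2 * pi * (y \<bullet> p)))"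
    if "p \<in> span B" "\<And>x. x \<in> span B \<Longrightarrow> x \<bullet> r = 0" for p r
    using GPD that unfolding C0_def m_def by blast
  define S where "S = (\<Sum>\<^sub>\<infinity>y\<in>dual_in_span B. exp (- pi * (norm y)\<^sup>2 / t))"
  have inner_le: "(\<Sum>\<^sub>\<infinity>x\<in>zspan B. exp (- pi * t * (norm (x + (p + r)))\<^sup>2)) \<le> C0 * exp (- pi * t * (norm r)\<^sup>2) * S"
    if "p \<in> span B" "\<And>x. x \<in> span B \<Longrightarrow> x \<bullet> r = 0" for p r
  proof -
    let ?s = "\<Sum>\<^sub>\<infinity>y\<in>dual_in_span B. complex_of_real (exp (- pi * (norm y)\<^sup>2 / t)) * cis (2 * pi * (y \<bullet> p))"
    have "cmod ?s \<le> S"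
      using norm_infsum_bound[of "\<lambda>y. complex_of_real (exp (- pi * (norm y)\<^sup>2 / t)) * cis (2 * pi * (y \<bullet> p))" "dual_in_span B"] dsumm
      by (simp add: norm_mult S_def)
    then have "C0 * exp (- pi * t * (norm r)\<^sup>2) * cmod ?s \<le> C0 * exp (- pi * t * (norm r)\<^sup>2) * S"
      using C0 by (intro mult_left_mono) auto
    moreover have "cmod (complex_of_real (\<Sum>\<^sub>\<infinity>x\<in>zspan B. exp (- pi * t * (norm (x + (p + r)))\<^sup>2))) = C0 * exp (- pi * t * (norm r)\<^sup>2) * cmod ?s"
      by (subst inner[OF that]) (use C0 in \<open>simp_all add: norm_mult\<close>)
    ultimately show ?thesis by simp
  qed
  have b_in: "b \<in> span (insert b B)" by (simp add: span_base)
  have sub: "span B \<subseteq> span (insert b B)" by (intro span_mono) auto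
  have \<beta>_in: "\<beta> \<in> span (insert b B)" using b b0 sub b_in
    by (metis add_diff_cancel_left' span_diff subsetD)
  have decomp: "\<exists>p0 v. p0 \<in> span B \<and> p = p0 + v *\<^sub>R \<beta>" if pin: "p \<in> span (insert b B)" for p
  proof -
    obtain v where "p - v *\<^sub>R b \<in> span B" using pin span_breakdown_eq by blast
    then have "p - v *\<^sub>R b + v *\<^sub>R b0 \<in> span B" using b0 by (intro span_add span_scale)
    moreover have "p = (p - v *\<^sub>R b + v *\<^sub>R b0) + v *\<^sub>R \<beta>" by (simp add: b algebra_simps)
    ultimately show ?thesis by blast
  qed
  have nr: "(norm (s *\<^sub>R \<beta> + r))\<^sup>2 = s\<^sup>2 * (norm \<beta>)\<^sup>2 + (norm r)\<^sup>2" if "\<beta> \<bullet> r = 0" for s r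
    using that by (subst norm_add_Pythagorean) (auto simp: orthogonal_def power_mult_distrib)
  have shift: "x + of_int k *\<^sub>R b + (p0 + v *\<^sub>R \<beta> + r) = x + ((of_int k *\<^sub>R b0 + p0) + ((of_int k + v) *\<^sub>R \<beta> + r))" for x k p0 v r
    by (simp add: b algebra_simps)
  have bij: "bij_betw (\<lambda>(k::int, x). x + of_int k *\<^sub>R b) (UNIV \<times> zspan B) (zspan (insert b B))"
    by (rule bij_betw_zspan_insert[OF fin bB ind])
  have psum: "(\<lambda>(k::int, x). exp (- pi * t * (norm (x + of_int k *\<^sub>R b + (p0 + v *\<^sub>R \<beta> + r)))\<^sup>2)) abs_summable_on UNIV \<times> zspan B"
    if p0: "p0 \<in> span B" and r: "\<And>x. x \<in> span B \<Longrightarrow> x \<bullet> r = 0" "\<beta> \<bullet> r = 0" for p0 v r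
    unfolding shift
  proof (subst Infinite_Sum.abs_summable_on_Sigma_iff, intro conjI ballI)
    fix k :: int
    show "(\<lambda>x. case (k, x) of (k, x) \<Rightarrow> exp (- pi * t * (norm (x + ((of_int k *\<^sub>R b0 + p0) + ((of_int k + v) *\<^sub>R \<beta> + r))))\<^sup>2)) abs_summable_on zspan B"
      using summ by simp
  next
    have "(\<lambda>k::int. \<Sum>\<^sub>\<infinity>x\<in>zspan B. exp (- pi * t * (norm (x + ((of_int k *\<^sub>R b0 + p0) + ((of_int k + v) *\<^sub>R \<beta> + r))))\<^sup>2)) summable_on UNIV"
    proof (rule summable_on_comparison_test)
      show "(\<lambda>k::int. exp (- (pi * A) * (of_int k + v)\<^sup>2) * (C0 * exp (- pi * t * (norm r)\<^sup>2) * S)) summable_on UNIV"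
        using A by (intro summable_on_cmult_left summable_gauss_shift) auto
      fix k :: int
      have "(\<Sum>\<^sub>\<infinity>x\<in>zspan B. exp (- pi * t * (norm (x + ((of_int k *\<^sub>R b0 + p0) + ((of_int k + v) *\<^sub>R \<beta> + r))))\<^sup>2))
         \<le> C0 * exp (- pi * t * (norm ((of_int k + v) *\<^sub>R \<beta> + r))\<^sup>2) * S"
        using b0 p0 r orth by (intro inner_le) (auto intro: span_add span_scale simp: inner_add_right)
      also have "\<dots> = exp (- (pi * A) * (of_int k + v)\<^sup>2) * (C0 * exp (- pi * t * (norm r)\<^sup>2) * S)"
        unfolding nr[OF r(2)] A_def by (simp add: algebra_simps flip: exp_add)
      finally show "(\<Sum>\<^sub>\<infinity>x\<in>zspan B. exp (- pi * t * (norm (x + ((of_int k *\<^sub>R b0 + p0) + ((of_int k + v) *\<^sub>R \<beta> + r))))\<^sup>2))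
        \<le> exp (- (pi * A) * (of_int k + v)\<^sup>2) * (C0 * exp (- pi * t * (norm r)\<^sup>2) * S)" .
    qed (auto intro!: infsum_nonneg)
    then show "(\<lambda>k::int. \<Sum>\<^sub>\<infinity>x\<in>zspan B. norm (case (k, x) of (k, x) \<Rightarrow> exp (- pi * t * (norm (x + ((of_int k *\<^sub>R b0 + p0) + ((of_int k + v) *\<^sub>R \<beta> + r))))\<^sup>2))) abs_summable_on UNIV"
      by (simp add: infsum_nonneg)
  qed
  have c1: "(\<lambda>x. exp (- pi * t * (norm (x + u))\<^sup>2)) summable_on zspan (insert b B)" for u
  proof -
    obtain p r where pr: "p \<in> span (insert b B)" "\<And>w. w \<in> span (insert b B) \<Longrightarrow> orthogonal r w" "u = p + r"
      using orthogonal_subspace_decomp_exists[of "insert b B" u] by metis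
    obtain p0 v where p0: "p0 \<in> span B" "p = p0 + v *\<^sub>R \<beta>" using decomp[OF pr(1)] by blast
    have "(\<lambda>(k::int, x). exp (- pi * t * (norm (x + of_int k *\<^sub>R b + (p0 + v *\<^sub>R \<beta> + r)))\<^sup>2)) summable_on UNIV \<times> zspan B"
      by (rule abs_summable_summable, rule psum)
        (use p0 pr(2) sub \<beta>_in in \<open>auto simp: orthogonal_def inner_commute\<close>)
    then show ?thesis
      using summable_on_reindex_bij_betw[OF bij, of "\<lambda>x. exp (- pi * t * (norm (x + u))\<^sup>2)"]
      by (simp add: case_prod_unfold pr(3) p0(2))
  qed
  \<comment> \<open>\<open>\<phi> (y, k)\<close> is the one vector of the larger span that projects
    to \<open>y\<close> in \<open>span B\<close> and has inner product \<open>k\<close> with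
    \<open>b\<close>; this parametrises the new dual lattice.\<close>
  define \<phi> where "\<phi> = (\<lambda>(y, k::int). y + ((of_int k - y \<bullet> b) / (norm \<beta>)\<^sup>2) *\<^sub>R \<beta>)"
  have yb: "y \<bullet> b0 = y \<bullet> b" if "y \<in> span B" for y using orth[OF that] by (simp add: b inner_add_right)
  have \<phi>b: "\<phi> (y, k) \<bullet> b = of_int k" if "y \<in> span B" for y k
    using that n\<beta> orth[OF b0] by (simp add: \<phi>_def inner_add_left b inner_add_right orth power2_norm_eq_inner inner_commute[of \<beta> b0])
  have \<phi>x: "x \<bullet> \<phi> (y, k) = x \<bullet> y" if "x \<in> span B" for x y k
    using orth[OF that] by (simp add: \<phi>_def inner_add_right)
  have n\<phi>: "(norm (\<phi> (y, k)))\<^sup>2 = (norm y)\<^sup>2 + (of_int k - y \<bullet> b)\<^sup>2 / (norm \<beta>)\<^sup>2" if "y \<in> span B" for y k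
  proof -
    have "(norm (\<phi> (y, k)))\<^sup>2 = (norm (((of_int k - y \<bullet> b) / (norm \<beta>)\<^sup>2) *\<^sub>R \<beta> + y))\<^sup>2"
      by (simp add: \<phi>_def add.commute)
    also have "\<dots> = ((of_int k - y \<bullet> b) / (norm \<beta>)\<^sup>2)\<^sup>2 * (norm \<beta>)\<^sup>2 + (norm y)\<^sup>2"
      using orth[OF that] by (intro nr) (simp add: inner_commute)
    finally show ?thesis using n\<beta> by (simp add: power_divide power2_eq_square)
  qed
  have bij\<phi>: "bij_betw \<phi> (dual_in_span B \<times> UNIV) (dual_in_span (insert b B))"
  proof (rule bij_betw_imageI)
    show "inj_on \<phi> (dual_in_span B \<times> UNIV)"
    proof (rule inj_onI, clarify)
      fix y y' k k' assume y: "y \<in> dual_in_span B" "y' \<in> dual_in_span B" and eq: "\<phi> (y, k) = \<phi> (y', k')"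
      have ys: "y \<in> span B" "y' \<in> span B" using y by (auto simp: dual_in_span_def)
      have k: "k = k'" using \<phi>b[OF ys(1), of k] \<phi>b[OF ys(2), of k'] eq by simp
      have "y - y' \<in> span B" using ys by (rule span_diff)
      from \<phi>x[OF this, of y k] \<phi>x[OF this, of y' k'] eq have "(y - y') \<bullet> (y - y') = 0" by (simp add: inner_diff_right)
      with k show "y = y' \<and> k = k'" by simp
    qed
    show "\<phi> ` (dual_in_span B \<times> UNIV) = dual_in_span (insert b B)" (is "?L = ?R")
    proof
      show "?L \<subseteq> ?R"
      proof clarify
        fix y k assume y: "y \<in> dual_in_span B"
        then have ys: "y \<in> span B" by (simp add: dual_in_span_def)
        have "\<phi> (y, k) \<in> span (insert b B)" unfolding \<phi>_def prod.case
          using ys sub \<beta>_in by (intro span_add span_scale) auto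
        moreover have "b \<bullet> \<phi> (y, k) \<in> \<int>" using \<phi>b[OF ys, of k] by (simp add: inner_commute)
        moreover have "\<forall>x\<in>B. x \<bullet> \<phi> (y, k) \<in> \<int>"
          using y \<phi>x by (auto simp: dual_in_span_def span_base)
        ultimately show "\<phi> (y, k) \<in> dual_in_span (insert b B)" by (simp add: dual_in_span_def)
      qed
      show "?R \<subseteq> ?L"
      proof
        fix z assume "z \<in> ?R"
        then have z: "z \<in> span (insert b B)" "b \<bullet> z \<in> \<int>" "\<And>x. x \<in> B \<Longrightarrow> x \<bullet> z \<in> \<int>"
          by (auto simp: dual_in_span_def)
        obtain y v where y: "y \<in> span B" "z = y + v *\<^sub>R \<beta>" using decomp[OF z(1)] by blast
        obtain k where k: "b \<bullet> z = of_int k" using z(2) by (auto elim: Ints_cases)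
        have "of_int k = y \<bullet> b + v * (norm \<beta>)\<^sup>2"
          using k y orth[OF b0] by (simp add: inner_add_right b inner_add_left power2_norm_eq_inner inner_commute)
        then have "v = (of_int k - y \<bullet> b) / (norm \<beta>)\<^sup>2" using n\<beta> by (simp add: field_simps)
        then have "z = \<phi> (y, k)" by (simp add: \<phi>_def y(2))
        moreover have "y \<in> dual_in_span B"
          using y z(3) orth by (auto simp: dual_in_span_def inner_add_right span_base)
        ultimately show "z \<in> ?L" by auto
      qed
    qed
  qed
  have e\<phi>: "exp (- pi * (norm (\<phi> (y, k)))\<^sup>2 / t) = exp (- pi * (norm y)\<^sup>2 / t) * exp (- pi * (of_int k - y \<bullet> b)\<^sup>2 / A)"
    if "y \<in> dual_in_span B" for y k
  proof -
    have ys: "y \<in> span B" using that by (simp add: dual_in_span_def)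
    have "- pi * (norm (\<phi> (y, k)))\<^sup>2 / t = - pi * (norm y)\<^sup>2 / t + - pi * (of_int k - y \<bullet> b)\<^sup>2 / A"
      unfolding n\<phi>[OF ys] A_def using t n\<beta> by (simp add: field_simps)
    then show ?thesis by (simp only: exp_add)
  qed
  have sumk: "(\<lambda>k::int. exp (- pi * (of_int k - s)\<^sup>2 / A)) summable_on UNIV" for s
    using summable_gauss_shift[of "pi / A" "- s"] A by simp
  have abs\<phi>: "(\<lambda>(y, k::int). exp (- pi * (norm y)\<^sup>2 / t) * exp (- pi * (of_int k - y \<bullet> b)\<^sup>2 / A)) abs_summable_on dual_in_span B \<times> UNIV"
  proof (subst Infinite_Sum.abs_summable_on_Sigma_iff, intro conjI ballI)
    fix y
    show "(\<lambda>k::int. case (y, k) of (y, k) \<Rightarrow> exp (- pi * (norm y)\<^sup>2 / t) * exp (- pi * (of_int k - y \<bullet> b)\<^sup>2 / A)) abs_summable_on UNIV"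
      using sumk by (auto intro!: summable_on_cmult_right)
  next
    let ?K = "sqrt A * (\<Sum>\<^sub>\<infinity>k\<in>(UNIV::int set). exp (- pi * A * (of_int k)\<^sup>2))"
    have "(\<lambda>y. exp (- pi * (norm y)\<^sup>2 / t) * (\<Sum>\<^sub>\<infinity>k\<in>(UNIV::int set). exp (- pi * (of_int k - y \<bullet> b)\<^sup>2 / A))) summable_on dual_in_span B"
    proof (rule summable_on_comparison_test)
      show "(\<lambda>y. exp (- pi * (norm y)\<^sup>2 / t) * ?K) summable_on dual_in_span B"
        using dsumm by (rule summable_on_cmult_left)
      show "exp (- pi * (norm y)\<^sup>2 / t) * (\<Sum>\<^sub>\<infinity>k\<in>(UNIV::int set). exp (- pi * (of_int k - y \<bullet> b)\<^sup>2 / A)) \<le>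
          exp (- pi * (norm y)\<^sup>2 / t) * ?K" for y
        using infsum_gauss_dual_le[OF A] by (intro mult_left_mono) auto
    qed (auto intro!: mult_nonneg_nonneg infsum_nonneg)
    then show "(\<lambda>y. \<Sum>\<^sub>\<infinity>k\<in>(UNIV::int set). norm (case (y, k) of (y, k) \<Rightarrow> exp (- pi * (norm y)\<^sup>2 / t) * exp (- pi * (of_int k - y \<bullet> b)\<^sup>2 / A))) abs_summable_on dual_in_span B"
      using sumk by (simp add: infsum_cmult_right infsum_nonneg)
  qed
  have c2: "(\<lambda>y. exp (- pi * (norm y)\<^sup>2 / t)) summable_on dual_in_span (insert b B)"
  proof -
    have "(\<lambda>(y, k::int). exp (- pi * (norm y)\<^sup>2 / t) * exp (- pi * (of_int k - y \<bullet> b)\<^sup>2 / A)) summable_on dual_in_span B \<times> UNIV"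
      using abs\<phi> by (rule abs_summable_summable)
    then have "(\<lambda>z. exp (- pi * (norm (\<phi> z))\<^sup>2 / t)) summable_on dual_in_span B \<times> UNIV"
      by (rule summable_on_cong[THEN iffD1, rotated]) (clarify, simp only: prod.case e\<phi>)
    then show ?thesis using summable_on_reindex_bij_betw[OF bij\<phi>, of "\<lambda>y. exp (- pi * (norm y)\<^sup>2 / t)"] by simp
  qed
  have c3: "complex_of_real (\<Sum>\<^sub>\<infinity>x\<in>zspan (insert b B). exp (- pi * t * (norm (x + (p + r)))\<^sup>2)) =
       of_real (V / norm \<beta> * (1 / sqrt t) ^ card (insert b B) * exp (- pi * t * (norm r)\<^sup>2)) *
       (\<Sum>\<^sub>\<infinity>y\<in>dual_in_span (insert b B). of_real (exp (- pi * (norm y)\<^sup>2 / t)) * cis (2 * pi * (y \<bullet> p)))"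
    if p: "p \<in> span (insert b B)" and r: "\<And>x. x \<in> span (insert b B) \<Longrightarrow> x \<bullet> r = 0" for p r
  proof -
    obtain p0 v where p0: "p0 \<in> span B" "p = p0 + v *\<^sub>R \<beta>" using decomp[OF p] by blast
    have rB: "\<And>x. x \<in> span B \<Longrightarrow> x \<bullet> r = 0" and r\<beta>: "\<beta> \<bullet> r = 0" using r sub \<beta>_in by auto
    define E where "E = exp (- pi * t * (norm r)\<^sup>2)"
    have "(\<Sum>\<^sub>\<infinity>x\<in>zspan (insert b B). exp (- pi * t * (norm (x + (p + r)))\<^sup>2)) =
      (\<Sum>\<^sub>\<infinity>z\<in>(UNIV::int set) \<times> zspan B. case z of (k, x) \<Rightarrow> exp (- pi * t * (norm (x + of_int k *\<^sub>R b + (p0 + v *\<^sub>R \<beta> + r)))\<^sup>2))"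
      using infsum_reindex_bij_betw[OF bij, of "\<lambda>x. exp (- pi * t * (norm (x + (p + r)))\<^sup>2)"]
      by (simp add: case_prod_unfold p0(2))
    also have "\<dots> = (\<Sum>\<^sub>\<infinity>k\<in>(UNIV::int set). \<Sum>\<^sub>\<infinity>x\<in>zspan B. exp (- pi * t * (norm (x + of_int k *\<^sub>R b + (p0 + v *\<^sub>R \<beta> + r)))\<^sup>2))"
      by (rule infsum_Sigma'_banach[symmetric], rule abs_summable_summable, rule psum[OF p0(1) rB r\<beta>])
    finally have "complex_of_real (\<Sum>\<^sub>\<infinity>x\<in>zspan (insert b B). exp (- pi * t * (norm (x + (p + r)))\<^sup>2)) =
      (\<Sum>\<^sub>\<infinity>k\<in>(UNIV::int set). of_real (\<Sum>\<^sub>\<infinity>x\<in>zspan B. exp (- pi * t * (norm (x + of_int k *\<^sub>R b + (p0 + v *\<^sub>R \<beta> + r)))\<^sup>2)))"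
      using summable_on_Sigma_banach[OF abs_summable_summable[OF psum[OF p0(1) rB r\<beta>, of v]]]
      by (simp add: infsumI[OF has_sum_of_real, symmetric])
    also have "\<dots> = (\<Sum>\<^sub>\<infinity>k\<in>(UNIV::int set). of_real (C0 * E) * (\<Sum>\<^sub>\<infinity>y\<in>dual_in_span B.
        of_real (exp (- pi * A * (of_int k + v)\<^sup>2) * exp (- pi * (norm y)\<^sup>2 / t)) * cis (2 * pi * (of_int k * (y \<bullet> b) + y \<bullet> p0))))"
    proof (rule infsum_cong)
      fix k :: int
      have "complex_of_real (\<Sum>\<^sub>\<infinity>x\<in>zspan B. exp (- pi * t * (norm (x + of_int k *\<^sub>R b + (p0 + v *\<^sub>R \<beta> + r)))\<^sup>2)) =
        of_real (C0 * exp (- pi * t * (norm ((of_int k + v) *\<^sub>R \<beta> + r))\<^sup>2)) *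
         (\<Sum>\<^sub>\<infinity>y\<in>dual_in_span B. of_real (exp (- pi * (norm y)\<^sup>2 / t)) * cis (2 * pi * (y \<bullet> (of_int k *\<^sub>R b0 + p0))))"
        unfolding shift using b0 p0 rB r\<beta> orth
        by (intro inner) (auto intro: span_add span_scale simp: inner_add_right)
      also have "exp (- pi * t * (norm ((of_int k + v) *\<^sub>R \<beta> + r))\<^sup>2) = E * exp (- pi * A * (of_int k + v)\<^sup>2)"
        unfolding nr[OF r\<beta>] A_def E_def by (simp add: algebra_simps flip: exp_add)
      also have "(\<Sum>\<^sub>\<infinity>y\<in>dual_in_span B. complex_of_real (exp (- pi * (norm y)\<^sup>2 / t)) * cis (2 * pi * (y \<bullet> (of_int k *\<^sub>R b0 + p0)))) =
         (\<Sum>\<^sub>\<infinity>y\<in>dual_in_span B. complex_of_real (exp (- pi * (norm y)\<^sup>2 / t)) * cis (2 * pi * (of_int k * (y \<bullet> b) + y \<bullet> p0)))"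
        by (rule infsum_cong) (auto simp: inner_add_right yb dual_in_span_def)
      finally show "complex_of_real (\<Sum>\<^sub>\<infinity>x\<in>zspan B. exp (- pi * t * (norm (x + of_int k *\<^sub>R b + (p0 + v *\<^sub>R \<beta> + r)))\<^sup>2)) =
        of_real (C0 * E) * (\<Sum>\<^sub>\<infinity>y\<in>dual_in_span B.
        of_real (exp (- pi * A * (of_int k + v)\<^sup>2) * exp (- pi * (norm y)\<^sup>2 / t)) * cis (2 * pi * (of_int k * (y \<bullet> b) + y \<bullet> p0)))"
        by (simp add: mult_ac flip: infsum_cmult_right')
    qed
    also have "\<dots> = of_real (C0 * E) * (\<Sum>\<^sub>\<infinity>k\<in>(UNIV::int set). \<Sum>\<^sub>\<infinity>y\<in>dual_in_span B.
        of_real (exp (- pi * A * (of_int k + v)\<^sup>2) * exp (- pi * (norm y)\<^sup>2 / t)) * cis (2 * pi * (of_int k * (y \<bullet> b) + y \<bullet> p0)))"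
      by (rule infsum_cmult_right')
    also have "(\<Sum>\<^sub>\<infinity>k\<in>(UNIV::int set). \<Sum>\<^sub>\<infinity>y\<in>dual_in_span B.
        of_real (exp (- pi * A * (of_int k + v)\<^sup>2) * exp (- pi * (norm y)\<^sup>2 / t)) * cis (2 * pi * (of_int k * (y \<bullet> b) + y \<bullet> p0))) =
       (\<Sum>\<^sub>\<infinity>y\<in>dual_in_span B. \<Sum>\<^sub>\<infinity>k\<in>(UNIV::int set).
        of_real (exp (- pi * A * (of_int k + v)\<^sup>2) * exp (- pi * (norm y)\<^sup>2 / t)) * cis (2 * pi * (of_int k * (y \<bullet> b) + y \<bullet> p0)))"
    \<comment> \<open>The phases have modulus 1, and the moduli form a product of two convergent
      sums.\<close>
    proof (rule infsum_swap_banach, rule abs_summable_summable)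
      have "(\<lambda>(k::int, y). exp (- pi * A * (of_int k + v)\<^sup>2) * exp (- pi * (norm y)\<^sup>2 / t)) abs_summable_on UNIV \<times> dual_in_span B"
        using summable_gauss_shift[of "pi * A" v] A by (intro abs_summable_on_times dsumm) auto
      then show "(\<lambda>(k::int, y). of_real (exp (- pi * A * (of_int k + v)\<^sup>2) * exp (- pi * (norm y)\<^sup>2 / t)) * cis (2 * pi * (of_int k * (y \<bullet> b) + y \<bullet> p0))) abs_summable_on UNIV \<times> dual_in_span B"
        by (simp add: norm_mult case_prod_unfold)
    qed
    also have "\<dots> = (\<Sum>\<^sub>\<infinity>y\<in>dual_in_span B. \<Sum>\<^sub>\<infinity>k\<in>(UNIV::int set).
        of_real (1 / sqrt A) * (of_real (exp (- pi * (norm (\<phi> (y, k)))\<^sup>2 / t)) * cis (2 * pi * (\<phi> (y, k) \<bullet> p))))"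
    proof (rule infsum_cong)
      fix y assume y: "y \<in> dual_in_span B"
      then have ys: "y \<in> span B" by (simp add: dual_in_span_def)
      \<comment> \<open>The phase is split so that the frequency y.b multiplies k + v, as the
        one-dimensional formula requires; the surplus -v (y.b) goes into the constant.\<close>
      let ?c = "complex_of_real (exp (- pi * (norm y)\<^sup>2 / t)) * cis (2 * pi * (y \<bullet> p0 - v * (y \<bullet> b)))"
      have "(\<Sum>\<^sub>\<infinity>k\<in>(UNIV::int set).
        of_real (exp (- pi * A * (of_int k + v)\<^sup>2) * exp (- pi * (norm y)\<^sup>2 / t)) * cis (2 * pi * (of_int k * (y \<bullet> b) + y \<bullet> p0)))
        = (\<Sum>\<^sub>\<infinity>k\<in>(UNIV::int set). ?c * (of_real (exp (- pi * A * (of_int k + v)\<^sup>2)) * cis (2 * pi * (y \<bullet> b) * (of_int k + v))))"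
      proof (rule infsum_cong)
        fix k :: int
        have "cis (2 * pi * (of_int k * (y \<bullet> b) + y \<bullet> p0)) = cis (2 * pi * (y \<bullet> p0 - v * (y \<bullet> b))) * cis (2 * pi * (y \<bullet> b) * (of_int k + v))"
          by (simp add: cis_mult algebra_simps)
        then show "of_real (exp (- pi * A * (of_int k + v)\<^sup>2) * exp (- pi * (norm y)\<^sup>2 / t)) * cis (2 * pi * (of_int k * (y \<bullet> b) + y \<bullet> p0)) =
          ?c * (of_real (exp (- pi * A * (of_int k + v)\<^sup>2)) * cis (2 * pi * (y \<bullet> b) * (of_int k + v)))" by (simp add: mult_ac)
      qed
      also have "\<dots> = ?c * (\<Sum>\<^sub>\<infinity>k\<in>(UNIV::int set). (of_real (exp (- pi * A * (of_int k + v)\<^sup>2)) * cis (2 * pi * (y \<bullet> b) * (of_int k + v))))"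
        by (rule infsum_cmult_right')
      also have "\<dots> = ?c * (\<Sum>\<^sub>\<infinity>k\<in>(UNIV::int set). of_real (exp (- pi * (of_int k - y \<bullet> b)\<^sup>2 / A) / sqrt A) * cis (2 * pi * of_int k * v))"
        by (subst poisson_gauss_int[OF A]) (rule refl)
      also have "\<dots> = (\<Sum>\<^sub>\<infinity>k\<in>(UNIV::int set). ?c * (of_real (exp (- pi * (of_int k - y \<bullet> b)\<^sup>2 / A) / sqrt A) * cis (2 * pi * of_int k * v)))"
        by (rule infsum_cmult_right'[symmetric])
      also have "\<dots> = (\<Sum>\<^sub>\<infinity>k\<in>(UNIV::int set). of_real (1 / sqrt A) * (of_real (exp (- pi * (norm (\<phi> (y, k)))\<^sup>2 / t)) * cis (2 * pi * (\<phi> (y, k) \<bullet> p))))"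
      proof (rule infsum_cong)
        fix k :: int
        have "\<phi> (y, k) \<bullet> p = y \<bullet> p0 - v * (y \<bullet> b) + of_int k * v"
        proof -
          have "\<phi> (y, k) \<bullet> p = y \<bullet> p0 + (of_int k - y \<bullet> b) / (norm \<beta>)\<^sup>2 * (v * (norm \<beta>)\<^sup>2)"
            using orth[OF ys] orth[OF p0(1)]
            by (simp add: \<phi>_def p0(2) inner_add_left inner_add_right inner_commute[of \<beta> p0] power2_norm_eq_inner)
          also have "(of_int k - y \<bullet> b) / (norm \<beta>)\<^sup>2 * (v * (norm \<beta>)\<^sup>2) = (of_int k - y \<bullet> b) * v"
            using n\<beta> by simp
          finally show ?thesis by (simp add: algebra_simps)
        qed
        then have "cis (2 * pi * (\<phi> (y, k) \<bullet> p)) = cis (2 * pi * (y \<bullet> p0 - v * (y \<bullet> b))) * cis (2 * pi * of_int k * v)"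
          unfolding cis_mult by (simp only:) (simp add: algebra_simps)
        then show "?c * (of_real (exp (- pi * (of_int k - y \<bullet> b)\<^sup>2 / A) / sqrt A) * cis (2 * pi * of_int k * v)) =
          of_real (1 / sqrt A) * (of_real (exp (- pi * (norm (\<phi> (y, k)))\<^sup>2 / t)) * cis (2 * pi * (\<phi> (y, k) \<bullet> p)))"
          unfolding e\<phi>[OF y] by (simp add: mult_ac)
      qed
      finally show "(\<Sum>\<^sub>\<infinity>k\<in>(UNIV::int set).
        of_real (exp (- pi * A * (of_int k + v)\<^sup>2) * exp (- pi * (norm y)\<^sup>2 / t)) * cis (2 * pi * (of_int k * (y \<bullet> b) + y \<bullet> p0)))
        = (\<Sum>\<^sub>\<infinity>k\<in>(UNIV::int set). of_real (1 / sqrt A) * (of_real (exp (- pi * (norm (\<phi> (y, k)))\<^sup>2 / t)) * cis (2 * pi * (\<phi> (y, k) \<bullet> p))))" .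
    qed
    also have "\<dots> = of_real (1 / sqrt A) * (\<Sum>\<^sub>\<infinity>y\<in>dual_in_span B. \<Sum>\<^sub>\<infinity>k\<in>(UNIV::int set).
        (of_real (exp (- pi * (norm (\<phi> (y, k)))\<^sup>2 / t)) * cis (2 * pi * (\<phi> (y, k) \<bullet> p))))"
      by (simp only: infsum_cmult_right')
    also have "(\<Sum>\<^sub>\<infinity>y\<in>dual_in_span B. \<Sum>\<^sub>\<infinity>k\<in>(UNIV::int set).
        (of_real (exp (- pi * (norm (\<phi> (y, k)))\<^sup>2 / t)) * cis (2 * pi * (\<phi> (y, k) \<bullet> p)))) =
       (\<Sum>\<^sub>\<infinity>z\<in>dual_in_span B \<times> UNIV. (of_real (exp (- pi * (norm (\<phi> z))\<^sup>2 / t)) * cis (2 * pi * (\<phi> z \<bullet> p))))"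
    proof (rule infsum_Sigma_banach, rule abs_summable_summable)
      have "(\<lambda>z. exp (- pi * (norm (\<phi> z))\<^sup>2 / t)) summable_on dual_in_span B \<times> UNIV"
        using c2 summable_on_reindex_bij_betw[OF bij\<phi>, of "\<lambda>y. exp (- pi * (norm y)\<^sup>2 / t)"] by simp
      then show "(\<lambda>z. of_real (exp (- pi * (norm (\<phi> z))\<^sup>2 / t)) * cis (2 * pi * (\<phi> z \<bullet> p))) abs_summable_on dual_in_span B \<times> UNIV"
        by (simp add: norm_mult)
    qed
    also have "\<dots> = (\<Sum>\<^sub>\<infinity>y\<in>dual_in_span (insert b B). of_real (exp (- pi * (norm y)\<^sup>2 / t)) * cis (2 * pi * (y \<bullet> p)))"
      by (rule infsum_reindex_bij_betw[OF bij\<phi>])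
    also have "of_real (C0 * E) * (of_real (1 / sqrt A) * z) =
        of_real (V / norm \<beta> * (1 / sqrt t) ^ card (insert b B) * exp (- pi * t * (norm r)\<^sup>2)) * z" for z :: complex
      using fin bB by (simp add: C0_def E_def sA m_def mult_ac)
    finally show ?thesis .
  qed
  show ?thesis unfolding gauss_poisson_def using c1 c2 c3 by blast
qed

text \<open>\<open>V\<close> is fixed before \<open>t\<close>, being the product of the inverse
  Gram-Schmidt lengths. A single value of \<open>t\<close> can therefore determine it.\<close>

lemma gauss_poisson_exists:
  fixes B :: "'a::euclidean_space set"
  assumes "finite B" "independent B"
  shows "\<exists>V>0. \<forall>t>0. gauss_poisson B V t"
  using assms
proof (induction B rule: finite_induct)
  case empty
  have "gauss_poisson ({} :: 'a set) 1 t" for t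
    by (simp add: gauss_poisson_def zspan_def dual_in_span_def Collect_conv_if)
  then show ?case by (intro exI[of _ 1]) auto
next
  case (insert b B)
  then obtain V where V: "V > 0" "\<And>t. t > 0 \<Longrightarrow> gauss_poisson B V t"
    by (auto simp: independent_insert split: if_splits)
  obtain b0 \<beta> where b: "b0 \<in> span B" "\<And>w. w \<in> span B \<Longrightarrow> orthogonal \<beta> w" "b = b0 + \<beta>"
    using orthogonal_subspace_decomp_exists[of B b] by metis
  have "\<beta> \<noteq> 0" using b insert by (auto simp: independent_insert split: if_splits)
  then have "V / norm \<beta> > 0" using V by simp
  moreover have "gauss_poisson (insert b B) (V / norm \<beta>) t" if "t > 0" for t
    by (rule gauss_poisson_insert[OF insert.hyps insert.prems that V(1) V(2)[OF that] b(1) _ b(3)])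
      (use b(2) in \<open>auto simp: orthogonal_def inner_commute\<close>)
  ultimately show ?case by blast
qed

text \<open>Selfduality identifies the two lattices, so for t = 1 and u = 0 both sides contain the
  same positive sum and \<open>V\<close> = 1: a selfdual lattice is unimodular.\<close>

lemma selfdual_gauss:
  fixes L :: "(real^'n) set"
  assumes L: "selfdual L"
  shows selfdual_gauss_summable: "t > 0 \<Longrightarrow> (\<lambda>x. exp (- pi * t * (norm (x + u))\<^sup>2)) summable_on L"
    and selfdual_poisson: "t > 0 \<Longrightarrow> complex_of_real (\<Sum>\<^sub>\<infinity>x\<in>L. exp (- pi * t * (norm (x + u))\<^sup>2)) =
      of_real ((1 / sqrt t) ^ CARD('n)) * (\<Sum>\<^sub>\<infinity>y\<in>L. of_real (exp (- pi * (norm y)\<^sup>2 / t)) * cis (2 * pi * (y \<bullet> u)))"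
proof -
  obtain b :: "'n \<Rightarrow> real^'n" where b: "inj b" "independent (range b)"
    and Lb: "L = range (\<lambda>c::'n \<Rightarrow> int. \<Sum>i\<in>UNIV. of_int (c i) *\<^sub>R b i)"
    using L by (auto simp: selfdual_def is_lattice_def)
  define B where "B = range b"
  have fin: "finite B" and ind: "independent B" and card: "card B = CARD('n)"
    using b by (auto simp: B_def card_image)
  have zs: "zspan B = L"
  proof -
    have "(\<Sum>a\<in>B. of_int (c a) *\<^sub>R a) = (\<Sum>i\<in>UNIV. of_int (c (b i)) *\<^sub>R b i)" for c :: "real^'n \<Rightarrow> int"
      unfolding B_def using b(1) by (subst sum.reindex) auto
    then have "zspan B = range (\<lambda>c::real^'n \<Rightarrow> int. \<Sum>i\<in>UNIV. of_int (c (b i)) *\<^sub>R b i)"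
      unfolding zspan_def by simp
    also have "\<dots> = L"
    proof -
      have "\<exists>c'::real^'n \<Rightarrow> int. (\<Sum>i\<in>UNIV. of_int (c i) *\<^sub>R b i) = (\<Sum>i\<in>UNIV. of_int (c' (b i)) *\<^sub>R b i)" for c :: "'n \<Rightarrow> int"
        using b(1) by (intro exI[of _ "\<lambda>a. c (inv b a)"]) simp
      then show ?thesis unfolding Lb by (auto intro!: rangeI)
    qed
    finally show ?thesis .
  qed
  have span: "span B = UNIV"
    using card_ge_dim_independent[of B UNIV] fin ind card by auto
  have int_comb: "x \<bullet> y \<in> \<int>" if "\<forall>a\<in>B. a \<bullet> y \<in> \<int>" "x \<in> zspan B" for x y
    using that by (auto simp: zspan_def inner_sum_left intro!: Ints_sum Ints_mult)
  have BL: "a \<in> zspan B" if "a \<in> B" for a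
  proof -
    have "a = (\<Sum>x\<in>B. of_int (if x = a then 1 else 0) *\<^sub>R x)"
      using fin that by (simp add: if_distrib[of of_int] if_distrib[of "\<lambda>c. c *\<^sub>R _"] cong: if_cong)
    then show ?thesis unfolding zspan_def by (rule image_eqI[where x = "\<lambda>x. if x = a then 1 else 0"]) simp
  qed
  have "dual_in_span B = dual_lattice L"
    unfolding dual_in_span_def dual_lattice_def span using int_comb BL zs by auto
  then have dual: "dual_in_span B = L" using L by (simp add: selfdual_def)
  obtain V where V: "V > 0" "\<And>t. t > 0 \<Longrightarrow> gauss_poisson B V t"
    using gauss_poisson_exists[OF fin ind] by blast
  have summ: "(\<lambda>x. exp (- pi * t * (norm (x + u))\<^sup>2)) summable_on L" if "t > 0" for t u
    using V(2)[OF that] by (simp add: gauss_poisson_def zs)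
  have pois: "complex_of_real (\<Sum>\<^sub>\<infinity>x\<in>L. exp (- pi * t * (norm (x + u))\<^sup>2)) =
      of_real (V * (1 / sqrt t) ^ CARD('n)) * (\<Sum>\<^sub>\<infinity>y\<in>L. of_real (exp (- pi * (norm y)\<^sup>2 / t)) * cis (2 * pi * (y \<bullet> u)))"
    if "t > 0" for t u
    using V(2)[OF that, unfolded gauss_poisson_def, THEN conjunct2, THEN conjunct2, rule_format, of u 0]
    by (simp add: zs dual span card)
  let ?S = "\<Sum>\<^sub>\<infinity>x\<in>L. exp (- pi * (norm x)\<^sup>2)"
  have S: "(\<lambda>x. exp (- pi * (norm x)\<^sup>2)) summable_on L" using summ[of 1 0] by simp
  have "((\<lambda>x. complex_of_real (exp (- pi * (norm x)\<^sup>2))) has_sum of_real ?S) L"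
    by (intro has_sum_of_real has_sum_infsum S)
  then have "complex_of_real ?S = of_real V * of_real ?S"
    using pois[of 1 0] by (simp add: infsumI)
  then have "complex_of_real ?S = of_real (V * ?S)" by simp
  then have VS: "?S = V * ?S" by (simp only: of_real_eq_iff)
  have "0 \<in> L" using zs by (auto simp: zspan_def intro!: image_eqI[where x = "\<lambda>_. 0"])
  then have "sum (\<lambda>x. exp (- pi * (norm x)\<^sup>2)) {0::real^'n} \<le> ?S"
    by (intro finite_sum_le_infsum[OF S]) auto
  then have "?S \<noteq> 0" by auto
  with VS have "V = 1" by simp
  with summ pois show "t > 0 \<Longrightarrow> (\<lambda>x. exp (- pi * t * (norm (x + u))\<^sup>2)) summable_on L"
    "t > 0 \<Longrightarrow> complex_of_real (\<Sum>\<^sub>\<infinity>x\<in>L. exp (- pi * t * (norm (x + u))\<^sup>2)) =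
      of_real ((1 / sqrt t) ^ CARD('n)) * (\<Sum>\<^sub>\<infinity>y\<in>L. of_real (exp (- pi * (norm y)\<^sup>2 / t)) * cis (2 * pi * (y \<bullet> u)))"
    by simp_all
qed

section \<open>Characteristic vectors and the shadow as a coset\<close>

lemma selfdual_closed:
  assumes "selfdual L"
  shows selfdual_zero: "0 \<in> L"
    and selfdual_add: "x \<in> L \<Longrightarrow> y \<in> L \<Longrightarrow> x + y \<in> L"
    and selfdual_uminus: "x \<in> L \<Longrightarrow> - x \<in> L"
    and selfdual_inner: "x \<in> L \<Longrightarrow> y \<in> L \<Longrightarrow> x \<bullet> y \<in> \<int>"
proof -
  have L: "x \<in> L \<longleftrightarrow> (\<forall>y\<in>L. y \<bullet> x \<in> \<int>)" for x
    using assms by (auto simp: selfdual_def dual_lattice_def)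
  show "0 \<in> L" by (subst L) auto
  show "x \<in> L \<Longrightarrow> y \<in> L \<Longrightarrow> x + y \<in> L" using L[of x] L[of y] by (subst L) (auto simp: inner_add_right)
  show "x \<in> L \<Longrightarrow> - x \<in> L" using L[of x] by (subst L) (auto simp: inner_minus_right)
  show "x \<in> L \<Longrightarrow> y \<in> L \<Longrightarrow> x \<bullet> y \<in> \<int>" using L[of y] by auto
qed

text \<open>The parity of the norm is additive on a selfdual lattice, hence represented by the inner product
  with a lattice vector.\<close>

lemma characteristic_vector:
  fixes L :: "(real^'n) set"
  assumes L: "selfdual L"
  shows "\<exists>w\<in>L. \<forall>x\<in>L. \<exists>k::int. x \<bullet> x - x \<bullet> w = 2 * of_int k"
proof -
  obtain b :: "'n \<Rightarrow> real^'n" where b: "inj b" "independent (range b)"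
    and Lb: "L = range (\<lambda>c::'n \<Rightarrow> int. \<Sum>i\<in>UNIV. of_int (c i) *\<^sub>R b i)"
    using L by (auto simp: selfdual_def is_lattice_def)
  have bL: "b i \<in> L" for i
  proof -
    have "b i = (\<Sum>j\<in>UNIV. of_int (if j = i then 1 else 0) *\<^sub>R b j)"
      by (simp add: if_distrib[of of_int] if_distrib[of "\<lambda>c. c *\<^sub>R _"] cong: if_cong)
    then show ?thesis unfolding Lb by (rule image_eqI[where x = "\<lambda>j. if j = i then 1 else 0"]) simp
  qed
  \<comment> \<open>The linear functional with the values b_i . b_i on the basis; its Riesz vector
    \<open>w\<close> pairs integrally with \<open>L\<close> and so lies in \<open>L\<close> by
    selfduality.\<close>
  obtain f where f: "linear f" "\<And>x. x \<in> range b \<Longrightarrow> f x = x \<bullet> x"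
    using linear_independent_extend[OF b(2), of "\<lambda>x. x \<bullet> x"] by blast
  define w where "w = adjoint f 1"
  have fw: "f x = x \<bullet> w" for x
    unfolding w_def using adjoint_works[OF f(1), of x 1] by simp
  have bw: "b i \<bullet> w = b i \<bullet> b i" for i using f(2)[of "b i"] fw[of "b i"] by simp
  have "x \<bullet> w \<in> \<int>" if "x \<in> L" for x
    using that unfolding Lb
    by (auto simp: inner_sum_left bw selfdual_inner[OF L bL bL] intro!: Ints_sum Ints_mult)
  then have wL: "w \<in> L" using L by (auto simp: selfdual_def dual_lattice_def)
  have add: "\<exists>k::int. (x + y) \<bullet> (x + y) - (x + y) \<bullet> w = 2 * of_int k"
    if xy: "x \<in> L" "y \<in> L" "\<exists>k::int. x \<bullet> x - x \<bullet> w = 2 * of_int k" "\<exists>k::int. y \<bullet> y - y \<bullet> w = 2 * of_int k" for x y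
  proof -
    obtain k l where "x \<bullet> x - x \<bullet> w = 2 * of_int k" "y \<bullet> y - y \<bullet> w = 2 * of_int l" using xy by blast
    moreover obtain j where "x \<bullet> y = of_int j" using selfdual_inner[OF L xy(1,2)] by (auto elim: Ints_cases)
    ultimately have "(x + y) \<bullet> (x + y) - (x + y) \<bullet> w = 2 * of_int (k + l + j)"
      by (simp add: inner_add_left inner_add_right inner_commute[of y x])
    then show ?thesis by blast
  qed
  \<comment> \<open>Since c^2 - c is even, on multiples of a basis vector the norm has the parity of
    a linear function.\<close>
  have scale: "\<exists>k::int. (of_int c *\<^sub>R b i) \<bullet> (of_int c *\<^sub>R b i) - (of_int c *\<^sub>R b i) \<bullet> w = 2 * of_int k" for c :: int and i
  proof -
    obtain j where j: "b i \<bullet> b i = of_int j" using selfdual_inner[OF L bL[of i] bL[of i]] by (auto elim: Ints_cases)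
    have "even (c * c - c)" by simp
    then obtain k where "c * c - c = 2 * k" by (elim evenE)
    then have "real_of_int c * of_int c - of_int c = 2 * of_int k" by (metis of_int_diff of_int_mult of_int_numeral)
    moreover have "(of_int c *\<^sub>R b i) \<bullet> (of_int c *\<^sub>R b i) - (of_int c *\<^sub>R b i) \<bullet> w = (real_of_int c * of_int c - of_int c) * of_int j"
      by (simp add: bw j algebra_simps)
    ultimately have "(of_int c *\<^sub>R b i) \<bullet> (of_int c *\<^sub>R b i) - (of_int c *\<^sub>R b i) \<bullet> w = 2 * of_int (k * j)"
      by (simp add: mult.assoc)
    then show ?thesis by blast
  qed
  have sc: "of_int c *\<^sub>R b i \<in> L" for c :: int and i
  proof -
    have "of_int c *\<^sub>R b i = (\<Sum>j\<in>UNIV. of_int (if j = i then c else 0) *\<^sub>R b j)"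
      by (simp add: if_distrib[of of_int] if_distrib[of "\<lambda>c. c *\<^sub>R _"] cong: if_cong)
    then show ?thesis unfolding Lb by (rule image_eqI[where x = "\<lambda>j. if j = i then c else 0"]) simp
  qed
  have "(\<Sum>i\<in>I. of_int (c i) *\<^sub>R b i) \<in> L \<and> (\<exists>k::int. (\<Sum>i\<in>I. of_int (c i) *\<^sub>R b i) \<bullet> (\<Sum>i\<in>I. of_int (c i) *\<^sub>R b i) - (\<Sum>i\<in>I. of_int (c i) *\<^sub>R b i) \<bullet> w = 2 * of_int k)"
    if "finite I" for I and c :: "'n \<Rightarrow> int"
    using that
  proof (induction I)
    case empty
    show ?case using selfdual_zero[OF L] by (auto intro!: exI[of _ 0])
  next
    case (insert i I)
    then show ?case using add[OF sc[of "c i" i] _ scale[of "c i" i]] selfdual_add[OF L sc[of "c i" i]] by simp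
  qed
  then have "\<forall>x\<in>L. \<exists>k::int. x \<bullet> x - x \<bullet> w = 2 * of_int k" unfolding Lb by auto
  with wL show ?thesis by blast
qed

text \<open>A lattice vector x has even norm iff x . w/2 is an integer. If all norms are even, w/2
  lies in \<open>L\<close> and the coset is \<open>L\<close> itself. Otherwise a vector outside
  \<open>L\<close> in the dual of the even sublattice has half-integral inner product with every
  vector of odd norm, exactly like w/2, so the two differ by an element of \<open>L\<close>. Both
  cases of \<open>shadow\<close> thus become one coset.\<close>

lemma shadow_eq_coset:
  fixes L :: "(real^'n) set"
  assumes L: "selfdual L" and w: "w \<in> L" "\<And>x. x \<in> L \<Longrightarrow> \<exists>k::int. x \<bullet> x - x \<bullet> w = 2 * of_int k"
  shows "shadow L = (\<lambda>x. x + (1/2) *\<^sub>R w) ` L"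
proof -
  have memL: "x \<in> L \<longleftrightarrow> (\<forall>y\<in>L. y \<bullet> x \<in> \<int>)" for x
    using L by (auto simp: selfdual_def dual_lattice_def)
  have coset: "x \<in> (\<lambda>x. x + (1/2) *\<^sub>R w) ` L \<longleftrightarrow> x - (1/2) *\<^sub>R w \<in> L" for x
    by (auto simp: image_iff intro: bexI[of _ "x - (1/2) *\<^sub>R w"])
  have ev: "even_vec x \<longleftrightarrow> (1/2) * (x \<bullet> w) \<in> \<int>" if xL: "x \<in> L" for x
  proof -
    obtain k where k: "x \<bullet> x - x \<bullet> w = 2 * of_int k" using w(2)[OF xL] by blast
    show ?thesis
    proof
      assume "even_vec x"
      then obtain j :: int where "x \<bullet> x = 2 * of_int j" by (auto simp: even_vec_def)
      then have "(1/2) * (x \<bullet> w) = of_int (j - k)" using k by simp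
      then show "(1/2) * (x \<bullet> w) \<in> \<int>" by (metis Ints_of_int)
    next
      assume "(1/2) * (x \<bullet> w) \<in> \<int>"
      then obtain j where "(1/2) * (x \<bullet> w) = of_int j" by (auto elim: Ints_cases)
      then have "x \<bullet> x = 2 * of_int (j + k)" using k by simp
      then show "even_vec x" unfolding even_vec_def by blast
    qed
  qed
  show ?thesis
  proof (cases "even_lattice L")
    case True
    then have wL: "(1/2) *\<^sub>R w \<in> L" using ev by (subst memL) (auto simp: even_lattice_def)
    have "x \<in> L \<longleftrightarrow> x - (1/2) *\<^sub>R w \<in> L" for x
    proof
      show "x - (1/2) *\<^sub>R w \<in> L" if "x \<in> L"
        using selfdual_add[OF L that selfdual_uminus[OF L wL]] by simp
      show "x \<in> L" if "x - (1/2) *\<^sub>R w \<in> L"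
        using selfdual_add[OF L that wL] by simp
    qed
    then show ?thesis using True coset by (auto simp: shadow_def)
  next
    case False
    then obtain v0 where v0: "v0 \<in> L" "\<not> even_vec v0" by (auto simp: even_lattice_def)
    have half: "\<exists>k::int. (x \<bullet> w) / 2 = of_int k + 1/2" if xL: "x \<in> L" "\<not> even_vec x" for x
    proof -
      obtain k where k: "x \<bullet> w = of_int k" using selfdual_inner[OF L xL(1) w(1)] by (auto elim: Ints_cases)
      have "odd k"
      proof
        assume "even k"
        then obtain j where "k = 2 * j" by (elim evenE)
        then have "(1/2) * (x \<bullet> w) = of_int j" using k by simp
        then have "(1/2) * (x \<bullet> w) \<in> \<int>" by (metis Ints_of_int)
        with ev xL show False by blast
      qed
      then obtain j where "k = 2 * j + 1" by (elim oddE)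
      then have "(x \<bullet> w) / 2 = of_int j + 1/2" using k by simp
      then show ?thesis by blast
    qed
    have "x \<in> dual_lattice (even_sublattice L) - L \<longleftrightarrow> x - (1/2) *\<^sub>R w \<in> L" for x
    proof
      assume x: "x - (1/2) *\<^sub>R w \<in> L"
      have "y \<bullet> x \<in> \<int>" if "y \<in> even_sublattice L" for y
      proof -
        have y: "y \<in> L" "even_vec y" using that by (auto simp: even_sublattice_def)
        have "y \<bullet> x = y \<bullet> (x - (1/2) *\<^sub>R w) + (1/2) * (y \<bullet> w)" by (simp add: inner_diff_right)
        also have "\<dots> \<in> \<int>" using selfdual_inner[OF L y(1) x] ev[OF y(1)] y(2) by auto
        finally show ?thesis .
      qed
      moreover have "x \<notin> L"
      proof
        assume "x \<in> L"
        obtain k where "(v0 \<bullet> w) / 2 = of_int k + 1/2" using half[OF v0] by blast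
        moreover obtain i j where "v0 \<bullet> x = of_int i" "v0 \<bullet> (x - (1/2) *\<^sub>R w) = of_int j"
          using selfdual_inner[OF L v0(1) \<open>x \<in> L\<close>] selfdual_inner[OF L v0(1) x] by (auto elim!: Ints_cases)
        moreover have "v0 \<bullet> (x - (1/2) *\<^sub>R w) = v0 \<bullet> x - (v0 \<bullet> w) / 2" by (simp add: inner_diff_right)
        ultimately have "(of_int (i - j - k) :: real) = 1/2" unfolding of_int_diff by linarith
        then have "of_int (2 * (i - j - k)) = (of_int 1 :: real)" by simp
        then have "2 * (i - j - k) = 1" by (simp only: of_int_eq_iff)
        then show False by presburger
      qed
      ultimately show "x \<in> dual_lattice (even_sublattice L) - L" by (auto simp: dual_lattice_def)
    next
      assume x: "x \<in> dual_lattice (even_sublattice L) - L"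
      then have xe: "y \<bullet> x \<in> \<int>" if "y \<in> L" "even_vec y" for y
        using that by (auto simp: dual_lattice_def even_sublattice_def)
      \<comment> \<open>The even sublattice has index at most 2: what is known for one odd vector
        \<open>u\<close> passes to every other odd vector through their sum.\<close>
      have sum_even: "even_vec (y + z)" if yz: "y \<in> L" "\<not> even_vec y" "z \<in> L" "\<not> even_vec z" for y z
      proof -
        obtain k l :: int where "(y \<bullet> w) / 2 = of_int k + 1/2" "(z \<bullet> w) / 2 = of_int l + 1/2"
          using half yz by blast
        then have "(1/2) * ((y + z) \<bullet> w) = of_int (k + l + 1)" by (simp add: inner_add_left)
        then show ?thesis using ev[OF selfdual_add[OF L yz(1,3)]] by (metis Ints_of_int)
      qed
      obtain u where u: "u \<in> L" "u \<bullet> x \<notin> \<int>" using x memL[of x] by blast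
      have uo: "\<not> even_vec u" using xe u by blast
      have "2 * (u \<bullet> x) \<in> \<int>" using xe[OF selfdual_add[OF L u(1) u(1)] sum_even[OF u(1) uo u(1) uo]]
        unfolding inner_add_left by simp
      then obtain k where k: "2 * (u \<bullet> x) = of_int k" by (auto elim: Ints_cases)
      have "odd k"
      proof
        assume "even k"
        then obtain j where "k = 2 * j" by (elim evenE)
        then have "u \<bullet> x = of_int j" using k by simp
        with u show False by simp
      qed
      then obtain j where "k = 2 * j + 1" by (elim oddE)
      then have ux: "u \<bullet> x = of_int j + 1/2" using k by simp
      have "y \<bullet> (x - (1/2) *\<^sub>R w) \<in> \<int>" if y: "y \<in> L" for y
      proof (cases "even_vec y")
        case True
        then show ?thesis using xe[OF y] ev[OF y] by (auto simp: inner_diff_right)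
      next
        case False
        obtain i where i: "(y + u) \<bullet> x = of_int i"
          using xe[OF selfdual_add[OF L y u(1)] sum_even[OF y False u(1) uo]] by (auto elim: Ints_cases)
        obtain l where l: "(y \<bullet> w) / 2 = of_int l + 1/2" using half[OF y False] by blast
        have "y \<bullet> (x - (1/2) *\<^sub>R w) = of_int (i - j - l - 1)"
          using i l ux unfolding inner_diff_right inner_scaleR_right inner_add_left of_int_diff of_int_1 by linarith
        then show ?thesis by (metis Ints_of_int)
      qed
      then show "x - (1/2) *\<^sub>R w \<in> L" by (subst memL) auto
    qed
    then show ?thesis using False coset by (auto simp: shadow_def)
  qed
qed

section \<open>Harmonic polynomials and apolarity\<close>

definition vmon :: "real^'n \<Rightarrow> ('n::finite \<Rightarrow> nat) \<Rightarrow> real" where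
  "vmon x \<alpha> = (\<Prod>i\<in>UNIV. (x $ i) ^ \<alpha> i)"

text \<open>The weight of the Fischer inner product on polynomials, for which multiplication by
  \<open>v \<bullet> v\<close> is adjoint to the Laplacian.\<close>

definition mfact :: "('n::finite \<Rightarrow> nat) \<Rightarrow> real" where
  "mfact \<alpha> = (\<Prod>i\<in>UNIV. fact (\<alpha> i))"

lemma mfact_pos: "mfact \<alpha> > 0"
  unfolding mfact_def by (intro prod_pos) auto

lemma le_of_monomials_deg: "\<alpha> \<in> monomials_deg d \<Longrightarrow> \<alpha> i \<le> d"
  unfolding monomials_deg_def using member_le_sum[of i UNIV \<alpha>] by auto

lemma finite_monomials_deg [simp]: "finite (monomials_deg d :: ('n::finite \<Rightarrow> nat) set)"
proof (rule finite_subset)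
  show "(monomials_deg d :: ('n \<Rightarrow> nat) set) \<subseteq> (UNIV :: 'n set) \<rightarrow>\<^sub>E {..d}"
    using le_of_monomials_deg by (auto simp: PiE_def)
  show "finite ((UNIV :: 'n set) \<rightarrow>\<^sub>E {..d})" by (intro finite_PiE) auto
qed

lemma prod_fun_upd:
  fixes F :: "'n::finite \<Rightarrow> nat \<Rightarrow> 'a::comm_monoid_mult"
  shows "(\<Prod>j\<in>UNIV. F j ((\<alpha>(i := k)) j)) = F i k * (\<Prod>j\<in>UNIV - {i}. F j (\<alpha> j))"
  by (subst prod.remove[of UNIV i]) auto

lemma vmon_upd: "vmon x (\<beta>(i := \<beta> i + m)) = vmon x \<beta> * (x $ i) ^ m"
  unfolding vmon_def prod_fun_upd[of "\<lambda>j k. (x $ j) ^ k"]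
  by (subst prod.remove[of UNIV i]) (auto simp: power_add mult_ac)

lemma mfact_upd_Suc: "mfact (\<beta>(i := \<beta> i + 1)) = mfact \<beta> * real (\<beta> i + 1)"
  unfolding mfact_def prod_fun_upd[of "\<lambda>j k. fact k"]
  by (subst prod.remove[of UNIV i]) (auto simp: mult_ac)

lemma mfact_upd_2: "mfact (\<beta>(i := \<beta> i + 2)) = mfact \<beta> * real ((\<beta> i + 2) * (\<beta> i + 1))"
proof -
  have "\<beta>(i := \<beta> i + 2) = (\<beta>(i := \<beta> i + 1))(i := (\<beta>(i := \<beta> i + 1)) i + 1)" by simp
  then have "mfact (\<beta>(i := \<beta> i + 2)) = mfact (\<beta>(i := \<beta> i + 1)) * real ((\<beta>(i := \<beta> i + 1)) i + 1)"
    by (metis mfact_upd_Suc)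
  also have "\<dots> = mfact \<beta> * real (\<beta> i + 1) * real (\<beta> i + 1 + 1)" by (simp only: mfact_upd_Suc fun_upd_same)
  finally show ?thesis by (simp add: algebra_simps)
qed

lemma sum_upd: "(\<Sum>j\<in>UNIV. (\<alpha>(i := k)) j) = k + (\<Sum>j\<in>UNIV - {i}. (\<alpha> :: 'n::finite \<Rightarrow> nat) j)"
  by (subst sum.remove[of UNIV i]) auto

text \<open>Raising one exponent by \<open>m\<close> and lowering it again are inverse operations on
  pairs of a monomial and a variable. The case m = 1 serves the multinomial theorem, m = 2
  multiplication by \<open>v \<bullet> v\<close>.\<close>

lemma monomials_deg_reindex:
  fixes g :: "('n::finite \<Rightarrow> nat) \<Rightarrow> 'n \<Rightarrow> 'a::comm_monoid_add"
  shows "(\<Sum>\<beta>\<in>monomials_deg k. \<Sum>i\<in>UNIV. g (\<beta>(i := \<beta> i + m)) i) =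
    (\<Sum>\<alpha>\<in>monomials_deg (k + m). \<Sum>i | m \<le> \<alpha> i. g \<alpha> i)"
proof -
  have S: "(\<Sum>j\<in>UNIV. \<alpha> j) = \<alpha> i + (\<Sum>j\<in>UNIV - {i}. \<alpha> j)" for \<alpha> :: "'n \<Rightarrow> nat" and i
    by (subst sum.remove[of UNIV i]) auto
  have mem: "\<beta>(i := \<beta> i + m) \<in> monomials_deg (k + m)" if "\<beta> \<in> monomials_deg k" for \<beta> :: "'n \<Rightarrow> nat" and i
    using that S[of \<beta> i] unfolding monomials_deg_def mem_Collect_eq sum_upd by simp
  have mem': "\<alpha>(i := \<alpha> i - m) \<in> monomials_deg k" if "\<alpha> \<in> monomials_deg (k + m)" "m \<le> \<alpha> i" for \<alpha> :: "'n \<Rightarrow> nat" and i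
    using that S[of \<alpha> i] unfolding monomials_deg_def mem_Collect_eq sum_upd by simp
  have "(\<Sum>\<beta>\<in>monomials_deg k. \<Sum>i\<in>UNIV. g (\<beta>(i := \<beta> i + m)) i) =
    (\<Sum>(\<beta>, i)\<in>monomials_deg k \<times> UNIV. g (\<beta>(i := \<beta> i + m)) i)"
    by (subst sum.Sigma) auto
  also have "\<dots> = (\<Sum>(\<alpha>, i)\<in>Sigma (monomials_deg (k + m)) (\<lambda>\<alpha>. {i. m \<le> \<alpha> i}). g \<alpha> i)"
    by (rule sum.reindex_bij_witness[where i = "\<lambda>(\<alpha>, i). (\<alpha>(i := \<alpha> i - m), i)" and j = "\<lambda>(\<beta>, i). (\<beta>(i := \<beta> i + m), i)"])
      (use mem mem' in \<open>auto simp: fun_eq_iff\<close>)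
  also have "\<dots> = (\<Sum>\<alpha>\<in>monomials_deg (k + m). \<Sum>i | m \<le> \<alpha> i. g \<alpha> i)"
    by (subst sum.Sigma) auto
  finally show ?thesis .
qed

lemma multinomial_inner:
  fixes x v :: "real^'n"
  shows "(x \<bullet> v) ^ k = (\<Sum>\<alpha>\<in>monomials_deg k. fact k / mfact \<alpha> * vmon x \<alpha> * vmon v \<alpha>)"
proof (induction k)
  case 0
  have "(monomials_deg 0 :: ('n \<Rightarrow> nat) set) = {\<lambda>_. 0}" by (auto simp: monomials_deg_def)
  then show ?case by (simp add: vmon_def mfact_def)
next
  case (Suc k)
  let ?g = "\<lambda>\<alpha> i. fact k * real (\<alpha> i) / mfact \<alpha> * vmon x \<alpha> * vmon v \<alpha>"
  have "(x \<bullet> v) ^ Suc k = (\<Sum>i\<in>UNIV. x $ i * v $ i) * (\<Sum>\<beta>\<in>monomials_deg k. fact k / mfact \<beta> * vmon x \<beta> * vmon v \<beta>)"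
    using Suc by (simp add: inner_vec_def)
  also have "\<dots> = (\<Sum>\<beta>\<in>monomials_deg k. \<Sum>i\<in>UNIV. ?g (\<beta>(i := \<beta> i + 1)) i)"
    unfolding sum_product
  proof (subst sum.swap, intro sum.cong refl)
    fix \<beta> :: "'n \<Rightarrow> nat" and i
    show "x $ i * v $ i * (fact k / mfact \<beta> * vmon x \<beta> * vmon v \<beta>) = ?g (\<beta>(i := \<beta> i + 1)) i"
      using mfact_pos[of \<beta>] unfolding mfact_upd_Suc vmon_upd
      by (simp add: field_simps del: of_nat_Suc of_nat_add)
  qed
  also have "\<dots> = (\<Sum>\<alpha>\<in>monomials_deg (k + 1). \<Sum>i | 1 \<le> \<alpha> i. ?g \<alpha> i)"
    by (rule monomials_deg_reindex)
  also have "\<dots> = (\<Sum>\<alpha>\<in>monomials_deg (Suc k). fact (Suc k) / mfact \<alpha> * vmon x \<alpha> * vmon v \<alpha>)"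
  proof (rule sum.cong)
    fix \<alpha> :: "'n \<Rightarrow> nat" assume \<alpha>: "\<alpha> \<in> monomials_deg (Suc k)"
    have "(\<Sum>i | 1 \<le> \<alpha> i. ?g \<alpha> i) = (\<Sum>i\<in>UNIV. ?g \<alpha> i)"
      by (rule sum.mono_neutral_left) auto
    also have "\<dots> = fact k * (\<Sum>i\<in>UNIV. real (\<alpha> i)) / mfact \<alpha> * vmon x \<alpha> * vmon v \<alpha>"
      by (simp add: sum_distrib_left sum_distrib_right sum_divide_distrib)
    also have "(\<Sum>i\<in>UNIV. real (\<alpha> i)) = real (Suc k)" using \<alpha> by (simp add: monomials_deg_def flip: of_nat_sum)
    finally show "(\<Sum>i | 1 \<le> \<alpha> i. ?g \<alpha> i) = fact (Suc k) / mfact \<alpha> * vmon x \<alpha> * vmon v \<alpha>"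
      by (simp add: mult_ac)
  qed simp
  finally show ?case .
qed

lemma digits_unique:
  fixes a b :: "nat \<Rightarrow> nat"
  assumes "\<And>j. j < N \<Longrightarrow> a j < M" "\<And>j. j < N \<Longrightarrow> b j < M"
    and "(\<Sum>j<N. a j * M ^ j) = (\<Sum>j<N. b j * M ^ j)" "j < N"
  shows "a j = b j"
  using assms
proof (induction N arbitrary: a b j)
  case (Suc N)
  have split: "(\<Sum>j<Suc N. c j * M ^ j) = c 0 + M * (\<Sum>j<N. c (Suc j) * M ^ j)" for c :: "nat \<Rightarrow> nat"
    unfolding sum.lessThan_Suc_shift by (simp add: sum_distrib_left mult_ac)
  have M: "a 0 < M" "b 0 < M" using Suc.prems by auto
  have eq: "a 0 + M * (\<Sum>j<N. a (Suc j) * M ^ j) = b 0 + M * (\<Sum>j<N. b (Suc j) * M ^ j)"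
    using Suc.prems(3) unfolding split .
  then have "(a 0 + M * (\<Sum>j<N. a (Suc j) * M ^ j)) mod M = (b 0 + M * (\<Sum>j<N. b (Suc j) * M ^ j)) mod M" by simp
  then have a0: "a 0 = b 0" using M by simp
  with eq M have "(\<Sum>j<N. a (Suc j) * M ^ j) = (\<Sum>j<N. b (Suc j) * M ^ j)" by simp
  then have "a (Suc i) = b (Suc i)" if "i < N" for i
    using Suc.IH[of "\<lambda>j. a (Suc j)" "\<lambda>j. b (Suc j)" i] Suc.prems(1,2) that by auto
  with a0 Suc.prems(4) show ?case by (cases j) auto
qed simp

text \<open>Kronecker substitution: setting the \<open>j\<close>-th variable to \<open>s\<close> raised to \<open>(d + 1)\<^sup>j\<close> separates
  the monomials of degree \<open>d\<close>.\<close>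

lemma vmon_linear_independent:
  fixes c :: "('n::finite \<Rightarrow> nat) \<Rightarrow> complex"
  assumes zero: "\<And>v :: real^'n. (\<Sum>\<alpha>\<in>monomials_deg d. c \<alpha> * of_real (vmon v \<alpha>)) = 0"
    and \<alpha>: "\<alpha> \<in> monomials_deg d"
  shows "c \<alpha> = 0"
proof -
  obtain e :: "'n \<Rightarrow> nat" where e: "bij_betw e UNIV {0..<CARD('n)}" using ex_bij_betw_finite_nat[of "UNIV :: 'n set"] by auto
  define E where "E \<alpha> = (\<Sum>i\<in>UNIV. \<alpha> i * (d + 1) ^ e i)" for \<alpha> :: "'n \<Rightarrow> nat"
  have inj: "inj_on E (monomials_deg d)"
  proof (rule inj_onI)
    fix \<alpha> \<beta> :: "'n \<Rightarrow> nat" assume \<alpha>: "\<alpha> \<in> monomials_deg d" and \<beta>: "\<beta> \<in> monomials_deg d" and eq: "E \<alpha> = E \<beta>"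
    have E: "E \<alpha> = (\<Sum>j<CARD('n). \<alpha> (inv e j) * (d + 1) ^ j)" for \<alpha>
    proof -
      have "inv e (e i) = i" for i using e by (simp add: bij_betw_def)
      then show ?thesis unfolding E_def
        using sum.reindex_bij_betw[OF e, of "\<lambda>j. \<alpha> (inv e j) * (d + 1) ^ j"] by (simp add: atLeast0LessThan)
    qed
    have "\<alpha> i = \<beta> i" for i
    proof -
      have "\<alpha> (inv e (e i)) = \<beta> (inv e (e i))"
        using le_of_monomials_deg[OF \<alpha>] le_of_monomials_deg[OF \<beta>] eq[unfolded E] bij_betwE[OF e]
        by (intro digits_unique[of "CARD('n)" "\<lambda>j. \<alpha> (inv e j)" "d + 1" "\<lambda>j. \<beta> (inv e j)" "e i"]) (auto simp: less_Suc_eq_le)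
      then show ?thesis using e by (simp add: bij_betw_def)
    qed
    then show "\<alpha> = \<beta>" by blast
  qed
  \<comment> \<open>The univariate polynomial produced by the substitution; it vanishes at every
    real number, hence is zero, and injectivity of \<open>E\<close> isolates one
    coefficient.\<close>
  define p where "p = (\<Sum>\<alpha>\<in>monomials_deg d. monom (c \<alpha>) (E \<alpha>))"
  have "poly p (of_real s) = 0" for s :: real
  proof -
    have "vmon (\<chi> i. s ^ ((d + 1) ^ e i)) \<alpha> = s ^ E \<alpha>" for \<alpha>
      by (simp add: vmon_def E_def power_sum flip: power_mult) (simp add: mult.commute)
    then show ?thesis using zero[of "\<chi> i. s ^ ((d + 1) ^ e i)"]
      by (simp add: p_def poly_sum poly_monom)
  qed
  then have "range complex_of_real \<subseteq> {x. poly p x = 0}" by auto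
  moreover have "infinite (range complex_of_real)"
    using finite_imageD[of complex_of_real UNIV] infinite_UNIV_char_0[where 'a = real] by (auto simp: inj_def)
  ultimately have "p = 0" using poly_roots_finite[of p] finite_subset by blast
  then have "coeff p (E \<alpha>) = 0" by simp
  also have "coeff p (E \<alpha>) = (\<Sum>\<beta>\<in>monomials_deg d. if \<beta> = \<alpha> then c \<beta> else 0)"
    unfolding p_def coeff_sum using inj_onD[OF inj _ _ \<alpha>] by (intro sum.cong) auto
  also have "\<dots> = c \<alpha>" using \<alpha> by simp
  finally show ?thesis .
qed

text \<open>By linear independence of monomials, \<tau> consists of the coefficients of
  \<open>v \<bullet> v\<close> times \<rho>. With the factorial weights, raising an exponent by 2
  produces the factor of a second derivative, so the pairing turns into \<rho> against the Laplacian
  of the harmonic polynomial.\<close>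

lemma apolar_harmonic:
  fixes c :: "('n::finite \<Rightarrow> nat) \<Rightarrow> real" and \<tau> \<rho> :: "('n \<Rightarrow> nat) \<Rightarrow> complex"
  assumes harm: "harmonic (d + 2) c"
    and eq: "\<And>v :: real^'n. (\<Sum>\<alpha>\<in>monomials_deg (d + 2). \<tau> \<alpha> * of_real (vmon v \<alpha>)) =
      of_real (v \<bullet> v) * (\<Sum>\<beta>\<in>monomials_deg d. \<rho> \<beta> * of_real (vmon v \<beta>))"
  shows "(\<Sum>\<alpha>\<in>monomials_deg (d + 2). of_real (c \<alpha> * mfact \<alpha>) * \<tau> \<alpha>) = 0"
proof -
  have \<tau>: "\<tau> \<alpha> = (\<Sum>i | 2 \<le> \<alpha> i. \<rho> (\<alpha>(i := \<alpha> i - 2)))" if \<alpha>: "\<alpha> \<in> monomials_deg (d + 2)" for \<alpha>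
  proof -
    have "(\<Sum>\<alpha>\<in>monomials_deg (d + 2). (\<tau> \<alpha> - (\<Sum>i | 2 \<le> \<alpha> i. \<rho> (\<alpha>(i := \<alpha> i - 2)))) * of_real (vmon v \<alpha>)) = 0" for v :: "real^'n"
    proof -
      let ?g = "\<lambda>\<alpha> i. \<rho> (\<alpha>(i := \<alpha> i - 2)) * of_real (vmon v \<alpha>)"
      have "of_real (v \<bullet> v) * (\<Sum>\<beta>\<in>monomials_deg d. \<rho> \<beta> * of_real (vmon v \<beta>)) =
        (\<Sum>i\<in>UNIV. of_real ((v $ i) ^ 2)) * (\<Sum>\<beta>\<in>monomials_deg d. \<rho> \<beta> * of_real (vmon v \<beta>))"
        by (simp add: inner_vec_def power2_eq_square)
      also have "\<dots> = (\<Sum>\<beta>\<in>monomials_deg d. \<Sum>i\<in>UNIV. ?g (\<beta>(i := \<beta> i + 2)) i)"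
        unfolding sum_product
        by (subst sum.swap, intro sum.cong refl) (simp add: vmon_upd mult_ac del: add_2_eq_Suc')
      also have "\<dots> = (\<Sum>\<alpha>\<in>monomials_deg (d + 2). \<Sum>i | 2 \<le> \<alpha> i. ?g \<alpha> i)"
        by (rule monomials_deg_reindex)
      finally show ?thesis using eq[of v] by (simp add: left_diff_distrib sum_subtractf sum_distrib_right)
    qed
    from vmon_linear_independent[OF this \<alpha>] show ?thesis by simp
  qed
  let ?h = "\<lambda>\<alpha> i. complex_of_real (c \<alpha> * mfact \<alpha>) * \<rho> (\<alpha>(i := \<alpha> i - 2))"
  have "(\<Sum>\<alpha>\<in>monomials_deg (d + 2). of_real (c \<alpha> * mfact \<alpha>) * \<tau> \<alpha>) = (\<Sum>\<alpha>\<in>monomials_deg (d + 2). \<Sum>i | 2 \<le> \<alpha> i. ?h \<alpha> i)"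
    using \<tau> by (simp add: sum_distrib_left)
  also have "\<dots> = (\<Sum>\<beta>\<in>monomials_deg d. \<Sum>i\<in>UNIV. ?h (\<beta>(i := \<beta> i + 2)) i)"
    by (rule monomials_deg_reindex[symmetric])
  also have "\<dots> = (\<Sum>\<beta>\<in>monomials_deg d. \<rho> \<beta> * of_real (mfact \<beta>) * of_real (\<Sum>i\<in>UNIV. real ((\<beta> i + 2) * (\<beta> i + 1)) * c (\<beta>(i := \<beta> i + 2))))"
    by (intro sum.cong refl) (simp add: mfact_upd_2 sum_distrib_left mult_ac del: add_2_eq_Suc')
  also have "\<dots> = 0"
    using harm by (intro sum.neutral) (simp add: harmonic_def)
  finally show ?thesis .
qed

text \<open>Coefficients are hidden behind an existential, since all that has to be recorded about a
  remainder is its divisibility by \<open>v \<bullet> v\<close>.\<close>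

definition hom_poly :: "nat \<Rightarrow> (real^'n \<Rightarrow> complex) \<Rightarrow> bool" where
  "hom_poly k f \<longleftrightarrow> (\<exists>\<rho>. \<forall>v. f v = (\<Sum>\<alpha>\<in>monomials_deg k. \<rho> \<alpha> * of_real (vmon v \<alpha>)))"

lemma hom_poly_sum:
  assumes "finite I" "\<And>i. i \<in> I \<Longrightarrow> hom_poly k (f i)"
  shows "hom_poly k (\<lambda>v. \<Sum>i\<in>I. f i v)"
proof -
  have "\<forall>i\<in>I. \<exists>\<rho>. \<forall>v. f i v = (\<Sum>\<alpha>\<in>monomials_deg k. \<rho> \<alpha> * of_real (vmon v \<alpha>))"
    using assms(2) by (auto simp: hom_poly_def)
  then obtain \<rho> where \<rho>: "\<And>i v. i \<in> I \<Longrightarrow> f i v = (\<Sum>\<alpha>\<in>monomials_deg k. \<rho> i \<alpha> * of_real (vmon v \<alpha>))"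
    by metis
  have "(\<Sum>i\<in>I. f i v) = (\<Sum>\<alpha>\<in>monomials_deg k. (\<Sum>i\<in>I. \<rho> i \<alpha>) * of_real (vmon v \<alpha>))" for v
    using \<rho> by (simp add: sum_distrib_right) (rule sum.swap)
  then have "\<forall>v. (\<Sum>i\<in>I. f i v) = (\<Sum>\<alpha>\<in>monomials_deg k. (\<Sum>i\<in>I. \<rho> i \<alpha>) * of_real (vmon v \<alpha>))" by blast
  then show ?thesis unfolding hom_poly_def by (rule exI[where x = "\<lambda>\<alpha>. \<Sum>i\<in>I. \<rho> i \<alpha>"])
qed

lemma hom_poly_cmult:
  assumes "hom_poly k f"
  shows "hom_poly k (\<lambda>v. a * f v)"
proof -
  obtain \<rho> where "\<And>v. f v = (\<Sum>\<alpha>\<in>monomials_deg k. \<rho> \<alpha> * of_real (vmon v \<alpha>))"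
    using assms by (auto simp: hom_poly_def)
  then have "\<forall>v. a * f v = (\<Sum>\<alpha>\<in>monomials_deg k. (a * \<rho> \<alpha>) * of_real (vmon v \<alpha>))"
    by (simp add: sum_distrib_left mult_ac)
  then show ?thesis unfolding hom_poly_def by (intro exI)
qed

lemma hom_poly_norm_mult:
  assumes "hom_poly k f"
  shows "hom_poly (k + 2) (\<lambda>v :: real^'n. of_real (v \<bullet> v) * f v)"
proof -
  obtain \<rho> where \<rho>: "\<And>v. f v = (\<Sum>\<alpha>\<in>monomials_deg k. \<rho> \<alpha> * of_real (vmon v \<alpha>))"
    using assms by (auto simp: hom_poly_def)
  have "of_real (v \<bullet> v) * f v = (\<Sum>\<alpha>\<in>monomials_deg (k + 2). (\<Sum>i | 2 \<le> \<alpha> i. \<rho> (\<alpha>(i := \<alpha> i - 2))) * of_real (vmon v \<alpha>))" for v :: "real^'n"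
  proof -
    let ?g = "\<lambda>\<alpha> i. \<rho> (\<alpha>(i := \<alpha> i - 2)) * of_real (vmon v \<alpha>)"
    have "of_real (v \<bullet> v) * f v =
      (\<Sum>i\<in>UNIV. of_real ((v $ i) ^ 2)) * (\<Sum>\<beta>\<in>monomials_deg k. \<rho> \<beta> * of_real (vmon v \<beta>))"
      by (simp add: inner_vec_def power2_eq_square \<rho>)
    also have "\<dots> = (\<Sum>\<beta>\<in>monomials_deg k. \<Sum>i\<in>UNIV. ?g (\<beta>(i := \<beta> i + 2)) i)"
      unfolding sum_product
      by (subst sum.swap, intro sum.cong refl) (simp add: vmon_upd mult_ac del: add_2_eq_Suc')
    also have "\<dots> = (\<Sum>\<alpha>\<in>monomials_deg (k + 2). \<Sum>i | 2 \<le> \<alpha> i. ?g \<alpha> i)"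
      by (rule monomials_deg_reindex)
    finally show ?thesis by (simp add: sum_distrib_right)
  qed
  then show ?thesis unfolding hom_poly_def
    by (intro exI[where x = "\<lambda>\<alpha>. \<Sum>i | 2 \<le> \<alpha> i. \<rho> (\<alpha>(i := \<alpha> i - 2))"] allI)
qed

lemma hom_poly_norm_power_mult:
  assumes "hom_poly k f"
  shows "hom_poly (k + 2 * j) (\<lambda>v :: real^'n. of_real ((v \<bullet> v) ^ j) * f v)"
proof (induction j)
  case (Suc j)
  from hom_poly_norm_mult[OF Suc] show ?case by (simp add: mult.assoc)
qed (use assms in simp)

lemma has_sum_finite_sum:
  fixes f :: "'i \<Rightarrow> 'a \<Rightarrow> 'b::topological_comm_monoid_add"
  assumes "finite I" "\<And>i. i \<in> I \<Longrightarrow> (f i has_sum s i) A"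
  shows "((\<lambda>x. \<Sum>i\<in>I. f i x) has_sum (\<Sum>i\<in>I. s i)) A"
  using assms by (induction I rule: finite_induct) (auto intro: has_sum_add)

text \<open>The k-th moments in all directions v form one polynomial in v whose coefficients are the
  monomial moments, a form to which linear independence applies.\<close>

lemma moment_expand:
  fixes W :: "real^'n \<Rightarrow> complex"
  assumes "\<And>\<alpha>. \<alpha> \<in> monomials_deg k \<Longrightarrow> (\<lambda>y. W y * of_real (vmon y \<alpha>)) summable_on A"
  shows "(\<Sum>\<^sub>\<infinity>y\<in>A. W y * of_real ((y \<bullet> v) ^ k)) =
    (\<Sum>\<alpha>\<in>monomials_deg k. (of_real (fact k / mfact \<alpha>) * (\<Sum>\<^sub>\<infinity>y\<in>A. W y * of_real (vmon y \<alpha>))) * of_real (vmon v \<alpha>))"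
proof -
  have "((\<lambda>y. \<Sum>\<alpha>\<in>monomials_deg k. (of_real (fact k / mfact \<alpha>) * (W y * of_real (vmon y \<alpha>))) * of_real (vmon v \<alpha>)) has_sum
    (\<Sum>\<alpha>\<in>monomials_deg k. (of_real (fact k / mfact \<alpha>) * (\<Sum>\<^sub>\<infinity>y\<in>A. W y * of_real (vmon y \<alpha>))) * of_real (vmon v \<alpha>))) A"
    using assms by (intro has_sum_finite_sum has_sum_cmult_left has_sum_cmult_right has_sum_infsum finite_monomials_deg)
  moreover have "(\<Sum>\<alpha>\<in>monomials_deg k. (of_real (fact k / mfact \<alpha>) * (W y * of_real (vmon y \<alpha>))) * of_real (vmon v \<alpha>)) = W y * of_real ((y \<bullet> v) ^ k)" for y
    unfolding multinomial_inner of_real_sum sum_distrib_left by (intro sum.cong) auto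
  ultimately show ?thesis by (simp add: infsumI)
qed

section \<open>Harmonic Poisson summation\<close>

lemma power_le_fact_exp:
  assumes x: "(x::real) \<ge> 0"
  shows "x ^ k \<le> fact k * exp x"
proof -
  have "(\<Sum>i\<in>{k}. x ^ i /\<^sub>R fact i) \<le> (\<Sum>i. x ^ i /\<^sub>R fact i)"
    using x by (intro sum_le_suminf summable_exp_generic) auto
  then show ?thesis by (simp add: exp_def field_simps)
qed

text \<open>Expanding the exponential gives a double series; for |s| <= 1 it is dominated by the sum
  assumed convergent, so the two summations commute. The unit disc suffices, since only Taylor
  coefficients at 0 are compared afterwards.\<close>

lemma exp_moment_expansion:
  fixes W z :: "'a \<Rightarrow> complex"
  assumes summ: "(\<lambda>y. cmod (W y) * exp (cmod (z y))) summable_on A"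
  shows "(\<lambda>y. W y * z y ^ k) summable_on A"
    and "cmod s \<le> 1 \<Longrightarrow> (\<lambda>k. (\<Sum>\<^sub>\<infinity>y\<in>A. W y * z y ^ k) / fact k * s ^ k) sums (\<Sum>\<^sub>\<infinity>y\<in>A. W y * exp (s * z y))"
proof -
  have pw: "cmod (z y) ^ k \<le> fact k * exp (cmod (z y))" for y k
    by (rule power_le_fact_exp) simp
  show wk: "(\<lambda>y. W y * z y ^ k) summable_on A" for k
  proof (rule abs_summable_summable, rule summable_on_comparison_test)
    show "(\<lambda>y. fact k * (cmod (W y) * exp (cmod (z y)))) summable_on A"
      using summ by (rule summable_on_cmult_right)
    show "cmod (W y * z y ^ k) \<le> fact k * (cmod (W y) * exp (cmod (z y)))" for y
      using mult_left_mono[OF pw[of y k], of "cmod (W y)"] by (simp add: norm_mult norm_power mult_ac)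
  qed auto
  assume s: "cmod s \<le> 1"
  have hs: "((\<lambda>k. W y * ((s * z y) ^ k /\<^sub>R fact k)) has_sum W y * exp (s * z y)) UNIV" for y
  proof (intro has_sum_cmult_right norm_summable_imp_has_sum)
    show "summable (\<lambda>k. norm ((s * z y) ^ k /\<^sub>R fact k))" by (rule summable_norm_exp)
    show "(\<lambda>k. (s * z y) ^ k /\<^sub>R fact k) sums exp (s * z y)" by (rule exp_converges)
  qed
  have abs: "(\<lambda>p. norm ((\<lambda>(y, k). W y * ((s * z y) ^ k /\<^sub>R fact k)) p)) summable_on A \<times> (UNIV :: nat set)"
  proof (subst Infinite_Sum.abs_summable_on_Sigma_iff, intro conjI ballI)
    fix y
    have "summable (\<lambda>k. norm ((s * z y) ^ k /\<^sub>R fact k))" by (rule summable_norm_exp)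
    then have "(\<lambda>k. norm ((s * z y) ^ k /\<^sub>R fact k)) summable_on UNIV"
      by (intro summable_nonneg_imp_summable_on) auto
    from summable_on_cmult_right[OF this, of "cmod (W y)"]
    show "(\<lambda>k. norm (case (y, k) of (y, k) \<Rightarrow> W y * ((s * z y) ^ k /\<^sub>R fact k))) summable_on UNIV"
      by (simp only: prod.case norm_mult)
  next
    have "(\<Sum>\<^sub>\<infinity>k. norm (W y * ((s * z y) ^ k /\<^sub>R fact k))) = cmod (W y) * exp (cmod (s * z y))" for y
    proof (rule infsumI)
      have "((\<lambda>k. cmod (W y) * (cmod (s * z y) ^ k /\<^sub>R fact k)) has_sum cmod (W y) * exp (cmod (s * z y))) UNIV"
        by (intro has_sum_cmult_right sums_nonneg_imp_has_sum exp_converges) auto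
      moreover have "norm (W y * ((s * z y) ^ k /\<^sub>R fact k)) = cmod (W y) * (cmod (s * z y) ^ k /\<^sub>R fact k)" for k
        by (simp add: norm_mult norm_power)
      ultimately show "((\<lambda>k. norm (W y * ((s * z y) ^ k /\<^sub>R fact k))) has_sum cmod (W y) * exp (cmod (s * z y))) UNIV"
        by (simp only:)
    qed
    moreover have "(\<lambda>y. cmod (W y) * exp (cmod (s * z y))) summable_on A"
      by (rule summable_on_comparison_test[OF summ]) (use s in \<open>auto simp: norm_mult intro!: mult_left_mono mult_left_le_one_le\<close>)
    ultimately show "(\<lambda>y. norm (\<Sum>\<^sub>\<infinity>k. norm (case (y, k) of (y, k) \<Rightarrow> W y * ((s * z y) ^ k /\<^sub>R fact k)))) summable_on A"
      by simp
  qed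
  have sw: "(\<lambda>(y, k). W y * ((s * z y) ^ k /\<^sub>R fact k)) summable_on A \<times> (UNIV :: nat set)"
    using abs by (rule abs_summable_summable)
  have sw': "(\<lambda>(k, y). W y * ((s * z y) ^ k /\<^sub>R fact k)) summable_on (UNIV :: nat set) \<times> A"
    using sw by (subst (asm) summable_on_swap) simp
  have "((\<lambda>k. \<Sum>\<^sub>\<infinity>y\<in>A. W y * ((s * z y) ^ k /\<^sub>R fact k)) has_sum (\<Sum>\<^sub>\<infinity>k. \<Sum>\<^sub>\<infinity>y\<in>A. W y * ((s * z y) ^ k /\<^sub>R fact k))) UNIV"
    using summable_on_Sigma_banach[OF sw'] by (rule has_sum_infsum)
  moreover have "(\<Sum>\<^sub>\<infinity>k. \<Sum>\<^sub>\<infinity>y\<in>A. W y * ((s * z y) ^ k /\<^sub>R fact k)) = (\<Sum>\<^sub>\<infinity>y\<in>A. \<Sum>\<^sub>\<infinity>k. W y * ((s * z y) ^ k /\<^sub>R fact k))"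
    by (rule infsum_swap_banach[OF sw'])
  moreover have "\<dots> = (\<Sum>\<^sub>\<infinity>y\<in>A. W y * exp (s * z y))"
    using hs by (intro infsum_cong) (rule infsumI)
  moreover have "(\<Sum>\<^sub>\<infinity>y\<in>A. W y * ((s * z y) ^ k /\<^sub>R fact k)) = (\<Sum>\<^sub>\<infinity>y\<in>A. W y * z y ^ k) / fact k * s ^ k" for k
  proof -
    have "(\<Sum>\<^sub>\<infinity>y\<in>A. W y * ((s * z y) ^ k /\<^sub>R fact k)) = (\<Sum>\<^sub>\<infinity>y\<in>A. (W y * z y ^ k) * (s ^ k / fact k))"
      by (intro infsum_cong) (simp add: power_mult_distrib scaleR_conv_of_real field_simps)
    then show ?thesis by (simp only: infsum_cmult_left') simp
  qed
  ultimately show "(\<lambda>k. (\<Sum>\<^sub>\<infinity>y\<in>A. W y * z y ^ k) / fact k * s ^ k) sums (\<Sum>\<^sub>\<infinity>y\<in>A. W y * exp (s * z y))"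
    by (intro has_sum_imp_sums) simp
qed

lemma exp_square_sums:
  fixes a s :: complex
  shows "(\<lambda>k. (if even k then a ^ (k div 2) / fact (k div 2) else 0) * s ^ k) sums exp (a * s\<^sup>2)"
proof -
  let ?f = "\<lambda>k. (if even k then a ^ (k div 2) / fact (k div 2) else 0) * s ^ k"
  have "(\<lambda>j. (a * s\<^sup>2) ^ j /\<^sub>R fact j) sums exp (a * s\<^sup>2)" by (rule exp_converges)
  moreover have "(a * s\<^sup>2) ^ j /\<^sub>R fact j = ?f (2 * j)" for j
    by (simp add: power_mult_distrib scaleR_conv_of_real divide_inverse mult_ac flip: power_mult)
  ultimately have "(\<lambda>j. ?f (2 * j)) sums exp (a * s\<^sup>2)" by (simp only:)
  moreover have "?f k = 0" if "k \<notin> range (\<lambda>j. 2 * j)" for k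
  proof -
    have "odd k"
    proof
      assume "even k"
      then have "k = 2 * (k div 2)" by simp
      with that show False by blast
    qed
    then show ?thesis by simp
  qed
  ultimately show ?thesis
    by (subst (asm) sums_mono_reindex) (auto simp: strict_mono_def)
qed

text \<open>The segment accumulates at 0, so the identity theorem applies. Lattice identities are at
  hand only for real parameters, and this is how their coefficients are compared.\<close>

lemma power_series_real_unique:
  fixes F G :: "complex fps"
  assumes "fps_conv_radius F \<ge> 1" "fps_conv_radius G \<ge> 1"
    and eq: "\<And>s. 0 < s \<Longrightarrow> s < 1 \<Longrightarrow> eval_fps F (of_real s) = eval_fps G (of_real s)"
  shows "F = G"
proof -
  let ?D = "\<lambda>z. eval_fps F z - eval_fps G z"
  have z0: "?D z = 0" if "z \<in> ball 0 1" for z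
  proof (rule analytic_continuation[of ?D "ball 0 1" "complex_of_real ` {0<..<1}" 0])
    show "?D holomorphic_on ball 0 1"
      using assms(1,2) by (intro holomorphic_on_diff holomorphic_on_eval_fps ball_eball_mono) (auto simp: one_ereal_def)
    show "0 islimpt complex_of_real ` {0<..<1}"
      unfolding islimpt_approachable
    proof (intro allI impI)
      fix e :: real assume "e > 0"
      then show "\<exists>x'\<in>complex_of_real ` {0<..<1}. x' \<noteq> 0 \<and> dist x' 0 < e"
      proof (intro bexI conjI)
        show "complex_of_real (min e 1 / 2) \<in> complex_of_real ` {0<..<1}"
          using \<open>e > 0\<close> by (intro imageI) (simp add: min_def)
        show "complex_of_real (min e 1 / 2) \<noteq> 0" using \<open>e > 0\<close> by (simp add: min_def)
        have "dist (complex_of_real (min e 1 / 2)) 0 = \<bar>min e 1 / 2\<bar>" by (simp only: dist_0_norm norm_of_real dist_commute)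
        then show "dist (complex_of_real (min e 1 / 2)) 0 < e" using \<open>e > 0\<close> by linarith
      qed
    qed
  qed (use eq that in auto)
  show ?thesis
  proof (rule eval_fps_eqD)
    show "\<forall>\<^sub>F z in nhds 0. eval_fps F z = eval_fps G z"
    proof -
      have "\<forall>\<^sub>F z in nhds 0. z \<in> ball (0::complex) 1" by (intro eventually_nhds_in_open) auto
      then show ?thesis by eventually_elim (use z0 in simp)
    qed
    show "fps_conv_radius F > 0" by (rule less_le_trans[OF _ assms(1)]) simp
    show "fps_conv_radius G > 0" by (rule less_le_trans[OF _ assms(2)]) simp
  qed
qed

text \<open>Completing the square: half of the Gaussian exponent absorbs the exponential, up to the
  constant exp(r^2/(2t)).\<close>

lemma gauss_exp_summable:
  fixes A :: "'a::real_normed_vector set"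
  assumes g: "\<And>t::real. t > 0 \<Longrightarrow> (\<lambda>x. exp (- t * (norm x)\<^sup>2)) summable_on A" and t: "t > 0"
  shows "(\<lambda>x. exp (- t * (norm x)\<^sup>2) * exp (r * norm x)) summable_on A"
proof (rule summable_on_comparison_test)
  show "(\<lambda>x. exp (r\<^sup>2 / (2 * t)) * exp (- (t / 2) * (norm x)\<^sup>2)) summable_on A"
    using t by (intro summable_on_cmult_right g) auto
  show "exp (- t * (norm x)\<^sup>2) * exp (r * norm x) \<le> exp (r\<^sup>2 / (2 * t)) * exp (- (t / 2) * (norm x)\<^sup>2)" for x
  proof -
    have "0 \<le> (t * norm x - r)\<^sup>2 / (2 * t)" using t by simp
    also have "(t * norm x - r)\<^sup>2 / (2 * t) = r\<^sup>2 / (2 * t) + (t / 2) * (norm x)\<^sup>2 - r * norm x"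
      using t by (simp add: power2_diff power_mult_distrib field_simps power2_eq_square)
    finally show ?thesis by (simp flip: exp_add)
  qed
qed auto

lemma abs_vmon_le: "\<bar>vmon x \<alpha>\<bar> \<le> norm x ^ (\<Sum>i\<in>UNIV. \<alpha> i)"
proof -
  have "\<bar>vmon x \<alpha>\<bar> = (\<Prod>i\<in>UNIV. \<bar>x $ i\<bar> ^ \<alpha> i)" by (simp add: vmon_def abs_prod power_abs)
  also have "\<dots> \<le> (\<Prod>i\<in>UNIV. norm x ^ \<alpha> i)" by (intro prod_mono) (auto intro!: power_mono component_le_norm_cart)
  finally show ?thesis by (simp add: power_sum)
qed

lemma gauss_vmon_summable:
  fixes A :: "(real^'n) set" and W :: "real^'n \<Rightarrow> complex"
  assumes g: "\<And>t::real. t > 0 \<Longrightarrow> (\<lambda>x. exp (- t * (norm x)\<^sup>2)) summable_on A" and t: "t > 0"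
    and W: "\<And>x. x \<in> A \<Longrightarrow> cmod (W x) = exp (- t * (norm x)\<^sup>2)"
  shows "(\<lambda>x. W x * of_real (vmon x \<alpha>)) summable_on A"
proof (rule abs_summable_summable, rule summable_on_comparison_test)
  let ?k = "\<Sum>i\<in>UNIV. \<alpha> i"
  show "(\<lambda>x. fact ?k * (exp (- t * (norm x)\<^sup>2) * exp (1 * norm x))) summable_on A"
    by (intro summable_on_cmult_right gauss_exp_summable g t)
  show "cmod (W x * of_real (vmon x \<alpha>)) \<le> fact ?k * (exp (- t * (norm x)\<^sup>2) * exp (1 * norm x))" if "x \<in> A" for x
  proof -
    have "\<bar>vmon x \<alpha>\<bar> \<le> fact ?k * exp (norm x)"
      using abs_vmon_le[of x \<alpha>] power_le_fact_exp[of "norm x" ?k] by (simp add: order_trans)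
    then have "exp (- t * (norm x)\<^sup>2) * \<bar>vmon x \<alpha>\<bar> \<le> exp (- t * (norm x)\<^sup>2) * (fact ?k * exp (norm x))"
      by (intro mult_left_mono) auto
    then show ?thesis using W[OF that] by (simp add: norm_mult mult_ac)
  qed
qed auto

text \<open>Comparing the coefficients of \<open>s\<^sup>d\<close> in the generating identity along every line \<open>u = s v\<close> gives an
  identity of polynomials in \<open>v\<close>; apolarity with a harmonic polynomial kills the terms divisible
  by \<open>v \<bullet> v\<close>.\<close>

lemma harmonic_transfer:
  fixes A L :: "(real^'n) set" and W W' :: "real^'n \<Rightarrow> complex"
  assumes gA: "\<And>t::real. t > 0 \<Longrightarrow> (\<lambda>x. exp (- t * (norm x)\<^sup>2)) summable_on A"
    and gL: "\<And>t::real. t > 0 \<Longrightarrow> (\<lambda>x. exp (- t * (norm x)\<^sup>2)) summable_on L"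
    and pos: "p > 0" "p' > 0"
    and W: "\<And>x. x \<in> A \<Longrightarrow> cmod (W x) = exp (- p * (norm x)\<^sup>2)"
    and W': "\<And>y. y \<in> L \<Longrightarrow> cmod (W' y) = exp (- p' * (norm y)\<^sup>2)"
    and gen: "\<And>u. (\<Sum>\<^sub>\<infinity>x\<in>A. W x * exp (a * of_real (x \<bullet> u))) =
       K * exp (e * of_real (u \<bullet> u)) * (\<Sum>\<^sub>\<infinity>y\<in>L. W' y * exp (b * of_real (y \<bullet> u)))"
    and harm: "harmonic d c"
  shows "a ^ d * (\<Sum>\<^sub>\<infinity>x\<in>A. W x * of_real (hpoly d c x)) = K * b ^ d * (\<Sum>\<^sub>\<infinity>y\<in>L. W' y * of_real (hpoly d c y))"
proof -
  define M where "M k v = (\<Sum>\<^sub>\<infinity>x\<in>A. W x * of_real ((x \<bullet> v) ^ k))" for k v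
  define N where "N k v = (\<Sum>\<^sub>\<infinity>y\<in>L. W' y * of_real ((y \<bullet> v) ^ k))" for k v
  have sA: "(\<lambda>x. W x * of_real (vmon x \<alpha>)) summable_on A" for \<alpha>
    by (rule gauss_vmon_summable[OF gA pos(1) W])
  have sL: "(\<lambda>x. W' x * of_real (vmon x \<alpha>)) summable_on L" for \<alpha>
    by (rule gauss_vmon_summable[OF gL pos(2) W'])
  define mA where "mA \<alpha> = (\<Sum>\<^sub>\<infinity>x\<in>A. W x * of_real (vmon x \<alpha>))" for \<alpha>
  define mL where "mL \<alpha> = (\<Sum>\<^sub>\<infinity>y\<in>L. W' y * of_real (vmon y \<alpha>))" for \<alpha>
  have M: "M k v = (\<Sum>\<alpha>\<in>monomials_deg k. (of_real (fact k / mfact \<alpha>) * mA \<alpha>) * of_real (vmon v \<alpha>))" for k v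
    unfolding M_def mA_def by (rule moment_expand[OF sA])
  have N: "N k v = (\<Sum>\<alpha>\<in>monomials_deg k. (of_real (fact k / mfact \<alpha>) * mL \<alpha>) * of_real (vmon v \<alpha>))" for k v
    unfolding N_def mL_def by (rule moment_expand[OF sL])
  have hN: "hom_poly k (N k)" for k
    unfolding hom_poly_def using N by (intro exI[where x = "\<lambda>\<alpha>. of_real (fact k / mfact \<alpha>) * mL \<alpha>"] allI)
  have bd: "(\<lambda>y. cmod (w y) * exp (cmod (q * of_real (y \<bullet> v)))) summable_on S"
    if g: "\<And>t::real. t > 0 \<Longrightarrow> (\<lambda>x. exp (- t * (norm x)\<^sup>2)) summable_on S" and r: "r > 0"
      and w: "\<And>x. x \<in> S \<Longrightarrow> cmod (w x) = exp (- r * (norm x)\<^sup>2)" for S :: "(real^'n) set" and w q v r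
  proof (rule summable_on_comparison_test)
    show "(\<lambda>x. exp (- r * (norm x)\<^sup>2) * exp ((cmod q * norm v) * norm x)) summable_on S"
      by (rule gauss_exp_summable[OF g r])
    show "cmod (w x) * exp (cmod (q * of_real (x \<bullet> v))) \<le> exp (- r * (norm x)\<^sup>2) * exp ((cmod q * norm v) * norm x)" if "x \<in> S" for x
    proof -
      have "cmod q * \<bar>x \<bullet> v\<bar> \<le> cmod q * (norm x * norm v)" by (intro mult_left_mono Cauchy_Schwarz_ineq2) auto
      then show ?thesis using w[OF that] by (simp add: norm_mult mult_ac)
    qed
  qed auto
  let ?E = "\<lambda>v k. if even k then (e * of_real (v \<bullet> v)) ^ (k div 2) / fact (k div 2) else 0"
  \<comment> \<open>The coefficient of s^d on the line u = s v, as a Cauchy product; the Gaussian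
    prefactor in u contributes only even powers of s, each with factors
    \<open>v \<bullet> v\<close>.\<close>
  have coeff: "a ^ d * M d v / fact d = K * (\<Sum>i=0..d. ?E v i * (b ^ (d - i) * N (d - i) v / fact (d - i)))" for v
  proof -
    define FA where "FA = Abs_fps (\<lambda>k. (\<Sum>\<^sub>\<infinity>x\<in>A. W x * (a * of_real (x \<bullet> v)) ^ k) / fact k)"
    define FL where "FL = Abs_fps (\<lambda>k. (\<Sum>\<^sub>\<infinity>y\<in>L. W' y * (b * of_real (y \<bullet> v)) ^ k) / fact k)"
    define FE where "FE = Abs_fps (?E v)"
    have SA: "(\<lambda>k. fps_nth FA k * s ^ k) sums (\<Sum>\<^sub>\<infinity>x\<in>A. W x * exp (s * (a * of_real (x \<bullet> v))))" if "cmod s \<le> 1" for s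
      unfolding FA_def fps_nth_Abs_fps
      by (rule exp_moment_expansion(2)[OF _ that]) (rule bd[OF gA pos(1) W])
    have SL: "(\<lambda>k. fps_nth FL k * s ^ k) sums (\<Sum>\<^sub>\<infinity>y\<in>L. W' y * exp (s * (b * of_real (y \<bullet> v))))" if "cmod s \<le> 1" for s
      unfolding FL_def fps_nth_Abs_fps
      by (rule exp_moment_expansion(2)[OF _ that]) (rule bd[OF gL pos(2) W'])
    have SE: "(\<lambda>k. fps_nth FE k * s ^ k) sums exp (e * of_real (v \<bullet> v) * s\<^sup>2)" for s
      unfolding FE_def fps_nth_Abs_fps by (rule exp_square_sums)
    have rad: "fps_conv_radius F \<ge> 1" if "summable (\<lambda>k. fps_nth F k * (1::complex) ^ k)" for F
      using conv_radius_geI[OF that] by (simp add: fps_conv_radius_def one_ereal_def)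
    have rA: "fps_conv_radius FA \<ge> 1" using SA[of 1] by (intro rad) (simp add: sums_iff)
    have rL: "fps_conv_radius FL \<ge> 1" using SL[of 1] by (intro rad) (simp add: sums_iff)
    have rE: "fps_conv_radius FE \<ge> 1" using SE[of 1] by (intro rad) (simp add: sums_iff)
    have rEL: "fps_conv_radius (FE * FL) \<ge> 1"
      using order_trans[OF _ fps_conv_radius_mult[of FE FL], of 1] rE rL by simp
    have rEL': "fps_conv_radius (fps_const K * (FE * FL)) \<ge> 1"
      using order_trans[OF _ fps_conv_radius_mult[of "fps_const K" "FE * FL"], of 1] rEL by simp
    have "FA = fps_const K * (FE * FL)"
    proof (rule power_series_real_unique[OF rA rEL'])
      fix s :: real assume s: "0 < s" "s < 1"
      have lt: "ereal (norm (complex_of_real s)) < r" if "r \<ge> 1" for r :: ereal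
        using s by (intro less_le_trans[OF _ that]) (simp add: one_ereal_def)
      have "eval_fps FA (of_real s) = (\<Sum>\<^sub>\<infinity>x\<in>A. W x * exp (of_real s * (a * of_real (x \<bullet> v))))"
        unfolding eval_fps_def using SA[of "of_real s"] s by (simp add: sums_iff)
      also have "\<dots> = (\<Sum>\<^sub>\<infinity>x\<in>A. W x * exp (a * of_real (x \<bullet> (s *\<^sub>R v))))" by (simp add: mult_ac)
      also have "\<dots> = K * exp (e * of_real ((s *\<^sub>R v) \<bullet> (s *\<^sub>R v))) * (\<Sum>\<^sub>\<infinity>y\<in>L. W' y * exp (b * of_real (y \<bullet> (s *\<^sub>R v))))"
        by (rule gen)
      also have "exp (e * of_real ((s *\<^sub>R v) \<bullet> (s *\<^sub>R v))) = eval_fps FE (of_real s)"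
        unfolding eval_fps_def using SE[of "of_real s"] by (simp add: sums_iff power2_eq_square mult_ac)
      also have "(\<Sum>\<^sub>\<infinity>y\<in>L. W' y * exp (b * of_real (y \<bullet> (s *\<^sub>R v)))) = eval_fps FL (of_real s)"
        unfolding eval_fps_def using SL[of "of_real s"] s by (simp add: sums_iff mult_ac)
      also have "K * eval_fps FE (of_real s) * eval_fps FL (of_real s) = eval_fps (fps_const K * (FE * FL)) (of_real s)"
        using lt[OF rE] lt[OF rL] lt[OF rEL] by (simp add: eval_fps_mult mult.assoc)
      finally show "eval_fps FA (of_real s) = eval_fps (fps_const K * (FE * FL)) (of_real s)" .
    qed
    then have "fps_nth FA d = K * fps_nth (FE * FL) d" by simp
    moreover have "fps_nth FA k = a ^ k * M k v / fact k" for k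
      unfolding FA_def M_def by (simp add: power_mult_distrib infsum_cmult_right'[symmetric] mult_ac)
    moreover have "fps_nth FL k = b ^ k * N k v / fact k" for k
      unfolding FL_def N_def by (simp add: power_mult_distrib infsum_cmult_right'[symmetric] mult_ac)
    moreover have "fps_nth FE k = ?E v k" for k by (simp add: FE_def)
    ultimately show ?thesis by (simp only: fps_mult_nth)
  qed
  define T where "T v = a ^ d * M d v - K * b ^ d * N d v" for v
  define \<tau> where "\<tau> \<alpha> = of_real (fact d / mfact \<alpha>) * (a ^ d * mA \<alpha> - K * b ^ d * mL \<alpha>)" for \<alpha>
  have T\<tau>: "T v = (\<Sum>\<alpha>\<in>monomials_deg d. \<tau> \<alpha> * of_real (vmon v \<alpha>))" for v
    unfolding T_def M N \<tau>_def by (simp add: sum_distrib_left sum_subtractf algebra_simps)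
  have T: "T v = (\<Sum>i=1..d. fact d * K * (?E v i * (b ^ (d - i) * N (d - i) v / fact (d - i))))" for v
  proof -
    have "a ^ d * M d v = fact d * K * (\<Sum>i=0..d. ?E v i * (b ^ (d - i) * N (d - i) v / fact (d - i)))"
      using coeff[of v] by (simp add: field_simps)
    also have "\<dots> = K * b ^ d * N d v + fact d * K * (\<Sum>i=1..d. ?E v i * (b ^ (d - i) * N (d - i) v / fact (d - i)))"
      by (subst sum.atLeast_Suc_atMost) (auto simp: algebra_simps)
    finally show ?thesis by (simp add: T_def sum_distrib_left)
  qed
  have key: "(\<Sum>\<alpha>\<in>monomials_deg d. of_real (c \<alpha> * mfact \<alpha>) * \<tau> \<alpha>) = 0"
  proof (cases "d \<ge> 2")
    case True
    then obtain d' where d: "d = d' + 2" by (metis le_add_diff_inverse2)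
    \<comment> \<open>Every correction term has even i >= 2 and hence a factor (v . v)^(i/2); one
      factor is split off, and what remains is homogeneous of degree d - 2.\<close>
    define R where "R v = (\<Sum>i\<in>{i\<in>{2..d}. even i}. (fact d * K * e ^ (i div 2) / fact (i div 2) * b ^ (d - i) / fact (d - i)) *
       (of_real ((v \<bullet> v) ^ (i div 2 - 1)) * N (d - i) v))" for v :: "real^'n"
    have "hom_poly d' R"
      unfolding R_def
    proof (intro hom_poly_sum hom_poly_cmult)
      fix i assume i: "i \<in> {i \<in> {2..d}. even i}"
      then have "d - i + 2 * (i div 2 - 1) = d'" using d by auto
      with hom_poly_norm_power_mult[OF hN[of "d - i"], of "i div 2 - 1"]
      show "hom_poly d' (\<lambda>v. of_real ((v \<bullet> v) ^ (i div 2 - 1)) * N (d - i) v)" by simp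
    qed auto
    then obtain \<rho> where \<rho>: "\<And>v. R v = (\<Sum>\<alpha>\<in>monomials_deg d'. \<rho> \<alpha> * of_real (vmon v \<alpha>))"
      by (auto simp: hom_poly_def)
    have "T v = of_real (v \<bullet> v) * R v" for v
    proof -
      have "T v = (\<Sum>i\<in>{i\<in>{2..d}. even i}. fact d * K * (?E v i * (b ^ (d - i) * N (d - i) v / fact (d - i))))"
        unfolding T
      proof (rule sum.mono_neutral_right)
        show "\<forall>i\<in>{1..d} - {i \<in> {2..d}. even i}. fact d * K * (?E v i * (b ^ (d - i) * N (d - i) v / fact (d - i))) = 0"
        proof
          fix i assume i: "i \<in> {1..d} - {i \<in> {2..d}. even i}"
          have "odd i"
          proof (rule ccontr)
            assume "\<not> odd i"
            moreover from this have "i \<noteq> 1" by auto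
            ultimately show False using i by auto
          qed
          then show "fact d * K * (?E v i * (b ^ (d - i) * N (d - i) v / fact (d - i))) = 0" by simp
        qed
      qed auto
      also have "\<dots> = of_real (v \<bullet> v) * R v"
        unfolding R_def sum_distrib_left
      proof (intro sum.cong refl)
        fix i assume i: "i \<in> {i \<in> {2..d}. even i}"
        then obtain j where j: "i div 2 = Suc j" by (cases "i div 2") auto
        show "fact d * K * (?E v i * (b ^ (d - i) * N (d - i) v / fact (d - i))) =
          of_real (v \<bullet> v) * ((fact d * K * e ^ (i div 2) / fact (i div 2) * b ^ (d - i) / fact (d - i)) *
       (of_real ((v \<bullet> v) ^ (i div 2 - 1)) * N (d - i) v))"
          using i unfolding j by (simp add: power_mult_distrib mult_ac del: fact_Suc)
      qed
      finally show ?thesis .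
    qed
    then have eq: "(\<Sum>\<alpha>\<in>monomials_deg d. \<tau> \<alpha> * of_real (vmon v \<alpha>)) =
        of_real (v \<bullet> v) * (\<Sum>\<alpha>\<in>monomials_deg d'. \<rho> \<alpha> * of_real (vmon v \<alpha>))" for v
      by (simp only: T\<tau>[symmetric] \<rho>[symmetric])
    show ?thesis unfolding d
      by (rule apolar_harmonic[OF harm[unfolded d] eq[unfolded d]])
  next
    case False
    \<comment> \<open>For d < 2 the only possible correction has i = 1, and its coefficient is
      0.\<close>
    then have "T v = 0" for v unfolding T by (intro sum.neutral) auto
    then have "\<tau> \<alpha> = 0" if "\<alpha> \<in> monomials_deg d" for \<alpha>
      using vmon_linear_independent[OF _ that, of \<tau>] T\<tau> by metis
    then show ?thesis by simp
  qed
  have hA: "(\<Sum>\<^sub>\<infinity>x\<in>A. W x * of_real (hpoly d c x)) = (\<Sum>\<alpha>\<in>monomials_deg d. of_real (c \<alpha>) * mA \<alpha>)"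
  proof (rule infsumI)
    have "((\<lambda>x. \<Sum>\<alpha>\<in>monomials_deg d. of_real (c \<alpha>) * (W x * of_real (vmon x \<alpha>))) has_sum (\<Sum>\<alpha>\<in>monomials_deg d. of_real (c \<alpha>) * mA \<alpha>)) A"
      unfolding mA_def using sA by (intro has_sum_finite_sum has_sum_cmult_right has_sum_infsum) auto
    then show "((\<lambda>x. W x * of_real (hpoly d c x)) has_sum (\<Sum>\<alpha>\<in>monomials_deg d. of_real (c \<alpha>) * mA \<alpha>)) A"
      by (simp add: hpoly_def vmon_def sum_distrib_left mult_ac)
  qed
  have hL: "(\<Sum>\<^sub>\<infinity>x\<in>L. W' x * of_real (hpoly d c x)) = (\<Sum>\<alpha>\<in>monomials_deg d. of_real (c \<alpha>) * mL \<alpha>)"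
  proof (rule infsumI)
    have "((\<lambda>x. \<Sum>\<alpha>\<in>monomials_deg d. of_real (c \<alpha>) * (W' x * of_real (vmon x \<alpha>))) has_sum (\<Sum>\<alpha>\<in>monomials_deg d. of_real (c \<alpha>) * mL \<alpha>)) L"
      unfolding mL_def using sL by (intro has_sum_finite_sum has_sum_cmult_right has_sum_infsum) auto
    then show "((\<lambda>x. W' x * of_real (hpoly d c x)) has_sum (\<Sum>\<alpha>\<in>monomials_deg d. of_real (c \<alpha>) * mL \<alpha>)) L"
      by (simp add: hpoly_def vmon_def sum_distrib_left mult_ac)
  qed
  have "(\<Sum>\<alpha>\<in>monomials_deg d. of_real (c \<alpha> * mfact \<alpha>) * \<tau> \<alpha>) =
     fact d * (a ^ d * (\<Sum>\<alpha>\<in>monomials_deg d. of_real (c \<alpha>) * mA \<alpha>) - K * b ^ d * (\<Sum>\<alpha>\<in>monomials_deg d. of_real (c \<alpha>) * mL \<alpha>))"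
    unfolding sum_distrib_left right_diff_distrib sum_subtractf[symmetric]
  proof (intro sum.cong refl)
    fix \<alpha> :: "'n \<Rightarrow> nat"
    have "complex_of_real (mfact \<alpha>) \<noteq> 0" using mfact_pos[of \<alpha>] by simp
    then show "of_real (c \<alpha> * mfact \<alpha>) * \<tau> \<alpha> = fact d * (a ^ d * (of_real (c \<alpha>) * mA \<alpha>)) - fact d * (K * b ^ d * (of_real (c \<alpha>) * mL \<alpha>))"
      unfolding \<tau>_def by (simp add: field_simps)
  qed
  with key show ?thesis unfolding hA hL by simp
qed

text \<open>Translate the Poisson formula by a further vector u: expanding |x + u|^2 produces exp(-2
  pi t x.u) on one side, the phase produces exp(2 pi i y.u) on the other.
  \<open>harmonic_transfer\<close> exchanges these generating functions for the harmonic weight; the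
  common factor (2 pi)^d cancels, leaving (-t)^d against i^d.\<close>

theorem selfdual_harmonic_poisson:
  fixes L :: "(real^'n) set"
  assumes L: "selfdual L" and harm: "harmonic d c" and t: "t > 0"
  shows "of_real ((- t) ^ d) * (\<Sum>\<^sub>\<infinity>x\<in>(\<lambda>x. x + w) ` L. of_real (exp (- pi * t * (norm x)\<^sup>2)) * of_real (hpoly d c x)) =
    of_real ((1 / sqrt t) ^ CARD('n)) * \<i> ^ d *
    (\<Sum>\<^sub>\<infinity>y\<in>L. (of_real (exp (- pi * (norm y)\<^sup>2 / t)) * cis (2 * pi * (y \<bullet> w))) * complex_of_real (hpoly d c y))"
proof -
  let ?A = "(\<lambda>x. x + w) ` L"
  let ?K = "complex_of_real ((1 / sqrt t) ^ CARD('n))"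
  have gL: "(\<lambda>x. exp (- r * (norm x)\<^sup>2)) summable_on L" if "r > 0" for r :: real
    using selfdual_gauss_summable[OF L, of "r / pi" 0] that by simp
  have gA: "(\<lambda>x. exp (- r * (norm x)\<^sup>2)) summable_on ?A" if "r > 0" for r :: real
    using selfdual_gauss_summable[OF L, of "r / pi" w] that
    by (subst summable_on_reindex) (auto simp: o_def)
  have "(- 2 * of_real pi * of_real t) ^ d * (\<Sum>\<^sub>\<infinity>x\<in>?A. of_real (exp (- pi * t * (norm x)\<^sup>2)) * complex_of_real (hpoly d c x)) =
    ?K * (2 * of_real pi * \<i>) ^ d *
    (\<Sum>\<^sub>\<infinity>y\<in>L. (of_real (exp (- pi * (norm y)\<^sup>2 / t)) * cis (2 * pi * (y \<bullet> w))) * of_real (hpoly d c y))"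
  proof (rule harmonic_transfer[OF gA gL, where p = "pi * t" and p' = "pi / t" and e = "of_real (pi * t)"])
    fix u :: "real^'n"
    have "(\<Sum>\<^sub>\<infinity>x\<in>?A. complex_of_real (exp (- pi * t * (norm x)\<^sup>2)) * exp (- 2 * of_real pi * of_real t * of_real (x \<bullet> u))) =
      (\<Sum>\<^sub>\<infinity>x\<in>L. exp (of_real (pi * t) * of_real (u \<bullet> u)) * complex_of_real (exp (- pi * t * (norm (x + (w + u)))\<^sup>2)))"
    proof (subst infsum_reindex)
      show "infsum ((\<lambda>x. complex_of_real (exp (- pi * t * (norm x)\<^sup>2)) * exp (- 2 * of_real pi * of_real t * of_real (x \<bullet> u))) \<circ> (\<lambda>x. x + w)) L =
        (\<Sum>\<^sub>\<infinity>x\<in>L. exp (of_real (pi * t) * of_real (u \<bullet> u)) * complex_of_real (exp (- pi * t * (norm (x + (w + u)))\<^sup>2)))"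
      proof (rule infsum_cong)
        fix x
        have "(norm (x + (w + u)))\<^sup>2 = (norm (x + w))\<^sup>2 + 2 * ((x + w) \<bullet> u) + u \<bullet> u"
          by (simp add: power2_norm_eq_inner inner_add_left inner_add_right inner_commute)
        then have "exp (- pi * t * (norm (x + w))\<^sup>2) * exp (- 2 * pi * t * ((x + w) \<bullet> u)) =
            exp (pi * t * (u \<bullet> u)) * exp (- pi * t * (norm (x + (w + u)))\<^sup>2)"
          by (simp add: algebra_simps flip: exp_add)
        then have "complex_of_real (exp (- pi * t * (norm (x + w))\<^sup>2) * exp (- 2 * pi * t * ((x + w) \<bullet> u))) =
            of_real (exp (pi * t * (u \<bullet> u)) * exp (- pi * t * (norm (x + (w + u)))\<^sup>2))" by (simp only:)
        then show "((\<lambda>x. complex_of_real (exp (- pi * t * (norm x)\<^sup>2)) * exp (- 2 * of_real pi * of_real t * of_real (x \<bullet> u))) \<circ> (\<lambda>x. x + w)) x =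
          exp (of_real (pi * t) * of_real (u \<bullet> u)) * complex_of_real (exp (- pi * t * (norm (x + (w + u)))\<^sup>2))"
          by (simp add: exp_of_real[symmetric])
      qed
    qed auto
    also have "\<dots> = exp (of_real (pi * t) * of_real (u \<bullet> u)) * complex_of_real (\<Sum>\<^sub>\<infinity>x\<in>L. exp (- pi * t * (norm (x + (w + u)))\<^sup>2))"
    proof -
      have "((\<lambda>x. complex_of_real (exp (- pi * t * (norm (x + (w + u)))\<^sup>2))) has_sum of_real (\<Sum>\<^sub>\<infinity>x\<in>L. exp (- pi * t * (norm (x + (w + u)))\<^sup>2))) L"
        by (intro has_sum_of_real has_sum_infsum selfdual_gauss_summable[OF L t])
      then show ?thesis by (simp add: infsum_cmult_right' infsumI)
    qed
    also have "complex_of_real (\<Sum>\<^sub>\<infinity>x\<in>L. exp (- pi * t * (norm (x + (w + u)))\<^sup>2)) =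
      ?K * (\<Sum>\<^sub>\<infinity>y\<in>L. of_real (exp (- pi * (norm y)\<^sup>2 / t)) * cis (2 * pi * (y \<bullet> (w + u))))"
      by (rule selfdual_poisson[OF L t])
    also have "(\<Sum>\<^sub>\<infinity>y\<in>L. complex_of_real (exp (- pi * (norm y)\<^sup>2 / t)) * cis (2 * pi * (y \<bullet> (w + u)))) =
      (\<Sum>\<^sub>\<infinity>y\<in>L. (of_real (exp (- pi * (norm y)\<^sup>2 / t)) * cis (2 * pi * (y \<bullet> w))) * exp (2 * of_real pi * \<i> * of_real (y \<bullet> u)))"
    proof (rule infsum_cong)
      fix y
      have "cis (2 * pi * (y \<bullet> (w + u))) = cis (2 * pi * (y \<bullet> w)) * cis (2 * pi * (y \<bullet> u))"
        by (simp add: cis_mult inner_add_right distrib_left)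
      also have "cis (2 * pi * (y \<bullet> u)) = exp (2 * of_real pi * \<i> * of_real (y \<bullet> u))" by (simp add: cis_conv_exp mult_ac)
      finally show "complex_of_real (exp (- pi * (norm y)\<^sup>2 / t)) * cis (2 * pi * (y \<bullet> (w + u))) =
        (of_real (exp (- pi * (norm y)\<^sup>2 / t)) * cis (2 * pi * (y \<bullet> w))) * exp (2 * of_real pi * \<i> * of_real (y \<bullet> u))" by simp
    qed
    finally show "(\<Sum>\<^sub>\<infinity>x\<in>?A. complex_of_real (exp (- pi * t * (norm x)\<^sup>2)) * exp (- 2 * of_real pi * of_real t * of_real (x \<bullet> u))) =
      ?K * exp (of_real (pi * t) * of_real (u \<bullet> u)) *
      (\<Sum>\<^sub>\<infinity>y\<in>L. (of_real (exp (- pi * (norm y)\<^sup>2 / t)) * cis (2 * pi * (y \<bullet> w))) * exp (2 * of_real pi * \<i> * of_real (y \<bullet> u)))"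
      by (simp add: mult_ac)
  qed (use t harm in \<open>auto simp: norm_mult\<close>)
  moreover have "(- 2 * of_real pi * complex_of_real t) ^ d = (2 * of_real pi) ^ d * of_real ((- t) ^ d)"
    unfolding of_real_power power_mult_distrib[symmetric] by simp
  moreover have "(2 * of_real pi * \<i>) ^ d = (2 * of_real pi) ^ d * \<i> ^ d"
    by (rule power_mult_distrib)
  ultimately have "(2 * of_real pi) ^ d * (of_real ((- t) ^ d) * (\<Sum>\<^sub>\<infinity>x\<in>?A. of_real (exp (- pi * t * (norm x)\<^sup>2)) * complex_of_real (hpoly d c x))) =
    (2 * of_real pi) ^ d * (?K * \<i> ^ d *
    (\<Sum>\<^sub>\<infinity>y\<in>L. (of_real (exp (- pi * (norm y)\<^sup>2 / t)) * cis (2 * pi * (y \<bullet> w))) * of_real (hpoly d c y)))"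
    by (simp only: mult_ac)
  then show ?thesis by simp
qed

section \<open>Functions invariant under the theta group\<close>

lemma strip_representative:
  assumes per: "\<And>z. Im z > 0 \<Longrightarrow> G (z + 2) = G z" and z: "Im z > 0"
  shows "\<exists>w. \<bar>Re w\<bar> \<le> 1 \<and> Im w = Im z \<and> G w = (G z :: complex)"
proof -
  have shift: "G (z + 2 * of_nat k) = G z" if "Im z > 0" for z k
  proof (induction k)
    case (Suc k)
    have "G (z + 2 * of_nat (Suc k)) = G ((z + 2 * of_nat k) + 2)" by (simp add: algebra_simps)
    also have "\<dots> = G z" using Suc per[of "z + 2 * of_nat k"] that by simp
    finally show ?case .
  qed simp
  have shift': "G (z + 2 * of_int k) = G z" for k :: int
  proof (cases "k \<ge> 0")
    case True
    then show ?thesis using shift[OF z, of "nat k"] by simp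
  next
    case False
    then have "G ((z + 2 * of_int k) + 2 * of_nat (nat (-k))) = G (z + 2 * of_int k)"
      using z by (intro shift) simp
    then show ?thesis using False by simp
  qed
  define k :: int where "k = - \<lfloor>(Re z + 1) / 2\<rfloor>"
  have "of_int \<lfloor>(Re z + 1) / 2\<rfloor> \<le> (Re z + 1) / 2" "(Re z + 1) / 2 < of_int \<lfloor>(Re z + 1) / 2\<rfloor> + 1"
    by linarith+
  then have "\<bar>Re z - 2 * of_int \<lfloor>(Re z + 1) / 2\<rfloor>\<bar> \<le> 1"
    unfolding abs_le_iff by argo
  then have "\<bar>Re (z + 2 * of_int k)\<bar> \<le> 1"
    by (simp add: k_def)
  then show ?thesis using shift'[of k] by (intro exI[of _ "z + 2 * of_int k"]) simp
qed

text \<open>Among the points of a horizontal strip sharing a given modulus of \<open>G\<close>, one of largest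
  imaginary part must lie outside the open unit disc, since inversion would raise it further.\<close>

lemma fundamental_domain_representative:
  fixes G :: "complex \<Rightarrow> complex"
  assumes cont: "continuous_on {z. Im z > 0} G"
    and per: "\<And>z. Im z > 0 \<Longrightarrow> G (z + 2) = G z"
    and inv: "\<And>z. Im z > 0 \<Longrightarrow> cmod (G (-1/z)) = cmod (G z)"
    and Y: "\<And>z. Im z \<ge> Y \<Longrightarrow> Im z > 0 \<Longrightarrow> cmod (G z) < cmod (G z0)"
    and z0: "Im z0 > 0"
  shows "\<exists>w. \<bar>Re w\<bar> \<le> 1 \<and> 1 \<le> cmod w \<and> Im z0 \<le> Im w \<and> Im w \<le> Y \<and> cmod (G w) = cmod (G z0)"
proof -
  \<comment> \<open>Points where |G| equals |G z0| have height at most \<open>Y\<close>, so the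
    search for a highest one takes place in a compact box.\<close>
  define B where "B = cbox (Complex (-1) (Im z0)) (Complex 1 Y)"
  define V where "V = {w \<in> B. cmod (G w) = cmod (G z0)}"
  have B: "w \<in> B \<longleftrightarrow> \<bar>Re w\<bar> \<le> 1 \<and> Im z0 \<le> Im w \<and> Im w \<le> Y" for w
    by (auto simp: B_def in_cbox_complex_iff)
  have le_Y: "Im w \<le> Y" if "cmod (G w) = cmod (G z0)" "Im w > 0" for w
    using Y[of w] that by linarith
  have "continuous_on B (\<lambda>w. cmod (G w))"
    by (intro continuous_on_norm continuous_on_subset[OF cont]) (use z0 in \<open>auto simp: B\<close>)
  then have "closed V" unfolding V_def
    by (intro continuous_closed_preimage_constant) (auto simp: B_def)
  moreover have "bounded V"
    by (rule bounded_subset[of B]) (auto simp: B_def V_def)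
  ultimately have "compact V" by (simp add: compact_eq_bounded_closed)
  moreover have mem: "\<exists>w'\<in>V. Im w' = Im w" if "Im w > 0" "Im z0 \<le> Im w" "cmod (G w) = cmod (G z0)" for w
    using strip_representative[of G, OF per that(1)] le_Y[of w] that by (auto simp: V_def B)
  moreover have "V \<noteq> {}" using mem[OF z0] by auto
  ultimately obtain w where w: "w \<in> V" and max: "\<And>v. v \<in> V \<Longrightarrow> Im v \<le> Im w"
    using continuous_attains_sup[of V Im] continuous_on_Im[OF continuous_on_id, of V] by auto
  have "1 \<le> cmod w"
  proof (rule ccontr)
    assume "\<not> 1 \<le> cmod w"
    have Iw: "Im w > 0" using w z0 by (auto simp: V_def B)
    then have "w \<noteq> 0" by auto
    have Im: "Im (-1/w) = Im w / (cmod w)\<^sup>2" by (simp add: Im_divide cmod_power2)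
    have "(cmod w)\<^sup>2 < 1" using \<open>\<not> 1 \<le> cmod w\<close> by (simp add: power_less_one_iff)
    then have "Im w / (cmod w)\<^sup>2 > Im w" using Iw \<open>w \<noteq> 0\<close> by (simp add: pos_less_divide_eq)
    with Im have *: "Im (-1/w) > Im w" by simp
    then have "\<exists>w'\<in>V. Im w' = Im (-1/w)"
      using Iw w inv[OF Iw] by (intro mem) (auto simp: V_def B)
    then show False using max * by force
  qed
  with w show ?thesis by (intro exI[of _ w]) (auto simp: V_def B)
qed

text \<open>Outside the unit disc 1 - Re z <= (Im z)^2, so a low point in the right half of the
  strip lies close to 1. The map 1/(1 - z), which sends the cusp 1 to infinity, therefore lifts it
  high up.\<close>

lemma cusp_neighbourhood:
  assumes "\<bar>Re z\<bar> \<le> 1" "1 \<le> cmod z" "0 < Im z" "Im z \<le> 1" "0 \<le> Re z"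
  shows "Im (1 / (1 - z)) \<ge> 1 / (2 * Im z)"
proof -
  have "1 \<le> (cmod z)\<^sup>2" using assms(2) by (simp add: one_le_power)
  then have "1 - (Re z)\<^sup>2 \<le> (Im z)\<^sup>2" by (simp add: cmod_power2)
  moreover have "(Re z)\<^sup>2 \<le> Re z" using assms by (simp add: power2_eq_square mult_left_le)
  ultimately have 1: "1 - Re z \<le> (Im z)\<^sup>2" by simp
  then have "(1 - Re z)\<^sup>2 \<le> ((Im z)\<^sup>2)\<^sup>2" using assms by (intro power_mono) auto
  also have "\<dots> \<le> (Im z)\<^sup>2" using assms by (simp add: power_le_one mult_left_le power2_eq_square mult_le_one)
  finally have "(cmod (1 - z))\<^sup>2 \<le> 2 * (Im z)\<^sup>2" by (simp add: cmod_power2)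
  moreover have "1 - z \<noteq> 0" using assms by (auto simp: complex_eq_iff)
  ultimately have "1 / (2 * Im z) \<le> Im z / (cmod (1 - z))\<^sup>2"
    using assms by (simp add: field_simps power2_eq_square)
  also have "\<dots> = Im (1 / (1 - z))" by (simp add: Im_divide cmod_power2)
  finally show ?thesis .
qed

text \<open>The fundamental domain |Re z| <= 1, |z| >= 1 has the cusps infinity and 1, with -1 a
  translate of 1. As |G| tends to 0 there, it attains its supremum over the half plane on a compact
  part, so \<open>G\<close> is constant by the maximum principle, and smallness near infinity leaves
  only the constant 0.\<close>

theorem theta_group_invariant_vanishes:
  fixes G :: "complex \<Rightarrow> complex"
  assumes holo: "G holomorphic_on {z. Im z > 0}"
    and per: "\<And>z. Im z > 0 \<Longrightarrow> G (z + 2) = G z"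
    and inv: "\<And>z. Im z > 0 \<Longrightarrow> cmod (G (-1/z)) = cmod (G z)"
    and inf: "\<And>e. e > 0 \<Longrightarrow> \<exists>Y>0. \<forall>z. Im z \<ge> Y \<longrightarrow> cmod (G z) < e"
    and cusp: "\<And>e. e > 0 \<Longrightarrow> \<exists>Y>0. \<forall>z. Im z \<ge> Y \<longrightarrow> cmod (G (1 - 1/z)) < e"
    and z: "Im z > 0"
  shows "G z = 0"
proof (rule ccontr)
  assume nz: "G z \<noteq> 0"
  define e where "e = cmod (G z)"
  have e: "e > 0" using nz by (simp add: e_def)
  obtain Y1 where Y1: "Y1 > 0" "\<And>z. Im z \<ge> Y1 \<Longrightarrow> cmod (G z) < e" using inf[OF e] by blast
  obtain Y2 where Y2: "Y2 > 0" "\<And>z. Im z \<ge> Y2 \<Longrightarrow> cmod (G (1 - 1/z)) < e" using cusp[OF e] by blast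
  have cont: "continuous_on {z. Im z > 0} G" using holo by (rule holomorphic_on_imp_continuous_on)
  \<comment> \<open>Below this height a point w of the right half of the fundamental domain has Im
    (1/(1 - w)) >= 1/(2 Im w) >= \<open>Y2\<close>, so the hypothesis at the cusp takes
    over.\<close>
  define \<delta> where "\<delta> = min 1 (1 / (2 * Y2))"
  have \<delta>: "\<delta> > 0" using Y2(1) by (simp add: \<delta>_def)
  define K where "K = cbox (Complex (-1) \<delta>) (Complex 1 Y1)"
  \<comment> \<open>Every modulus at least e is attained on the compact set \<open>K\<close>: above
    \<open>Y1\<close> and, in the fundamental domain, below \<delta> the modulus is smaller than
    e.\<close>
  have red: "\<exists>w\<in>K. cmod (G w) = cmod (G u)" if u: "Im u > 0" "cmod (G u) \<ge> e" for u
  proof -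
    have "\<exists>w. \<bar>Re w\<bar> \<le> 1 \<and> 1 \<le> cmod w \<and> Im u \<le> Im w \<and> Im w \<le> Y1 \<and> cmod (G w) = cmod (G u)"
      using Y1(2) u by (intro fundamental_domain_representative[OF cont per inv]) (auto intro: less_le_trans)
    then obtain w where w: "\<bar>Re w\<bar> \<le> 1" "1 \<le> cmod w" "Im u \<le> Im w" "Im w \<le> Y1" "cmod (G w) = cmod (G u)"
      by blast
    have Iw: "Im w > 0" using w u by simp
    have "Im w \<ge> \<delta>"
    proof (rule ccontr)
      assume "\<not> Im w \<ge> \<delta>"
      then have sm: "Im w < 1" "Im w < 1 / (2 * Y2)" by (auto simp: \<delta>_def)
      have ge: "Y2 \<le> 1 / (2 * Im w)" using sm(2) Iw Y2(1) by (simp add: field_simps)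
      have "cmod (G w) < e"
      proof (cases "Re w \<ge> 0")
        case True
        have "Im (1 / (1 - w)) \<ge> Y2"
          using cusp_neighbourhood[OF w(1,2) Iw _ True] sm ge by linarith
        \<comment> \<open>Substituting 1/(1 - w) for z in 1 - 1/z gives back w.\<close>
        from Y2(2)[OF this] show ?thesis by simp
      next
        case False
        \<comment> \<open>reflecting in the imaginary axis exchanges the cusps \<open>1\<close> and \<open>-1\<close>\<close>
        have "Im (1 / (1 - (- cnj w))) \<ge> 1 / (2 * Im (- cnj w))"
          using w Iw sm False by (intro cusp_neighbourhood) auto
        moreover have "Im (1 / (1 - (- cnj w))) = Im (1 / (1 - (w + 2)))"
          by (simp add: Im_divide) (simp add: power2_eq_square algebra_simps)
        ultimately have "Im (1 / (1 - (w + 2))) \<ge> Y2" using ge by simp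
        from Y2(2)[OF this] show ?thesis using per[OF Iw] by (simp add: add.commute)
      qed
      with u w show False by simp
    qed
    with w show ?thesis by (intro bexI[of _ w]) (auto simp: K_def in_cbox_complex_iff)
  qed
  have KH: "K \<subseteq> {z. Im z > 0}" using \<delta> by (auto simp: K_def in_cbox_complex_iff)
  obtain w0 where w0: "w0 \<in> K" and max: "\<And>w. w \<in> K \<Longrightarrow> cmod (G w) \<le> cmod (G w0)"
  proof -
    have "K \<noteq> {}" using red[OF z] by (auto simp: e_def)
    moreover have "continuous_on K (\<lambda>w. cmod (G w))"
      by (intro continuous_on_norm continuous_on_subset[OF cont] KH)
    ultimately show ?thesis using continuous_attains_sup[of K "\<lambda>w. cmod (G w)"] that
      by (auto simp: K_def compact_cbox)
  qed
  have maxH: "cmod (G u) \<le> cmod (G w0)" if "Im u > 0" for u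
  proof (cases "cmod (G u) \<ge> e")
    case True then show ?thesis using red[OF that] max by force
  next
    case False
    obtain w where "w \<in> K" "cmod (G w) = e" using red[OF z] by (auto simp: e_def)
    then show ?thesis using max[of w] False by simp
  qed
  have "G constant_on {z. Im z > 0}"
    using holo maxH w0 KH
    by (intro maximum_modulus_principle[where \<xi> = w0 and U = "{z. Im z > 0}"])
      (auto simp: open_halfspace_Im_gt convex_halfspace_Im_gt intro!: convex_connected)
  then obtain c where c: "\<And>u. Im u > 0 \<Longrightarrow> G u = c" by (auto simp: constant_on_def)
  show False using c[OF z] c[of "Complex 0 Y1"] Y1 Y1(2)[of "Complex 0 Y1"] by (auto simp: e_def)
qed

section \<open>Expansions in the nome\<close>

lemma fps_conv_radius_ge_1I:
  fixes F :: "complex fps"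
  assumes "\<And>r::real. 0 < r \<Longrightarrow> r < 1 \<Longrightarrow> summable (\<lambda>k. fps_nth F k * of_real r ^ k)"
  shows "fps_conv_radius F \<ge> 1"
proof (rule ccontr)
  assume "\<not> fps_conv_radius F \<ge> 1"
  then have lt: "fps_conv_radius F < 1" by simp
  obtain r :: real where r: "fps_conv_radius F < ereal r" "r < 1"
    using ereal_dense2[OF lt] by (auto simp: one_ereal_def)
  have "0 \<le> fps_conv_radius F" by (simp add: fps_conv_radius_def conv_radius_nonneg)
  then have "0 < ereal r" using r(1) by (rule le_less_trans)
  then have r0: "r > 0" by simp
  have "conv_radius (fps_nth F) \<ge> ereal (norm (complex_of_real r))"
    by (rule conv_radius_geI[OF assms[OF r0 r(2)]])
  then show False using r r0 by (simp add: fps_conv_radius_def)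
qed

text \<open>Sorting an absolutely convergent sum by the exponent \<nu> turns it into a power series.
  The case q = 0 is excluded because summability over a fibre is obtained by dividing by
  q^k.\<close>

lemma q_series:
  fixes P :: "'a \<Rightarrow> complex" and \<nu> :: "'a \<Rightarrow> nat"
  assumes summ: "\<And>r. 0 < r \<Longrightarrow> r < 1 \<Longrightarrow> (\<lambda>x. cmod (P x) * r ^ \<nu> x) summable_on A"
  defines "F \<equiv> Abs_fps (\<lambda>k. \<Sum>\<^sub>\<infinity>x\<in>{x\<in>A. \<nu> x = k}. P x)"
  shows q_series_radius: "fps_conv_radius F \<ge> 1"
    and q_series_has_sum: "\<And>q. q \<noteq> 0 \<Longrightarrow> cmod q < 1 \<Longrightarrow> ((\<lambda>x. P x * q ^ \<nu> x) has_sum eval_fps F q) A"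
proof -
  have main: "((\<lambda>k. fps_nth F k * q ^ k) has_sum (\<Sum>\<^sub>\<infinity>x\<in>A. P x * q ^ \<nu> x)) UNIV \<and> (\<lambda>x. P x * q ^ \<nu> x) summable_on A"
    if q: "q \<noteq> 0" "cmod q < 1" for q
  proof
    have "(\<lambda>x. cmod (P x) * cmod q ^ \<nu> x) summable_on A" using q by (intro summ) auto
    then have "(\<lambda>x. norm (P x * q ^ \<nu> x)) summable_on A" by (simp add: norm_mult norm_power)
    then show sA: "(\<lambda>x. P x * q ^ \<nu> x) summable_on A" by (rule abs_summable_summable)
    have bij: "bij_betw snd (Sigma UNIV (\<lambda>k. {x\<in>A. \<nu> x = k})) A"
      by (rule bij_betwI[where g = "\<lambda>x. (\<nu> x, x)"]) auto
    have "((\<lambda>x. P x * q ^ \<nu> x) has_sum (\<Sum>\<^sub>\<infinity>x\<in>A. P x * q ^ \<nu> x)) A" using sA by (rule has_sum_infsum)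
    then have "((\<lambda>p. P (snd p) * q ^ \<nu> (snd p)) has_sum (\<Sum>\<^sub>\<infinity>x\<in>A. P x * q ^ \<nu> x)) (Sigma UNIV (\<lambda>k. {x\<in>A. \<nu> x = k}))"
      using has_sum_reindex_bij_betw[OF bij, of "\<lambda>x. P x * q ^ \<nu> x"] by blast
    then show "((\<lambda>k. fps_nth F k * q ^ k) has_sum (\<Sum>\<^sub>\<infinity>x\<in>A. P x * q ^ \<nu> x)) UNIV"
    proof (rule has_sum_SigmaD)
      fix k :: nat
      have "(\<lambda>x. P x * q ^ \<nu> x) summable_on {x\<in>A. \<nu> x = k}"
        using sA by (rule summable_on_subset_banach) auto
      then have "(\<lambda>x. P x * q ^ k) summable_on {x\<in>A. \<nu> x = k}"
        by (rule summable_on_cong[THEN iffD1, rotated]) auto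
      then have "(\<lambda>x. P x * q ^ k * (1 / q ^ k)) summable_on {x\<in>A. \<nu> x = k}"
        by (rule summable_on_cmult_left)
      then have "P summable_on {x\<in>A. \<nu> x = k}" using q by simp
      then have "((\<lambda>x. P x * q ^ k) has_sum (fps_nth F k * q ^ k)) {x\<in>A. \<nu> x = k}"
        unfolding F_def by (intro has_sum_cmult_left) simp
      then show "((\<lambda>x. P (snd (k, x)) * q ^ \<nu> (snd (k, x))) has_sum (fps_nth F k * q ^ k)) {x\<in>A. \<nu> x = k}"
        by (rule has_sum_cong[THEN iffD1, rotated]) auto
    qed
  qed
  show "fps_conv_radius F \<ge> 1"
  proof (rule fps_conv_radius_ge_1I)
    fix r :: real assume "0 < r" "r < 1"
    then show "summable (\<lambda>k. fps_nth F k * of_real r ^ k)"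
      using main[of "of_real r"] by (intro sums_summable[OF has_sum_imp_sums]) auto
  qed
  show "((\<lambda>x. P x * q ^ \<nu> x) has_sum eval_fps F q) A" if "q \<noteq> 0" "cmod q < 1" for q
  proof -
    have "eval_fps F q = (\<Sum>\<^sub>\<infinity>x\<in>A. P x * q ^ \<nu> x)"
      unfolding eval_fps_def using main[OF that] has_sum_imp_sums sums_unique by metis
    then show ?thesis using main[OF that] by simp
  qed
qed

text \<open>The value r = 1 serves lattices, whose norms are integers, and r = 4 shadows, whose
  norms are quarter integers. The radius is part of the notion so that sums and products of series
  may be evaluated on the whole disc.\<close>

definition q_expansion :: "nat \<Rightarrow> (complex \<Rightarrow> complex) \<Rightarrow> complex fps \<Rightarrow> bool" where
  "q_expansion r F A \<longleftrightarrow> fps_conv_radius A \<ge> 1 \<and> (\<forall>z. Im z > 0 \<longrightarrow> F z = eval_fps A (exp (\<i> * of_real pi * z / of_nat r)))"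

lemma norm_nome: "cmod (exp (\<i> * of_real pi * z / of_nat r)) = exp (- pi * Im z / real r)"
  by (cases "r = 0") (simp_all add: Re_divide_of_nat)

lemma norm_nome_less: "r > 0 \<Longrightarrow> Im z > 0 \<Longrightarrow> cmod (exp (\<i> * of_real pi * z / of_nat r)) < 1"
  unfolding norm_nome by (simp add: divide_neg_pos)

lemma norm_less_radius: "cmod q < 1 \<Longrightarrow> (R::ereal) \<ge> 1 \<Longrightarrow> ereal (cmod q) < R"
  by (rule less_le_trans[of _ 1]) (simp_all add: one_ereal_def)

lemma q_expansion_add:
  assumes "q_expansion r F A" "q_expansion r G B" "r > 0"
  shows "q_expansion r (\<lambda>z. F z + G z) (A + B)"
proof -
  have rad: "fps_conv_radius A \<ge> 1" "fps_conv_radius B \<ge> 1" using assms by (auto simp: q_expansion_def)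
  show ?thesis
    unfolding q_expansion_def
  proof (intro conjI allI impI)
    show "fps_conv_radius (A + B) \<ge> 1"
      using order_trans[OF _ fps_conv_radius_add[of A B], of 1] rad by simp
    fix z assume z: "Im z > 0"
    show "F z + G z = eval_fps (A + B) (exp (\<i> * of_real pi * z / of_nat r))"
      unfolding eval_fps_add[OF norm_less_radius[OF norm_nome_less[OF assms(3) z] rad(1)] norm_less_radius[OF norm_nome_less[OF assms(3) z] rad(2)]]
      using assms z by (simp add: q_expansion_def)
  qed
qed

lemma q_expansion_mult:
  assumes "q_expansion r F A" "q_expansion r G B" "r > 0"
  shows "q_expansion r (\<lambda>z. F z * G z) (A * B)"
proof -
  have rad: "fps_conv_radius A \<ge> 1" "fps_conv_radius B \<ge> 1" using assms by (auto simp: q_expansion_def)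
  show ?thesis
    unfolding q_expansion_def
  proof (intro conjI allI impI)
    show "fps_conv_radius (A * B) \<ge> 1"
      using order_trans[OF _ fps_conv_radius_mult[of A B], of 1] rad by simp
    fix z assume z: "Im z > 0"
    show "F z * G z = eval_fps (A * B) (exp (\<i> * of_real pi * z / of_nat r))"
      unfolding eval_fps_mult[OF norm_less_radius[OF norm_nome_less[OF assms(3) z] rad(1)] norm_less_radius[OF norm_nome_less[OF assms(3) z] rad(2)]]
      using assms z by (simp add: q_expansion_def)
  qed
qed

lemma q_expansion_const: "q_expansion r (\<lambda>z. c) (fps_const c)"
  by (simp add: q_expansion_def)

lemma q_expansion_cmult:
  assumes "q_expansion r F A" "r > 0"
  shows "q_expansion r (\<lambda>z. c * F z) (fps_const c * A)"
  by (rule q_expansion_mult[OF q_expansion_const assms])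

lemma q_expansion_diff:
  assumes "q_expansion r F A" "q_expansion r G B" "r > 0"
  shows "q_expansion r (\<lambda>z. F z - G z) (A - B)"
  using q_expansion_add[OF assms(1) q_expansion_cmult[OF assms(2,3), of "-1"] assms(3)]
  by (simp add: fps_const_neg[symmetric] del: fps_const_neg)

lemma q_expansion_power:
  assumes "q_expansion r F A" "r > 0"
  shows "q_expansion r (\<lambda>z. F z ^ n) (A ^ n)"
proof (induction n)
  case 0
  show ?case using q_expansion_const[of r 1] by simp
next
  case (Suc n)
  show ?case using q_expansion_mult[OF assms(1) Suc assms(2)] by simp
qed

lemma q_expansion_nome: "q_expansion 1 (\<lambda>z. exp (\<i> * of_real pi * z)) fps_X"
  by (simp add: q_expansion_def)

lemma q_expansion_holomorphic:
  assumes "q_expansion r F A" "r > 0"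
  shows "F holomorphic_on {z. Im z > 0}"
proof -
  have "(\<lambda>z. eval_fps A (exp (\<i> * of_real pi * z / of_nat r))) holomorphic_on {z. Im z > 0}"
  proof (rule holomorphic_on_compose_gen[unfolded o_def, where t = "eball 0 (fps_conv_radius A)" and g = "eval_fps A"])
    show "(\<lambda>z. exp (\<i> * of_real pi * z / of_nat r)) holomorphic_on {z. Im z > 0}"
      using assms(2) by (intro holomorphic_intros) auto
    show "(\<lambda>z. exp (\<i> * of_real pi * z / of_nat r)) ` {z. Im z > 0} \<subseteq> eball 0 (fps_conv_radius A)"
    proof clarify
      fix z assume z: "Im z > 0"
      have "fps_conv_radius A \<ge> 1" using assms(1) by (simp add: q_expansion_def)
      from norm_less_radius[OF norm_nome_less[OF assms(2) z] this]
      show "exp (\<i> * of_real pi * z / of_nat r) \<in> eball 0 (fps_conv_radius A)"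
        unfolding in_eball_iff dist_0_norm .
    qed
  qed (auto intro: holomorphic_on_eval_fps)
  then show ?thesis by (rule holomorphic_transform) (use assms in \<open>auto simp: q_expansion_def\<close>)
qed

lemma q_expansion_periodic:
  assumes "q_expansion 1 F A" "Im z > 0"
  shows "F (z + 2) = F z"
proof -
  have "exp (\<i> * of_real pi * (z + 2)) = exp (\<i> * of_real pi * z) * exp (2 * of_real pi * \<i>)"
    unfolding exp_add[symmetric] by (simp only: algebra_simps)
  then show ?thesis using assms by (simp add: q_expansion_def)
qed

lemma q_expansion_unique:
  assumes "q_expansion r F A" "q_expansion r G B" "r > 0" "\<And>z. Im z > 0 \<Longrightarrow> F z = G z"
  shows "A = B"
proof (rule power_series_real_unique)
  fix s :: real assume s: "0 < s" "s < 1"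
  \<comment> \<open>The point of the imaginary axis whose nome, with denominator r, is
    \<open>s\<close>.\<close>
  define z where "z = - \<i> * of_real (real r * ln s / pi)"
  have Im: "Im z > 0" using s assms(3) by (simp add: z_def mult_pos_neg divide_neg_pos)
  have "\<i> * of_real pi * z / of_nat r = of_real (ln s)" using assms(3) by (simp add: z_def)
  then have "exp (\<i> * of_real pi * z / of_nat r) = of_real s" using s by (simp add: exp_of_real)
  then show "eval_fps A (of_real s) = eval_fps B (of_real s)"
    using assms(1,2,4) Im unfolding q_expansion_def by metis
qed (use assms in \<open>auto simp: q_expansion_def\<close>)

text \<open>Divided by q^j the series stays bounded on the closed disc of radius exp(-pi/r), which
  contains the image of Im z >= 1; the factor |q|^j is the exponential.\<close>

lemma q_expansion_order:
  assumes qe: "q_expansion r F A" and r: "r > 0" and ord: "\<And>i. i < j \<Longrightarrow> fps_nth A i = 0"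
  shows "\<exists>C\<ge>0. \<forall>z. Im z \<ge> 1 \<longrightarrow> cmod (F z) \<le> C * exp (- pi * real j * Im z / real r)"
proof (cases "A = 0")
  case True
  then show ?thesis using qe by (intro exI[of _ 0]) (auto simp: q_expansion_def)
next
  case False
  have sub: "subdegree A \<ge> j" using False ord by (intro subdegree_geI) auto
  define \<rho> where "\<rho> = exp (- pi / real r)"
  have \<rho>: "\<rho> < 1" using r by (simp add: \<rho>_def)
  have rad: "fps_conv_radius A \<ge> 1" using qe by (simp add: q_expansion_def)
  have "continuous_on (cball 0 \<rho>) (eval_fps (fps_shift j A))"
  proof (rule continuous_on_subset[OF continuous_on_eval_fps])
    show "cball (0::complex) \<rho> \<subseteq> eball 0 (fps_conv_radius (fps_shift j A))"
      using \<rho> rad by (auto intro!: norm_less_radius)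
  qed
  then have "bounded (eval_fps (fps_shift j A) ` cball 0 \<rho>)"
    by (intro compact_imp_bounded compact_continuous_image) auto
  then obtain C where "\<forall>q\<in>cball 0 \<rho>. cmod (eval_fps (fps_shift j A) q) \<le> C"
    by (auto simp: bounded_iff)
  then have C: "\<And>q. cmod q \<le> \<rho> \<Longrightarrow> cmod (eval_fps (fps_shift j A) q) \<le> C" by simp
  have C0: "C \<ge> 0" using C[of 0] by (rule order_trans[OF norm_ge_zero]) (simp add: \<rho>_def)
  have "cmod (F z) \<le> C * exp (- pi * real j * Im z / real r)" if z: "Im z \<ge> 1" for z
  proof -
    define q where "q = exp (\<i> * of_real pi * z / of_nat r)"
    have Im: "Im z > 0" using z by simp
    have nq: "cmod q = exp (- pi * Im z / real r)" unfolding q_def by (rule norm_nome)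
    have "cmod q \<le> \<rho>" unfolding nq \<rho>_def using z r by (simp add: divide_right_mono)
    have "q \<noteq> 0" by (simp add: q_def)
    have "eval_fps (fps_shift j A) q = eval_fps A q / q ^ j"
      using sub \<open>q \<noteq> 0\<close> norm_less_radius[OF norm_nome_less[OF r Im] rad] by (subst eval_fps_shift) (auto simp: q_def)
    then have "F z = eval_fps (fps_shift j A) q * q ^ j"
      using \<open>q \<noteq> 0\<close> qe Im by (simp add: q_expansion_def q_def)
    then have "cmod (F z) = cmod (eval_fps (fps_shift j A) q) * cmod q ^ j" by (simp add: norm_mult norm_power)
    also have "\<dots> \<le> C * cmod q ^ j" using C[OF \<open>cmod q \<le> \<rho>\<close>] by (intro mult_right_mono) auto
    also have "cmod q ^ j = exp (- pi * real j * Im z / real r)"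
      unfolding nq by (simp add: exp_of_nat_mult[symmetric] mult_ac)
    finally show ?thesis .
  qed
  with C0 show ?thesis by blast
qed

text \<open>The error is O(exp(-pi y)), so high up the value is within a factor 2 of the constant
  term. This keeps the denominators of quotients of forms away from 0.\<close>

lemma q_expansion_near_const:
  assumes qe: "q_expansion 1 F A" and c: "fps_nth A 0 \<noteq> 0"
  shows "\<exists>Y\<ge>1. \<forall>z. Im z \<ge> Y \<longrightarrow> cmod (fps_nth A 0) / 2 \<le> cmod (F z) \<and> cmod (F z) \<le> 2 * cmod (fps_nth A 0)"
proof -
  let ?c = "fps_nth A 0"
  have "q_expansion 1 (\<lambda>z. F z - ?c) (A - fps_const ?c)"
    by (intro q_expansion_diff qe q_expansion_const) auto
  then obtain C where C: "C \<ge> 0" "\<And>z. Im z \<ge> 1 \<Longrightarrow> cmod (F z - ?c) \<le> C * exp (- pi * real 1 * Im z / real 1)"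
    using q_expansion_order[of 1 "\<lambda>z. F z - ?c" "A - fps_const ?c" 1] by auto
  have "((\<lambda>y. C * exp (- pi * y)) \<longlongrightarrow> C * 0) at_top"
    by (intro tendsto_intros filterlim_compose[OF exp_at_bot] filterlim_tendsto_neg_mult_at_bot[OF tendsto_const] filterlim_ident) auto
  then have "\<forall>\<^sub>F y in at_top. C * exp (- pi * y) < cmod ?c / 2"
    by (rule order_tendstoD) (use c in auto)
  then obtain Y where Y: "\<And>y. y \<ge> Y \<Longrightarrow> C * exp (- pi * y) < cmod ?c / 2"
    by (auto simp: eventually_at_top_linorder)
  show ?thesis
  proof (intro exI[of _ "max 1 Y"] conjI allI impI)
    fix z assume z: "Im z \<ge> max 1 Y"
    then have "cmod (F z - ?c) < cmod ?c / 2" using C(2)[of z] Y[of "Im z"] by simp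
    moreover have "cmod ?c \<le> cmod (F z) + cmod (F z - ?c)" using norm_triangle_ineq[of "F z" "?c - F z"] by (simp add: norm_minus_commute)
    moreover have "cmod (F z) \<le> cmod ?c + cmod (F z - ?c)" using norm_triangle_ineq[of "?c" "F z - ?c"] by simp
    ultimately show "cmod ?c / 2 \<le> cmod (F z)" "cmod (F z) \<le> 2 * cmod ?c" by linarith+
  qed simp
qed

lemma q_expansion_shift:
  assumes "q_expansion 1 F A"
  shows "q_expansion 1 (\<lambda>z. F (z + 1)) (Abs_fps (\<lambda>k. (-1) ^ k * fps_nth A k))"
proof -
  have "fps_conv_radius (Abs_fps (\<lambda>k. (-1) ^ k * fps_nth A k)) = fps_conv_radius A"
    unfolding fps_conv_radius_def
    by (subst (1 2) conv_radius_norm[symmetric]) (simp add: norm_mult norm_power)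
  moreover have "eval_fps A (exp (\<i> * of_real pi * (z + 1))) = eval_fps (Abs_fps (\<lambda>k. (-1) ^ k * fps_nth A k)) (exp (\<i> * of_real pi * z))" for z
  proof -
    have "exp (\<i> * of_real pi * (z + 1)) = exp (\<i> * of_real pi) * exp (\<i> * of_real pi * z)"
      by (simp only: exp_add[symmetric]) (simp add: algebra_simps)
    then have "exp (\<i> * of_real pi * (z + 1)) = - exp (\<i> * of_real pi * z)" by simp
    then show ?thesis by (simp add: eval_fps_def power_minus[of "exp _"] mult_ac)
  qed
  ultimately show ?thesis using assms by (simp add: q_expansion_def)
qed

text \<open>Adding the translate by 1 doubles the terms of even index and cancels the others, while
  E(2z) is the series of \<open>E\<close> in q^2. The hypothesis thus says that the operator U_2,
  which keeps the coefficients of even index, sends \<open>F\<close> to a multiple of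
  \<open>E\<close>.\<close>

lemma q_expansion_even_part:
  assumes F: "q_expansion 1 F A" and E: "q_expansion 1 E B"
    and eq: "\<And>z. Im z > 0 \<Longrightarrow> F z + F (z + 1) = c * E (2 * z)"
  shows "2 * fps_nth A (2 * m) = c * fps_nth B m"
proof -
  define B2 where "B2 = Abs_fps (\<lambda>k. if even k then fps_nth B (k div 2) else 0)"
  have B2: "(\<lambda>k. fps_nth B2 k * q ^ k) sums eval_fps B (q\<^sup>2)" if "cmod q < 1" for q
  proof -
    have "cmod (q\<^sup>2) < 1" using that by (simp add: norm_power power_less_one_iff)
    then have "(\<lambda>k. fps_nth B k * (q\<^sup>2) ^ k) sums eval_fps B (q\<^sup>2)"
      using E by (intro sums_eval_fps norm_less_radius) (auto simp: q_expansion_def)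
    moreover have "fps_nth B k * (q\<^sup>2) ^ k = fps_nth B2 (2 * k) * q ^ (2 * k)" for k
      by (simp add: B2_def power_mult)
    ultimately have "(\<lambda>k. fps_nth B2 (2 * k) * q ^ (2 * k)) sums eval_fps B (q\<^sup>2)" by (simp only:)
    moreover have "fps_nth B2 k * q ^ k = 0" if "k \<notin> range (\<lambda>j. 2 * j)" for k
    proof -
      have "odd k"
      proof
        assume "even k"
        then have "k = 2 * (k div 2)" by simp
        with that show False by blast
      qed
      then show ?thesis by (simp add: B2_def)
    qed
    ultimately show ?thesis
      by (subst (asm) sums_mono_reindex[of "\<lambda>j. 2 * j" "\<lambda>k. fps_nth B2 k * q ^ k"]) (auto simp: strict_mono_def)
  qed
  have rB2: "fps_conv_radius B2 \<ge> 1"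
  proof (rule fps_conv_radius_ge_1I)
    fix s :: real assume "0 < s" "s < 1"
    then show "summable (\<lambda>k. fps_nth B2 k * of_real s ^ k)"
      using B2[of "of_real s"] by (intro sums_summable) auto
  qed
  have q2: "q_expansion 1 (\<lambda>z. E (2 * z)) B2"
    unfolding q_expansion_def
  proof (intro conjI rB2 allI impI)
    fix z assume z: "Im z > 0"
    let ?q = "exp (\<i> * of_real pi * z)"
    have "cmod ?q < 1" using norm_nome_less[of 1 z] z by simp
    then have "eval_fps B2 ?q = eval_fps B (?q\<^sup>2)" unfolding eval_fps_def[of B2] using B2 sums_unique by metis
    moreover have "?q\<^sup>2 = exp (\<i> * of_real pi * (2 * z))" by (simp add: exp_double[symmetric] mult_ac)
    ultimately show "E (2 * z) = eval_fps B2 (exp (\<i> * of_real pi * z / of_nat 1))"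
      using E z by (simp add: q_expansion_def)
  qed
  have "A + Abs_fps (\<lambda>k. (-1) ^ k * fps_nth A k) = fps_const c * B2"
    by (rule q_expansion_unique[OF q_expansion_add[OF F q_expansion_shift[OF F]] q_expansion_cmult[OF q2, of c] _ eq]) auto
  then have "fps_nth (A + Abs_fps (\<lambda>k. (-1) ^ k * fps_nth A k)) (2 * m) = fps_nth (fps_const c * B2) (2 * m)" by simp
  then show ?thesis by (simp add: B2_def)
qed

text \<open>Transformation rules are proved on the imaginary axis, where the Gaussians are real and
  Poisson summation applies, and are carried over by the identity theorem.\<close>

lemma upper_half_plane_identity:
  assumes "F holomorphic_on {z. Im z > 0}" "G holomorphic_on {z. Im z > 0}"
    and eq: "\<And>t::real. t > 0 \<Longrightarrow> F (\<i> * of_real t) = G (\<i> * of_real t)" and z: "Im z > 0"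
  shows "F z = G z"
proof -
  have "(\<lambda>z. F z - G z) z = 0"
  proof (rule analytic_continuation[of "\<lambda>z. F z - G z" "{z. Im z > 0}" "(\<lambda>t. \<i> * complex_of_real t) ` {1<..<2}" \<i>])
    show "(\<lambda>z. F z - G z) holomorphic_on {z. Im z > 0}" by (intro holomorphic_on_diff assms(1,2))
    show "\<i> islimpt (\<lambda>t. \<i> * complex_of_real t) ` {1<..<2}"
      unfolding islimpt_approachable
    proof (intro allI impI)
      fix e :: real assume e: "e > 0"
      let ?s = "1 + min e 1 / 2"
      show "\<exists>x'\<in>(\<lambda>t. \<i> * complex_of_real t) ` {1<..<2}. x' \<noteq> \<i> \<and> dist x' \<i> < e"
      proof (intro bexI conjI)
        show "\<i> * complex_of_real ?s \<in> (\<lambda>t. \<i> * complex_of_real t) ` {1<..<2}"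
          using e by (intro imageI) (simp add: min_def)
        have ne: "min e 1 / 2 \<noteq> 0" using e by (simp add: min_def)
        have d: "\<i> * complex_of_real ?s - \<i> = \<i> * of_real (min e 1 / 2)" by (simp add: algebra_simps)
        show "\<i> * complex_of_real ?s \<noteq> \<i>" using d ne by (metis diff_self mult_eq_0_iff of_real_eq_0_iff complex_i_not_zero)
        have "dist (\<i> * complex_of_real ?s) \<i> = \<bar>min e 1 / 2\<bar>" unfolding dist_norm d norm_mult norm_of_real by simp
        then show "dist (\<i> * complex_of_real ?s) \<i> < e" using e by linarith
      qed
    qed
    show "open {z. Im z > 0}" by (rule open_halfspace_Im_gt)
    show "connected {z. Im z > 0}" by (intro convex_connected convex_halfspace_Im_gt)
  qed (use eq z in \<open>auto\<close>)
  then show ?thesis by simp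
qed

section \<open>Jacobi theta functions\<close>

definition theta3 :: "complex \<Rightarrow> complex" where
  "theta3 z = (\<Sum>\<^sub>\<infinity>n\<in>(UNIV::int set). exp (\<i> * of_real pi * z * (of_int n)\<^sup>2))"

definition theta2 :: "complex \<Rightarrow> complex" where
  "theta2 z = (\<Sum>\<^sub>\<infinity>n\<in>(UNIV::int set). exp (\<i> * of_real pi * z * (of_int n + 1/2)\<^sup>2))"

text \<open>Since n^2 and n have the same parity, this is Jacobi's alternating series.\<close>

definition theta4 :: "complex \<Rightarrow> complex" where
  "theta4 z = theta3 (z + 1)"

lemma nonneg_pronic: "n\<^sup>2 + n \<ge> (0::int)"
proof (cases "n \<ge> 0")
  case False
  then have "n * (n + 1) \<ge> 0" by (intro mult_nonpos_nonpos) auto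
  then show ?thesis by (simp add: power2_eq_square algebra_simps)
qed simp

lemma summable_square_power:
  fixes r :: real
  assumes r: "0 < r" "r < 1"
  shows "(\<lambda>n::int. r ^ nat (n\<^sup>2)) summable_on UNIV"
    and "(\<lambda>n::int. r ^ nat (n\<^sup>2 + n)) summable_on UNIV"
proof -
  define c where "c = - ln r"
  have c: "c > 0" using r by (simp add: c_def)
  have rc: "r ^ k = exp (- c * real k)" for k
    using r by (simp add: c_def exp_of_nat_mult[symmetric] mult.commute[of _ "real k"] exp_ln exp_of_nat_mult)
  have "r ^ nat (n\<^sup>2) = exp (- c * (of_int n + 0)\<^sup>2)" for n :: int
    unfolding rc by (simp add: of_nat_nat)
  then show "(\<lambda>n::int. r ^ nat (n\<^sup>2)) summable_on UNIV"
    using summable_gauss_shift[OF c, of 0] by (simp only:)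
  have "r ^ nat (n\<^sup>2 + n) = exp (c / 4) * exp (- c * (of_int n + 1/2)\<^sup>2)" for n :: int
    unfolding rc using nonneg_pronic[of n] by (simp add: of_nat_nat exp_add[symmetric] power2_eq_square algebra_simps)
  then show "(\<lambda>n::int. r ^ nat (n\<^sup>2 + n)) summable_on UNIV"
    using summable_on_cmult_right[OF summable_gauss_shift[OF c, of "1/2"], of "exp (c / 4)"] by (simp only:)
qed

lemma exp_nome_power: "exp (\<i> * of_real pi * z) ^ k = exp (\<i> * of_real pi * z * of_nat k)"
  by (simp add: exp_of_nat_mult[symmetric] mult_ac)

lemma norm_nome_1: "Im z > 0 \<Longrightarrow> cmod (exp (\<i> * of_real pi * z)) < 1"
  using norm_nome_less[of 1 z] by simp

lemma theta3_has_sum: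
  assumes "Im z > 0"
  shows "((\<lambda>n::int. exp (\<i> * of_real pi * z * (of_int n)\<^sup>2)) has_sum theta3 z) UNIV"
    and "(\<lambda>n::int. norm (exp (\<i> * of_real pi * z * (of_int n)\<^sup>2))) summable_on UNIV"
proof -
  have "(\<lambda>n::int. cmod (exp (\<i> * of_real pi * z)) ^ nat (n\<^sup>2)) summable_on UNIV"
    using assms norm_nome_1 by (intro summable_square_power) auto
  then show abs: "(\<lambda>n::int. norm (exp (\<i> * of_real pi * z * (of_int n)\<^sup>2))) summable_on UNIV"
    unfolding norm_power[symmetric] exp_nome_power by (simp add: of_nat_nat)
  show "((\<lambda>n::int. exp (\<i> * of_real pi * z * (of_int n)\<^sup>2)) has_sum theta3 z) UNIV"
    unfolding theta3_def by (rule has_sum_infsum, rule abs_summable_summable, rule abs)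
qed

text \<open>The sum of 1 over a fibre counts the n with the given exponent; this is the shape that
  \<open>q_series\<close> delivers.\<close>

definition psi_fps :: "complex fps" where
  "psi_fps = Abs_fps (\<lambda>k. \<Sum>\<^sub>\<infinity>n\<in>{n::int. nat (n\<^sup>2 + n) = k}. 1)"

definition theta3_fps :: "complex fps" where
  "theta3_fps = Abs_fps (\<lambda>k. \<Sum>\<^sub>\<infinity>n\<in>{n::int. nat (n\<^sup>2) = k}. 1)"

lemma theta3_q_expansion: "q_expansion 1 theta3 theta3_fps"
  unfolding q_expansion_def
proof (intro conjI allI impI)
  have s: "(\<lambda>n::int. cmod 1 * r ^ nat (n\<^sup>2)) summable_on UNIV" if "0 < r" "r < 1" for r
    using summable_square_power[OF that] by simp
  note q = q_series[of "\<lambda>_. 1" "\<lambda>n. nat (n\<^sup>2)" "UNIV :: int set", OF s, simplified, folded theta3_fps_def]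
  show "fps_conv_radius theta3_fps \<ge> 1" using q(1) .
  fix z assume z: "Im z > 0"
  have "((\<lambda>n::int. exp (\<i> * of_real pi * z) ^ nat (n\<^sup>2)) has_sum eval_fps theta3_fps (exp (\<i> * of_real pi * z))) UNIV"
    using q(2)[of "exp (\<i> * of_real pi * z)"] norm_nome_1[OF z] by simp
  moreover have "exp (\<i> * of_real pi * z) ^ nat (n\<^sup>2) = exp (\<i> * of_real pi * z * (of_int n)\<^sup>2)" for n
    unfolding exp_nome_power by (simp add: of_nat_nat)
  ultimately have "((\<lambda>n::int. exp (\<i> * of_real pi * z * (of_int n)\<^sup>2)) has_sum eval_fps theta3_fps (exp (\<i> * of_real pi * z))) UNIV"
    by (simp only:)
  from has_sum_unique[OF theta3_has_sum(1)[OF z] this]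
  show "theta3 z = eval_fps theta3_fps (exp (\<i> * of_real pi * z / of_nat 1))" by simp
qed

lemma theta3_fps_coeffs:
  "fps_nth theta3_fps 0 = 1" "fps_nth theta3_fps (Suc 0) = 2" "fps_nth theta3_fps 2 = 0"
proof -
  have 0: "{n::int. nat (n\<^sup>2) = 0} = {0}" by (auto simp: nat_eq_iff)
  have 1: "{n::int. nat (n\<^sup>2) = Suc 0} = {1, -1}" by (auto simp: nat_eq_iff power2_eq_1_iff)
  have 2: "{n::int. nat (n\<^sup>2) = 2} = {}"
  proof -
    have "n\<^sup>2 \<noteq> 2" for n :: int
    proof
      assume n: "n\<^sup>2 = 2"
      have "\<bar>n\<bar> \<le> 1 \<or> \<bar>n\<bar> \<ge> 2" by linarith
      then show False
      proof
        assume "\<bar>n\<bar> \<le> 1" then have "\<bar>n\<bar>\<^sup>2 \<le> 1\<^sup>2" by (intro power_mono) auto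
        then show False using n by simp
      next
        assume "\<bar>n\<bar> \<ge> 2" then have "\<bar>n\<bar>\<^sup>2 \<ge> 2\<^sup>2" by (intro power_mono) auto
        then show False using n by simp
      qed
    qed
    then show ?thesis by (auto simp: nat_eq_iff)
  qed
  show "fps_nth theta3_fps 0 = 1" "fps_nth theta3_fps (Suc 0) = 2" "fps_nth theta3_fps 2 = 0"
    unfolding theta3_fps_def fps_nth_Abs_fps 0 1 2 by simp_all
qed

lemma theta4_q_expansion: "q_expansion 1 theta4 (Abs_fps (\<lambda>k. (-1) ^ k * fps_nth theta3_fps k))"
  using q_expansion_shift[OF theta3_q_expansion] by (simp add: theta4_def[abs_def])

text \<open>As (n + 1/2)^2 = n^2 + n + 1/4, the quotient is a power series in the nome; the fourth
  root of the nome stays outside.\<close>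

definition psi :: "complex \<Rightarrow> complex" where
  "psi z = theta2 z / exp (\<i> * of_real pi * z / 4)"

lemma theta2_psi: "theta2 z = exp (\<i> * of_real pi * z / 4) * psi z"
  by (simp add: psi_def)

lemma theta2_term:
  "exp (\<i> * of_real pi * z * (of_int n + 1/2)\<^sup>2) = exp (\<i> * of_real pi * z / 4) * exp (\<i> * of_real pi * z) ^ nat (n\<^sup>2 + n)"
proof -
  have "of_nat (nat (n\<^sup>2 + n)) = (of_int (n\<^sup>2 + n) :: complex)" using nonneg_pronic[of n] by (simp add: of_nat_nat)
  then show ?thesis unfolding exp_nome_power exp_add[symmetric]
    by (simp add: power2_eq_square algebra_simps)
qed

lemma theta2_abs_summable:
  assumes "Im z > 0"
  shows "(\<lambda>n::int. norm (exp (\<i> * of_real pi * z * (of_int n + 1/2)\<^sup>2))) summable_on UNIV"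
proof -
  have "(\<lambda>n::int. cmod (exp (\<i> * of_real pi * z)) ^ nat (n\<^sup>2 + n)) summable_on UNIV"
    using assms norm_nome_1 by (intro summable_square_power) auto
  from summable_on_cmult_right[OF this, of "cmod (exp (\<i> * of_real pi * z / 4))"]
  show ?thesis unfolding theta2_term norm_mult norm_power .
qed

lemma theta2_has_sum:
  assumes "Im z > 0"
  shows "((\<lambda>n::int. exp (\<i> * of_real pi * z * (of_int n + 1/2)\<^sup>2)) has_sum theta2 z) UNIV"
  unfolding theta2_def
  by (rule has_sum_infsum, rule abs_summable_summable, rule theta2_abs_summable[OF assms])

lemma psi_q_expansion: "q_expansion 1 psi psi_fps"
  unfolding q_expansion_def
proof (intro conjI allI impI)
  have s: "(\<lambda>n::int. cmod 1 * r ^ nat (n\<^sup>2 + n)) summable_on UNIV" if "0 < r" "r < 1" for r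
    using summable_square_power[OF that] by simp
  note q = q_series[of "\<lambda>_. 1" "\<lambda>n. nat (n\<^sup>2 + n)" "UNIV :: int set", OF s, simplified, folded psi_fps_def]
  show "fps_conv_radius psi_fps \<ge> 1" using q(1) .
  fix z assume z: "Im z > 0"
  have "((\<lambda>n::int. exp (\<i> * of_real pi * z) ^ nat (n\<^sup>2 + n)) has_sum eval_fps psi_fps (exp (\<i> * of_real pi * z))) UNIV"
    using q(2)[of "exp (\<i> * of_real pi * z)"] norm_nome_1[OF z] by simp
  from has_sum_cmult_right[OF this, of "exp (\<i> * of_real pi * z / 4)"]
  have "((\<lambda>n::int. exp (\<i> * of_real pi * z * (of_int n + 1/2)\<^sup>2)) has_sum exp (\<i> * of_real pi * z / 4) * eval_fps psi_fps (exp (\<i> * of_real pi * z))) UNIV"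
    unfolding theta2_term .
  from has_sum_unique[OF theta2_has_sum[OF z] this]
  show "psi z = eval_fps psi_fps (exp (\<i> * of_real pi * z / of_nat 1))" by (simp add: psi_def)
qed

lemma psi_fps_coeffs: "fps_nth psi_fps 0 = 2" "fps_nth psi_fps (Suc 0) = 0"
proof -
  have pron: "n\<^sup>2 + n = 0 \<longleftrightarrow> n = 0 \<or> n = -1" for n :: int
  proof -
    have "n\<^sup>2 + n = n * (n + 1)" by (simp add: power2_eq_square algebra_simps)
    then show ?thesis by (simp add: add_eq_0_iff)
  qed
  have 0: "{n::int. nat (n\<^sup>2 + n) = 0} = {0, -1}"
    using nonneg_pronic pron by (auto simp: nat_eq_iff)
  have "even (n\<^sup>2 + n)" for n :: int by simp
  then have "n\<^sup>2 + n \<noteq> 1" for n :: int by (metis odd_one)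
  then have 1: "{n::int. nat (n\<^sup>2 + n) = Suc 0} = {}" by (auto simp: nat_eq_iff)
  show "fps_nth psi_fps 0 = 2" "fps_nth psi_fps (Suc 0) = 0"
    unfolding psi_fps_def fps_nth_Abs_fps 0 1 by simp_all
qed

lemma theta2_power4_q_expansion: "q_expansion 1 (\<lambda>z. theta2 z ^ 4) (fps_X * psi_fps ^ 4)"
proof -
  have "q_expansion 1 (\<lambda>z. exp (\<i> * of_real pi * z) * psi z ^ 4) (fps_X * psi_fps ^ 4)"
    by (intro q_expansion_mult q_expansion_nome q_expansion_power psi_q_expansion) auto
  moreover have "exp (\<i> * of_real pi * z) * psi z ^ 4 = theta2 z ^ 4" for z
    unfolding theta2_psi power_mult_distrib by (simp add: exp_of_nat_mult[symmetric])
  ultimately show ?thesis by simp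
qed

lemma theta2_holomorphic: "theta2 holomorphic_on {z. Im z > 0}"
  unfolding theta2_psi[abs_def]
  using q_expansion_holomorphic[OF psi_q_expansion] by (intro holomorphic_intros) auto

lemma theta3_holomorphic: "theta3 holomorphic_on {z. Im z > 0}"
  using q_expansion_holomorphic[OF theta3_q_expansion] by simp

lemma theta4_holomorphic: "theta4 holomorphic_on {z. Im z > 0}"
  using q_expansion_holomorphic[OF theta4_q_expansion] by simp

lemma theta3_periodic: "Im z > 0 \<Longrightarrow> theta3 (z + 2) = theta3 z"
  by (rule q_expansion_periodic[OF theta3_q_expansion])

lemma theta4_plus_1: "Im z > 0 \<Longrightarrow> theta4 (z + 1) = theta3 z"
  using theta3_periodic[of z] by (simp add: theta4_def add.assoc)

text \<open>Only even powers of the nome occur, because n^2 + n is even.\<close>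

lemma psi_plus_1:
  assumes "Im z > 0" shows "psi (z + 1) = psi z"
proof -
  have "((\<lambda>n::int. exp (\<i> * of_real pi * (z + 1)) ^ nat (n\<^sup>2 + n)) has_sum psi (z + 1)) UNIV"
       "((\<lambda>n::int. exp (\<i> * of_real pi * z) ^ nat (n\<^sup>2 + n)) has_sum psi z) UNIV"
    using has_sum_cmult_right[OF theta2_has_sum[of "z + 1", unfolded theta2_term], of "1 / exp (\<i> * of_real pi * (z + 1) / 4)"]
      has_sum_cmult_right[OF theta2_has_sum[of z, unfolded theta2_term], of "1 / exp (\<i> * of_real pi * z / 4)"] assms
    by (simp_all add: psi_def)
  moreover have "exp (\<i> * of_real pi * (z + 1)) ^ nat (n\<^sup>2 + n) = exp (\<i> * of_real pi * z) ^ nat (n\<^sup>2 + n)" for n :: int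
  proof -
    have "even (nat (n\<^sup>2 + n))" using nonneg_pronic[of n] by (simp add: even_nat_iff)
    moreover have "exp (\<i> * of_real pi * (z + 1)) = - exp (\<i> * of_real pi * z)"
    proof -
      have "exp (\<i> * of_real pi * (z + 1)) = exp (\<i> * of_real pi) * exp (\<i> * of_real pi * z)"
        by (simp only: exp_add[symmetric]) (simp add: algebra_simps)
      then show ?thesis by simp
    qed
    ultimately show ?thesis by (simp only: power_minus_even)
  qed
  ultimately show ?thesis using has_sum_unique by (simp only:) blast
qed

lemma theta2_power4_plus_1:
  assumes "Im z > 0" shows "theta2 (z + 1) ^ 4 = - (theta2 z ^ 4)"
proof -
  have e: "exp (\<i> * of_real pi * w / 4) ^ 4 = exp (\<i> * of_real pi * w)" for w
    by (simp add: exp_of_nat_mult[symmetric])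
  have "exp (\<i> * of_real pi * (z + 1)) = exp (\<i> * of_real pi) * exp (\<i> * of_real pi * z)"
    by (simp only: exp_add[symmetric]) (simp add: algebra_simps)
  then show ?thesis unfolding theta2_psi power_mult_distrib e psi_plus_1[OF assms] by simp
qed

text \<open>One-dimensional Poisson summation, without shift and with shift 1/2. The shift becomes
  the sign (-1)^n on the dual side, which is why \<open>theta2\<close> and \<open>theta4\<close> are
  exchanged.\<close>

lemma theta_imaginary:
  assumes t: "t > 0"
  shows theta3_imaginary: "theta3 (\<i> * of_real (1 / t)) = of_real (sqrt t) * theta3 (\<i> * of_real t)"
    and theta4_imaginary: "theta4 (\<i> * of_real (1 / t)) = of_real (sqrt t) * theta2 (\<i> * of_real t)"
proof -
  have trm: "exp (\<i> * of_real pi * (\<i> * of_real s) * (of_real x)\<^sup>2) = of_real (exp (- pi * s * x\<^sup>2))" for s x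
    by (simp add: exp_of_real[symmetric] mult_ac)
  have t3: "theta3 (\<i> * of_real s) = (\<Sum>\<^sub>\<infinity>n\<in>(UNIV::int set). of_real (exp (- pi * s * (of_int n)\<^sup>2)))" for s
    unfolding theta3_def using trm[of s "of_int _"] by simp
  have t2: "theta2 (\<i> * of_real s) = (\<Sum>\<^sub>\<infinity>n\<in>(UNIV::int set). of_real (exp (- pi * s * (of_int n + 1/2)\<^sup>2)))" for s
    unfolding theta2_def using trm[of s "of_int _ + 1/2"] by simp
  have t4: "theta4 (\<i> * of_real s) = (\<Sum>\<^sub>\<infinity>n\<in>(UNIV::int set). of_real (exp (- pi * s * (of_int n)\<^sup>2)) * cis (2 * pi * of_int n * (1/2)))" for s
    unfolding theta4_def theta3_def
  proof (rule infsum_cong)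
    fix n :: int
    \<comment> \<open>As n^2 - n is even, the sign (-1)^(n^2) is the character (-1)^n, in the form
      that the Poisson formula produces for v = 1/2.\<close>
    have "exp (\<i> * of_real pi * (of_int n)\<^sup>2) = cis (2 * pi * of_int n * (1/2))"
    proof -
      have "exp (\<i> * of_real pi * (of_int n)\<^sup>2) = cis (pi * of_int n + 2 * pi * of_int ((n\<^sup>2 - n) div 2))"
      proof -
        have "2 * ((n\<^sup>2 - n) div 2) = n\<^sup>2 - n" by simp
        then have "2 * real_of_int ((n\<^sup>2 - n) div 2) = of_int (n\<^sup>2 - n)" by (metis of_int_mult of_int_numeral)
        then have "of_int n + 2 * real_of_int ((n\<^sup>2 - n) div 2) = (of_int n)\<^sup>2" by simp
        moreover have "pi * of_int n + 2 * pi * of_int ((n\<^sup>2 - n) div 2) = pi * (of_int n + 2 * real_of_int ((n\<^sup>2 - n) div 2))"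
          by (simp only: distrib_left mult_ac)
        ultimately have "pi * of_int n + 2 * pi * of_int ((n\<^sup>2 - n) div 2) = pi * (of_int n)\<^sup>2" by (simp only:)
        then show ?thesis by (simp add: cis_conv_exp mult.assoc)
      qed
      also have "\<dots> = cis (pi * of_int n) * cis (2 * pi * of_int ((n\<^sup>2 - n) div 2))" by (simp only: cis_mult)
      also have "cis (2 * pi * of_int ((n\<^sup>2 - n) div 2)) = 1" by (rule cis_multiple_2pi) auto
      finally show ?thesis by simp
    qed
    moreover have "exp (\<i> * of_real pi * (\<i> * of_real s + 1) * (of_int n)\<^sup>2) =
        exp (\<i> * of_real pi * (\<i> * of_real s) * (of_int n)\<^sup>2) * exp (\<i> * of_real pi * (of_int n)\<^sup>2)"
      unfolding exp_add[symmetric] by (simp add: algebra_simps)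
    ultimately show "exp (\<i> * of_real pi * (\<i> * of_real s + 1) * (of_int n)\<^sup>2) =
      of_real (exp (- pi * s * (of_int n)\<^sup>2)) * cis (2 * pi * of_int n * (1/2))"
      using trm[of s "of_int n"] by simp
  qed
  have st: "complex_of_real (sqrt t) \<noteq> 0" using t by simp
  have "theta3 (\<i> * of_real t) = (\<Sum>\<^sub>\<infinity>n\<in>(UNIV::int set). (1 / of_real (sqrt t)) * of_real (exp (- pi * (1 / t) * (of_int n)\<^sup>2)))"
    unfolding t3 using poisson_gauss_int[OF t, of 0 0] by simp
  also have "\<dots> = (1 / of_real (sqrt t)) * theta3 (\<i> * of_real (1 / t))"
    unfolding t3 by (rule infsum_cmult_right')
  finally show "theta3 (\<i> * of_real (1 / t)) = of_real (sqrt t) * theta3 (\<i> * of_real t)" using st by (simp add: field_simps)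
  have "theta2 (\<i> * of_real t) = (\<Sum>\<^sub>\<infinity>n\<in>(UNIV::int set). (1 / of_real (sqrt t)) * (of_real (exp (- pi * (1 / t) * (of_int n)\<^sup>2)) * cis (2 * pi * of_int n * (1/2))))"
    unfolding t2 using poisson_gauss_int[OF t, of "1/2" 0] by simp
  also have "\<dots> = (1 / of_real (sqrt t)) * theta4 (\<i> * of_real (1 / t))"
    unfolding t4 by (rule infsum_cmult_right')
  finally show "theta4 (\<i> * of_real (1 / t)) = of_real (sqrt t) * theta2 (\<i> * of_real t)" using st by (simp add: field_simps)
qed

section \<open>Transformation rules of the theta functions\<close>

lemma Im_inversion: "Im z > 0 \<Longrightarrow> Im (-1/z) > 0"
  by (cases "z = 0") (auto simp: Im_divide intro!: divide_pos_pos add_nonneg_pos)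

lemma inversion_holomorphic:
  assumes "F holomorphic_on {z. Im z > 0}"
  shows "(\<lambda>z. F (-1/z)) holomorphic_on {z. Im z > 0}"
proof (rule holomorphic_on_compose_gen[unfolded o_def, OF _ assms])
  show "(\<lambda>z. -1/z) holomorphic_on {z. Im z > 0}" by (intro holomorphic_intros) auto
qed (use Im_inversion in auto)

lemma cusp_holomorphic:
  assumes "F holomorphic_on {z. Im z > 0}"
  shows "(\<lambda>z. F (1 - 1/z)) holomorphic_on {z. Im z > 0}"
proof (rule holomorphic_on_compose_gen[unfolded o_def, OF _ assms])
  show "(\<lambda>z. 1 - 1/z) holomorphic_on {z. Im z > 0}" by (intro holomorphic_intros) auto
  have "Im (1 - 1/z) > 0" if "Im z > 0" for z using Im_inversion[OF that] by simp
  then show "(\<lambda>z. 1 - 1/z) ` {z. Im z > 0} \<subseteq> {z. Im z > 0}" by auto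
qed

text \<open>For Im z > 0 the number -i z has positive real part, so the principal root is
  holomorphic. Its powers serve as automorphy factors for integral and half-integral weights
  alike.\<close>

lemma csqrt_holomorphic: "(\<lambda>z. csqrt (- \<i> * z)) holomorphic_on {z. Im z > 0}"
proof (rule holomorphic_on_compose_gen[unfolded o_def, where t = "- \<real>\<^sub>\<le>\<^sub>0" and g = csqrt])
  show "(\<lambda>z. - \<i> * z) ` {z. Im z > 0} \<subseteq> - \<real>\<^sub>\<le>\<^sub>0"
    by (auto simp: complex_nonpos_Reals_iff)
qed (auto intro!: holomorphic_intros)

lemma csqrt_imaginary: "t > 0 \<Longrightarrow> csqrt (- \<i> * (\<i> * of_real t)) = of_real (sqrt t)"
  by (simp add: csqrt_of_real_nonneg)

lemma inversion_imaginary: "-1 / (\<i> * complex_of_real t) = \<i> * of_real (1 / t)"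
  by (cases "t = 0") (simp_all add: complex_eq_iff Re_divide Im_divide power2_eq_square)

lemma theta3_inversion:
  assumes "Im z > 0" shows "theta3 (-1/z) = csqrt (- \<i> * z) * theta3 z"
proof (rule upper_half_plane_identity[OF _ _ _ assms])
  show "(\<lambda>z. theta3 (-1/z)) holomorphic_on {z. Im z > 0}" by (rule inversion_holomorphic[OF theta3_holomorphic])
  show "(\<lambda>z. csqrt (- \<i> * z) * theta3 z) holomorphic_on {z. Im z > 0}"
    by (intro holomorphic_on_mult csqrt_holomorphic theta3_holomorphic)
  fix t :: real assume t: "t > 0"
  have "-1 / (\<i> * complex_of_real t) = \<i> * of_real (1 / t)" by (rule inversion_imaginary)
  then show "theta3 (-1 / (\<i> * of_real t)) = csqrt (- \<i> * (\<i> * of_real t)) * theta3 (\<i> * of_real t)"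
    using theta3_imaginary[OF t] csqrt_imaginary[OF t] by (simp only:)
qed

lemma theta4_inversion:
  assumes "Im z > 0" shows "theta4 (-1/z) = csqrt (- \<i> * z) * theta2 z"
proof (rule upper_half_plane_identity[OF _ _ _ assms])
  show "(\<lambda>z. theta4 (-1/z)) holomorphic_on {z. Im z > 0}" by (rule inversion_holomorphic[OF theta4_holomorphic])
  show "(\<lambda>z. csqrt (- \<i> * z) * theta2 z) holomorphic_on {z. Im z > 0}"
    by (intro holomorphic_on_mult csqrt_holomorphic theta2_holomorphic)
  fix t :: real assume t: "t > 0"
  have "-1 / (\<i> * complex_of_real t) = \<i> * of_real (1 / t)" by (rule inversion_imaginary)
  then show "theta4 (-1 / (\<i> * of_real t)) = csqrt (- \<i> * (\<i> * of_real t)) * theta2 (\<i> * of_real t)"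
    using theta4_imaginary[OF t] csqrt_imaginary[OF t] by (simp only:)
qed

lemma theta2_inversion:
  assumes "Im z > 0" shows "theta2 (-1/z) = csqrt (- \<i> * z) * theta4 z"
proof (rule upper_half_plane_identity[OF _ _ _ assms])
  show "(\<lambda>z. theta2 (-1/z)) holomorphic_on {z. Im z > 0}" by (rule inversion_holomorphic[OF theta2_holomorphic])
  show "(\<lambda>z. csqrt (- \<i> * z) * theta4 z) holomorphic_on {z. Im z > 0}"
    by (intro holomorphic_on_mult csqrt_holomorphic theta4_holomorphic)
  fix t :: real assume t: "t > 0"
  have "-1 / (\<i> * complex_of_real t) = \<i> * of_real (1 / t)" by (rule inversion_imaginary)
  moreover have "theta4 (\<i> * of_real t) = of_real (sqrt (1 / t)) * theta2 (\<i> * of_real (1 / t))"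
    using theta4_imaginary[of "1 / t"] t by simp
  ultimately show "theta2 (-1 / (\<i> * of_real t)) = csqrt (- \<i> * (\<i> * of_real t)) * theta4 (\<i> * of_real t)"
    using csqrt_imaginary[OF t] t by (simp only:) (simp add: real_sqrt_divide)
qed

lemma theta2_plus_4: "Im z > 0 \<Longrightarrow> theta2 (z + 4) = - theta2 z"
proof -
  assume z: "Im z > 0"
  have "psi (z + 4) = psi z"
    using psi_plus_1[of "z + 3"] psi_plus_1[of "z + 2"] psi_plus_1[of "z + 1"] psi_plus_1[of z] z by (simp add: add.assoc)
  moreover have "exp (\<i> * of_real pi * (z + 4) / 4) = exp (\<i> * of_real pi) * exp (\<i> * of_real pi * z / 4)"
    unfolding exp_add[symmetric] by (simp add: algebra_simps add_divide_distrib)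
  ultimately show ?thesis by (simp add: theta2_psi)
qed

lemma theta2_plus_2_square: "Im z > 0 \<Longrightarrow> (theta2 (z + 2))\<^sup>2 = - (theta2 z)\<^sup>2"
proof -
  assume z: "Im z > 0"
  have "psi (z + 2) = psi z"
    using psi_plus_1[of "z + 1"] psi_plus_1[of z] z by (simp add: add.assoc)
  moreover have "(exp (\<i> * of_real pi * (z + 2) / 4))\<^sup>2 = exp (\<i> * of_real pi) * (exp (\<i> * of_real pi * z / 4))\<^sup>2"
    unfolding exp_double[symmetric] exp_add[symmetric] by (simp add: algebra_simps add_divide_distrib)
  ultimately show ?thesis by (simp add: theta2_psi power_mult_distrib)
qed

section \<open>Duplication formulas and zeros of the theta functions\<close>

lemma theta3_split:
  assumes z: "Im z > 0" shows "theta3 z = theta3 (4 * z) + theta2 (4 * z)"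
proof -
  let ?f = "\<lambda>n::int. exp (\<i> * of_real pi * z * (of_int n)\<^sup>2)"
  have summ: "?f summable_on A" for A
    using summable_on_subset_banach[OF abs_summable_summable[OF theta3_has_sum(2)[OF z]]] by auto
  let ?E = "range (\<lambda>m::int. 2 * m)" and ?O = "range (\<lambda>m::int. 2 * m + 1)"
  have U: "UNIV = ?E \<union> ?O"
  proof -
    have "n \<in> ?E \<union> ?O" for n :: int by (cases "even n") (auto elim!: evenE oddE)
    then show ?thesis by blast
  qed
  have disj: "?E \<inter> ?O = {}" by auto presburger
  have "theta3 z = infsum ?f (?E \<union> ?O)" unfolding theta3_def U[symmetric] by simp
  also have "\<dots> = infsum ?f ?E + infsum ?f ?O" by (rule infsum_Un_disjoint[OF summ summ disj])
  also have "infsum ?f ?E = theta3 (4 * z)"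
    unfolding theta3_def by (subst infsum_reindex) (auto simp: inj_def o_def mult_ac power_mult_distrib intro!: infsum_cong)
  also have "infsum ?f ?O = theta2 (4 * z)"
    unfolding theta2_def
  proof (subst infsum_reindex)
    have "(of_int (2 * m + 1) :: complex)\<^sup>2 = 4 * (of_int m + 1/2)\<^sup>2" for m :: int
      by (simp add: power2_eq_square field_simps)
    then show "infsum (?f \<circ> (\<lambda>m. 2 * m + 1)) UNIV = (\<Sum>\<^sub>\<infinity>n::int. exp (\<i> * of_real pi * (4 * z) * (of_int n + 1/2)\<^sup>2))"
      by (intro infsum_cong) (simp only: o_def mult_ac)
  qed (auto simp: inj_def)
  finally show ?thesis .
qed

lemma theta4_split:
  assumes z: "Im z > 0" shows "theta4 z = theta3 (4 * z) - theta2 (4 * z)"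
proof -
  have "theta4 z = theta3 (4 * z + 4) + theta2 (4 * z + 4)"
    using theta3_split[of "z + 1"] z by (simp add: theta4_def distrib_left)
  moreover have "theta3 (4 * z + 4) = theta3 (4 * z)"
    using theta3_periodic[of "4 * z + 2"] theta3_periodic[of "4 * z"] z by (simp add: add.assoc)
  ultimately show ?thesis using theta2_plus_4[of "4 * z"] z by simp
qed

text \<open>Pairs (m, n) with m + n even are (r + s, r - s), with m^2 + n^2 = 2 r^2 + 2 s^2; those
  with m + n odd are (r + s + 1, r - s), with m^2 + n^2 = 2 (r + 1/2)^2 + 2 (s + 1/2)^2.\<close>

lemma theta3_square_split:
  assumes z: "Im z > 0" shows "(theta3 z)\<^sup>2 = (theta3 (2 * z))\<^sup>2 + (theta2 (2 * z))\<^sup>2"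
proof -
  let ?e = "\<lambda>w (x::complex). exp (\<i> * of_real pi * w * x\<^sup>2)"
  have z2: "Im (2 * z) > 0" using z by simp
  have prod: "(infsum f UNIV)\<^sup>2 = (\<Sum>\<^sub>\<infinity>(m, n)\<in>UNIV \<times> UNIV. f m * f n)" and psumm: "(\<lambda>(m, n). f m * f n) summable_on UNIV \<times> UNIV"
    if f: "(\<lambda>n. norm (f n)) summable_on UNIV" for f :: "int \<Rightarrow> complex"
  proof -
    have "(\<lambda>p. norm ((\<lambda>(m, n). f m * f n) p)) summable_on UNIV \<times> UNIV"
      using abs_summable_on_times[OF f f] by (simp add: case_prod_unfold norm_mult)
    then show s: "(\<lambda>(m, n). f m * f n) summable_on UNIV \<times> UNIV" by (rule abs_summable_summable)
    from infsum_Sigma'_banach[OF s]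
    show "(infsum f UNIV)\<^sup>2 = (\<Sum>\<^sub>\<infinity>(m, n)\<in>UNIV \<times> UNIV. f m * f n)"
      by (simp add: infsum_cmult_right' infsum_cmult_left' power2_eq_square)
  qed
  let ?f = "\<lambda>n::int. ?e z (of_int n)"
  let ?g = "\<lambda>(m, n). ?f m * ?f n"
  have gs: "?g summable_on A" for A
    using summable_on_subset_banach[OF psumm[OF theta3_has_sum(2)[OF z]]] by auto
  let ?\<phi> = "\<lambda>(r::int, s::int). (r + s, r - s)" and ?\<chi> = "\<lambda>(r::int, s::int). (r + s + 1, r - s)"
  have U: "UNIV \<times> UNIV = range ?\<phi> \<union> range ?\<chi>"
  proof -
    have "(m, n) \<in> range ?\<phi> \<union> range ?\<chi>" for m n :: int
    proof (cases "even (m + n)")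
      case True
      then obtain r where r: "m + n = 2 * r" by (elim evenE)
      then have "(m, n) = ?\<phi> (r, m - r)" by simp
      then show ?thesis by blast
    next
      case False
      then obtain r where r: "m + n = 2 * r + 1" by (elim oddE)
      then have "(m, n) = ?\<chi> (r, m - r - 1)" by simp
      then show ?thesis by blast
    qed
    then show ?thesis by auto
  qed
  have disj: "range ?\<phi> \<inter> range ?\<chi> = {}"
  proof -
    have "(r + s, r - s) \<noteq> (r' + s' + 1, r' - s')" for r s r' s' :: int by (auto; presburger)
    then show ?thesis by auto
  qed
  have inj: "inj ?\<phi>" "inj ?\<chi>" by (auto simp: inj_def)
  have "(theta3 z)\<^sup>2 = infsum ?g (range ?\<phi> \<union> range ?\<chi>)"
    unfolding theta3_def U[symmetric] by (rule prod[OF theta3_has_sum(2)[OF z]])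
  also have "\<dots> = infsum ?g (range ?\<phi>) + infsum ?g (range ?\<chi>)" by (rule infsum_Un_disjoint[OF gs gs disj])
  also have "infsum ?g (range ?\<phi>) = (theta3 (2 * z))\<^sup>2"
  proof -
    have "(?g \<circ> ?\<phi>) p = (\<lambda>(m, n). ?e (2 * z) (of_int m) * ?e (2 * z) (of_int n)) p" for p
    proof -
      obtain r s where p: "p = (r, s)" by (cases p)
      have "z * (of_int (r + s))\<^sup>2 + z * (of_int (r - s))\<^sup>2 = (2 * z) * (of_int r)\<^sup>2 + (2 * z) * (of_int s)\<^sup>2"
        by (simp add: power2_eq_square algebra_simps)
      then have "\<i> * of_real pi * z * (of_int (r + s))\<^sup>2 + \<i> * of_real pi * z * (of_int (r - s))\<^sup>2 =
          \<i> * of_real pi * (2 * z) * (of_int r)\<^sup>2 + \<i> * of_real pi * (2 * z) * (of_int s)\<^sup>2"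
        by (simp only: mult.assoc flip: distrib_left)
      then show ?thesis by (simp only: p o_def prod.case flip: exp_add)
    qed
    then have "infsum (?g \<circ> ?\<phi>) UNIV = (theta3 (2 * z))\<^sup>2"
      unfolding theta3_def prod[OF theta3_has_sum(2)[OF z2]] UNIV_Times_UNIV by (rule infsum_cong)
    then show ?thesis unfolding infsum_reindex[OF inj(1)] .
  qed
  also have "infsum ?g (range ?\<chi>) = (theta2 (2 * z))\<^sup>2"
  proof -
    have "(?g \<circ> ?\<chi>) p = (\<lambda>(m, n). ?e (2 * z) (of_int m + 1/2) * ?e (2 * z) (of_int n + 1/2)) p" for p
    proof -
      obtain r s where p: "p = (r, s)" by (cases p)
      have "z * (of_int (r + s + 1))\<^sup>2 + z * (of_int (r - s))\<^sup>2 = (2 * z) * (of_int r + 1/2)\<^sup>2 + (2 * z) * (of_int s + 1/2)\<^sup>2"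
        by (simp add: power2_eq_square field_simps)
      then have "\<i> * of_real pi * z * (of_int (r + s + 1))\<^sup>2 + \<i> * of_real pi * z * (of_int (r - s))\<^sup>2 =
          \<i> * of_real pi * (2 * z) * (of_int r + 1/2)\<^sup>2 + \<i> * of_real pi * (2 * z) * (of_int s + 1/2)\<^sup>2"
        by (simp only: mult.assoc flip: distrib_left)
      then show ?thesis by (simp only: p o_def prod.case flip: exp_add)
    qed
    then have "infsum (?g \<circ> ?\<chi>) UNIV = (theta2 (2 * z))\<^sup>2"
      unfolding theta2_def prod[OF theta2_abs_summable[OF z2]] UNIV_Times_UNIV by (rule infsum_cong)
    then show ?thesis unfolding infsum_reindex[OF inj(2)] .
  qed
  finally show ?thesis .
qed

lemma theta4_square_split:
  assumes z: "Im z > 0" shows "(theta4 z)\<^sup>2 = (theta3 (2 * z))\<^sup>2 - (theta2 (2 * z))\<^sup>2"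
  using theta3_square_split[of "z + 1"] theta3_periodic[of "2 * z"] theta2_plus_2_square[of "2 * z"] z
  by (simp add: theta4_def distrib_left)

text \<open>At z/2 the squares of \<open>theta3\<close> and \<open>theta4\<close> are known in two
  ways: from the splitting of squares, and as squares of the splitting into even and odd terms.
  Subtracting the two relations isolates the square of \<open>theta2\<close>.\<close>

lemma theta2_square_double:
  assumes z: "Im z > 0" shows "(theta2 z)\<^sup>2 = 2 * theta2 (2 * z) * theta3 (2 * z)"
proof -
  have z2: "Im (z / 2) > 0" using z by simp
  have "(theta3 z)\<^sup>2 + (theta2 z)\<^sup>2 = (theta3 (2 * z) + theta2 (2 * z))\<^sup>2"
    using theta3_split[OF z2] theta3_square_split[OF z2] by simp
  moreover have "(theta3 z)\<^sup>2 - (theta2 z)\<^sup>2 = (theta3 (2 * z) - theta2 (2 * z))\<^sup>2"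
    using theta4_split[OF z2] theta4_square_split[OF z2] by simp
  ultimately have "2 * (theta2 z)\<^sup>2 = 2 * (2 * theta2 (2 * z) * theta3 (2 * z))" by algebra
  then show ?thesis by simp
qed

text \<open>This is the duplication formula for \<open>theta2\<close> at -1/(2z), transported by
  inversion.\<close>

lemma theta3_theta4_double:
  assumes z: "Im z > 0" shows "theta3 z * theta4 z = (theta4 (2 * z))\<^sup>2"
proof -
  have z2: "Im (2 * z) > 0" and nz: "z \<noteq> 0" using z by auto
  have "(theta2 (-1 / (2 * z)))\<^sup>2 = 2 * theta2 (2 * (-1 / (2 * z))) * theta3 (2 * (-1 / (2 * z)))"
    by (rule theta2_square_double[OF Im_inversion[OF z2]])
  also have "2 * (-1 / (2 * z)) = -1 / z" by simp
  finally have "(csqrt (- \<i> * (2 * z)))\<^sup>2 * (theta4 (2 * z))\<^sup>2 = 2 * ((csqrt (- \<i> * z))\<^sup>2 * (theta4 z * theta3 z))"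
    unfolding theta2_inversion[OF z2] theta2_inversion[OF z] theta3_inversion[OF z] by (simp add: power2_eq_square mult_ac)
  then have "(2 * (- \<i> * z)) * (theta4 (2 * z))\<^sup>2 = (2 * (- \<i> * z)) * (theta4 z * theta3 z)"
    unfolding power2_csqrt by (simp only: mult_ac)
  then show ?thesis using nz by simp
qed

text \<open>With u and v the squares of \<open>theta3\<close> and \<open>theta2\<close> at 2z, the
  fourth powers of \<open>theta3\<close> and \<open>theta4\<close> are (u + v)^2 and (u - v)^2.
  Their difference 4uv is the fourth power of \<open>theta2\<close> by duplication.\<close>

lemma jacobi_identity:
  assumes z: "Im z > 0" shows "theta3 z ^ 4 = theta2 z ^ 4 + theta4 z ^ 4"
proof -
  have "(theta2 z)\<^sup>2 = 2 * theta2 (2 * z) * theta3 (2 * z)" by (rule theta2_square_double[OF z])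
  then have "theta2 z ^ 4 = 4 * (theta2 (2 * z))\<^sup>2 * (theta3 (2 * z))\<^sup>2" by algebra
  then show ?thesis using theta3_square_split[OF z] theta4_square_split[OF z] by algebra
qed

lemma Im_power2_mult_eq: "Im (2 ^ k * z) = 2 ^ k * Im z"
proof -
  have "2 ^ k * z = of_real (2 ^ k) * z" by simp
  then show ?thesis by (simp only: times_complex.sel Re_complex_of_real Im_complex_of_real)
qed

lemma Im_power2_mult: "Im z > 0 \<Longrightarrow> Im (2 ^ k * z) > 0"
  by (simp add: Im_power2_mult_eq)

lemma theta4_eventually_nonzero:
  assumes z: "Im z > 0" shows "\<exists>k. theta4 (2 ^ k * z) \<noteq> 0"
proof -
  obtain Y where Y: "\<And>w. Im w \<ge> Y \<Longrightarrow> 1 / 2 \<le> cmod (theta4 w)"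
    using q_expansion_near_const[OF theta4_q_expansion] theta3_fps_coeffs by auto
  obtain k where "Y / Im z < 2 ^ k" using real_arch_pow[of 2 "Y / Im z"] by auto
  then have "Y \<le> 2 ^ k * Im z" using z by (simp add: pos_divide_less_eq)
  also have "2 ^ k * Im z = Im (2 ^ k * z)" by (rule Im_power2_mult_eq[symmetric])
  finally have "theta4 (2 ^ k * z) \<noteq> 0" using Y[of "2 ^ k * z"] by auto
  then show ?thesis by blast
qed

text \<open>A zero of \<open>theta4\<close> would propagate along the doubled arguments, where \<open>theta4\<close> tends to \<open>1\<close>.\<close>

lemma theta4_nonzero:
  assumes z: "Im z > 0" shows "theta4 z \<noteq> 0"
proof
  assume 0: "theta4 z = 0"
  have "theta4 (2 ^ k * z) = 0" for k
  proof (induction k)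
    case (Suc k)
    have "(theta4 (2 * (2 ^ k * z)))\<^sup>2 = 0"
      using theta3_theta4_double[OF Im_power2_mult[OF z, of k]] Suc by simp
    then show ?case by (simp add: mult.assoc)
  qed (use 0 in simp)
  then show False using theta4_eventually_nonzero[OF z] by blast
qed

lemma theta3_nonzero:
  assumes z: "Im z > 0" shows "theta3 z \<noteq> 0"
  using theta3_theta4_double[OF z] theta4_nonzero[of "2 * z"] z by auto

lemma theta2_nonzero:
  assumes z: "Im z > 0" shows "theta2 z \<noteq> 0"
proof
  assume "theta2 z = 0"
  moreover have "theta4 (-1/z) = csqrt (- \<i> * z) * theta2 z" by (rule theta4_inversion[OF z])
  ultimately show False using theta4_nonzero[OF Im_inversion[OF z]] by simp
qed

text \<open>A form of weight 4 with a simple zero in the nome at infinity and none at the cusp 1;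
  dividing by 16 normalises its leading coefficient to 1.\<close>

definition Delta8 :: "complex \<Rightarrow> complex" where
  "Delta8 z = theta2 z ^ 4 * theta4 z ^ 4 / 16"

text \<open>Weight 2, leading coefficient 1 and sign -1 under inversion: the factor that provides
  the sign i^6 in degree 6.\<close>

definition Phi :: "complex \<Rightarrow> complex" where
  "Phi z = theta4 z ^ 4 - theta2 z ^ 4"

definition theta4_fps :: "complex fps" where
  "theta4_fps = Abs_fps (\<lambda>k. (-1) ^ k * fps_nth theta3_fps k)"

definition Delta8_fps :: "complex fps" where
  "Delta8_fps = fps_X * (fps_const (1/16) * (psi_fps ^ 4 * theta4_fps ^ 4))"

definition Phi_fps :: "complex fps" where
  "Phi_fps = theta4_fps ^ 4 - fps_X * psi_fps ^ 4"

text \<open>\<open>K\<close> is twice the weight and \<epsilon> the sign under inversion.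
  \<open>F'\<close> describes \<open>F\<close> at the cusp 1; it is carried along as data so that
  products and differences of forms act on it in parallel, and its decay is stated where it is
  used.\<close>

definition theta_form :: "nat \<Rightarrow> complex \<Rightarrow> (complex \<Rightarrow> complex) \<Rightarrow> (complex \<Rightarrow> complex) \<Rightarrow> complex fps \<Rightarrow> bool" where
  "theta_form K \<epsilon> F F' A \<longleftrightarrow> q_expansion 1 F A \<and>
     (\<forall>z. Im z > 0 \<longrightarrow> F (-1/z) = \<epsilon> * csqrt (- \<i> * z) ^ K * F z) \<and>
     (\<forall>z. Im z > 0 \<longrightarrow> F (1 - 1/z) = csqrt (- \<i> * z) ^ K * F' z)"

lemma theta_form_mult:
  assumes "theta_form K \<epsilon> F F' A" "theta_form L \<delta> G G' B"
  shows "theta_form (K + L) (\<epsilon> * \<delta>) (\<lambda>z. F z * G z) (\<lambda>z. F' z * G' z) (A * B)"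
  using assms q_expansion_mult[of 1 F A G B] by (simp add: theta_form_def power_add mult_ac)

lemma theta_form_power:
  assumes "theta_form K \<epsilon> F F' A"
  shows "theta_form (K * n) (\<epsilon> ^ n) (\<lambda>z. F z ^ n) (\<lambda>z. F' z ^ n) (A ^ n)"
proof (induction n)
  case 0
  show ?case using q_expansion_const[of 1 1] by (simp add: theta_form_def)
next
  case (Suc n)
  show ?case using theta_form_mult[OF assms Suc] by simp
qed

lemma theta_form_cmult:
  assumes "theta_form K \<epsilon> F F' A"
  shows "theta_form K \<epsilon> (\<lambda>z. c * F z) (\<lambda>z. c * F' z) (fps_const c * A)"
  using assms q_expansion_cmult[of 1 F A c] by (simp add: theta_form_def mult_ac)

lemma theta_form_diff:
  assumes "theta_form K \<epsilon> F F' A" "theta_form K \<epsilon> G G' B"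
  shows "theta_form K \<epsilon> (\<lambda>z. F z - G z) (\<lambda>z. F' z - G' z) (A - B)"
  using assms q_expansion_diff[of 1 F A G B] by (simp add: theta_form_def algebra_simps)

lemma theta3_cusp: "Im z > 0 \<Longrightarrow> theta3 (1 - 1/z) = csqrt (- \<i> * z) * theta2 z"
  using theta4_inversion[of z] by (simp add: theta4_def add.commute)

lemma theta4_cusp: "Im z > 0 \<Longrightarrow> theta4 (1 - 1/z) = csqrt (- \<i> * z) * theta3 z"
  using theta4_plus_1[OF Im_inversion[of z]] theta3_inversion[of z] by (simp add: add.commute)

lemma theta2_cusp: "Im z > 0 \<Longrightarrow> theta2 (1 - 1/z) ^ 4 = - (csqrt (- \<i> * z) ^ 4 * theta4 z ^ 4)"
  using theta2_power4_plus_1[OF Im_inversion[of z]] theta2_inversion[of z]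
  by (simp add: add.commute power_mult_distrib)

lemma theta3_form: "theta_form 1 1 theta3 theta2 theta3_fps"
  unfolding theta_form_def using theta3_q_expansion theta3_inversion theta3_cusp by simp

lemma Delta8_form: "theta_form 8 1 Delta8 (\<lambda>z. - (theta3 z ^ 4 * theta4 z ^ 4 / 16)) Delta8_fps"
  unfolding theta_form_def
proof (intro conjI allI impI)
  have "q_expansion 1 (\<lambda>z. theta2 z ^ 4 * (theta4 z ^ 4 * (1/16))) ((fps_X * psi_fps ^ 4) * (theta4_fps ^ 4 * fps_const (1/16)))"
    unfolding theta4_fps_def
    by (intro q_expansion_mult theta2_power4_q_expansion q_expansion_power theta4_q_expansion q_expansion_const) auto
  then show "q_expansion 1 Delta8 Delta8_fps"
    by (simp add: Delta8_def[abs_def] Delta8_fps_def mult_ac)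
  fix z assume z: "Im z > 0"
  show "Delta8 (-1/z) = 1 * csqrt (- \<i> * z) ^ 8 * Delta8 z"
    unfolding Delta8_def theta2_inversion[OF z] theta4_inversion[OF z] by algebra
  show "Delta8 (1 - 1/z) = csqrt (- \<i> * z) ^ 8 * - (theta3 z ^ 4 * theta4 z ^ 4 / 16)"
    unfolding Delta8_def theta2_cusp[OF z] theta4_cusp[OF z] by algebra
qed

lemma Phi_form: "theta_form 4 (-1) Phi (\<lambda>z. theta3 z ^ 4 + theta4 z ^ 4) Phi_fps"
  unfolding theta_form_def
proof (intro conjI allI impI)
  show "q_expansion 1 Phi Phi_fps" unfolding Phi_def[abs_def] Phi_fps_def theta4_fps_def
    by (intro q_expansion_diff theta2_power4_q_expansion q_expansion_power theta4_q_expansion) auto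
  fix z assume z: "Im z > 0"
  show "Phi (-1/z) = - 1 * csqrt (- \<i> * z) ^ 4 * Phi z"
    unfolding Phi_def theta2_inversion[OF z] theta4_inversion[OF z] by algebra
  show "Phi (1 - 1/z) = csqrt (- \<i> * z) ^ 4 * (theta3 z ^ 4 + theta4 z ^ 4)"
    unfolding Phi_def theta2_cusp[OF z] theta4_cusp[OF z] by algebra
qed

text \<open>The exponent may have either sign: it will be the power of \<open>theta3\<close> that
  remains after the weight of a power of \<open>Delta8\<close> has been split off.\<close>

lemma power_int_lower_bound:
  fixes l u :: real
  assumes "0 < l"
  shows "\<exists>m>0. \<forall>x. l \<le> x \<and> x \<le> u \<longrightarrow> m \<le> x powi a"
proof (cases "a \<ge> 0")
  case True
  then show ?thesis using assms
    by (intro exI[of _ "l powi a"]) (auto simp: power_int_def intro: power_mono)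
next
  case False
  define n where "n = nat (- a)"
  have a: "x powi a = inverse (x ^ n)" if "x > 0" for x :: real
    using False that by (simp add: power_int_def n_def power_inverse)
  have "inverse ((max l u) ^ n) \<le> x powi a" if "l \<le> x" "x \<le> u" for x
    using that assms by (subst a) (auto intro!: le_imp_inverse_le power_mono)
  then show ?thesis using assms by (intro exI[of _ "inverse ((max l u) ^ n)"]) auto
qed

lemma exp_decay:
  assumes "\<kappa> > 0" "e > (0::real)"
  shows "\<exists>Y>0. \<forall>y\<ge>Y. C * exp (- \<kappa> * y) < e"
proof -
  have "((\<lambda>y. C * exp (- \<kappa> * y)) \<longlongrightarrow> C * 0) at_top"
    using assms by (intro tendsto_intros filterlim_compose[OF exp_at_bot] filterlim_tendsto_neg_mult_at_bot[OF tendsto_const] filterlim_ident) auto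
  then have "\<forall>\<^sub>F y in at_top. C * exp (- \<kappa> * y) < e"
    by (rule order_tendstoD) (use assms in auto)
  then obtain Y where "\<And>y. y \<ge> Y \<Longrightarrow> C * exp (- \<kappa> * y) < e"
    by (auto simp: eventually_at_top_linorder)
  then show ?thesis by (intro exI[of _ "max 1 Y"]) auto
qed

section \<open>A vanishing criterion\<close>

lemma psi_bounds: "\<exists>Y\<ge>1. \<forall>z. Im z \<ge> Y \<longrightarrow> 1 \<le> cmod (psi z) \<and> cmod (psi z) \<le> 4"
  using q_expansion_near_const[OF psi_q_expansion] psi_fps_coeffs by simp

lemma theta3_bounds: "\<exists>Y\<ge>1. \<forall>z. Im z \<ge> Y \<longrightarrow> 1 / 2 \<le> cmod (theta3 z) \<and> cmod (theta3 z) \<le> 2"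
  using q_expansion_near_const[OF theta3_q_expansion] theta3_fps_coeffs by simp

lemma theta4_bounds: "\<exists>Y\<ge>1. \<forall>z. Im z \<ge> Y \<longrightarrow> 1 / 2 \<le> cmod (theta4 z) \<and> cmod (theta4 z) \<le> 2"
  using q_expansion_near_const[OF theta4_q_expansion] theta3_fps_coeffs by simp

lemma norm_theta2: "cmod (theta2 z) = exp (- pi * Im z / 4) * cmod (psi z)"
  using norm_nome[of z 4] by (simp add: theta2_psi norm_mult)

lemma Delta8_q_expansion: "q_expansion 1 Delta8 Delta8_fps"
  using Delta8_form by (simp add: theta_form_def)

lemma Delta8_nonzero: "Im z > 0 \<Longrightarrow> Delta8 z \<noteq> 0"
  by (simp add: Delta8_def theta2_nonzero theta4_nonzero)

lemma norm_csqrt_pos: "Im z > 0 \<Longrightarrow> cmod (csqrt (- \<i> * z)) > 0"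
  by auto

text \<open>Dividing a suitable power of the form by the nowhere vanishing product
  \<open>theta3\<^sup>a Delta8\<^sup>b\<close> of the same weight gives a function to which the maximum principle applies;
  the slack in the order condition makes the quotient vanish at both cusps.\<close>

theorem theta_form_vanishes:
  assumes form: "theta_form K \<epsilon> F F' A" and \<epsilon>: "cmod \<epsilon> = 1"
    and ord: "\<And>i. i < j \<Longrightarrow> fps_nth A i = 0" and j: "j \<ge> 1"
    and F': "\<And>z. Im z \<ge> 1 \<Longrightarrow> cmod (F' z) \<le> C' * exp (- pi * s * Im z)"
    and weight: "real K < 8 * real j + 4 * s" and z: "Im z > 0"
  shows "F z = 0"
proof -
  have qF: "q_expansion 1 F A" and S: "\<And>z. Im z > 0 \<Longrightarrow> F (-1/z) = \<epsilon> * csqrt (- \<i> * z) ^ K * F z"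
    and T: "\<And>z. Im z > 0 \<Longrightarrow> F (1 - 1/z) = csqrt (- \<i> * z) ^ K * F' z"
    using form by (auto simp: theta_form_def)
  \<comment> \<open>With b = N j - 1 one factor of the nome remains at infinity, and at the cusp 1
    the surplus exponent is N s - a/4 = (N (8j + 4s - K) - 8)/4; N is taken large enough to make it
    positive.\<close>
  obtain N :: nat where "8 / (8 * real j + 4 * s - real K) < real N" using reals_Archimedean2 by blast
  then have N8: "8 < real N * (8 * real j + 4 * s - real K)"
    using weight by (simp add: pos_divide_less_eq)
  then have N: "N \<ge> 1" using weight by (cases N) auto
  define b where "b = N * j - 1"
  have Nj: "N * j \<ge> 1" using N j by (simp add: Suc_le_eq)
  then have bN: "real b = real N * real j - 1" by (simp add: b_def of_nat_diff)
  \<comment> \<open>Chosen so that a + 8b = K N, which matches the weight of F^N; it may be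
    negative.\<close>
  define a :: int where "a = int (K * N) - 8 * int b"
  have a: "real_of_int a = real K * real N - 8 * real b" by (simp add: a_def)
  have decay: "real N * s - real_of_int a / 4 > 0"
    using N8 unfolding a bN by (simp add: algebra_simps)
  define G where "G z = F z ^ N / (theta3 z powi a * Delta8 z ^ b)" for z
  have nG: "cmod (G z) = cmod (F z) ^ N / (cmod (theta3 z) powi a * cmod (Delta8 z) ^ b)" for z
    by (simp add: G_def norm_divide norm_mult norm_power norm_power_int)
  have split: "x ^ (K * N) = x powi a * x ^ (8 * b)" if "x > 0" for x :: real
  proof -
    have "a + int (8 * b) = int (K * N)" by (simp add: a_def)
    then have "x ^ (K * N) = x powi (a + int (8 * b))" by (simp only: power_int_of_nat)
    also have "\<dots> = x powi a * x ^ (8 * b)" using power_int_add[of x a "int (8 * b)"] that unfolding power_int_of_nat by simp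
    finally show ?thesis .
  qed
  have "G z = 0"
  proof (rule theta_group_invariant_vanishes[OF _ _ _ _ _ z])
    show "G holomorphic_on {z. Im z > 0}"
      unfolding G_def
      using theta3_nonzero Delta8_nonzero q_expansion_holomorphic[OF qF] theta3_holomorphic
        q_expansion_holomorphic[OF Delta8_q_expansion]
      by (intro holomorphic_intros holomorphic_on_power_int) auto
    show "G (z + 2) = G z" if "Im z > 0" for z
      by (simp add: G_def q_expansion_periodic[OF qF that] theta3_periodic[OF that] q_expansion_periodic[OF Delta8_q_expansion that])
    show "cmod (G (-1/z)) = cmod (G z)" if z: "Im z > 0" for z
    proof -
      define c where "c = csqrt (- \<i> * z)"
      let ?x = "cmod c"
      have x: "?x > 0" unfolding c_def by (rule norm_csqrt_pos[OF z])
      have D: "Delta8 (-1/z) = csqrt (- \<i> * z) ^ 8 * Delta8 z" using Delta8_form z by (simp add: theta_form_def)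
      have "cmod (G (-1/z)) = ?x ^ (K * N) * cmod (F z) ^ N / (?x powi a * ?x ^ (8 * b) * (cmod (theta3 z) powi a * cmod (Delta8 z) ^ b))"
        unfolding nG S[OF z] theta3_inversion[OF z] D c_def[symmetric]
        by (simp add: norm_mult norm_power \<epsilon> power_mult_distrib power_int_mult_distrib mult_ac flip: power_mult)
      also have "\<dots> = cmod (G z)" unfolding nG split[OF x] using x by simp
      finally show ?thesis .
    qed
    show "\<exists>Y>0. \<forall>z. Im z \<ge> Y \<longrightarrow> cmod (G z) < e" if e: "e > 0" for e
    proof -
      obtain C where C: "C \<ge> 0" "\<And>z. Im z \<ge> 1 \<Longrightarrow> cmod (F z) \<le> C * exp (- pi * real j * Im z)"
        using q_expansion_order[OF qF _ ord] by auto
      obtain Y3 where Y3: "Y3 \<ge> 1" "\<And>z. Im z \<ge> Y3 \<Longrightarrow> 1/2 \<le> cmod (theta3 z) \<and> cmod (theta3 z) \<le> 2" using theta3_bounds by auto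
      obtain Y4 where Y4: "Y4 \<ge> 1" "\<And>z. Im z \<ge> Y4 \<Longrightarrow> 1/2 \<le> cmod (theta4 z)" using theta4_bounds by auto
      obtain Yp where Yp: "Yp \<ge> 1" "\<And>z. Im z \<ge> Yp \<Longrightarrow> 1 \<le> cmod (psi z)" using psi_bounds by auto
      obtain m :: real where m: "m > 0" "\<And>x. 1/2 \<le> x \<Longrightarrow> x \<le> 2 \<Longrightarrow> m \<le> x powi a" using power_int_lower_bound[of "1/2" 2 a] by auto
      \<comment> \<open>The constant 1/256 is (1/2)^4 / 16, from |psi| >= 1 and |theta4| >= 1/2 in
        \<open>Delta8\<close>.\<close>
      define B where "B = C ^ N / (m * (1/256) ^ b)"
      obtain Ye where Ye: "Ye > 0" "\<And>y. y \<ge> Ye \<Longrightarrow> B * exp (- pi * y) < e" using exp_decay[of pi e B] e by auto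
      show ?thesis
      proof (intro exI[of _ "Max {Y3, Y4, Yp, Ye}"] conjI allI impI)
        show "Max {Y3, Y4, Yp, Ye} > 0" using Ye by (simp add: less_max_iff_disj)
        fix z assume "Im z \<ge> Max {Y3, Y4, Yp, Ye}"
        then have y: "Im z \<ge> Y3" "Im z \<ge> Y4" "Im z \<ge> Yp" "Im z \<ge> Ye" by auto
        define y where "y = Im z"
        have D8: "cmod (Delta8 z) \<ge> exp (- pi * y) * (1/256)"
        proof -
          have "cmod (psi z) ^ 4 * cmod (theta4 z) ^ 4 \<ge> 1 ^ 4 * (1/2) ^ 4"
            using Yp(2)[OF y(3)] Y4(2)[OF y(2)] by (intro mult_mono power_mono) auto
          then have "exp (- pi * y) * (1 / 16) * (1 / 16) \<le> exp (- pi * y) * (1 / 16) * (cmod (psi z) ^ 4 * cmod (theta4 z) ^ 4)"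
            by (intro mult_left_mono) (auto simp: power4_eq_xxxx)
          also have "\<dots> = cmod (Delta8 z)"
            by (simp add: Delta8_def norm_mult norm_divide norm_power norm_theta2 power_mult_distrib exp_of_nat_mult[symmetric] y_def)
          finally show ?thesis by simp
        qed
        have "cmod (F z) ^ N \<le> (C * exp (- pi * real j * y)) ^ N"
          using C(2)[of z] y Y3(1) by (intro power_mono) (auto simp: y_def)
        also have "\<dots> = C ^ N * exp (- pi * (real N * real j) * y)"
          by (simp add: power_mult_distrib exp_of_nat_mult[symmetric] mult_ac)
        finally have num: "cmod (F z) ^ N \<le> C ^ N * exp (- pi * (real N * real j) * y)" .
        have "(exp (- pi * y) * (1/256)) ^ b \<le> cmod (Delta8 z) ^ b" using D8 by (intro power_mono) auto
        then have "m * (exp (- pi * y) * (1/256)) ^ b \<le> cmod (theta3 z) powi a * cmod (Delta8 z) ^ b"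
          using m Y3(2)[OF y(1)] by (intro mult_mono) auto
        with num have "cmod (G z) \<le> C ^ N * exp (- pi * (real N * real j) * y) / (m * (exp (- pi * y) * (1/256)) ^ b)"
          unfolding nG using m C(1) by (intro frac_le) auto
        also have "\<dots> = B * exp (- pi * y)"
        proof -
          have "exp (- pi * (real N * real j) * y) = exp (- pi * y) * exp (- pi * y) ^ b"
            unfolding exp_of_nat_mult[symmetric] exp_add[symmetric] bN by (simp add: algebra_simps)
          then show ?thesis by (simp add: B_def power_mult_distrib field_simps)
        qed
        also have "\<dots> < e" using Ye(2)[OF y(4)] by (simp add: y_def)
        finally show "cmod (G z) < e" .
      qed
    qed
    show "\<exists>Y>0. \<forall>z. Im z \<ge> Y \<longrightarrow> cmod (G (1 - 1/z)) < e" if e: "e > 0" for e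
    proof -
      obtain Y3 where Y3: "Y3 \<ge> 1" "\<And>z. Im z \<ge> Y3 \<Longrightarrow> 1/2 \<le> cmod (theta3 z)" using theta3_bounds by auto
      obtain Y4 where Y4: "Y4 \<ge> 1" "\<And>z. Im z \<ge> Y4 \<Longrightarrow> 1/2 \<le> cmod (theta4 z)" using theta4_bounds by auto
      obtain Yp where Yp: "Yp \<ge> 1" "\<And>z. Im z \<ge> Yp \<Longrightarrow> 1 \<le> cmod (psi z) \<and> cmod (psi z) \<le> 4" using psi_bounds by auto
      obtain m :: real where m: "m > 0" "\<And>x. 1 \<le> x \<Longrightarrow> x \<le> 4 \<Longrightarrow> m \<le> x powi a" using power_int_lower_bound[of 1 4 a] by auto
      \<comment> \<open>At the cusp 1 \<open>Delta8\<close> becomes a product bounded below by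
        (1/2)^8 / 16 = 1/4096, and \<open>theta3\<close> becomes \<open>theta2\<close>, whose decay
        exp(-pi y/4) accounts for a/4 in the exponent below.\<close>
      define B where "B = C' ^ N / (m * (1/4096) ^ b)"
      let ?\<kappa> = "pi * (real N * s - real_of_int a / 4)"
      obtain Ye where Ye: "Ye > 0" "\<And>y. y \<ge> Ye \<Longrightarrow> B * exp (- ?\<kappa> * y) < e" using exp_decay[of ?\<kappa> e B] e decay by auto
      show ?thesis
      proof (intro exI[of _ "Max {Y3, Y4, Yp, Ye}"] conjI allI impI)
        show "Max {Y3, Y4, Yp, Ye} > 0" using Ye by (simp add: less_max_iff_disj)
        fix z assume "Im z \<ge> Max {Y3, Y4, Yp, Ye}"
        then have y: "Im z \<ge> Y3" "Im z \<ge> Y4" "Im z \<ge> Yp" "Im z \<ge> Ye" by auto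
        have z: "Im z > 0" "Im z \<ge> 1" using y Y3(1) by auto
        define y where "y = Im z"
        define c where "c = csqrt (- \<i> * z)"
        let ?x = "cmod c"
        have x: "?x > 0" unfolding c_def by (rule norm_csqrt_pos[OF z(1)])
        define D where "D = theta3 z ^ 4 * theta4 z ^ 4 / 16"
        have D: "Delta8 (1 - 1/z) = csqrt (- \<i> * z) ^ 8 * - D" using Delta8_form z by (simp add: theta_form_def D_def)
        have D8: "cmod D \<ge> 1/4096"
        proof -
          have "cmod (theta3 z) ^ 4 * cmod (theta4 z) ^ 4 \<ge> (1/2) ^ 4 * (1/2) ^ 4"
            using Y3(2)[OF y(1)] Y4(2)[OF y(2)] by (intro mult_mono power_mono) auto
          then show ?thesis by (simp add: D_def norm_mult norm_divide norm_power power4_eq_xxxx)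
        qed
        have "cmod (G (1 - 1/z)) = ?x ^ (K * N) * cmod (F' z) ^ N / (?x powi a * ?x ^ (8 * b) * (cmod (theta2 z) powi a * cmod D ^ b))"
          unfolding nG T[OF z(1)] theta3_cusp[OF z(1)] D c_def[symmetric]
          by (simp add: norm_mult norm_power power_mult_distrib power_int_mult_distrib mult_ac flip: power_mult)
        also have "\<dots> = cmod (F' z) ^ N / (cmod (theta2 z) powi a * cmod D ^ b)" unfolding split[OF x] using x by simp
        also have "\<dots> \<le> (C' ^ N * exp (- pi * (real N * s) * y)) / (m * exp (- pi * y * of_int a / 4) * (1/4096) ^ b)"
        proof (rule frac_le)
          have "cmod (F' z) ^ N \<le> (C' * exp (- pi * s * y)) ^ N"
            using F'[OF z(2)] by (intro power_mono) (auto simp: y_def)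
          also have "\<dots> = C' ^ N * exp (- pi * (real N * s) * y)"
            by (simp add: power_mult_distrib exp_of_nat_mult[symmetric] mult_ac)
          finally show "cmod (F' z) ^ N \<le> C' ^ N * exp (- pi * (real N * s) * y)" .
          then show "0 \<le> C' ^ N * exp (- pi * (real N * s) * y)" by (rule order_trans[rotated]) simp
          have "cmod (theta2 z) powi a = exp (- pi * y / 4) powi a * cmod (psi z) powi a"
            by (simp add: norm_theta2 power_int_mult_distrib y_def)
          also have "exp (- pi * y / 4) powi a = exp (- pi * y * of_int a / 4)"
            by (simp add: exp_power_int mult_ac)
          finally have "cmod (theta2 z) powi a = exp (- pi * y * of_int a / 4) * cmod (psi z) powi a" .
          moreover have "m \<le> cmod (psi z) powi a" using m Yp(2)[OF y(3)] by auto
          ultimately have "m * exp (- pi * y * of_int a / 4) \<le> cmod (theta2 z) powi a" by simp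
          moreover have "(1/4096) ^ b \<le> cmod D ^ b" using D8 by (intro power_mono) auto
          ultimately show "m * exp (- pi * y * of_int a / 4) * (1/4096) ^ b \<le> cmod (theta2 z) powi a * cmod D ^ b"
            using m by (intro mult_mono) auto
          show "0 < m * exp (- pi * y * of_int a / 4) * (1/4096) ^ b" using m by simp
        qed
        also have "\<dots> = B * exp (- ?\<kappa> * y)"
        proof -
          have "exp (- pi * (real N * s) * y) = exp (- ?\<kappa> * y) * exp (- pi * y * of_int a / 4)"
            unfolding exp_add[symmetric] by (simp add: algebra_simps)
          then show ?thesis by (simp add: B_def field_simps)
        qed
        also have "\<dots> < e" using Ye(2)[OF y(4)] by (simp add: y_def)
        finally show "cmod (G (1 - 1/z)) < e" .
      qed
    qed
  qed
  then show ?thesis using theta3_nonzero[OF z] Delta8_nonzero[OF z] N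
    by (auto simp: G_def power_int_eq_0_iff)
qed

text \<open>Up to a nonzero factor, \<open>F'\<close> is \<open>F\<close> at the point 1 - 1/z. This
  passes vanishing from a lattice to its shadow.\<close>

lemma theta_form_dual_vanishes:
  assumes "theta_form K \<epsilon> F F' A" "\<And>z. Im z > 0 \<Longrightarrow> F z = 0" "Im z > 0"
  shows "F' z = 0"
proof -
  have "Im (1 - 1/z) > 0" using Im_inversion[OF assms(3)] by simp
  then have "csqrt (- \<i> * z) ^ K * F' z = 0" using assms by (metis theta_form_def)
  then show ?thesis using norm_csqrt_pos[OF assms(3)] by auto
qed

section \<open>Theta series of selfdual lattices\<close>

definition theta_series :: "(real^'n) set \<Rightarrow> (real^'n \<Rightarrow> real) \<Rightarrow> complex \<Rightarrow> complex" where
  "theta_series A P z = (\<Sum>\<^sub>\<infinity>x\<in>A. of_real (P x) * exp (\<i> * of_real pi * z * of_real (x \<bullet> x)))"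

definition shell_sums :: "nat \<Rightarrow> (real^'n) set \<Rightarrow> (real^'n \<Rightarrow> real) \<Rightarrow> complex fps" where
  "shell_sums r A P = Abs_fps (\<lambda>k. of_real (\<Sum>x\<in>shell A (real k / real r). P x))"

text \<open>An analytic form of discreteness, supplied by Poisson summation for lattices and cosets
  alike; it yields finite shells and convergence with polynomial weights.\<close>

definition gauss_set :: "(real^'n) set \<Rightarrow> bool" where
  "gauss_set A \<longleftrightarrow> (\<forall>t>0. (\<lambda>x. exp (- t * (norm x)\<^sup>2)) summable_on A)"

text \<open>The Gaussian is a positive constant on a shell, and summability of a positive constant
  bounds the size of finite subsets.\<close>

lemma finite_shell:
  assumes "gauss_set A"
  shows "finite (shell A m)"
proof -
  have "(\<lambda>x. exp (- 1 * (norm x)\<^sup>2)) summable_on A"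
    using assms zero_less_one unfolding gauss_set_def by blast
  then have "(\<lambda>x. exp (- 1 * (norm x)\<^sup>2)) summable_on shell A m"
    by (rule summable_on_subset_banach) (auto simp: shell_def)
  moreover have "exp (- 1 * (norm x)\<^sup>2) = exp (- m)" if "x \<in> shell A m" for x
    using that by (simp add: shell_def power2_norm_eq_inner)
  ultimately have s: "(\<lambda>x. exp (- m)) summable_on shell A m"
    using summable_on_cong[of "shell A m" "\<lambda>x. exp (- 1 * (norm x)\<^sup>2)" "\<lambda>x. exp (- m)"] by blast
  define C where "C = infsum (\<lambda>x. exp (- m)) (shell A m)"
  have C: "real (card F) * exp (- m) \<le> C" if "finite F" "F \<subseteq> shell A m" for F
    using finite_sum_le_infsum[OF s that, folded C_def] by simp
  show ?thesis
  proof (rule ccontr)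
    assume "infinite (shell A m)"
    then obtain F where F: "finite F" "card F = Suc (nat \<lceil>C * exp m\<rceil>)" "F \<subseteq> shell A m"
      using infinite_arbitrarily_large by blast
    have "real (card F) \<le> C * exp m" using C[OF F(1,3)] by (simp add: exp_minus field_simps)
    moreover have "real (card F) > C * exp m" using F(2) by linarith
    ultimately show False by simp
  qed
qed

lemma gauss_hpoly_abs_summable:
  assumes A: "gauss_set A" and t: "t > 0"
  shows "(\<lambda>x. \<bar>hpoly d c x\<bar> * exp (- t * (norm x)\<^sup>2)) summable_on A"
proof -
  let ?W = "\<lambda>x. complex_of_real (exp (- t * (norm x)\<^sup>2))"
  have s: "(\<lambda>x. ?W x * of_real (vmon x \<alpha>)) summable_on A" for \<alpha>
    using A t by (intro gauss_vmon_summable[where t = t]) (auto simp: gauss_set_def)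
  have "((\<lambda>x. \<Sum>\<alpha>\<in>monomials_deg d. of_real (c \<alpha>) * (?W x * of_real (vmon x \<alpha>))) has_sum
    (\<Sum>\<alpha>\<in>monomials_deg d. of_real (c \<alpha>) * (\<Sum>\<^sub>\<infinity>x\<in>A. ?W x * of_real (vmon x \<alpha>)))) A"
    using s by (intro has_sum_finite_sum has_sum_cmult_right has_sum_infsum) auto
  moreover have "(\<Sum>\<alpha>\<in>monomials_deg d. of_real (c \<alpha>) * (?W x * of_real (vmon x \<alpha>))) = of_real (hpoly d c x * exp (- t * (norm x)\<^sup>2))" for x
    by (simp add: hpoly_def vmon_def sum_distrib_left sum_distrib_right mult_ac)
  ultimately have "(\<lambda>x. complex_of_real (hpoly d c x * exp (- t * (norm x)\<^sup>2))) summable_on A"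
    using has_sum_imp_summable by (simp only:) blast
  then have "(\<lambda>x. norm (complex_of_real (hpoly d c x * exp (- t * (norm x)\<^sup>2)))) summable_on A"
    by (simp only: summable_on_iff_abs_summable_on_complex)
  then show ?thesis by (simp add: norm_mult abs_mult)
qed

lemma theta_series_q_expansion:
  assumes A: "gauss_set A" and r: "r > 0" and int: "\<And>x. x \<in> A \<Longrightarrow> real r * (x \<bullet> x) \<in> \<nat>"
  shows "q_expansion r (theta_series A (hpoly d c)) (shell_sums r A (hpoly d c))"
proof -
  define \<nu> where "\<nu> x = nat \<lfloor>real r * (x \<bullet> x)\<rfloor>" for x :: "real^'a"
  have \<nu>: "real (\<nu> x) = real r * (x \<bullet> x)" if xA: "x \<in> A" for x
  proof -
    obtain n where "real r * (x \<bullet> x) = real n" using int[OF xA] by (rule Nats_cases)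
    then show ?thesis by (simp add: \<nu>_def)
  qed
  have fib: "{x \<in> A. \<nu> x = k} = shell A (real k / real r)" for k
  proof -
    have "\<nu> x = k \<longleftrightarrow> x \<bullet> x = real k / real r" if "x \<in> A" for x
      using \<nu>[OF that] r by (auto simp: field_simps)
    then show ?thesis by (auto simp: shell_def)
  qed
  have summ: "(\<lambda>x. cmod (of_real (hpoly d c x)) * \<rho> ^ \<nu> x) summable_on A" if \<rho>: "0 < \<rho>" "\<rho> < 1" for \<rho> :: real
  proof -
    have "\<rho> ^ \<nu> x = exp (- (- ln \<rho> * real r) * (norm x)\<^sup>2)" if "x \<in> A" for x
    proof -
      have "\<rho> ^ \<nu> x = exp (real (\<nu> x) * ln \<rho>)" using \<rho> by (simp add: exp_of_nat_mult)
      then show ?thesis by (simp add: \<nu>[OF that] power2_norm_eq_inner mult_ac)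
    qed
    moreover have "(\<lambda>x. \<bar>hpoly d c x\<bar> * exp (- (- ln \<rho> * real r) * (norm x)\<^sup>2)) summable_on A"
      using \<rho> r by (intro gauss_hpoly_abs_summable[OF A]) (simp add: mult_neg_pos)
    ultimately show ?thesis by (subst summable_on_cong[where g = "\<lambda>x. \<bar>hpoly d c x\<bar> * exp (- (- ln \<rho> * real r) * (norm x)\<^sup>2)"]) auto
  qed
  note q = q_series[of "\<lambda>x. of_real (hpoly d c x)" \<nu> A, OF summ]
  have S: "Abs_fps (\<lambda>k. \<Sum>\<^sub>\<infinity>x\<in>{x \<in> A. \<nu> x = k}. complex_of_real (hpoly d c x)) = shell_sums r A (hpoly d c)"
    unfolding fib shell_sums_def using finite_shell[OF A] by simp
  show ?thesis
    unfolding q_expansion_def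
  proof (intro conjI allI impI)
    show "fps_conv_radius (shell_sums r A (hpoly d c)) \<ge> 1" using q(1) unfolding S .
    fix z assume z: "Im z > 0"
    let ?q = "exp (\<i> * of_real pi * z / of_nat r)"
    have "((\<lambda>x. of_real (hpoly d c x) * ?q ^ \<nu> x) has_sum eval_fps (shell_sums r A (hpoly d c)) ?q) A"
      using q(2)[of ?q] norm_nome_less[OF r z] unfolding S by simp
    moreover have "?q ^ \<nu> x = exp (\<i> * of_real pi * z * of_real (x \<bullet> x))" if "x \<in> A" for x
    proof -
      have "of_nat (\<nu> x) = complex_of_real (real r * (x \<bullet> x))" using \<nu>[OF that] by (metis of_real_of_nat_eq)
      then show ?thesis using r by (simp add: exp_of_nat_mult[symmetric] mult_ac)
    qed
    ultimately have "((\<lambda>x. of_real (hpoly d c x) * exp (\<i> * of_real pi * z * of_real (x \<bullet> x))) has_sum eval_fps (shell_sums r A (hpoly d c)) ?q) A"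
      by (subst has_sum_cong[where g = "\<lambda>x. of_real (hpoly d c x) * ?q ^ \<nu> x"]) auto
    then show "theta_series A (hpoly d c) z = eval_fps (shell_sums r A (hpoly d c)) ?q"
      unfolding theta_series_def by (rule infsumI)
  qed
qed

text \<open>Levels that are not of the form k/r have empty shells, so a vanishing series settles
  every real \<open>m\<close>.\<close>

lemma shell_sum_zero:
  assumes S: "shell_sums r A P = 0" and r: "r > 0" and int: "\<And>x. x \<in> A \<Longrightarrow> real r * (x \<bullet> x) \<in> \<nat>"
  shows "(\<Sum>x\<in>shell A m. P x) = 0"
proof (cases "shell A m = {}")
  case False
  then obtain x where "x \<in> A" "x \<bullet> x = m" by (auto simp: shell_def)
  with int obtain k where "real r * m = real k" by (metis Nats_cases)
  then have m: "m = real k / real r" using r by (simp add: field_simps)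
  have "fps_nth (shell_sums r A P) k = 0" using S by simp
  then have "complex_of_real (\<Sum>x\<in>shell A m. P x) = 0" by (simp add: shell_sums_def m del: of_real_sum)
  then show ?thesis by (simp only: of_real_eq_0_iff)
qed simp

lemma gauss_set_selfdual:
  assumes "selfdual L" shows "gauss_set L"
  unfolding gauss_set_def using selfdual_gauss_summable[OF assms, of "_ / pi" 0] by simp

lemma gauss_set_coset:
  assumes "selfdual L" shows "gauss_set ((\<lambda>x. x + w) ` L)"
  unfolding gauss_set_def
proof (intro allI impI)
  fix t :: real assume "t > 0"
  then show "(\<lambda>x. exp (- t * (norm x)\<^sup>2)) summable_on (\<lambda>x. x + w) ` L"
    using selfdual_gauss_summable[OF assms, of "t / pi" w]
    by (subst summable_on_reindex) (auto simp: o_def)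
qed

lemma selfdual_norm_nat:
  assumes "selfdual L" "x \<in> L" shows "x \<bullet> x \<in> \<nat>"
  using selfdual_inner[OF assms(1) assms(2) assms(2)] by (simp add: Nats_altdef2)

lemma shadow_norm_nat:
  assumes L: "selfdual L" and w: "w \<in> L" and x: "x \<in> (\<lambda>x. x + (1/2) *\<^sub>R w) ` L"
  shows "real 4 * (x \<bullet> x) \<in> \<nat>"
proof -
  obtain v where v: "v \<in> L" "x = v + (1/2) *\<^sub>R w" using x by auto
  have "4 * (x \<bullet> x) = 4 * (v \<bullet> v) + 4 * (v \<bullet> w) + w \<bullet> w"
    by (simp add: v(2) inner_add_left inner_add_right inner_commute[of w v])
  moreover have "4 * (v \<bullet> v) + 4 * (v \<bullet> w) + w \<bullet> w \<in> \<int>"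
    using selfdual_inner[OF L v(1) v(1)] selfdual_inner[OF L v(1) w] selfdual_inner[OF L w w] by auto
  moreover have "4 * (x \<bullet> x) \<ge> 0" by simp
  ultimately show ?thesis unfolding Nats_altdef2 by simp
qed

text \<open>Inversion of \<open>theta_series\<close> on the imaginary axis comes from harmonic Poisson summation; the
  translate by \<open>1\<close> twists the sum by the parity of the norm, which is dual to the shadow.\<close>

lemma theta_series_form:
  fixes L :: "(real^'n) set"
  assumes L: "selfdual L" and harm: "harmonic d c" and d: "even d"
  shows "theta_form (CARD('n) + 2 * d) (\<i> ^ d) (theta_series L (hpoly d c))
    (\<lambda>z. \<i> ^ d * theta_series (shadow L) (hpoly d c) z) (shell_sums 1 L (hpoly d c))"
    and "q_expansion 4 (theta_series (shadow L) (hpoly d c)) (shell_sums 4 (shadow L) (hpoly d c))"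
proof -
  let ?P = "hpoly d c" and ?\<Theta> = "theta_series L (hpoly d c)"
  obtain w where w: "w \<in> L" "\<And>x. x \<in> L \<Longrightarrow> \<exists>k::int. x \<bullet> x - x \<bullet> w = 2 * of_int k"
    using characteristic_vector[OF L] by blast
  have sh: "shadow L = (\<lambda>x. x + (1/2) *\<^sub>R w) ` L" by (rule shadow_eq_coset[OF L w])
  have q: "q_expansion 1 ?\<Theta> (shell_sums 1 L ?P)"
    using selfdual_norm_nat[OF L] by (intro theta_series_q_expansion gauss_set_selfdual L) auto
  show qs: "q_expansion 4 (theta_series (shadow L) ?P) (shell_sums 4 (shadow L) ?P)"
    unfolding sh using shadow_norm_nat[OF L w(1)] by (intro theta_series_q_expansion gauss_set_coset L) auto
  have ii: "\<i> ^ d * \<i> ^ d = 1" using d by (auto elim!: evenE simp: power_mult power_mult_distrib[symmetric])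
  have sgn: "(- t) ^ d = t ^ d" for t :: real using d by simp
  have trm: "exp (\<i> * of_real pi * (\<i> * of_real s) * of_real (x \<bullet> x)) = complex_of_real (exp (- pi * s * (norm x)\<^sup>2))" for s and x :: "real^'n"
    by (simp add: exp_of_real[symmetric] power2_norm_eq_inner mult_ac)
  have im: "theta_series A ?P (\<i> * of_real s) = (\<Sum>\<^sub>\<infinity>x\<in>A. of_real (exp (- pi * s * (norm x)\<^sup>2)) * of_real (?P x))" for A s
    unfolding theta_series_def by (simp only: trm) (simp only: mult.commute)
  \<comment> \<open>Translation by 1 multiplies the term of y by (-1)^(y.y), which the
    characteristic vector turns into the character cis(2 pi y . w/2): the dual side of the coset w/2
    + L.\<close>
  have im1: "?\<Theta> (1 + \<i> * of_real s) = (\<Sum>\<^sub>\<infinity>y\<in>L. (of_real (exp (- pi * s * (norm y)\<^sup>2)) * cis (2 * pi * (y \<bullet> ((1/2) *\<^sub>R w)))) * of_real (?P y))" for s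
    unfolding theta_series_def
  proof (rule infsum_cong)
    fix y assume "y \<in> L"
    then obtain k :: int where k: "y \<bullet> y - y \<bullet> w = 2 * of_int k" using w(2) by blast
    have "cis (pi * (y \<bullet> y)) = cis (pi * (y \<bullet> w) + 2 * pi * of_int k)"
    proof -
      have "pi * (y \<bullet> y) = pi * (y \<bullet> w) + pi * (y \<bullet> y - y \<bullet> w)" by (simp add: algebra_simps)
      then show ?thesis unfolding k by (simp add: mult_ac)
    qed
    also have "\<dots> = cis (pi * (y \<bullet> w)) * cis (2 * pi * of_int k)" by (simp only: cis_mult)
    also have "cis (2 * pi * of_int k) = 1" by (rule cis_multiple_2pi) auto
    finally have c: "exp (\<i> * of_real pi * of_real (y \<bullet> y)) = cis (2 * pi * (y \<bullet> ((1/2) *\<^sub>R w)))"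
      by (simp add: cis_conv_exp mult_ac)
    have "exp (\<i> * of_real pi * (1 + \<i> * of_real s) * of_real (y \<bullet> y)) =
      exp (\<i> * of_real pi * of_real (y \<bullet> y)) * exp (\<i> * of_real pi * (\<i> * of_real s) * of_real (y \<bullet> y))"
      unfolding exp_add[symmetric] by (simp add: algebra_simps)
    then show "of_real (?P y) * exp (\<i> * of_real pi * (1 + \<i> * of_real s) * of_real (y \<bullet> y)) =
      (of_real (exp (- pi * s * (norm y)\<^sup>2)) * cis (2 * pi * (y \<bullet> ((1/2) *\<^sub>R w)))) * of_real (?P y)"
      unfolding c trm by (simp only: mult_ac)
  qed
  have rt: "complex_of_real (sqrt t) ^ (CARD('n) + 2 * d) = of_real (sqrt t ^ CARD('n)) * of_real (t ^ d)" if "t > 0" for t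
    using that by (simp add: power_add power_mult flip: of_real_power)
  have quot: "- pi * (norm y)\<^sup>2 / t = - pi * (1 / t) * (norm y)\<^sup>2" for y :: "real^'n" and t by simp
  \<comment> \<open>Solves the Poisson relation for the inverted series. As d is even, i^d is its
    own inverse and (-t)^d = t^d, which joins t^(n/2) to give the power n + 2d of sqrt t.\<close>
  have key: "Y = \<i> ^ d * of_real (sqrt t) ^ (CARD('n) + 2 * d) * X"
    if t: "t > 0" and eq: "of_real ((- t) ^ d) * X = of_real ((1 / sqrt t) ^ CARD('n)) * \<i> ^ d * Y" for t X Y
  proof -
    have "complex_of_real (sqrt t ^ CARD('n)) * of_real ((1 / sqrt t) ^ CARD('n)) = 1"
      using t by (simp add: power_divide flip: of_real_mult)
    then have "Y = (complex_of_real (sqrt t ^ CARD('n)) * of_real ((1 / sqrt t) ^ CARD('n))) * (\<i> ^ d * \<i> ^ d) * Y" using ii by simp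
    also have "\<dots> = \<i> ^ d * of_real (sqrt t ^ CARD('n)) * (of_real ((1 / sqrt t) ^ CARD('n)) * \<i> ^ d * Y)" by (simp only: mult_ac)
    also have "\<dots> = \<i> ^ d * of_real (sqrt t ^ CARD('n)) * (of_real (t ^ d) * X)" unfolding eq[symmetric] sgn ..
    finally show ?thesis unfolding rt[OF t] by (simp only: mult_ac)
  qed
  have hol: "?\<Theta> holomorphic_on {z. Im z > 0}" using q_expansion_holomorphic[OF q] by simp
  have hols: "theta_series (shadow L) ?P holomorphic_on {z. Im z > 0}" using q_expansion_holomorphic[OF qs] by simp
  show "theta_form (CARD('n) + 2 * d) (\<i> ^ d) ?\<Theta> (\<lambda>z. \<i> ^ d * theta_series (shadow L) ?P z) (shell_sums 1 L ?P)"
    unfolding theta_form_def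
  proof (intro conjI q allI impI)
    fix z assume z: "Im z > 0"
    show "?\<Theta> (-1/z) = \<i> ^ d * csqrt (- \<i> * z) ^ (CARD('n) + 2 * d) * ?\<Theta> z"
    proof (rule upper_half_plane_identity[OF _ _ _ z])
      show "(\<lambda>z. ?\<Theta> (-1/z)) holomorphic_on {z. Im z > 0}" by (rule inversion_holomorphic[OF hol])
      show "(\<lambda>z. \<i> ^ d * csqrt (- \<i> * z) ^ (CARD('n) + 2 * d) * ?\<Theta> z) holomorphic_on {z. Im z > 0}"
        by (intro holomorphic_on_mult holomorphic_on_power holomorphic_on_const csqrt_holomorphic hol)
      fix t :: real assume t: "t > 0"
      show "?\<Theta> (-1 / (\<i> * of_real t)) = \<i> ^ d * csqrt (- \<i> * (\<i> * of_real t)) ^ (CARD('n) + 2 * d) * ?\<Theta> (\<i> * of_real t)"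
        unfolding inversion_imaginary csqrt_imaginary[OF t]
      proof (rule key[OF t])
        show "of_real ((- t) ^ d) * ?\<Theta> (\<i> * of_real t) = of_real ((1 / sqrt t) ^ CARD('n)) * \<i> ^ d * ?\<Theta> (\<i> * of_real (1 / t))"
          using selfdual_harmonic_poisson[OF L harm t, of 0, unfolded quot] unfolding im by simp
      qed
    qed
    have "?\<Theta> (1 - 1/z) = \<i> ^ d * csqrt (- \<i> * z) ^ (CARD('n) + 2 * d) * theta_series (shadow L) ?P z"
    proof (rule upper_half_plane_identity[OF _ _ _ z])
      show "(\<lambda>z. ?\<Theta> (1 - 1/z)) holomorphic_on {z. Im z > 0}" by (rule cusp_holomorphic[OF hol])
      show "(\<lambda>z. \<i> ^ d * csqrt (- \<i> * z) ^ (CARD('n) + 2 * d) * theta_series (shadow L) ?P z) holomorphic_on {z. Im z > 0}"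
        by (intro holomorphic_on_mult holomorphic_on_power holomorphic_on_const csqrt_holomorphic hols)
      fix t :: real assume t: "t > 0"
      have "1 - 1 / (\<i> * complex_of_real t) = 1 + \<i> * of_real (1 / t)" using inversion_imaginary[of t] by simp
      then show "?\<Theta> (1 - 1 / (\<i> * of_real t)) = \<i> ^ d * csqrt (- \<i> * (\<i> * of_real t)) ^ (CARD('n) + 2 * d) * theta_series (shadow L) ?P (\<i> * of_real t)"
        unfolding csqrt_imaginary[OF t]
        by (simp only:) (rule key[OF t], unfold im im1 sh, rule selfdual_harmonic_poisson[OF L harm t, of "(1/2) *\<^sub>R w", unfolded quot])
    qed
    then show "?\<Theta> (1 - 1/z) = csqrt (- \<i> * z) ^ (CARD('n) + 2 * d) * (\<i> ^ d * theta_series (shadow L) ?P z)"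
      by (simp only: mult_ac)
  qed
qed

lemma shadow_props:
  fixes L :: "(real^'n) set"
  assumes L: "selfdual L"
  shows gauss_set_shadow: "gauss_set (shadow L)"
    and shadow_nonempty: "shadow L \<noteq> {}"
    and shadow_uminus: "x \<in> shadow L \<Longrightarrow> - x \<in> shadow L"
    and shadow_nat: "x \<in> shadow L \<Longrightarrow> real 4 * (x \<bullet> x) \<in> \<nat>"
proof -
  obtain w where w: "w \<in> L" "\<And>x. x \<in> L \<Longrightarrow> \<exists>k::int. x \<bullet> x - x \<bullet> w = 2 * of_int k"
    using characteristic_vector[OF L] by blast
  have sh: "shadow L = (\<lambda>x. x + (1/2) *\<^sub>R w) ` L" by (rule shadow_eq_coset[OF L w])
  show "gauss_set (shadow L)" unfolding sh by (rule gauss_set_coset[OF L])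
  show "shadow L \<noteq> {}" unfolding sh using selfdual_zero[OF L] by auto
  show "x \<in> shadow L \<Longrightarrow> real 4 * (x \<bullet> x) \<in> \<nat>" unfolding sh by (rule shadow_norm_nat[OF L w(1)])
  show "- x \<in> shadow L" if xs: "x \<in> shadow L"
  proof -
    obtain v where v: "v \<in> L" "x = v + (1/2) *\<^sub>R w" using xs by (auto simp: sh)
    have "(1/2) *\<^sub>R w + (1/2) *\<^sub>R w = w" by (simp flip: scaleR_add_left)
    then have "- x = (- v + - w) + (1/2) *\<^sub>R w" by (simp add: v(2) algebra_simps)
    moreover have "- v + - w \<in> L" by (intro selfdual_add[OF L] selfdual_uminus[OF L] v(1) w(1))
    ultimately show ?thesis unfolding sh by blast
  qed
qed

section \<open>Low coefficients and growth at the cusp 1\<close>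

lemma fps_mult_low:
  fixes A B :: "complex fps"
  shows "fps_nth (A * B) 0 = fps_nth A 0 * fps_nth B 0"
    and "fps_nth (A * B) (Suc 0) = fps_nth A 0 * fps_nth B (Suc 0) + fps_nth A (Suc 0) * fps_nth B 0"
    and "fps_nth (A * B) 2 = fps_nth A 0 * fps_nth B 2 + fps_nth A (Suc 0) * fps_nth B (Suc 0) + fps_nth A 2 * fps_nth B 0"
  by (simp_all add: fps_mult_nth numeral_2_eq_2)

text \<open>The third clause is doubled so that the induction need not divide the binomial
  coefficient n(n - 1)/2.\<close>

lemma fps_power_low:
  fixes A :: "complex fps"
  assumes "fps_nth A 0 = 1"
  shows "fps_nth (A ^ n) 0 = 1"
    and "fps_nth (A ^ n) (Suc 0) = of_nat n * fps_nth A (Suc 0)"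
    and "2 * fps_nth (A ^ n) 2 = 2 * of_nat n * fps_nth A 2 + of_nat n * (of_nat n - 1) * (fps_nth A (Suc 0))\<^sup>2"
proof (induction n)
  case (Suc n)
  {
    case 1 show ?case using Suc.IH(1) assms by (simp add: fps_mult_low)
  next
    case 2 show ?case using Suc.IH(1,2) assms by (simp add: fps_mult_low algebra_simps)
  next
    case 3
    have "2 * fps_nth (A ^ Suc n) 2 = 2 * fps_nth (A ^ n) 2 + 2 * fps_nth A (Suc 0) * (of_nat n * fps_nth A (Suc 0)) + 2 * fps_nth A 2"
      using Suc.IH(1,2) assms by (simp add: fps_mult_low algebra_simps)
    also have "\<dots> = 2 * of_nat (Suc n) * fps_nth A 2 + of_nat (Suc n) * (of_nat (Suc n) - 1) * (fps_nth A (Suc 0))\<^sup>2"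
      unfolding Suc.IH(3) by (simp add: power2_eq_square algebra_simps)
    finally show ?case .
  }
qed (use assms in \<open>simp_all\<close>)

lemma theta4_fps_coeffs: "fps_nth theta4_fps 0 = 1" "fps_nth theta4_fps (Suc 0) = -2" "fps_nth theta4_fps 2 = 0"
  by (simp_all add: theta4_fps_def theta3_fps_coeffs)

lemma psi_fps_power4_coeffs: "fps_nth (psi_fps ^ 4) 0 = 16" "fps_nth (psi_fps ^ 4) (Suc 0) = 0"
proof -
  have "psi_fps ^ 4 = psi_fps * (psi_fps * (psi_fps * psi_fps))" by (simp add: eval_nat_numeral)
  then show "fps_nth (psi_fps ^ 4) 0 = 16" "fps_nth (psi_fps ^ 4) (Suc 0) = 0"
    by (simp_all add: fps_mult_low psi_fps_coeffs)
qed

lemma Delta8_fps_coeffs: "fps_nth Delta8_fps 0 = 0" "fps_nth Delta8_fps (Suc 0) = 1" "fps_nth Delta8_fps 2 = -8"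
proof -
  let ?B = "fps_const (1/16) * (psi_fps ^ 4 * theta4_fps ^ 4)"
  have B: "fps_nth ?B 0 = 1" "fps_nth ?B (Suc 0) = -8"
    using fps_power_low(1,2)[OF theta4_fps_coeffs(1), of 4]
    by (simp_all add: fps_mult_low psi_fps_power4_coeffs theta4_fps_coeffs)
  show "fps_nth Delta8_fps 0 = 0" "fps_nth Delta8_fps (Suc 0) = 1" "fps_nth Delta8_fps 2 = -8"
    unfolding Delta8_fps_def using B by (simp_all add: fps_X_mult_nth numeral_2_eq_2)
qed

lemma theta3_fps_power_coeffs:
  "fps_nth (theta3_fps ^ n) 0 = 1" "fps_nth (theta3_fps ^ n) (Suc 0) = 2 * of_nat n"
  "fps_nth (theta3_fps ^ n) 2 = 2 * of_nat n * (of_nat n - 1)"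
proof -
  show "fps_nth (theta3_fps ^ n) 0 = 1" "fps_nth (theta3_fps ^ n) (Suc 0) = 2 * of_nat n"
    using fps_power_low(1,2)[OF theta3_fps_coeffs(1), of n] by (simp_all add: theta3_fps_coeffs mult_ac)
  have "2 * fps_nth (theta3_fps ^ n) 2 = 2 * (2 * of_nat n * (of_nat n - 1))"
    using fps_power_low(3)[OF theta3_fps_coeffs(1), of n] unfolding theta3_fps_coeffs by (simp add: algebra_simps)
  then show "fps_nth (theta3_fps ^ n) 2 = 2 * of_nat n * (of_nat n - 1)" by (simp only: mult_cancel_left) simp
qed

lemma theta_bounded:
  "\<exists>C\<ge>0. \<forall>z. Im z \<ge> 1 \<longrightarrow> cmod (theta2 z) \<le> C * exp (- pi * Im z / 4) \<and> cmod (theta3 z) \<le> C \<and> cmod (theta4 z) \<le> C"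
proof -
  obtain C1 where C1: "C1 \<ge> 0" "\<And>z. Im z \<ge> 1 \<Longrightarrow> cmod (psi z) \<le> C1"
    using q_expansion_order[OF psi_q_expansion, of 0] by auto
  obtain C2 where C2: "\<And>z. Im z \<ge> 1 \<Longrightarrow> cmod (theta3 z) \<le> C2"
    using q_expansion_order[OF theta3_q_expansion, of 0] by auto
  obtain C3 where C3: "\<And>z. Im z \<ge> 1 \<Longrightarrow> cmod (theta4 z) \<le> C3"
    using q_expansion_order[OF theta4_q_expansion, of 0] by auto
  define C where "C = max C1 (max C2 C3)"
  have "C \<ge> 0" "C1 \<le> C" "C2 \<le> C" "C3 \<le> C" using C1 by (auto simp: C_def)
  moreover have "cmod (theta2 z) \<le> C * exp (- pi * Im z / 4)" if "Im z \<ge> 1" for z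
    using C1(2)[OF that] \<open>C1 \<le> C\<close> unfolding norm_theta2 by (subst mult.commute) (intro mult_right_mono; simp)
  ultimately show ?thesis using C2 C3 by (intro exI[of _ C]) (auto intro: order_trans)
qed

text \<open>Each factor \<open>theta2\<close> carries a fourth root of the nome, so its k-th power
  supplies order k/4.\<close>

lemma theta2_power_bound:
  assumes "\<And>z. Im z \<ge> 1 \<Longrightarrow> cmod (H z) \<le> B"
  shows "\<exists>C. \<forall>z. Im z \<ge> 1 \<longrightarrow> cmod (theta2 z ^ k * H z) \<le> C * exp (- pi * (real k / 4) * Im z)"
proof -
  obtain C where C: "C \<ge> 0" "\<And>z. Im z \<ge> 1 \<Longrightarrow> cmod (theta2 z) \<le> C * exp (- pi * Im z / 4)"
    using theta_bounded by blast
  have "cmod (theta2 z ^ k * H z) \<le> C ^ k * B * exp (- pi * (real k / 4) * Im z)" if z: "Im z \<ge> 1" for z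
  proof -
    have "B \<ge> 0" using assms[OF z] by (rule order_trans[OF norm_ge_zero])
    have "cmod (theta2 z ^ k * H z) \<le> (C * exp (- pi * Im z / 4)) ^ k * B"
      unfolding norm_mult norm_power using C(2)[OF z] assms[OF z] C(1)
      by (intro mult_mono power_mono) auto
    also have "\<dots> = C ^ k * B * exp (- pi * (real k / 4) * Im z)"
      by (simp add: power_mult_distrib exp_of_nat_mult[symmetric] mult_ac)
    finally show ?thesis .
  qed
  then show ?thesis by blast
qed

lemma theta34_bounded: "\<exists>B. \<forall>z. Im z \<ge> 1 \<longrightarrow> cmod (theta3 z ^ i * theta4 z ^ j) \<le> B"
proof -
  obtain C where C: "C \<ge> 0" "\<And>z. Im z \<ge> 1 \<Longrightarrow> cmod (theta3 z) \<le> C \<and> cmod (theta4 z) \<le> C"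
    using theta_bounded by blast
  have "cmod (theta3 z ^ i * theta4 z ^ j) \<le> C ^ i * C ^ j" if "Im z \<ge> 1" for z
    unfolding norm_mult norm_power using C(2)[OF that] C(1) by (intro mult_mono power_mono) auto
  then show ?thesis by blast
qed

lemma diff_bound:
  assumes "\<exists>C. \<forall>z. Im z \<ge> 1 \<longrightarrow> cmod (F z) \<le> C * exp (- pi * s * Im z)"
    and "\<exists>C. \<forall>z. Im z \<ge> 1 \<longrightarrow> cmod (G z) \<le> C * exp (- pi * s * Im z)"
  shows "\<exists>C. \<forall>z. Im z \<ge> 1 \<longrightarrow> cmod (F z - c * G z) \<le> C * exp (- pi * s * Im z)"
proof -
  obtain C1 C2 where C1: "\<And>z. Im z \<ge> 1 \<Longrightarrow> cmod (F z) \<le> C1 * exp (- pi * s * Im z)"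
    and C2: "\<And>z. Im z \<ge> 1 \<Longrightarrow> cmod (G z) \<le> C2 * exp (- pi * s * Im z)" using assms by blast
  have "cmod (F z - c * G z) \<le> (C1 + cmod c * C2) * exp (- pi * s * Im z)" if z: "Im z \<ge> 1" for z
  proof -
    have "cmod (F z - c * G z) \<le> cmod (F z) + cmod c * cmod (G z)"
      using norm_triangle_ineq4[of "F z" "c * G z"] by (simp add: norm_mult)
    also have "\<dots> \<le> C1 * exp (- pi * s * Im z) + cmod c * (C2 * exp (- pi * s * Im z))"
      using C1[OF z] C2[OF z] by (intro add_mono mult_left_mono) auto
    finally show ?thesis by (simp add: algebra_simps)
  qed
  then show ?thesis by blast
qed

text \<open>Norms at least k/4 annihilate the first k coefficients of the expansion in the fourth
  root of the nome; a lower bound for the shadow thus becomes an order at the cusp 1.\<close>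

lemma shadow_series_bound:
  fixes L :: "(real^'n) set"
  assumes L: "selfdual L" and harm: "harmonic d c" and d: "even d"
    and sh: "\<And>x. x \<in> shadow L \<Longrightarrow> real k / 4 \<le> x \<bullet> x"
  shows "\<exists>C. \<forall>z. Im z \<ge> 1 \<longrightarrow> cmod (\<i> ^ d * theta_series (shadow L) (hpoly d c) z) \<le> C * exp (- pi * (real k / 4) * Im z)"
proof -
  have "fps_nth (shell_sums 4 (shadow L) (hpoly d c)) i = 0" if "i < k" for i
  proof -
    have "shell (shadow L) (real i / real 4) = {}" using sh that by (force simp: shell_def)
    then show ?thesis by (simp add: shell_sums_def)
  qed
  then show ?thesis
    using q_expansion_order[OF theta_series_form(2)[OF L harm d], of k] by (auto simp: norm_mult norm_power mult_ac)
qed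

section \<open>The vanishing criterion for lattices of minimum at least 2\<close>

lemma shell_sums_low:
  fixes L :: "(real^'n) set"
  assumes L: "selfdual L" and min: "\<And>x. x \<in> L \<Longrightarrow> x \<noteq> 0 \<Longrightarrow> 2 \<le> x \<bullet> x"
  shows "shell L 0 = {0}" "shell L 1 = {}"
proof -
  show "shell L 0 = {0}" using selfdual_zero[OF L] by (auto simp: shell_def)
  have "x \<bullet> x \<noteq> 1" if "x \<in> L" for x using min[OF that] by (cases "x = 0") auto
  then show "shell L 1 = {}" by (auto simp: shell_def)
qed

lemma hpoly_at_0: "d > 0 \<Longrightarrow> hpoly d c (0 :: real^'n) = 0"
  unfolding hpoly_def
proof (rule sum.neutral, intro ballI)
  fix \<alpha> :: "'n \<Rightarrow> nat" assume d: "d > 0" and "\<alpha> \<in> monomials_deg d"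
  then have "(\<Sum>i\<in>UNIV. \<alpha> i) > 0" by (simp add: monomials_deg_def)
  then obtain i where "\<alpha> i \<noteq> 0" by (metis sum.neutral less_irrefl)
  then have "(\<Prod>i\<in>UNIV. ((0::real^'n) $ i) ^ \<alpha> i) = 0" by (intro prod_zero) auto
  then show "c \<alpha> * (\<Prod>i\<in>UNIV. ((0::real^'n) $ i) ^ \<alpha> i) = 0" by simp
qed

text \<open>Subtract the multiple of the model form \<open>E\<close> given by the sum over the
  roots: the coefficients at 0, 1 and 2 then vanish, so j = 3. With s = (n - 8)/4 the criterion
  reads n + 2d < n + 16. If the multiplier is 0, the shadow series vanishes as well.\<close>

theorem theta_series_proportional:
  fixes L :: "(real^'n) set"
  assumes L: "selfdual L" and min: "\<And>x. x \<in> L \<Longrightarrow> x \<noteq> 0 \<Longrightarrow> 2 \<le> x \<bullet> x"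
    and n: "CARD('n) \<ge> 8" and sh: "\<And>x. x \<in> shadow L \<Longrightarrow> (real CARD('n) - 8) / 4 \<le> x \<bullet> x"
    and harm: "harmonic d c" and d: "even d" "d > 0" "d \<le> 6"
    and E: "theta_form (CARD('n) + 2 * d) (\<i> ^ d) E E' B"
    and B: "fps_nth B 0 = 0" "fps_nth B (Suc 0) = 0" "fps_nth B 2 = 1"
    and E': "\<exists>C. \<forall>z. Im z \<ge> 1 \<longrightarrow> cmod (E' z) \<le> C * exp (- pi * (real (CARD('n) - 8) / 4) * Im z)"
  shows "shell_sums 1 L (hpoly d c) = fps_const (of_real (\<Sum>x\<in>shell L 2. hpoly d c x)) * B"
    and "(\<Sum>x\<in>shell L 2. hpoly d c x) = 0 \<Longrightarrow> shell_sums 4 (shadow L) (hpoly d c) = 0"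
proof -
  define a where "a = complex_of_real (\<Sum>x\<in>shell L 2. hpoly d c x)"
  note form = theta_series_form[OF L harm d(1)]
  let ?F = "\<lambda>z. theta_series L (hpoly d c) z - a * E z"
  let ?F' = "\<lambda>z. \<i> ^ d * theta_series (shadow L) (hpoly d c) z - a * E' z"
  let ?A = "shell_sums 1 L (hpoly d c) - fps_const a * B"
  have F: "theta_form (CARD('n) + 2 * d) (\<i> ^ d) ?F ?F' ?A"
    by (intro theta_form_diff theta_form_cmult form E)
  have sh': "real (CARD('n) - 8) / 4 \<le> x \<bullet> x" if "x \<in> shadow L" for x using sh[OF that] n by (simp add: of_nat_diff)
  have bound: "\<exists>C. \<forall>z. Im z \<ge> 1 \<longrightarrow> cmod (?F' z) \<le> C * exp (- pi * (real (CARD('n) - 8) / 4) * Im z)"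
    by (rule diff_bound[OF shadow_series_bound[OF L harm d(1) sh'] E'])
  then obtain C where C: "\<And>z. Im z \<ge> 1 \<Longrightarrow> cmod (?F' z) \<le> C * exp (- pi * (real (CARD('n) - 8) / 4) * Im z)" by blast
  have ord: "fps_nth ?A i = 0" if "i < 3" for i
  proof -
    have "i = 0 \<or> i = Suc 0 \<or> i = 2" using that by auto
    then show ?thesis using B shell_sums_low[OF L min] d(2)
      by (auto simp: shell_sums_def a_def hpoly_at_0)
  qed
  have F0: "?F z = 0" if "Im z > 0" for z
  proof (rule theta_form_vanishes[OF F _ ord _ C _ that])
    have "real (CARD('n) - 8) = real CARD('n) - 8" using n by (simp add: of_nat_diff)
    then show "real (CARD('n) + 2 * d) < 8 * real 3 + 4 * (real (CARD('n) - 8) / 4)" using d(3) by linarith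
  qed (auto simp: norm_power)
  have "shell_sums 1 L (hpoly d c) = fps_const a * B"
    using F0 by (intro q_expansion_unique[of 1 "theta_series L (hpoly d c)" _ "\<lambda>z. a * E z"] q_expansion_cmult)
      (use form E in \<open>auto simp: theta_form_def\<close>)
  then show "shell_sums 1 L (hpoly d c) = fps_const (of_real (\<Sum>x\<in>shell L 2. hpoly d c x)) * B" by (simp add: a_def)
  assume "(\<Sum>x\<in>shell L 2. hpoly d c x) = 0"
  then have a0: "a = 0" by (simp only: a_def of_real_0)
  have "theta_series (shadow L) (hpoly d c) z = 0" if "Im z > 0" for z
    using theta_form_dual_vanishes[OF F F0 that] a0 by simp
  then show "shell_sums 4 (shadow L) (hpoly d c) = 0"
    by (intro q_expansion_unique[OF form(2) q_expansion_const[of 4 0, simplified]]) auto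
qed

text \<open>Here j = 2 comes for free, from P(0) = 0 and the absence of vectors of norm 1, and the
  criterion n + 4 < n + 8 holds.\<close>

lemma theta_series_zero_deg2:
  fixes L :: "(real^'n) set"
  assumes L: "selfdual L" and min: "\<And>x. x \<in> L \<Longrightarrow> x \<noteq> 0 \<Longrightarrow> 2 \<le> x \<bullet> x"
    and n: "CARD('n) \<ge> 8" and sh: "\<And>x. x \<in> shadow L \<Longrightarrow> (real CARD('n) - 8) / 4 \<le> x \<bullet> x"
    and harm: "harmonic 2 c"
  shows "shell_sums 1 L (hpoly 2 c) = 0" "shell_sums 4 (shadow L) (hpoly 2 c) = 0"
proof -
  have ev: "even (2::nat)" by simp
  note form = theta_series_form[OF L harm ev]
  have sh': "real (CARD('n) - 8) / 4 \<le> x \<bullet> x" if "x \<in> shadow L" for x using sh[OF that] n by (simp add: of_nat_diff)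
  obtain C where C: "\<And>z. Im z \<ge> 1 \<Longrightarrow> cmod (\<i>\<^sup>2 * theta_series (shadow L) (hpoly 2 c) z) \<le> C * exp (- pi * (real (CARD('n) - 8) / 4) * Im z)"
    using shadow_series_bound[OF L harm ev sh'] by blast
  have ord: "fps_nth (shell_sums 1 L (hpoly 2 c)) i = 0" if "i < 2" for i
  proof -
    have "i = 0 \<or> i = Suc 0" using that by auto
    then show ?thesis using shell_sums_low[OF L min] by (auto simp: shell_sums_def hpoly_at_0)
  qed
  have F0: "theta_series L (hpoly 2 c) z = 0" if "Im z > 0" for z
  proof (rule theta_form_vanishes[OF form(1) _ ord _ C _ that])
    have "real (CARD('n) - 8) = real CARD('n) - 8" using n by (simp add: of_nat_diff)
    then show "real (CARD('n) + 2 * 2) < 8 * real 2 + 4 * (real (CARD('n) - 8) / 4)" by linarith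
  qed (auto simp: norm_power)
  have qL: "q_expansion 1 (theta_series L (hpoly 2 c)) (shell_sums 1 L (hpoly 2 c))"
    using form(1) unfolding theta_form_def by blast
  have q0: "q_expansion 1 (\<lambda>z. 0) 0" using q_expansion_const[of 1 0] by simp
  show "shell_sums 1 L (hpoly 2 c) = 0" by (rule q_expansion_unique[OF qL q0 zero_less_one F0])
  have "theta_series (shadow L) (hpoly 2 c) z = 0" if "Im z > 0" for z
    using theta_form_dual_vanishes[OF form(1) F0 that] by simp
  then show "shell_sums 4 (shadow L) (hpoly 2 c) = 0"
    by (intro q_expansion_unique[OF form(2) q_expansion_const[of 4 0, simplified]]) auto
qed

text \<open>The form theta3^n - 2n theta3^(n-8) Delta8 has the coefficients 1, 2n - 2n = 0 and 2n(n
  - 1) - 2n(2(n - 8) - 8) = 2n(23 - n), so the number of roots makes it the theta series of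
  \<open>L\<close>. At the cusp 1 it is theta2^(n-8) times a bounded function, and a shadow vector
  of smaller norm would violate this decay high on the imaginary axis.\<close>

theorem shadow_norm_bound:
  fixes L :: "(real^'n) set"
  assumes L: "selfdual L" and min: "\<And>x. x \<in> L \<Longrightarrow> x \<noteq> 0 \<Longrightarrow> 2 \<le> x \<bullet> x"
    and n: "8 \<le> CARD('n)" "CARD('n) < 24"
    and roots: "real (card (shell L 2)) = 2 * real CARD('n) * (23 - real CARD('n))"
    and x: "x \<in> shadow L"
  shows "(real CARD('n) - 8) / 4 \<le> x \<bullet> x"
proof -
  let ?n = "CARD('n)"
  let ?c = "\<lambda>_::'n \<Rightarrow> nat. 1::real"
  have ev: "even (0::nat)" by simp
  have harm: "harmonic 0 ?c" by (simp add: harmonic_def)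
  have one: "hpoly 0 ?c y = 1" for y :: "real^'n"
  proof -
    have "(monomials_deg 0 :: ('n \<Rightarrow> nat) set) = {\<lambda>_. 0}" by (auto simp: monomials_deg_def)
    then show ?thesis by (simp add: hpoly_def)
  qed
  note form = theta_series_form[OF L harm ev]
  define E where "E z = theta3 z ^ (?n - 8) * Delta8 z" for z
  define E' where "E' z = theta2 z ^ (?n - 8) * - (theta3 z ^ 4 * theta4 z ^ 4 / 16)" for z
  have e1: "theta_form ?n 1 (\<lambda>z. theta3 z ^ ?n) (\<lambda>z. theta2 z ^ ?n) (theta3_fps ^ ?n)"
    using theta_form_power[OF theta3_form, of ?n] by simp
  have e2: "theta_form ?n 1 E E' (theta3_fps ^ (?n - 8) * Delta8_fps)"
    using theta_form_mult[OF theta_form_power[OF theta3_form, of "?n - 8"] Delta8_form] n(1)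
    by (simp add: E_def[abs_def] E'_def[abs_def])
  let ?F = "\<lambda>z. theta_series L (hpoly 0 ?c) z - theta3 z ^ ?n - (- 2 * of_nat ?n) * E z"
  let ?F' = "\<lambda>z. \<i> ^ 0 * theta_series (shadow L) (hpoly 0 ?c) z - theta2 z ^ ?n - (- 2 * of_nat ?n) * E' z"
  let ?A = "shell_sums 1 L (hpoly 0 ?c) - theta3_fps ^ ?n - fps_const (- 2 * of_nat ?n) * (theta3_fps ^ (?n - 8) * Delta8_fps)"
  have F: "theta_form ?n 1 ?F ?F' ?A"
    using form(1) e1 e2 by (intro theta_form_diff theta_form_cmult) auto
  have n8: "of_nat (?n - 8) = (of_nat ?n - 8 :: complex)" using n(1) by (simp add: of_nat_diff)
  have A2: "of_real (real (card (shell L 2))) = 2 * of_nat ?n * (23 - of_nat ?n :: complex)"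
    unfolding roots by simp
  have ord: "fps_nth ?A i = 0" if "i < 3" for i
  proof -
    have "i = 0 \<or> i = Suc 0 \<or> i = 2" using that by auto
    then show ?thesis
    proof (elim disjE)
      assume "i = 0"
      then show ?thesis using shell_sums_low[OF L min]
        by (simp add: shell_sums_def one theta3_fps_power_coeffs fps_mult_low Delta8_fps_coeffs)
    next
      assume "i = Suc 0"
      then show ?thesis using shell_sums_low[OF L min]
        by (simp add: shell_sums_def one theta3_fps_power_coeffs fps_mult_low Delta8_fps_coeffs)
    next
      assume i: "i = 2"
      have "fps_nth (shell_sums 1 L (hpoly 0 ?c)) 2 = 2 * of_nat ?n * (23 - of_nat ?n)"
        using A2 by (simp add: shell_sums_def one)
      then show ?thesis unfolding i
        by (simp add: theta3_fps_power_coeffs fps_mult_low Delta8_fps_coeffs n8 algebra_simps)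
    qed
  qed
  obtain B0 where B0: "\<And>z. Im z \<ge> 1 \<Longrightarrow> cmod (theta3 z ^ 4 * theta4 z ^ 4) \<le> B0"
    using theta34_bounded[of 4 4] by blast
  then have B0': "\<And>z. Im z \<ge> 1 \<Longrightarrow> cmod (- (theta3 z ^ 4 * theta4 z ^ 4 / 16)) \<le> B0 / 16"
    by (simp add: norm_divide divide_right_mono)
  have bE: "\<exists>C. \<forall>z. Im z \<ge> 1 \<longrightarrow> cmod (E' z) \<le> C * exp (- pi * (real (?n - 8) / 4) * Im z)"
    unfolding E'_def by (rule theta2_power_bound[OF B0'])
  have b2: "\<exists>C. \<forall>z. Im z \<ge> 1 \<longrightarrow> cmod (theta2 z ^ ?n) \<le> C * exp (- pi * (real (?n - 8) / 4) * Im z)"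
  proof -
    \<comment> \<open>Only n - 8 of the factors \<open>theta2\<close> are kept for the decay; the
      other eight are merely bounded.\<close>
    obtain B1 where B1: "\<And>z. Im z \<ge> 1 \<Longrightarrow> cmod (theta2 z ^ 8) \<le> B1"
    proof -
      obtain C where C: "C \<ge> 0" "\<And>z. Im z \<ge> 1 \<Longrightarrow> cmod (theta2 z) \<le> C * exp (- pi * Im z / 4)"
        using theta_bounded by blast
      have "cmod (theta2 z ^ 8) \<le> C ^ 8" if "Im z \<ge> 1" for z
      proof -
        have "exp (- pi * Im z / 4) \<le> 1" using that by simp
        then have "C * exp (- pi * Im z / 4) \<le> C" using C(1) by (simp add: mult_left_le)
        then have "cmod (theta2 z) \<le> C" using C(2)[OF that] by simp
        then show ?thesis unfolding norm_power by (intro power_mono) auto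
      qed
      then show ?thesis using that by blast
    qed
    have "theta2 z ^ (?n - 8) * theta2 z ^ 8 = theta2 z ^ ?n" for z using n(1) by (simp flip: power_add)
    then show ?thesis using theta2_power_bound[of "\<lambda>z. theta2 z ^ 8" B1 "?n - 8", OF B1] by (simp only:)
  qed
  let ?S = "theta_series (shadow L) (hpoly 0 ?c)"
  have F0: "?F z = 0" if "Im z > 0" for z
  proof -
    \<comment> \<open>No decay of the shadow series is known at this stage, so s = 0 is used and the
      criterion becomes n < 24.\<close>
    have s0: "\<exists>C. \<forall>z. Im z \<ge> 1 \<longrightarrow> cmod (\<i> ^ 0 * ?S z) \<le> C * exp (- pi * 0 * Im z)"
      using shadow_series_bound[OF L harm ev, of 0] by simp
    have weaken: "\<exists>C. \<forall>z. Im z \<ge> 1 \<longrightarrow> cmod (G z) \<le> C * exp (- pi * 0 * Im z)"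
      if bd: "\<exists>C. \<forall>z. Im z \<ge> 1 \<longrightarrow> cmod (G z) \<le> C * exp (- pi * (real (?n - 8) / 4) * Im z)" for G
    proof -
      obtain C where C: "\<And>z. Im z \<ge> 1 \<Longrightarrow> cmod (G z) \<le> C * exp (- pi * (real (?n - 8) / 4) * Im z)" using bd by blast
      have "cmod (G z) \<le> \<bar>C\<bar> * exp (- pi * 0 * Im z)" if z: "Im z \<ge> 1" for z
      proof -
        have "cmod (G z) \<le> \<bar>C\<bar> * exp (- pi * (real (?n - 8) / 4) * Im z)"
          using C[OF z] by (rule order_trans) (intro mult_right_mono; simp)
        also have "\<dots> \<le> \<bar>C\<bar> * 1" using z by (intro mult_left_mono) auto
        finally show ?thesis by simp
      qed
      then show ?thesis by blast
    qed
    have "\<exists>C. \<forall>z. Im z \<ge> 1 \<longrightarrow> cmod (\<i> ^ 0 * ?S z - 1 * theta2 z ^ ?n - (- 2 * of_nat ?n) * E' z) \<le> C * exp (- pi * 0 * Im z)"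
      by (intro diff_bound weaken s0 bE b2)
    then obtain C where C: "\<And>z. Im z \<ge> 1 \<Longrightarrow> cmod (?F' z) \<le> C * exp (- pi * 0 * Im z)" by auto
    show ?thesis using n(2) by (intro theta_form_vanishes[OF F _ ord _ C _ that]) auto
  qed
  have S: "?S z = theta2 z ^ ?n - 2 * of_nat ?n * E' z" if "Im z > 0" for z
    using theta_form_dual_vanishes[OF F F0 that] by (simp add: algebra_simps)
  obtain C where C: "\<And>z. Im z \<ge> 1 \<Longrightarrow> cmod (theta2 z ^ ?n - 2 * of_nat ?n * E' z) \<le> C * exp (- pi * (real (?n - 8) / 4) * Im z)"
    using diff_bound[OF b2 bE] by blast
  show ?thesis
  proof (rule ccontr)
    assume "\<not> ?thesis"
    then have lt: "x \<bullet> x < real (?n - 8) / 4" using n(1) by (simp add: of_nat_diff)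
    \<comment> \<open>All terms of the shadow series are positive on the imaginary axis, so the term
      of \<open>x\<close> alone is a lower bound; \<kappa> is the rate at which the upper bound
      falls below it.\<close>
    define \<kappa> where "\<kappa> = pi * (real (?n - 8) / 4 - x \<bullet> x)"
    have "\<kappa> > 0" using lt by (simp add: \<kappa>_def)
    then obtain Y where Y: "\<And>y. y \<ge> Y \<Longrightarrow> C * exp (- \<kappa> * y) < 1" using exp_decay[of \<kappa> 1 C] by auto
    define y where "y = max 1 Y"
    have y: "y \<ge> 1" "y \<ge> Y" by (auto simp: y_def)
    let ?T = "\<Sum>\<^sub>\<infinity>v\<in>shadow L. exp (- (pi * y) * (norm v)\<^sup>2)"
    have summ: "(\<lambda>v. exp (- (pi * y) * (norm v)\<^sup>2)) summable_on shadow L"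
      using gauss_set_shadow[OF L] y by (simp add: gauss_set_def del: mult_minus_left)
    have "?S (\<i> * of_real y) = of_real ?T"
    proof -
      have "((\<lambda>v. complex_of_real (exp (- (pi * y) * (norm v)\<^sup>2))) has_sum of_real ?T) (shadow L)"
        by (intro has_sum_of_real has_sum_infsum summ)
      moreover have "complex_of_real (exp (- (pi * y) * (norm v)\<^sup>2)) = of_real (hpoly 0 ?c v) * exp (\<i> * of_real pi * (\<i> * of_real y) * of_real (v \<bullet> v))" for v :: "real^'n"
        by (simp add: one exp_of_real[symmetric] power2_norm_eq_inner mult_ac)
      ultimately show ?thesis unfolding theta_series_def by (simp only: infsumI)
    qed
    moreover have "exp (- (pi * y) * (norm x)\<^sup>2) \<le> ?T"
      using finite_sum_le_infsum[OF summ, of "{x}"] x by simp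
    ultimately have "exp (- (pi * y) * (x \<bullet> x)) \<le> cmod (?S (\<i> * of_real y))"
      by (simp add: power2_norm_eq_inner)
    also have "\<dots> \<le> C * exp (- pi * (real (?n - 8) / 4) * y)"
      using C[of "\<i> * of_real y"] S[of "\<i> * of_real y"] y by simp
    also have "\<dots> = C * exp (- \<kappa> * y) * exp (- (pi * y) * (x \<bullet> x))"
      unfolding mult.assoc exp_add[symmetric] \<kappa>_def by (simp add: algebra_simps)
    also have "\<dots> < 1 * exp (- (pi * y) * (x \<bullet> x))" using Y[OF y(2)] by (intro mult_strict_right_mono) auto
    finally show False by simp
  qed
qed

text \<open>By Jacobi's formula theta2 theta3 theta4 = 2 eta^3 this is eta^24, the discriminant form
  of weight 12; in the nome q its expansion begins with q^2.\<close>

definition eta24 :: "complex \<Rightarrow> complex" where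
  "eta24 z = (theta2 z * theta3 z * theta4 z) ^ 8 / 256"

text \<open>Identifies the degree 4 model form of rank 16, where n - 8 = 8.\<close>

lemma theta3_Delta8_square: "theta3 z ^ 8 * Delta8 z ^ 2 = eta24 z"
  by (simp add: Delta8_def eta24_def power_mult_distrib power_divide mult_ac flip: power_mult)

lemma eta24_plus_1: "Im z > 0 \<Longrightarrow> eta24 (z + 1) = eta24 z"
proof -
  assume z: "Im z > 0"
  have "theta2 (z + 1) ^ 8 = theta2 z ^ 8"
  proof -
    have "theta2 (z + 1) ^ 8 = (theta2 (z + 1) ^ 4)\<^sup>2" by (simp flip: power_mult)
    also have "\<dots> = (theta2 z ^ 4)\<^sup>2" unfolding theta2_power4_plus_1[OF z] by simp
    finally show ?thesis by (simp flip: power_mult)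
  qed
  moreover have "theta3 (z + 1) = theta4 z" by (simp add: theta4_def)
  ultimately show ?thesis unfolding eta24_def power_mult_distrib theta4_plus_1[OF z] by simp
qed

text \<open>The level two cusp form \<open>f = (theta3\<^sup>4 + theta2\<^sup>4) eta24\<close> of weight 14 and its image \<open>e\<close> under
  the Hecke operator at 2 are exchanged up to the factor 4096.\<close>

definition hecke_f :: "complex \<Rightarrow> complex" where
  "hecke_f z = (theta3 z ^ 4 + theta2 z ^ 4) * eta24 z"

definition hecke_e :: "complex \<Rightarrow> complex" where
  "hecke_e z = (theta3 z ^ 4 + theta2 z ^ 4) * (theta4 z ^ 16 * theta3 z ^ 4 * theta2 z ^ 4 / 16)"

lemma theta_quartic_double:
  assumes z: "Im z > 0"
  shows "theta3 (2 * z) ^ 4 + theta2 (2 * z) ^ 4 = (theta3 z ^ 4 + theta4 z ^ 4) / 2"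
proof -
  have "theta3 z ^ 4 = ((theta3 z)\<^sup>2)\<^sup>2" "theta4 z ^ 4 = ((theta4 z)\<^sup>2)\<^sup>2" by (simp_all flip: power_mult)
  then have "theta3 z ^ 4 + theta4 z ^ 4 = 2 * (theta3 (2 * z) ^ 4 + theta2 (2 * z) ^ 4)"
    unfolding theta3_square_split[OF z] theta4_square_split[OF z] by algebra
  then show ?thesis by simp
qed

text \<open>The duplication formulas write \<open>eta24 z\<close> as a product of theta powers at 2z
  and the quartic factor as twice a sum of two fourth powers there. So the left side, which is twice
  the even part of \<open>hecke_f\<close>, is a form in 2z.\<close>

lemma hecke_even_part:
  assumes z: "Im z > 0"
  shows "(theta3 z ^ 4 + theta4 z ^ 4) * eta24 z = 2 * hecke_e (2 * z)"
proof -
  have "theta4 (2 * z) ^ 16 = (theta3 z * theta4 z) ^ 8"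
    unfolding theta3_theta4_double[OF z] by (simp flip: power_mult)
  moreover have "theta3 (2 * z) ^ 4 * theta2 (2 * z) ^ 4 = theta2 z ^ 8 / 16"
  proof -
    have "theta2 z ^ 8 = ((theta2 z)\<^sup>2) ^ 4" by (simp flip: power_mult)
    then have "theta2 z ^ 8 = 16 * (theta3 (2 * z) ^ 4 * theta2 (2 * z) ^ 4)"
      unfolding theta2_square_double[OF z] by algebra
    then show ?thesis by simp
  qed
  ultimately have "theta4 (2 * z) ^ 16 * theta3 (2 * z) ^ 4 * theta2 (2 * z) ^ 4 / 16 = eta24 z"
    by (simp add: eta24_def power_mult_distrib mult_ac)
  then show ?thesis unfolding hecke_e_def theta_quartic_double[OF z] by simp
qed

lemma hecke_e_even_part:
  assumes z: "Im z > 0"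
  shows "hecke_e z + hecke_e (z + 1) = 8192 * hecke_f (2 * z)"
proof -
  \<comment> \<open>In the fourth powers a, b, c both sides are polynomials; after removing common
    factors the claim is (a + b) c^3 - (c - b) a^3 = b^3 (a + c), which holds because a = b +
    c.\<close>
  define a b c where abc: "a = theta3 z ^ 4" "b = theta2 z ^ 4" "c = theta4 z ^ 4"
  have J: "a = b + c" unfolding abc by (rule jacobi_identity[OF z])
  have s: "theta3 (z + 1) = theta4 z" by (simp add: theta4_def)
  have e1: "hecke_e z = (a + b) * (c ^ 4 * a * b / 16)"
    by (simp add: hecke_e_def abc flip: power_mult)
  have e2: "hecke_e (z + 1) = (c - b) * (a ^ 4 * c * (- b) / 16)"
    unfolding hecke_e_def theta2_power4_plus_1[OF z] s theta4_plus_1[OF z] by (simp add: abc flip: power_mult)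
  have f: "hecke_f (2 * z) = ((a + c) / 2) * (b ^ 4 * a * c / 65536)"
  proof -
    have "theta2 (2 * z) ^ 8 * theta3 (2 * z) ^ 8 = b ^ 4 / 256"
    proof -
      have "b ^ 4 = ((theta2 z)\<^sup>2) ^ 8" by (simp add: abc flip: power_mult)
      then have "b ^ 4 = 256 * (theta2 (2 * z) ^ 8 * theta3 (2 * z) ^ 8)"
        unfolding theta2_square_double[OF z] by (simp add: power_mult_distrib)
      then show ?thesis by simp
    qed
    moreover have "theta4 (2 * z) ^ 8 = a * c"
    proof -
      have "theta4 (2 * z) ^ 8 = ((theta4 (2 * z))\<^sup>2) ^ 4" by (simp flip: power_mult)
      then show ?thesis unfolding theta3_theta4_double[OF z, symmetric] by (simp add: abc power_mult_distrib)
    qed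
    moreover have "eta24 (2 * z) = (theta2 (2 * z) ^ 8 * theta3 (2 * z) ^ 8) * theta4 (2 * z) ^ 8 / 256"
      by (simp add: eta24_def power_mult_distrib)
    ultimately have "eta24 (2 * z) = b ^ 4 * a * c / 65536" by (simp only:) simp
    then show ?thesis unfolding hecke_f_def theta_quartic_double[OF z] abc[symmetric] by (simp only:)
  qed
  show ?thesis unfolding e1 e2 f J by (simp add: field_simps) algebra
qed

section \<open>Spherical designs\<close>

lemma form_deg4:
  assumes "n \<ge> 8"
  shows "theta_form (n + 2 * 4) (\<i> ^ 4) (\<lambda>z. theta3 z ^ (n - 8) * Delta8 z ^ 2)
    (\<lambda>z. theta2 z ^ (n - 8) * (- (theta3 z ^ 4 * theta4 z ^ 4 / 16)) ^ 2) (theta3_fps ^ (n - 8) * Delta8_fps ^ 2)"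
proof -
  have "n - 8 + 16 = n + 2 * 4" using assms by simp
  then show ?thesis
    using theta_form_mult[OF theta_form_power[OF theta3_form, of "n - 8"] theta_form_power[OF Delta8_form, of 2]]
    by (simp add: add.commute)
qed

text \<open>Compared with degree 4, \<open>K\<close> grows by 4 and the sign changes from i^4 = 1 to
  i^6 = -1; \<open>Phi\<close> supplies both.\<close>

lemma form_deg6:
  assumes "n \<ge> 8"
  shows "theta_form (n + 2 * 6) (\<i> ^ 6) (\<lambda>z. Phi z * (theta3 z ^ (n - 8) * Delta8 z ^ 2))
    (\<lambda>z. (theta3 z ^ 4 + theta4 z ^ 4) * (theta2 z ^ (n - 8) * (- (theta3 z ^ 4 * theta4 z ^ 4 / 16)) ^ 2))
    (Phi_fps * (theta3_fps ^ (n - 8) * Delta8_fps ^ 2))"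
proof -
  have i6: "\<i> ^ 6 = -1" "\<i> ^ 4 = 1" by (simp_all add: eval_nat_numeral)
  have "4 + (n + 2 * 4) = n + 2 * 6" by simp
  then show ?thesis using theta_form_mult[OF Phi_form form_deg4[OF assms]] unfolding i6 by (simp add: add.commute)
qed

lemma deg4_fps_coeffs:
  "fps_nth (theta3_fps ^ k * Delta8_fps ^ 2) 0 = 0" "fps_nth (theta3_fps ^ k * Delta8_fps ^ 2) (Suc 0) = 0"
  "fps_nth (theta3_fps ^ k * Delta8_fps ^ 2) 2 = 1"
  by (simp_all add: fps_mult_low power2_eq_square[of Delta8_fps] Delta8_fps_coeffs theta3_fps_power_coeffs)

lemma Phi_fps_0: "fps_nth Phi_fps 0 = 1"
  using fps_power_low(1)[OF theta4_fps_coeffs(1), of 4] by (simp add: Phi_fps_def)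

lemma deg6_fps_coeffs:
  "fps_nth (Phi_fps * (theta3_fps ^ k * Delta8_fps ^ 2)) 0 = 0" "fps_nth (Phi_fps * (theta3_fps ^ k * Delta8_fps ^ 2)) (Suc 0) = 0"
  "fps_nth (Phi_fps * (theta3_fps ^ k * Delta8_fps ^ 2)) 2 = 1"
  unfolding fps_mult_low(1-3)[of Phi_fps] deg4_fps_coeffs Phi_fps_0 by simp_all

lemma deg4_dual_bound:
  "\<exists>C. \<forall>z. Im z \<ge> 1 \<longrightarrow> cmod (theta2 z ^ k * (- (theta3 z ^ 4 * theta4 z ^ 4 / 16)) ^ 2) \<le> C * exp (- pi * (real k / 4) * Im z)"
proof -
  obtain B where B: "\<And>z. Im z \<ge> 1 \<Longrightarrow> cmod (theta3 z ^ 8 * theta4 z ^ 8) \<le> B" using theta34_bounded by blast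
  have eq: "(- (theta3 z ^ 4 * theta4 z ^ 4 / 16)) ^ 2 = theta3 z ^ 8 * theta4 z ^ 8 / 256" for z
    by (simp add: power_divide power_mult_distrib flip: power_mult)
  have "cmod ((- (theta3 z ^ 4 * theta4 z ^ 4 / 16)) ^ 2) \<le> B / 256" if "Im z \<ge> 1" for z
    unfolding eq norm_divide using B[OF that] by simp
  then show ?thesis by (rule theta2_power_bound)
qed

lemma deg6_dual_bound:
  "\<exists>C. \<forall>z. Im z \<ge> 1 \<longrightarrow> cmod ((theta3 z ^ 4 + theta4 z ^ 4) * (theta2 z ^ k * (- (theta3 z ^ 4 * theta4 z ^ 4 / 16)) ^ 2)) \<le> C * exp (- pi * (real k / 4) * Im z)"
proof -
  obtain B1 where B1: "\<And>z. Im z \<ge> 1 \<Longrightarrow> cmod (theta3 z ^ 12 * theta4 z ^ 8) \<le> B1" using theta34_bounded by blast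
  obtain B2 where B2: "\<And>z. Im z \<ge> 1 \<Longrightarrow> cmod (theta3 z ^ 8 * theta4 z ^ 12) \<le> B2" using theta34_bounded by blast
  let ?H = "\<lambda>z. (theta3 z ^ 12 * theta4 z ^ 8 + theta3 z ^ 8 * theta4 z ^ 12) / 256"
  have H: "cmod (?H z) \<le> (B1 + B2) / 256" if "Im z \<ge> 1" for z
    using B1[OF that] B2[OF that] norm_triangle_ineq[of "theta3 z ^ 12 * theta4 z ^ 8" "theta3 z ^ 8 * theta4 z ^ 12"]
    by (simp add: norm_divide)
  have "(theta3 z ^ 4 + theta4 z ^ 4) * (theta2 z ^ k * (- (theta3 z ^ 4 * theta4 z ^ 4 / 16)) ^ 2) = theta2 z ^ k * ?H z" for z
  proof -
    have "(theta3 z ^ 4 + theta4 z ^ 4) * (- (theta3 z ^ 4 * theta4 z ^ 4 / 16)) ^ 2 = ?H z"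
    proof -
      have "(x + y) * (- (x * y / 16)) ^ 2 = (x ^ 3 * y ^ 2 + x ^ 2 * y ^ 3) / 256" for x y :: complex
        by (simp add: power2_eq_square power3_eq_cube field_simps)
      from this[of "theta3 z ^ 4" "theta4 z ^ 4"] show ?thesis by (simp flip: power_mult)
    qed
    then show ?thesis by (simp only: mult.left_commute)
  qed
  then show ?thesis using theta2_power_bound[of ?H, OF H] by (simp only:)
qed

definition hecke_f_fps :: "complex fps" where
  "hecke_f_fps = (theta3_fps ^ 4 + fps_X * psi_fps ^ 4) * (theta3_fps ^ 8 * Delta8_fps ^ 2)"

lemma hecke_f_q_expansion: "q_expansion 1 hecke_f hecke_f_fps"
  unfolding hecke_f_def[abs_def] hecke_f_fps_def theta3_Delta8_square[symmetric]
  by (intro q_expansion_mult q_expansion_add q_expansion_power theta3_q_expansion theta2_power4_q_expansion Delta8_q_expansion) auto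

lemma hecke_e_q_expansion: "\<exists>B. q_expansion 1 hecke_e B"
proof -
  have "q_expansion 1 (\<lambda>z. (theta3 z ^ 4 + theta2 z ^ 4) * (theta4 z ^ 16 * theta3 z ^ 4 * theta2 z ^ 4 * (1/16)))
    ((theta3_fps ^ 4 + fps_X * psi_fps ^ 4) * (theta4_fps ^ 16 * theta3_fps ^ 4 * (fps_X * psi_fps ^ 4) * fps_const (1/16)))"
    unfolding theta4_fps_def
    by (intro q_expansion_mult q_expansion_add q_expansion_power theta3_q_expansion theta4_q_expansion theta2_power4_q_expansion q_expansion_const) auto
  then show ?thesis by (auto simp: hecke_e_def[abs_def])
qed

text \<open>The two Hecke relations combine to \<open>f(4 m) = 4096 f(m)\<close>, and \<open>f(1) = 0\<close>.\<close>

lemma coeff_power4_zero: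
  assumes G: "q_expansion 1 G B"
    and eq: "\<And>z. Im z > 0 \<Longrightarrow> G z + G (z + 1) = (theta3 z ^ 4 + theta4 z ^ 4) * eta24 z"
    and a: "a \<ge> 1"
  shows "fps_nth B (4 ^ a) = 0"
proof -
  obtain E where E: "q_expansion 1 hecke_e E" using hecke_e_q_expansion by blast
  \<comment> \<open>The even part of any such G' is \<open>hecke_e\<close> in q^2, and the even part
    of \<open>hecke_e\<close> is 4096 \<open>hecke_f\<close> in q^2; together they reach the index
    4m.\<close>
  have step: "fps_nth B' (4 * m) = 4096 * fps_nth hecke_f_fps m"
    if G': "q_expansion 1 G' B'" and eq': "\<And>z. Im z > 0 \<Longrightarrow> G' z + G' (z + 1) = (theta3 z ^ 4 + theta4 z ^ 4) * eta24 z" for G' B' m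
  proof -
    have "2 * fps_nth B' (2 * (2 * m)) = 2 * fps_nth E (2 * m)"
      by (rule q_expansion_even_part[OF G' E]) (simp add: eq' hecke_even_part)
    moreover have "2 * fps_nth E (2 * m) = 8192 * fps_nth hecke_f_fps m"
      by (rule q_expansion_even_part[OF E hecke_f_q_expansion]) (rule hecke_e_even_part)
    ultimately have "2 * fps_nth B' (4 * m) = 2 * (4096 * fps_nth hecke_f_fps m)" by simp
    then show ?thesis by (simp only: mult_cancel_left) simp
  qed
  have f: "hecke_f z + hecke_f (z + 1) = (theta3 z ^ 4 + theta4 z ^ 4) * eta24 z" if z: "Im z > 0" for z
  proof -
    have "theta3 (z + 1) = theta4 z" by (simp add: theta4_def)
    then show ?thesis unfolding hecke_f_def theta2_power4_plus_1[OF z] eta24_plus_1[OF z] by (simp add: algebra_simps)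
  qed
  have "fps_nth hecke_f_fps (4 ^ k) = 0" for k
  proof (induction k)
    case 0
    \<comment> \<open>The coefficient of index 1 is 0 because the factor \<open>eta24\<close> starts
      with q^2.\<close>
    show ?case unfolding hecke_f_fps_def power_0 One_nat_def fps_mult_low(2)[of "theta3_fps ^ 4 + fps_X * psi_fps ^ 4"] deg4_fps_coeffs
      by simp
  next
    case (Suc k)
    then show ?case using step[OF hecke_f_q_expansion f, of "4 ^ k"] by simp
  qed
  moreover obtain k where "a = Suc k" using a by (cases a) auto
  ultimately show ?thesis using step[OF G eq, of "4 ^ k"] by simp
qed

lemma cond_C_shell:
  fixes L :: "(real^'n) set"
  assumes "\<And>c :: ('n \<Rightarrow> nat) \<Rightarrow> real. harmonic d c \<Longrightarrow> fps_nth (shell_sums 1 L (hpoly d c)) k = 0"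
  shows "cond_C d (shell L (real k))"
  unfolding cond_C_def
proof (intro allI impI)
  fix c :: "('n \<Rightarrow> nat) \<Rightarrow> real" assume "harmonic d c"
  then have "complex_of_real (\<Sum>x\<in>shell L (real k). hpoly d c x) = 0"
    using assms[of c] by (simp add: shell_sums_def del: of_real_sum)
  then show "(\<Sum>x\<in>shell L (real k). hpoly d c x) = 0" by (simp only: of_real_eq_0_iff)
qed

lemma shell_props:
  assumes "selfdual L"
  shows "finite (shell L m)" "antipodal (shell L m)" "finite (shell (shadow L) m)" "antipodal (shell (shadow L) m)"
  using finite_shell[OF gauss_set_selfdual[OF assms]] finite_shell[OF gauss_set_shadow[OF assms]]
    selfdual_uminus[OF assms] shadow_uminus[OF assms]
  by (auto simp: antipodal_def shell_def)

lemma cond_C2_shells: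
  fixes L :: "(real^'n) set"
  assumes L: "selfdual L" and min: "\<And>x. x \<in> L \<Longrightarrow> x \<noteq> 0 \<Longrightarrow> 2 \<le> x \<bullet> x"
    and n: "CARD('n) \<ge> 8" and sh: "\<And>x. x \<in> shadow L \<Longrightarrow> (real CARD('n) - 8) / 4 \<le> x \<bullet> x"
  shows "cond_C 2 (shell L m)" "cond_C 2 (shell (shadow L) m)"
proof -
  show "cond_C 2 (shell L m)" unfolding cond_C_def
    using theta_series_zero_deg2(1)[OF L min n sh] selfdual_norm_nat[OF L]
    by (auto intro!: shell_sum_zero[of 1])
  show "cond_C 2 (shell (shadow L) m)" unfolding cond_C_def
    using theta_series_zero_deg2(2)[OF L min n sh] shadow_nat[OF L]
    by (auto intro!: shell_sum_zero[of 4])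
qed

text \<open>A harmonic sum over a shell of \<open>L\<close> is a coefficient of the model form times
  a factor that depends on the polynomial alone. It vanishes with that coefficient, and without
  roots the factor itself is an empty sum.\<close>

lemma cond_C_4_6_shells:
  fixes L :: "(real^'n) set"
  assumes L: "selfdual L" and min: "\<And>x. x \<in> L \<Longrightarrow> x \<noteq> 0 \<Longrightarrow> 2 \<le> x \<bullet> x"
    and n: "CARD('n) \<ge> 8" and sh: "\<And>x. x \<in> shadow L \<Longrightarrow> (real CARD('n) - 8) / 4 \<le> x \<bullet> x"
  shows "fps_nth (theta3_fps ^ (CARD('n) - 8) * Delta8_fps ^ 2) k = 0 \<Longrightarrow> cond_C 4 (shell L (real k))"
    and "fps_nth (Phi_fps * (theta3_fps ^ (CARD('n) - 8) * Delta8_fps ^ 2)) k = 0 \<Longrightarrow> cond_C 6 (shell L (real k))"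
    and "shell L 2 = {} \<Longrightarrow> cond_C 4 (shell L m) \<and> cond_C 4 (shell (shadow L) m) \<and> cond_C 6 (shell L m) \<and> cond_C 6 (shell (shadow L) m)"
proof -
  have ev: "even (4::nat)" "(4::nat) > 0" "(4::nat) \<le> 6" "even (6::nat)" "(6::nat) > 0" "(6::nat) \<le> 6" by simp_all
  have p4: "shell_sums 1 L (hpoly 4 c) = fps_const (of_real (\<Sum>x\<in>shell L 2. hpoly 4 c x)) * (theta3_fps ^ (CARD('n) - 8) * Delta8_fps ^ 2)"
      "(\<Sum>x\<in>shell L 2. hpoly 4 c x) = 0 \<Longrightarrow> shell_sums 4 (shadow L) (hpoly 4 c) = 0" if "harmonic 4 c" for c
    by (rule theta_series_proportional[OF L min n sh that ev(1-3) form_deg4[OF n] deg4_fps_coeffs deg4_dual_bound]; assumption)+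
  have p6: "shell_sums 1 L (hpoly 6 c) = fps_const (of_real (\<Sum>x\<in>shell L 2. hpoly 6 c x)) * (Phi_fps * (theta3_fps ^ (CARD('n) - 8) * Delta8_fps ^ 2))"
      "(\<Sum>x\<in>shell L 2. hpoly 6 c x) = 0 \<Longrightarrow> shell_sums 4 (shadow L) (hpoly 6 c) = 0" if "harmonic 6 c" for c
    by (rule theta_series_proportional[OF L min n sh that ev(4-6) form_deg6[OF n] deg6_fps_coeffs deg6_dual_bound]; assumption)+
  show "cond_C 4 (shell L (real k))" if "fps_nth (theta3_fps ^ (CARD('n) - 8) * Delta8_fps ^ 2) k = 0"
    using that by (intro cond_C_shell) (simp only: p4(1) fps_mult_left_const_nth mult_zero_right)
  show "cond_C 6 (shell L (real k))" if "fps_nth (Phi_fps * (theta3_fps ^ (CARD('n) - 8) * Delta8_fps ^ 2)) k = 0"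
    using that by (intro cond_C_shell) (simp only: p6(1) fps_mult_left_const_nth mult_zero_right)
  assume e: "shell L 2 = {}"
  have z4: "shell_sums 1 L (hpoly 4 c) = 0" "shell_sums 4 (shadow L) (hpoly 4 c) = 0" if "harmonic 4 c" for c
    using p4[OF that] e by simp_all
  have z6: "shell_sums 1 L (hpoly 6 c) = 0" "shell_sums 4 (shadow L) (hpoly 6 c) = 0" if "harmonic 6 c" for c
    using p6[OF that] e by simp_all
  have nL: "real 1 * (x \<bullet> x) \<in> \<nat>" if "x \<in> L" for x using selfdual_norm_nat[OF L that] by simp
  have "cond_C 4 (shell L m)" "cond_C 6 (shell L m)"
    unfolding cond_C_def using shell_sum_zero[OF z4(1) _ nL] shell_sum_zero[OF z6(1) _ nL] by auto
  moreover have "cond_C 4 (shell (shadow L) m)" "cond_C 6 (shell (shadow L) m)"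
    unfolding cond_C_def using shell_sum_zero[OF z4(2) _ shadow_nat[OF L]] shell_sum_zero[OF z6(2) _ shadow_nat[OF L]] by auto
  ultimately show "cond_C 4 (shell L m) \<and> cond_C 4 (shell (shadow L) m) \<and> cond_C 6 (shell L m) \<and> cond_C 6 (shell (shadow L) m)"
    by blast
qed

section \<open>Counting roots\<close>

lemma card_kD:
  "card (kD k m) = 4 * length (filter (\<lambda>(i, j). i < j \<and> i div m = j div m) (List.product [0..<k*m] [0..<k*m]))"
proof -
  let ?P = "filter (\<lambda>(i, j). i < j \<and> i div m = j div m) (List.product [0..<k*m] [0..<k*m])"
  let ?T = "{1, -1} \<times> {1, -1} :: (int \<times> int) set"
  \<comment> \<open>Each root comes from one unordered pair of positions, listed as i < j, with four
    choices of signs; the filtered list makes the count computable.\<close>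
  define \<phi> :: "(nat \<times> nat) \<times> (int \<times> int) \<Rightarrow> nat \<Rightarrow> int"
    where "\<phi> = (\<lambda>((i, j), (s, t)) l. if l = i then s else if l = j then t else 0)"
  have "kD k m = \<phi> ` (set ?P \<times> ?T)"
  proof
    show "\<phi> ` (set ?P \<times> ?T) \<subseteq> kD k m"
    proof
      fix v assume "v \<in> \<phi> ` (set ?P \<times> ?T)"
      then obtain p q where pq: "p \<in> set ?P" "q \<in> ?T" "v = \<phi> (p, q)" by blast
      obtain i j where p: "p = (i, j)" by (cases p)
      obtain s t where q: "q = (s, t)" by (cases q)
      show "v \<in> kD k m"
        unfolding kD_def pq(3) p q \<phi>_def using pq(1,2) unfolding p q
        by (intro CollectI exI[of _ i] exI[of _ j] exI[of _ s] exI[of _ t]) auto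
    qed
    show "kD k m \<subseteq> \<phi> ` (set ?P \<times> ?T)"
    proof
      fix v assume "v \<in> kD k m"
      then obtain i j s t where h: "i < k * m" "j < k * m" "i \<noteq> j" "i div m = j div m" "s \<in> {1, -1}" "t \<in> {1, -1}"
        and v: "v = (\<lambda>l. if l = i then s else if l = j then t else 0)" unfolding kD_def by blast
      show "v \<in> \<phi> ` (set ?P \<times> ?T)"
      proof (cases "i < j")
        case True
        then show ?thesis using h by (intro image_eqI[of _ _ "((i, j), (s, t))"]) (auto simp: v \<phi>_def)
      next
        case False
        then show ?thesis using h by (intro image_eqI[of _ _ "((j, i), (t, s))"]) (auto simp: v \<phi>_def fun_eq_iff)
      qed
    qed
  qed
  moreover have "inj_on \<phi> (set ?P \<times> ?T)"
  proof (rule inj_onI)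
    fix p q assume pq: "p \<in> set ?P \<times> ?T" "q \<in> set ?P \<times> ?T" "\<phi> p = \<phi> q"
    obtain i j s t where p': "p = ((i, j), s, t)" by (metis surj_pair)
    obtain i' j' s' t' where q': "q = ((i', j'), s', t')" by (metis surj_pair)
    have p: "(i, j) \<in> set ?P" "(i', j') \<in> set ?P" "(s, t) \<in> ?T" "(s', t') \<in> ?T"
      and eq: "\<phi> ((i, j), s, t) = \<phi> ((i', j'), s', t')"
      using pq unfolding p' q' by auto
    have lt: "i < j" "i' < j'" using p by auto
    have nz: "s \<noteq> 0" "t \<noteq> 0" "s' \<noteq> 0" "t' \<noteq> 0" using p by auto
    have ev: "(if l = i then s else if l = j then t else 0) = (if l = i' then s' else if l = j' then t' else 0)" for l
      using fun_cong[OF eq, of l] by (simp add: \<phi>_def)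
    have "i = i' \<or> i = j'" "j = i' \<or> j = j'" "i' = i \<or> i' = j" using ev[of i] ev[of j] ev[of i'] nz by (auto split: if_splits)
    then have "i = i'" "j = j'" using lt by auto
    moreover from this have "s = s'" "t = t'" using ev[of i] ev[of j] lt by auto
    ultimately show "p = q" by (simp add: p' q')
  qed
  ultimately have "card (kD k m) = card (set ?P) * card ?T" by (simp add: card_image card_cartesian_product)
  also have "card (set ?P) = length ?P" by (intro distinct_card distinct_filter distinct_product) auto
  also have "card ?T = 4" by (simp add: card_cartesian_product)
  finally show ?thesis by simp
qed

lemma card_kA:
  "card (kA k m) = length (filter (\<lambda>(i, j). i \<noteq> j \<and> i div (m+1) = j div (m+1)) (List.product [0..<k*(m+1)] [0..<k*(m+1)]))"
proof -
  let ?P = "filter (\<lambda>(i, j). i \<noteq> j \<and> i div (m+1) = j div (m+1)) (List.product [0..<k*(m+1)] [0..<k*(m+1)])"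
  define \<phi> :: "nat \<times> nat \<Rightarrow> nat \<Rightarrow> int"
    where "\<phi> = (\<lambda>(i, j) l. if l = i then 1 else if l = j then -1 else 0)"
  have "kA k m = \<phi> ` set ?P"
    unfolding kA_def \<phi>_def by (auto simp: image_iff) blast+
  moreover have "inj_on \<phi> (set ?P)"
  proof (rule inj_onI, clarify)
    fix i j i' j' assume p: "(i, j) \<in> set ?P" "(i', j') \<in> set ?P" and eq: "\<phi> (i, j) = \<phi> (i', j')"
    have ne: "i \<noteq> j" "i' \<noteq> j'" using p by auto
    have ev: "(if l = i then 1 else if l = j then -1 else 0 :: int) = (if l = i' then 1 else if l = j' then -1 else 0)" for l
      using fun_cong[OF eq, of l] by (simp add: \<phi>_def)
    show "i = i' \<and> j = j'" using ev[of i] ev[of j] ne by (auto split: if_splits)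
  qed
  ultimately have "card (kA k m) = card (set ?P)" by (simp add: card_image)
  also have "card (set ?P) = length ?P" by (intro distinct_card distinct_filter distinct_product) auto
  finally show ?thesis .
qed

text \<open>These are the values of 2r(23 - r) for r = 16 and r = 20, as the shadow bound
  requires.\<close>

lemma card_root_systems: "card (kD 2 8) = 224" "card (kD 5 4) = 120" "card (kA 4 5) = 120"
  unfolding card_kD card_kA by code_simp+

section \<open>The design statements\<close>

lemma design_3_iff: "design X 3 \<longleftrightarrow> finite X \<and> antipodal X \<and> cond_C 2 X"
proof -
  have "2 \<le> 2 * j \<and> 2 * j \<le> (3::nat) \<longleftrightarrow> j = 1" for j by auto
  then show ?thesis by (simp add: design_def)
qed

lemma design_5_iff: "design X 5 \<longleftrightarrow> finite X \<and> antipodal X \<and> cond_C 2 X \<and> cond_C 4 X"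
proof -
  have "2 \<le> 2 * j \<and> 2 * j \<le> (5::nat) \<longleftrightarrow> j = 1 \<or> j = 2" for j by auto
  then show ?thesis by (auto simp: design_def)
qed

lemma design_7_iff: "design X 7 \<longleftrightarrow> finite X \<and> antipodal X \<and> cond_C 2 X \<and> cond_C 4 X \<and> cond_C 6 X"
proof -
  have "2 \<le> 2 * j \<and> 2 * j \<le> (7::nat) \<longleftrightarrow> j = 1 \<or> j = 2 \<or> j = 3" for j by auto
  then show ?thesis by (auto simp: design_def)
qed

lemma norm_ge_lattice_min:
  fixes L :: "(real^'n) set"
  assumes "lattice_min L = m" "x \<in> L" "x \<noteq> 0"
  shows "m \<le> x \<bullet> x"
  unfolding assms(1)[symmetric] lattice_min_def
  using assms(2,3) by (intro cInf_lower) (auto intro!: bdd_belowI[of _ 0])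

lemma minimal_shadow_designs:
  fixes L :: "(real^'n) set"
  assumes L: "selfdual L" and \<sigma>: "sigma_inv L = real CARD('n) - 8" and min: "lattice_min L = 2"
  shows "design (shell L m) 3" "design (shell (shadow L) m) 3"
proof -
  define I where "I = Inf ((\<lambda>x. x \<bullet> x) ` shadow L)"
  have I: "4 * I = real CARD('n) - 8" using \<sigma> unfolding sigma_inv_def I_def .
  \<comment> \<open>Norms in the shadow are nonnegative, so the hypothesis on
    \<open>sigma_inv\<close> forces rank at least 8.\<close>
  have "0 \<le> I" unfolding I_def using shadow_nonempty[OF L] by (intro cInf_greatest) auto
  then have n: "CARD('n) \<ge> 8" using I by linarith
  have sh: "(real CARD('n) - 8) / 4 \<le> x \<bullet> x" if "x \<in> shadow L" for x
  proof -
    have "I \<le> x \<bullet> x"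
      unfolding I_def using that by (intro cInf_lower) (auto intro!: bdd_belowI[of _ 0])
    then show ?thesis using I by (simp add: field_simps)
  qed
  show "design (shell L m) 3" "design (shell (shadow L) m) 3"
    unfolding design_3_iff using shell_props[OF L] cond_C2_shells[OF L norm_ge_lattice_min[OF min] n sh] by auto
qed

lemma plus_lattice_props:
  fixes L :: "(real^'n) set"
  assumes P: "plus_lattice L r N R" and r: "8 \<le> r" "r < 24" and R: "real (card R) = 2 * real r * (23 - real r)"
  shows "selfdual L" "CARD('n) = r" "\<And>x. x \<in> L \<Longrightarrow> x \<noteq> 0 \<Longrightarrow> 2 \<le> x \<bullet> x"
    "\<And>x. x \<in> shadow L \<Longrightarrow> (real CARD('n) - 8) / 4 \<le> x \<bullet> x"
proof -
  show L: "selfdual L" and n: "CARD('n) = r" and min: "\<And>x. x \<in> L \<Longrightarrow> x \<noteq> 0 \<Longrightarrow> 2 \<le> x \<bullet> x"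
    using P by (auto simp: plus_lattice_def)
  obtain f where "bij_betw f R (shell L 2)" using P by (auto simp: plus_lattice_def roots_are_def)
  then have "card (shell L 2) = card R" by (simp add: bij_betw_same_card)
  then show "(real CARD('n) - 8) / 4 \<le> x \<bullet> x" if "x \<in> shadow L" for x
    using r R n by (intro shadow_norm_bound[OF L min _ _ _ that]) simp_all
qed

lemma eta24_q_expansion: "q_expansion 1 eta24 (theta3_fps ^ 8 * Delta8_fps ^ 2)"
  unfolding theta3_Delta8_square[abs_def, symmetric]
  by (intro q_expansion_mult q_expansion_power theta3_q_expansion Delta8_q_expansion) auto

lemma eta24_odd_coeff:
  assumes "odd k" shows "fps_nth (theta3_fps ^ 8 * Delta8_fps ^ 2) k = 0"
proof -
  let ?A = "theta3_fps ^ 8 * Delta8_fps ^ 2"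
  have "Abs_fps (\<lambda>k. (-1) ^ k * fps_nth ?A k) = ?A"
    by (rule q_expansion_unique[OF q_expansion_shift[OF eta24_q_expansion] eta24_q_expansion]) (simp_all add: eta24_plus_1)
  then have "fps_nth (Abs_fps (\<lambda>k. (-1) ^ k * fps_nth ?A k)) k = fps_nth ?A k" by simp
  then have "- fps_nth ?A k = fps_nth ?A k" unfolding fps_nth_Abs_fps using assms by simp
  then show ?thesis by simp
qed

text \<open>In rank 16 the model forms are \<open>eta24\<close> and \<open>Phi\<close> times
  \<open>eta24\<close>. The first is even in the nome, which settles odd norms in degree 4. The
  second has the even part of \<open>hecke_f\<close>, because Phi(z) + Phi(z + 1) = theta3^4 +
  theta4^4; this settles norms 4^a in degree 6.\<close>

lemma designs_2D8:
  fixes L :: "(real^'n) set"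
  assumes P: "plus_lattice L 16 16 (kD 2 8)"
  shows "a \<ge> 1 \<Longrightarrow> design_3half (shell L (4 ^ a))" "design (shell L (2 * real a + 1)) 5"
proof -
  have "real (card (kD 2 8)) = 2 * real 16 * (23 - real 16)" by (simp add: card_root_systems)
  note props = plus_lattice_props[OF P _ _ this, simplified]
  have n: "CARD('n) \<ge> 8" using props(2) by simp
  have n8: "CARD('n) - 8 = 8" using props(2) by simp
  note C2 = cond_C2_shells[OF props(1) _ n]
  show "design_3half (shell L (4 ^ a))" if a: "a \<ge> 1"
  proof -
    have "q_expansion 1 (\<lambda>z. Phi z * eta24 z) (Phi_fps * (theta3_fps ^ 8 * Delta8_fps ^ 2))"
      using Phi_form by (intro q_expansion_mult eta24_q_expansion) (auto simp: theta_form_def)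
    then have "fps_nth (Phi_fps * (theta3_fps ^ 8 * Delta8_fps ^ 2)) (4 ^ a) = 0"
    proof (rule coeff_power4_zero[OF _ _ a])
      fix z assume z: "Im z > 0"
      have "Phi (z + 1) = theta3 z ^ 4 + theta2 z ^ 4"
        unfolding Phi_def theta2_power4_plus_1[OF z] theta4_plus_1[OF z] by simp
      then show "Phi z * eta24 z + Phi (z + 1) * eta24 (z + 1) = (theta3 z ^ 4 + theta4 z ^ 4) * eta24 z"
        unfolding eta24_plus_1[OF z] by (simp add: Phi_def algebra_simps)
    qed
    then have "cond_C 6 (shell L (real (4 ^ a)))"
      using props by (intro cond_C_4_6_shells(2)[OF _ _ n]) (simp_all add: n8)
    moreover have "cond_C 2 (shell L (4 ^ a))" using props by (intro cond_C2_shells(1)[OF _ _ n]) auto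
    ultimately show ?thesis using shell_props[OF props(1)] by (simp add: design_3half_def)
  qed
  have "cond_C 4 (shell L (real (2 * a + 1)))"
    using props eta24_odd_coeff[of "2 * a + 1"] by (intro cond_C_4_6_shells(1)[OF _ _ n]) (simp_all add: n8)
  moreover have "cond_C 2 (shell L (2 * real a + 1))" using props by (intro cond_C2_shells(1)[OF _ _ n]) auto
  ultimately show "design (shell L (2 * real a + 1)) 5"
    unfolding design_5_iff using shell_props[OF props(1)] by (simp add: add.commute)
qed

text \<open>Here n - 8 = 12, so the degree 4 model form is theta3^4 times \<open>eta24\<close>,
  again with the even part of \<open>hecke_f\<close>. Both root systems of rank 20 have 120 roots
  and are treated together.\<close>

lemma designs_rank_20:
  fixes L :: "(real^'n) set"
  assumes P: "plus_lattice L 20 N R" and R: "card R = 120" and a: "a \<ge> 1"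
  shows "design (shell L (4 ^ a)) 5"
proof -
  have "real (card R) = 2 * real 20 * (23 - real 20)" by (simp add: R)
  note props = plus_lattice_props[OF P _ _ this, simplified]
  have n: "CARD('n) \<ge> 8" using props(2) by simp
  have n8: "CARD('n) - 8 = 12" using props(2) by simp
  have "theta3_fps ^ 12 * Delta8_fps ^ 2 = theta3_fps ^ 4 * (theta3_fps ^ 8 * Delta8_fps ^ 2)"
    by (simp flip: power_add mult.assoc)
  moreover have "q_expansion 1 (\<lambda>z. theta3 z ^ 4 * eta24 z) (theta3_fps ^ 4 * (theta3_fps ^ 8 * Delta8_fps ^ 2))"
    by (intro q_expansion_mult q_expansion_power theta3_q_expansion eta24_q_expansion) auto
  then have "fps_nth (theta3_fps ^ 4 * (theta3_fps ^ 8 * Delta8_fps ^ 2)) (4 ^ a) = 0"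
    by (rule coeff_power4_zero[OF _ _ a]) (simp add: eta24_plus_1 theta4_def algebra_simps)
  ultimately have "fps_nth (theta3_fps ^ (CARD('n) - 8) * Delta8_fps ^ 2) (4 ^ a) = 0" by (simp only: n8)
  then have "cond_C 4 (shell L (real (4 ^ a)))"
    using props by (intro cond_C_4_6_shells(1)[OF _ _ n]) simp_all
  moreover have "cond_C 2 (shell L (4 ^ a))" using props by (intro cond_C2_shells(1)[OF _ _ n]) auto
  ultimately show ?thesis unfolding design_5_iff using shell_props[OF props(1)] by simp
qed

text \<open>Rank 23 is where 2n(23 - n) = 0, so the shadow bound applies to a lattice without roots,
  and the multipliers in degrees 4 and 6 are empty sums.\<close>

lemma designs_shorter_leech:
  fixes L :: "(real^'n) set"
  assumes n: "CARD('n) = 23" and L: "selfdual L" and min: "lattice_min L = 3"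
  shows "design (shell L m) 7" "design (shell (shadow L) m) 7"
proof -
  have min3: "3 \<le> x \<bullet> x" if "x \<in> L" "x \<noteq> 0" for x using norm_ge_lattice_min[OF min that] .
  then have min2: "2 \<le> x \<bullet> x" if "x \<in> L" "x \<noteq> 0" for x using that by force
  have n8: "CARD('n) \<ge> 8" "CARD('n) < 24" using n by simp_all
  have e: "shell L 2 = {}"
  proof -
    have "x \<bullet> x \<noteq> 2" if "x \<in> L" for x using min3[OF that] by (cases "x = 0") auto
    then show ?thesis by (auto simp: shell_def)
  qed
  have sh: "(real CARD('n) - 8) / 4 \<le> x \<bullet> x" if "x \<in> shadow L" for x
    by (rule shadow_norm_bound[OF L min2 n8 _ that]) (simp_all add: e n)
  have C2: "cond_C 2 (shell L m)" "cond_C 2 (shell (shadow L) m)"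
    by (rule cond_C2_shells[OF L min2 n8(1) sh]; assumption)+
  have "cond_C 4 (shell L m) \<and> cond_C 4 (shell (shadow L) m) \<and> cond_C 6 (shell L m) \<and> cond_C 6 (shell (shadow L) m)"
    by (rule cond_C_4_6_shells(3)[OF L min2 n8(1) sh e])
  with C2 show "design (shell L m) 7" "design (shell (shadow L) m) 7"
    unfolding design_7_iff using shell_props[OF L] by auto
qed

theorem theorem12p3:
  shows
  "(\<forall>L :: (real^'n) set. selfdual L \<and> sigma_inv L = real CARD('n) - 8 \<and> lattice_min L = 2 \<longrightarrow>
      (\<forall>m. shell L m \<noteq> {} \<longrightarrow> design (shell L m) 3) \<and>
      (\<forall>m. shell (shadow L) m \<noteq> {} \<longrightarrow> design (shell (shadow L) m) 3))
   \<and>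
   (\<forall>L :: (real^'a) set. plus_lattice L 16 16 (kD 2 8) \<longrightarrow>
      (\<forall>a::nat. a \<ge> 1 \<longrightarrow> design_3half (shell L (4 ^ a))))
   \<and>
   (\<forall>L :: (real^'b) set. plus_lattice L 20 24 (kA 4 5) \<longrightarrow>
      (\<forall>a::nat. a \<ge> 1 \<longrightarrow> design (shell L (4 ^ a)) 5))
   \<and>
   (\<forall>L :: (real^'b) set. plus_lattice L 20 20 (kD 5 4) \<longrightarrow>
      (\<forall>a::nat. a \<ge> 1 \<longrightarrow> design (shell L (4 ^ a)) 5))
   \<and>
   (\<forall>L :: (real^'a) set. plus_lattice L 16 16 (kD 2 8) \<longrightarrow>
      (\<forall>a::nat. a \<ge> 1 \<longrightarrow> design (shell L (2 * real a + 1)) 5))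
   \<and>
   (\<forall>L :: (real^'c) set. CARD('c) = 23 \<and> selfdual L \<and> lattice_min L = 3 \<longrightarrow>
      (\<forall>m. shell L m \<noteq> {} \<longrightarrow> design (shell L m) 7) \<and>
      (\<forall>m. shell (shadow L) m \<noteq> {} \<longrightarrow> design (shell (shadow L) m) 7))"
  using minimal_shadow_designs designs_2D8 designs_rank_20 designs_shorter_leech card_root_systems(2,3)
  by (intro conjI allI impI) blast+

end
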